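(* For each integer $n \geq 2$ there exists a positive constant $c(n)$ such that, for every real $w \geq c(n)$, there exists a complete immersed minimal surface of finite total curvature $\mathcal{JMV}_0(n+2,w) \subset \mathbb{R}^3$, having exactly $n+2$ ends, satisfying: 1) $\mathcal{JMV}_0(n+2,w)$ has genus zero; 2) $n$ of its ends are catenoid ends of weight one, and the normal vectors at these $n$ ends all lie in a horizontal plane and are symmetrically placed, i.e. up to a rotation of the surface their stereographic projections to the complex plane are the $n$-th roots of unity; 3) the other two ends are catenoid ends of weight $w$ with vertical normal vectors pointing in opposite directions; 4) the symmetry group of $\mathcal{JMV}_0(n+2,w)$ is $D_n \times \mathbb{Z}_2$.
   Context: Catenoid end: an end of a complete minimal immersion in $\mathbb{R}^3$ is a catenoid end if, after a rotation, a neighborhood of it is a graph of bounded slope over the exterior of a compact set in the $x_1x_2$-plane of a function $f(x_1,x_2) = a\log\sqrt{x_1^2+x_2^2} + b + \frac{c_1x_1+c_2x_2}{x_1^2+x_2^2} + O\left(\frac{1}{x_1^2+x_2^2}\right)$ with $a \neq 0$. Normal at an end: the Gauss map of a complete finite-total-curvature minimal surface extends continuously to each end; its value there is called the normal vector at that end. Weight: for a closed curve $\alpha$ on a minimal surface with unit conormal $\upsilon$ along $\alpha$, the weight (flux) vector is $w(\alpha)=\int_\alpha \upsilon\,ds$; it depends only on the homology class of $\alpha$ (with a consistent choice of conormal). The weight vector $w(E)$ of an end $E$ is that of a loop around the end, with conormal pointing toward the end; the weight of the end means the length $|w(E)|$. Symmetry group: the group of Euclidean isometries of $\mathbb{R}^3$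 mapping the surface to itself. $D_n \times \mathbb{Z}_2$ denotes the natural $\mathbb{Z}_2$ extension into $O(3)$ of the dihedral group $D_n \subset SO(3)$. It is the group of order $4n$ generated by the reflections in the planes $P_0=\{x_3=0\}$, $P_i=\{x_1=\cot(i\pi/n)\,x_2\}$ for $1\le i\le n-1$, and $P_n=\{x_2=0\}$, so that the $x_3$-axis is the axis of the order-$n$ rotational symmetry. "Horizontal" means parallel to $\{x_3=0\}$ and "vertical" means parallel to the $x_3$-axis. *)

theory Defs
  imports "HOL-Analysis.Analysis"
begin

section \<open>Differential geometry of parametrized surface patches\<close>

text \<open>The parameter plane, and the coordinate plane \<open>x\<^sub>3 = 0\<close> of \<open>\<real>\<^sup>3\<close>, are modelled
  by the type \<^typ>\<open>complex\<close>, with \<open>(u, v)\<close> written \<open>u + \<i> v\<close>.\<close>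

definition partial_u :: "(complex \<Rightarrow> real^3) \<Rightarrow> complex \<Rightarrow> real^3" where
  "partial_u x z = frechet_derivative x (at z) 1"

definition partial_v :: "(complex \<Rightarrow> real^3) \<Rightarrow> complex \<Rightarrow> real^3" where
  "partial_v x z = frechet_derivative x (at z) \<i>"

primrec Ck_on :: "nat \<Rightarrow> complex set \<Rightarrow> (complex \<Rightarrow> real^3) \<Rightarrow> bool" where
  "Ck_on 0 V x \<longleftrightarrow> continuous_on V x"
| "Ck_on (Suc k) V x \<longleftrightarrow>
     (\<forall>z\<in>V. x differentiable (at z)) \<and> Ck_on k V (partial_u x) \<and> Ck_on k V (partial_v x)"

definition smooth_on :: "complex set \<Rightarrow> (complex \<Rightarrow> real^3) \<Rightarrow> bool" where
  "smooth_on V x \<longleftrightarrow> (\<forall>k. Ck_on k V x)"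

definition fund_E :: "(complex \<Rightarrow> real^3) \<Rightarrow> complex \<Rightarrow> real" where
  "fund_E x z = partial_u x z \<bullet> partial_u x z"

definition fund_F :: "(complex \<Rightarrow> real^3) \<Rightarrow> complex \<Rightarrow> real" where
  "fund_F x z = partial_u x z \<bullet> partial_v x z"

definition fund_G :: "(complex \<Rightarrow> real^3) \<Rightarrow> complex \<Rightarrow> real" where
  "fund_G x z = partial_v x z \<bullet> partial_v x z"

definition patch_normal :: "(complex \<Rightarrow> real^3) \<Rightarrow> complex \<Rightarrow> real^3" where
  "patch_normal x z = sgn (cross3 (partial_u x z) (partial_v x z))"

definition fund_L :: "(complex \<Rightarrow> real^3) \<Rightarrow> complex \<Rightarrow> real" where
  "fund_L x z = partial_u (partial_u x) z \<bullet> patch_normal x z"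

definition fund_M :: "(complex \<Rightarrow> real^3) \<Rightarrow> complex \<Rightarrow> real" where
  "fund_M x z = partial_v (partial_u x) z \<bullet> patch_normal x z"

definition fund_N :: "(complex \<Rightarrow> real^3) \<Rightarrow> complex \<Rightarrow> real" where
  "fund_N x z = partial_v (partial_v x) z \<bullet> patch_normal x z"

definition area_density :: "(complex \<Rightarrow> real^3) \<Rightarrow> complex \<Rightarrow> real" where
  "area_density x z = sqrt (fund_E x z * fund_G x z - (fund_F x z)\<^sup>2)"

definition mean_curvature :: "(complex \<Rightarrow> real^3) \<Rightarrow> complex \<Rightarrow> real" where
  "mean_curvature x z =
     (fund_E x z * fund_N x z - 2 * fund_F x z * fund_M x z + fund_G x z * fund_L x z)
       / (2 * (fund_E x z * fund_G x z - (fund_F x z)\<^sup>2))"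

definition gauss_curvature :: "(complex \<Rightarrow> real^3) \<Rightarrow> complex \<Rightarrow> real" where
  "gauss_curvature x z =
     (fund_L x z * fund_N x z - (fund_M x z)\<^sup>2)
       / (fund_E x z * fund_G x z - (fund_F x z)\<^sup>2)"

section \<open>Immersed surfaces in \<open>\<real>\<^sup>3\<close>\<close>

text \<open>A surface is a topological space \<open>M\<close> together with a map \<open>X\<close> into \<open>\<real>\<^sup>3\<close>. No atlas is
  carried separately: the maps \<open>\<phi>\<close> below are exactly the inverse charts of the unique smooth
  structure on \<open>M\<close> that makes \<open>X\<close> a smooth immersion. (Two of them differ by a smooth change of
  parameters, because locally \<open>X \<circ> \<phi>\<close> has a smooth left inverse.)\<close>

definition local_parametrization ::
    "'a topology \<Rightarrow> ('a \<Rightarrow> real^3) \<Rightarrow> complex set \<Rightarrow> (complex \<Rightarrow> 'a) \<Rightarrow> bool" where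
  "local_parametrization M X V \<phi> \<longleftrightarrow>
     open V \<and> openin M (\<phi> ` V) \<and>
     homeomorphic_map (top_of_set V) (subtopology M (\<phi> ` V)) \<phi> \<and>
     smooth_on V (X \<circ> \<phi>) \<and>
     (\<forall>z\<in>V. cross3 (partial_u (X \<circ> \<phi>) z) (partial_v (X \<circ> \<phi>) z) \<noteq> 0)"

definition immersed_surface :: "'a topology \<Rightarrow> ('a \<Rightarrow> real^3) \<Rightarrow> bool" where
  "immersed_surface M X \<longleftrightarrow>
     Hausdorff_space M \<and> second_countable M \<and> connected_space M \<and> topspace M \<noteq> {} \<and>
     (\<forall>p\<in>topspace M. \<exists>V \<phi>. local_parametrization M X V \<phi> \<and> p \<in> \<phi> ` V)"

text \<open>Vanishing of the mean curvature, and tangency in \<open>gauss_map\<close>, do not depend on the local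
  parametrization, so one around each point is enough.\<close>

definition minimal_surface :: "'a topology \<Rightarrow> ('a \<Rightarrow> real^3) \<Rightarrow> bool" where
  "minimal_surface M X \<longleftrightarrow>
     immersed_surface M X \<and>
     (\<forall>p\<in>topspace M. \<exists>V \<phi>. local_parametrization M X V \<phi> \<and> p \<in> \<phi> ` V \<and>
        (\<forall>z\<in>V. mean_curvature (X \<circ> \<phi>) z = 0))"

definition gauss_map :: "'a topology \<Rightarrow> ('a \<Rightarrow> real^3) \<Rightarrow> ('a \<Rightarrow> real^3) \<Rightarrow> bool" where
  "gauss_map M X N \<longleftrightarrow>
     continuous_map M euclidean N \<and>
     (\<forall>p\<in>topspace M. norm (N p) = 1) \<and>
     (\<forall>p\<in>topspace M. \<exists>V \<phi>. local_parametrization M X V \<phi> \<and> p \<in> \<phi> ` V \<and>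
        (\<forall>z\<in>V. N (\<phi> z) \<bullet> partial_u (X \<circ> \<phi>) z = 0 \<and> N (\<phi> z) \<bullet> partial_v (X \<circ> \<phi>) z = 0))"

text \<open>Completeness of the induced metric: every divergent curve (one that leaves every compact
  subset of \<open>M\<close>) has infinite length.\<close>

definition complete_surface :: "'a topology \<Rightarrow> ('a \<Rightarrow> real^3) \<Rightarrow> bool" where
  "complete_surface M X \<longleftrightarrow>
     (\<forall>\<gamma> v. continuous_map (top_of_set {0::real..}) M \<gamma> \<and>
        (\<forall>t\<ge>0. ((X \<circ> \<gamma>) has_vector_derivative v t) (at t within {0..})) \<and>
        continuous_on {0..} v \<and>
        (\<forall>K. compactin M K \<longrightarrow> (\<forall>\<^sub>F t in at_top. \<gamma> t \<notin> K))
        \<longrightarrow> \<not> (\<lambda>t. norm (v t)) integrable_on {0..})"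

text \<open>\<open>\<integral>\<^sub>M \<bar>K\<bar> dA < \<infinity>\<close>, the surface integral being computed by cutting \<open>M\<close> into countably many
  Borel pieces \<open>\<phi> i ` D i\<close>, each lying in a single local parametrization.\<close>

definition finite_total_curvature :: "'a topology \<Rightarrow> ('a \<Rightarrow> real^3) \<Rightarrow> bool" where
  "finite_total_curvature M X \<longleftrightarrow>
     (\<exists>(V :: nat \<Rightarrow> complex set) \<phi> D.
        (\<forall>i. local_parametrization M X (V i) (\<phi> i) \<and> D i \<in> sets borel \<and> D i \<subseteq> V i) \<and>
        disjoint_family (\<lambda>i. \<phi> i ` D i) \<and>
        (\<Union>i. \<phi> i ` D i) = topspace M \<and>
        (\<Sum>i. \<integral>\<^sup>+z\<in>D i. ennreal (\<bar>gauss_curvature (X \<circ> \<phi> i) z\<bar> * area_density (X \<circ> \<phi> i) z)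
           \<partial>lborel) < \<infinity>)"

section \<open>Topological ends and genus\<close>

text \<open>The (Freudenthal) ends of \<open>M\<close>: compatible choices of a connected component of \<open>M - K\<close> for
  every compact \<open>K\<close>. The first clause only normalizes the irrelevant values.\<close>

definition ends :: "'a topology \<Rightarrow> ('a set \<Rightarrow> 'a set) set" where
  "ends M = {e.
     (\<forall>K. \<not> compactin M K \<longrightarrow> e K = {}) \<and>
     (\<forall>K. compactin M K \<longrightarrow>
        e K \<in> connected_components_of (subtopology M (topspace M - K))) \<and>
     (\<forall>K L. compactin M K \<and> compactin M L \<and> K \<subseteq> L \<longrightarrow> e L \<subseteq> e K)}"

definition end_filter :: "'a topology \<Rightarrow> ('a set \<Rightarrow> 'a set) \<Rightarrow> 'a filter" where
  "end_filter M e = (INF K\<in>Collect (compactin M). principal (e K))"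

definition end_neighborhood :: "'a topology \<Rightarrow> ('a set \<Rightarrow> 'a set) \<Rightarrow> 'a set \<Rightarrow> bool" where
  "end_neighborhood M e U \<longleftrightarrow> openin M U \<and> (\<exists>K. compactin M K \<and> e K \<subseteq> U)"

text \<open>The genus of a surface with finitely many ends is that of the closed surface from which it
  arises by removing finitely many points; genus zero means that this is the sphere.\<close>

definition genus_zero :: "'a topology \<Rightarrow> bool" where
  "genus_zero M \<longleftrightarrow>
     (\<exists>P. finite P \<and> P \<subseteq> sphere (0::real^3) 1 \<and>
        M homeomorphic_space top_of_set (sphere (0::real^3) 1 - P))"

section \<open>Geometry of the ends\<close>

definition end_normal ::
    "'a topology \<Rightarrow> ('a \<Rightarrow> real^3) \<Rightarrow> ('a set \<Rightarrow> 'a set) \<Rightarrow> real^3 \<Rightarrow> bool" where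
  "end_normal M N e \<nu> \<longleftrightarrow> (N \<longlongrightarrow> \<nu>) (end_filter M e)"

definition graph_over :: "complex set \<Rightarrow> (complex \<Rightarrow> real) \<Rightarrow> (real^3) set" where
  "graph_over S f = {x. Complex (x $ 1) (x $ 2) \<in> S \<and> x $ 3 = f (Complex (x $ 1) (x $ 2))}"

definition catenoid_end ::
    "'a topology \<Rightarrow> ('a \<Rightarrow> real^3) \<Rightarrow> ('a set \<Rightarrow> 'a set) \<Rightarrow> bool" where
  "catenoid_end M X e \<longleftrightarrow>
     (\<exists>(R :: real^3^3) U C f f' B a b c\<^sub>1 c\<^sub>2.
        rotation_matrix R \<and>
        end_neighborhood M e U \<and> inj_on X U \<and>
        compact C \<and> connected (- C) \<and>
        (\<lambda>p. R *v X p) ` U = graph_over (- C) f \<and>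
        (\<forall>z\<in>- C. (f has_derivative f' z) (at z) \<and> onorm (f' z) \<le> B) \<and>
        a \<noteq> 0 \<and>
        (\<lambda>z. f z - (a * ln (norm z) + b + (c\<^sub>1 * Re z + c\<^sub>2 * Im z) / (norm z)\<^sup>2))
          \<in> O[at_infinity](\<lambda>z. 1 / (norm z)\<^sup>2))"

text \<open>A loop around an end \<open>e\<close>: a regular simple closed curve \<open>\<alpha>\<close> (of period 1) that bounds
  a neighborhood \<open>D\<close> of \<open>e\<close> such that \<open>D\<close> together with \<open>\<alpha>\<close> is a closed punctured disc with
  boundary \<open>\<alpha>\<close>.\<close>

definition loop_around_end ::
    "'a topology \<Rightarrow> ('a \<Rightarrow> real^3) \<Rightarrow> ('a set \<Rightarrow> 'a set) \<Rightarrow> (real \<Rightarrow> 'a) \<Rightarrow> 'a set \<Rightarrow> bool" where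
  "loop_around_end M X e \<alpha> D \<longleftrightarrow>
     continuous_map euclidean M \<alpha> \<and> (\<forall>t. \<alpha> (t + 1) = \<alpha> t) \<and> inj_on \<alpha> {0..<1} \<and>
     (X \<circ> \<alpha>) C1_differentiable_on UNIV \<and>
     (\<forall>t. vector_derivative (X \<circ> \<alpha>) (at t) \<noteq> 0) \<and>
     end_neighborhood M e D \<and> D \<inter> range \<alpha> = {} \<and> closedin M (D \<union> range \<alpha>) \<and>
     (\<exists>h. homeomorphic_map (top_of_set {z::complex. 0 < norm z \<and> norm z \<le> 1})
            (subtopology M (D \<union> range \<alpha>)) h \<and>
          h ` sphere 0 1 = range \<alpha>)"

text \<open>The unit conormal \<open>\<upsilon>\<close> along \<open>\<alpha>\<close> pointing into \<open>D\<close>. It is tangent to the surface and points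
  into \<open>D\<close> because it is the initial velocity of a curve that starts on \<open>\<alpha>\<close> and enters \<open>D\<close>.\<close>

definition unit_conormal_into ::
    "'a topology \<Rightarrow> ('a \<Rightarrow> real^3) \<Rightarrow> (real \<Rightarrow> 'a) \<Rightarrow> 'a set \<Rightarrow> (real \<Rightarrow> real^3) \<Rightarrow> bool" where
  "unit_conormal_into M X \<alpha> D \<upsilon> \<longleftrightarrow>
     (\<forall>t. norm (\<upsilon> t) = 1 \<and> \<upsilon> t \<bullet> vector_derivative (X \<circ> \<alpha>) (at t) = 0 \<and>
        (\<exists>\<gamma>. continuous_map (top_of_set {0::real..<1}) M \<gamma> \<and> \<gamma> 0 = \<alpha> t \<and>
           (\<forall>s\<in>{0<..<1}. \<gamma> s \<in> D) \<and>
           ((X \<circ> \<gamma>) has_vector_derivative \<upsilon> t) (at 0 within {0..<1})))"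

text \<open>\<open>W = \<integral>\<^sub>\<alpha> \<upsilon> ds\<close>; by homology invariance the choice of the loop \<open>\<alpha>\<close> is immaterial.\<close>

definition end_weight_vector ::
    "'a topology \<Rightarrow> ('a \<Rightarrow> real^3) \<Rightarrow> ('a set \<Rightarrow> 'a set) \<Rightarrow> real^3 \<Rightarrow> bool" where
  "end_weight_vector M X e W \<longleftrightarrow>
     (\<exists>\<alpha> D \<upsilon>. loop_around_end M X e \<alpha> D \<and> unit_conormal_into M X \<alpha> D \<upsilon> \<and>
        ((\<lambda>t. norm (vector_derivative (X \<circ> \<alpha>) (at t)) *\<^sub>R \<upsilon> t) has_integral W) {0..1})"

definition end_weight ::
    "'a topology \<Rightarrow> ('a \<Rightarrow> real^3) \<Rightarrow> ('a set \<Rightarrow> 'a set) \<Rightarrow> real \<Rightarrow> bool" where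
  "end_weight M X e w \<longleftrightarrow> (\<exists>W. end_weight_vector M X e W \<and> norm W = w)"

text \<open>Stereographic projection from the north pole.\<close>

definition stereographic :: "real^3 \<Rightarrow> complex" where
  "stereographic x = Complex (x $ 1) (x $ 2) / of_real (1 - x $ 3)"

section \<open>Symmetries\<close>

definition symmetry_group :: "(real^3) set \<Rightarrow> (real^3 \<Rightarrow> real^3) set" where
  "symmetry_group S = {T. (\<forall>x y. dist (T x) (T y) = dist x y) \<and> T ` S = S}"

text \<open>Reflection in the plane through the origin with (not necessarily unit) normal \<open>u\<close>.\<close>

definition plane_reflection :: "real^3 \<Rightarrow> real^3 \<Rightarrow> real^3" where
  "plane_reflection u x = x - (2 * (x \<bullet> u) / (u \<bullet> u)) *\<^sub>R u"

text \<open>\<open>D\<^sub>n \<times> \<int>\<^sub>2\<close> as a subgroup of \<open>O(3)\<close>, generated by the reflections in \<open>x\<^sub>3 = 0\<close>,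
  \<open>x\<^sub>2 = 0\<close> and \<open>x\<^sub>1 = cot (i\<pi>/n) x\<^sub>2\<close> for \<open>1 \<le> i \<le> n - 1\<close>. Closure under inverses is automatic
  since the generators are involutions.\<close>

inductive_set dihedral_Z2 :: "nat \<Rightarrow> (real^3 \<Rightarrow> real^3) set" for n :: nat where
  id: "id \<in> dihedral_Z2 n"
| P0: "T \<in> dihedral_Z2 n \<Longrightarrow> plane_reflection (vector [0, 0, 1]) \<circ> T \<in> dihedral_Z2 n"
| Pi: "T \<in> dihedral_Z2 n \<Longrightarrow> 1 \<le> i \<Longrightarrow> i \<le> n - 1 \<Longrightarrow>
        plane_reflection (vector [1, - cot (real i * pi / real n), 0]) \<circ> T \<in> dihedral_Z2 n"
| Pn: "T \<in> dihedral_Z2 n \<Longrightarrow> plane_reflection (vector [0, 1, 0]) \<circ> T \<in> dihedral_Z2 n"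

end

theory Submission
  imports Defs "HOL-Complex_Analysis.Complex_Analysis" "HOL-Real_Asymp.Real_Asymp"
begin

text \<open>The surface is the plane punctured at \<open>0\<close> and at the \<open>n\<close>-th roots of unity, with Weierstrass data
  \<open>g = z (z\<^sup>n - \<alpha>) / (1 - \<alpha> z\<^sup>n)\<close> and
  \<open>dh = A (z\<^sup>n - \<alpha>) (z\<^sup>n - 1/\<alpha>) / (z (z\<^sup>n - 1)\<^sup>2) dz\<close>, where \<open>0 < \<alpha> < 1\<close>. The residues of all three
  coordinate forms are real, so there are no real periods and the immersion has a closed form, a sum of
  logarithms and simple poles. The ends at \<open>0\<close> and \<open>\<infinity>\<close> have weight \<open>2 \<pi> A\<close>, the ends at the roots of unity
  have weight \<open>2 \<pi> A r / \<alpha>\<close> with \<open>r = (1 - \<alpha>) (n + 1 + (n - 1) \<alpha>) / n\<^sup>2\<close>. Weights \<open>w\<close> and \<open>1\<close> thus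
  amount to \<open>A = w / (2 \<pi>)\<close> and \<open>w r = \<alpha>\<close>, which the intermediate value theorem solves for \<open>\<alpha>\<close>.

  The maps \<open>z \<mapsto> u z\<close> (with \<open>u\<^sup>n = 1\<close>), conjugation and \<open>z \<mapsto> 1 / cnj z\<close> induce the symmetries in
  \<open>D\<^sub>n \<times> \<int>\<^sub>2\<close>. Conversely, a symmetry permutes the asymptotic growth vectors of the
  image set, that is, the end normals scaled by the logarithmic growth rates. For \<open>w > 1\<close> the two vertical
  ones are longer than the others, which leaves only the linear parts from \<open>D\<^sub>n \<times> \<int>\<^sub>2\<close>; a
  translation would put an unbounded arithmetic progression on the surface, against the logarithmic
  growth of its ends.\<close>

text \<open>The form dh is dictated by g. The map g commutes with the reflection in the unit circle
  and fixes every root of unity, so the normals at these ends are horizontal; the height then grows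
  linearly there, which asks for double poles of dh, and regularity asks dh to vanish at the zeros
  and poles of g other than 0 and infinity, i.e. where the n-th power of z is \<alpha> or
  1/\<alpha>.

  The symmetry group in question is that of the image set. The immersion is not known to be
  injective, so an isometry of the image does not come with a map of the domain. Everything about an
  isometry is therefore read off from sequences in the image that tend to infinity: each of them has
  a subsequence that escapes along a single end.

  The strict inequality between the weights is a genuine restriction: for n = 4 and equal weights
  the growth vectors would be the vertices of a regular octahedron, which has more
  isometries.\<close>

section \<open>Minimal immersions from holomorphic null curves\<close>

lemma has_derivative_vec_lambda:
  fixes f :: "'a::real_normed_vector \<Rightarrow> 'n::finite \<Rightarrow> real"
  assumes "\<And>i. ((\<lambda>x. f x i) has_derivative (\<lambda>v. f' v i)) (at x within S)"
  shows "((\<lambda>x. \<chi> i. f x i) has_derivative (\<lambda>v. \<chi> i. f' v i)) (at x within S)"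
  unfolding has_derivative_componentwise_within[of "\<lambda>x. \<chi> i. f x i"]
  by (auto simp: Basis_vec_def inner_axis assms)

lemma has_derivative_Re_vec:
  fixes f :: "'n::finite \<Rightarrow> complex \<Rightarrow> complex"
  assumes "\<And>i. (f i has_field_derivative f' i) (at z)"
  shows "((\<lambda>x. \<chi> i. Re (f i x)) has_derivative (\<lambda>v. \<chi> i. Re (f' i * v))) (at z)"
proof (rule has_derivative_vec_lambda)
  fix i
  have "(f i has_derivative (\<lambda>v. f' i * v)) (at z)"
    using assms[of i] by (simp add: has_field_derivative_def)
  then show "((\<lambda>x. Re (f i x)) has_derivative (\<lambda>v. Re (f' i * v))) (at z)"
    by (rule has_derivative_Re)
qed

lemma has_derivative_Re_vec_on:
  fixes f :: "3 \<Rightarrow> complex \<Rightarrow> complex"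
  assumes "open V" "\<And>i. f i holomorphic_on V" "\<And>z. z \<in> V \<Longrightarrow> x z = (\<chi> i. Re (f i z))" "z \<in> V"
  shows "(x has_derivative (\<lambda>v. \<chi> i. Re (deriv (f i) z * v))) (at z)"
proof -
  have "((\<lambda>x. \<chi> i. Re (f i x)) has_derivative (\<lambda>v. \<chi> i. Re (deriv (f i) z * v))) (at z)"
    using assms by (intro has_derivative_Re_vec holomorphic_derivI)
  then show ?thesis
    by (rule has_derivative_transform_within_open[OF _ \<open>open V\<close> \<open>z \<in> V\<close>]) (use assms in auto)
qed

lemma partials_eqI:
  assumes "(x has_derivative D) (at z)"
  shows "partial_u x z = D 1" "partial_v x z = D \<i>"
  using frechet_derivative_at[OF assms] by (simp_all add: partial_u_def partial_v_def)

text \<open>The induction closes because the partials of \<open>Re f\<close> are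
  \<open>Re (deriv f)\<close> and \<open>Re (deriv f * \<i>)\<close>, again real parts of
  holomorphic functions. Agreement is asked on \<open>V\<close> only, since the partials of
  \<open>x\<close> are known only there.\<close>

lemma Ck_on_Re_vec:
  fixes f :: "3 \<Rightarrow> complex \<Rightarrow> complex"
  assumes "open V" "\<And>i. f i holomorphic_on V" "\<And>z. z \<in> V \<Longrightarrow> x z = (\<chi> i. Re (f i z))"
  shows "Ck_on k V x"
  using assms(2,3)
proof (induction k arbitrary: f x)
  case 0
  have "x differentiable (at z)" if "z \<in> V" for z
    using has_derivative_Re_vec_on[OF \<open>open V\<close> 0 that] differentiable_def by blast
  then show ?case
    by (simp add: continuous_at_imp_continuous_on differentiable_imp_continuous_within)
next
  case (Suc k)
  note d = has_derivative_Re_vec_on[OF \<open>open V\<close> Suc.prems]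
  have "x differentiable (at z)" if "z \<in> V" for z
    using d[OF _ that] differentiable_def by blast
  moreover have "Ck_on k V (partial_u x)"
    by (rule Suc.IH[of "\<lambda>i. deriv (f i)"])
      (use Suc.prems d partials_eqI(1)[OF d] in \<open>auto intro!: holomorphic_deriv \<open>open V\<close>\<close>)
  moreover have "Ck_on k V (partial_v x)"
    by (rule Suc.IH[of "\<lambda>i z. deriv (f i) z * \<i>"])
      (use Suc.prems d partials_eqI(2)[OF d] in \<open>auto intro!: holomorphic_intros holomorphic_deriv \<open>open V\<close>\<close>)
  ultimately show ?case by simp
qed

text \<open>\<^term>\<open>X\<close> is the real part of a primitive of the holomorphic null curve \<^term>\<open>\<phi>\<close>.\<close>

locale weierstrass =
  fixes \<Omega> :: "complex set" and \<phi> :: "3 \<Rightarrow> complex \<Rightarrow> complex" and X :: "complex \<Rightarrow> real^3"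
  assumes open_domain: "open \<Omega>"
    and holo: "\<And>i. \<phi> i holomorphic_on \<Omega>"
    and deriv_X: "\<And>z. z \<in> \<Omega> \<Longrightarrow> (X has_derivative (\<lambda>v. \<chi> i. Re (\<phi> i z * v))) (at z)"
    and null: "\<And>z. z \<in> \<Omega> \<Longrightarrow> (\<Sum>i\<in>UNIV. (\<phi> i z)\<^sup>2) = 0"
    and nonzero: "\<And>z. z \<in> \<Omega> \<Longrightarrow> \<exists>i. \<phi> i z \<noteq> 0"
begin

lemma partials:
  assumes "z \<in> \<Omega>"
  shows "partial_u X z = (\<chi> i. Re (\<phi> i z))" "partial_v X z = (\<chi> i. Re (\<phi> i z * \<i>))"
  using partials_eqI[OF deriv_X[OF assms]] by simp_all

lemma second_partials:
  assumes "z \<in> \<Omega>"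
  shows "partial_u (partial_u X) z = (\<chi> i. Re (deriv (\<phi> i) z))"
    and "partial_v (partial_u X) z = (\<chi> i. - Im (deriv (\<phi> i) z))"
    and "partial_v (partial_v X) z = (\<chi> i. - Re (deriv (\<phi> i) z))"
proof -
  note u = has_derivative_Re_vec_on[OF open_domain holo partials(1) assms]
  show "partial_u (partial_u X) z = (\<chi> i. Re (deriv (\<phi> i) z))"
    "partial_v (partial_u X) z = (\<chi> i. - Im (deriv (\<phi> i) z))"
    using partials_eqI[OF u] by simp_all
  have hol: "(\<lambda>z. \<phi> i z * \<i>) holomorphic_on \<Omega>" for i
    by (intro holomorphic_intros holo)
  have d: "deriv (\<lambda>z. \<phi> i z * \<i>) z = deriv (\<phi> i) z * \<i>" for i
    by (rule DERIV_imp_deriv) (auto intro!: derivative_eq_intros holomorphic_derivI[OF holo open_domain assms])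
  show "partial_v (partial_v X) z = (\<chi> i. - Re (deriv (\<phi> i) z))"
    using partials_eqI(2)[OF has_derivative_Re_vec_on[OF open_domain hol partials(2) assms]]
    by (simp add: d)
qed

lemma smooth: "smooth_on \<Omega> X"
  unfolding smooth_on_def
proof
  fix k
  show "Ck_on k \<Omega> X"
  proof (cases k)
    case 0
    have "continuous_on \<Omega> X"
      by (metis continuous_at_imp_continuous_on deriv_X has_derivative_continuous)
    then show ?thesis
      using 0 by simp
  next
    case (Suc j)
    have "X differentiable (at z)" if "z \<in> \<Omega>" for z
      using deriv_X[OF that] differentiable_def by blast
    moreover have "Ck_on j \<Omega> (partial_u X)"
      by (rule Ck_on_Re_vec[OF open_domain holo partials(1)])
    moreover have "Ck_on j \<Omega> (partial_v X)"
      by (rule Ck_on_Re_vec[OF open_domain _ partials(2)]) (intro holomorphic_intros holo)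
    ultimately show ?thesis using Suc by simp
  qed
qed

lemma continuous_X: "continuous_on \<Omega> X"
  by (metis continuous_at_imp_continuous_on deriv_X has_derivative_continuous)

definition conformal_factor :: "complex \<Rightarrow> real" where
  "conformal_factor z = (\<Sum>i\<in>UNIV. (norm (\<phi> i z))\<^sup>2) / 2"

lemma conformal_factor_pos: "z \<in> \<Omega> \<Longrightarrow> conformal_factor z > 0"
  using nonzero[of z] by (auto simp: conformal_factor_def intro!: sum_pos2)

text \<open>Real and imaginary part of the null equation: the vectors Re \<phi> and Im \<phi> have
  equal length and are orthogonal, so each squared length is half of the squared norm of
  \<phi>.\<close>

lemma null_Re_Im:
  assumes "z \<in> \<Omega>"
  shows "(\<Sum>i\<in>UNIV. Re (\<phi> i z) * Im (\<phi> i z)) = 0"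
    and "(\<Sum>i\<in>UNIV. (Re (\<phi> i z))\<^sup>2) = conformal_factor z"
    and "(\<Sum>i\<in>UNIV. (Im (\<phi> i z))\<^sup>2) = conformal_factor z"
  using null[OF assms]
  by (simp_all add: complex_eq_iff sum_3 conformal_factor_def cmod_power2)
    (simp_all add: power2_eq_square algebra_simps)

lemma first_fundamental_form:
  assumes "z \<in> \<Omega>"
  shows "fund_E X z = conformal_factor z" "fund_F X z = 0" "fund_G X z = conformal_factor z"
  using null_Re_Im[OF assms]
  by (simp_all add: fund_E_def fund_F_def fund_G_def partials[OF assms] inner_vec_def
      power2_eq_square sum_negf)

lemma conformal_derivative:
  assumes "z \<in> \<Omega>"
  shows "norm (\<chi> i. Re (\<phi> i z * v)) = sqrt (conformal_factor z) * norm v"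
    and "(\<chi> i. Re (\<phi> i z * (\<i> * v))) \<bullet> (\<chi> i. Re (\<phi> i z * v)) = 0"
proof -
  define S where "S = (\<Sum>i\<in>UNIV. (Re (\<phi> i z))\<^sup>2)"
  define T where "T = (\<Sum>i\<in>UNIV. (Im (\<phi> i z))\<^sup>2)"
  define U where "U = (\<Sum>i\<in>UNIV. Re (\<phi> i z) * Im (\<phi> i z))"
  have STU: "S = conformal_factor z" "T = conformal_factor z" "U = 0"
    using null_Re_Im[OF assms] by (simp_all add: S_def T_def U_def)
  have "(norm (\<chi> i. Re (\<phi> i z * v)))\<^sup>2 = S * (Re v)\<^sup>2 + T * (Im v)\<^sup>2 - 2 * U * Re v * Im v"
    unfolding power2_norm_eq_inner S_def T_def U_def
    by (simp add: inner_vec_def sum_3 power2_eq_square algebra_simps)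
  also have "\<dots> = (sqrt (conformal_factor z) * norm v)\<^sup>2"
    using conformal_factor_pos[OF assms] by (simp add: STU power_mult_distrib cmod_power2 algebra_simps)
  finally show "norm (\<chi> i. Re (\<phi> i z * v)) = sqrt (conformal_factor z) * norm v"
    using conformal_factor_pos[OF assms] by (simp add: power2_eq_iff_nonneg)
  have "(\<chi> i. Re (\<phi> i z * (\<i> * v))) \<bullet> (\<chi> i. Re (\<phi> i z * v)) =
      (T - S) * Re v * Im v + U * ((Im v)\<^sup>2 - (Re v)\<^sup>2)"
    unfolding S_def T_def U_def
    by (simp add: inner_vec_def sum_3 power2_eq_square algebra_simps)
  then show "(\<chi> i. Re (\<phi> i z * (\<i> * v))) \<bullet> (\<chi> i. Re (\<phi> i z * v)) = 0"
    by (simp add: STU)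
qed

lemma cross_partials_nonzero: "z \<in> \<Omega> \<Longrightarrow> cross3 (partial_u X z) (partial_v X z) \<noteq> 0"
proof
  assume z: "z \<in> \<Omega>" and c: "cross3 (partial_u X z) (partial_v X z) = 0"
  have "(norm (cross3 (partial_u X z) (partial_v X z)))\<^sup>2 = (conformal_factor z)\<^sup>2"
    using first_fundamental_form[OF z] unfolding power2_norm_eq_inner dot_cross
    by (simp add: inner_commute fund_E_def fund_F_def fund_G_def power2_eq_square)
  then show False using c conformal_factor_pos[OF z] by simp
qed

lemma area_density_eq: "z \<in> \<Omega> \<Longrightarrow> area_density X z = conformal_factor z"
  using conformal_factor_pos[of z] by (simp add: area_density_def first_fundamental_form)

text \<open>The parameters are conformal (E = G, F = 0) and \<open>X\<close> is harmonic, so L = -N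
  for any choice of normal.\<close>

lemma mean_curvature_zero: "z \<in> \<Omega> \<Longrightarrow> mean_curvature X z = 0"
  by (simp add: mean_curvature_def first_fundamental_form fund_L_def fund_N_def second_partials
      inner_vec_def sum_3 algebra_simps)

text \<open>Allows curvature to be computed with an explicit unit normal field. By Lagrange's
  identity \<open>n\<close> has vanishing cross product with the normal \<open>c\<close>, which is
  the equality case of Cauchy-Schwarz. The sign left open is harmless, because the Gauss curvature
  is quadratic in the normal.\<close>

lemma patch_normal_eq:
  assumes z: "z \<in> \<Omega>" and n: "norm n = 1" "n \<bullet> partial_u X z = 0" "n \<bullet> partial_v X z = 0"
  shows "patch_normal X z = n \<or> patch_normal X z = - n"
proof -
  define c where "c = cross3 (partial_u X z) (partial_v X z)"
  have c: "c \<noteq> 0" using cross_partials_nonzero[OF z] by (simp add: c_def)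
  have "cross3 n c = 0"
    unfolding c_def Lagrange using n by simp
  then have e: "(norm c)\<^sup>2 = (n \<bullet> c)\<^sup>2"
    using norm_cross[of n c] n by simp
  define s where "s = sgn c"
  have ns: "norm s = 1" using c by (simp add: s_def norm_sgn)
  have "n \<bullet> s = n \<bullet> c / norm c" by (simp add: s_def sgn_div_norm divide_inverse)
  then have k: "(n \<bullet> s)\<^sup>2 = 1" using e c by (simp add: power_divide flip: e)
  have "(n - (n \<bullet> s) *\<^sub>R s) \<bullet> (n - (n \<bullet> s) *\<^sub>R s) = n \<bullet> n - 2 * (n \<bullet> s)\<^sup>2 + (n \<bullet> s)\<^sup>2 * (s \<bullet> s)"
    by (simp add: algebra_simps inner_commute power2_eq_square)
  also have "\<dots> = 0" using k ns n by (simp add: dot_square_norm)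
  finally have "n = (n \<bullet> s) *\<^sub>R s" by simp
  moreover have "n \<bullet> s = 1 \<or> n \<bullet> s = -1" using k by (simp add: power2_eq_1_iff)
  ultimately show ?thesis
    by (metis c_def minus_minus patch_normal_def s_def scaleR_minus1_left scaleR_one)
qed

text \<open>With s the complex sum on the right, the second fundamental form is L = Re s, M = - Im
  s, N = - Re s up to a common sign, so its determinant is minus the squared norm of s. One of the
  two conformal factors in the denominator of the curvature cancels against the area
  density.\<close>

lemma total_curvature_density:
  assumes z: "z \<in> \<Omega>" and n: "norm n = 1" "n \<bullet> partial_u X z = 0" "n \<bullet> partial_v X z = 0"
  shows "\<bar>gauss_curvature X z\<bar> * area_density X z =
    (norm (\<Sum>i\<in>UNIV. deriv (\<phi> i) z * of_real (n $ i)))\<^sup>2 / conformal_factor z"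
proof -
  let ?s = "\<Sum>i\<in>UNIV. deriv (\<phi> i) z * of_real (n $ i)"
  have "fund_L X z * fund_N X z - (fund_M X z)\<^sup>2 = - (norm ?s)\<^sup>2"
    using patch_normal_eq[OF assms] cmod_power2[of ?s]
    by (auto simp: fund_L_def fund_M_def fund_N_def second_partials[OF z] inner_vec_def sum_3
        power2_eq_square algebra_simps)
  then show ?thesis
    using conformal_factor_pos[OF z]
    by (simp add: gauss_curvature_def first_fundamental_form[OF z] area_density_eq[OF z]
        power2_eq_square abs_mult)
qed

text \<open>The domain with the identity is a global chart; it serves at every point in the
  definitions that ask for some local parametrization.\<close>

lemma local_parametrization_domain: "local_parametrization (top_of_set \<Omega>) X \<Omega> id"
  using open_domain smooth cross_partials_nonzero
  by (simp add: local_parametrization_def comp_def subtopology_subtopology)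

lemma minimal_surface_domain:
  assumes "connected \<Omega>" "\<Omega> \<noteq> {}"
  shows "minimal_surface (top_of_set \<Omega>) X"
proof -
  have "second_countable (euclidean :: complex topology)"
  proof -
    obtain \<B> :: "complex set set" where "countable \<B>" "\<And>C. C \<in> \<B> \<Longrightarrow> open C"
      "\<And>S. open S \<Longrightarrow> \<exists>U. U \<subseteq> \<B> \<and> S = \<Union>U"
      using univ_second_countable by blast
    then show ?thesis
      unfolding second_countable_def open_openin[symmetric]
      by (intro exI[of _ \<B>]) blast
  qed
  then have "second_countable (top_of_set \<Omega>)"
    by (rule second_countable_subtopology)
  moreover have "Hausdorff_space (top_of_set \<Omega>)"
    by (intro Hausdorff_space_subtopology) simp
  ultimately show ?thesis
    unfolding minimal_surface_def immersed_surface_def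
    using assms local_parametrization_domain mean_curvature_zero
    by (fastforce simp: connected_space_subtopology comp_def)
qed

lemma gauss_map_domain:
  assumes "continuous_on \<Omega> N" "\<And>z. z \<in> \<Omega> \<Longrightarrow> norm (N z) = 1"
    and "\<And>z. z \<in> \<Omega> \<Longrightarrow> (\<Sum>i\<in>UNIV. \<phi> i z * of_real (N z $ i)) = 0"
  shows "gauss_map (top_of_set \<Omega>) X N"
proof -
  have "N z \<bullet> partial_u X z = 0 \<and> N z \<bullet> partial_v X z = 0" if "z \<in> \<Omega>" for z
    using assms(3)[OF that]
    by (simp add: partials[OF that] inner_vec_def complex_eq_iff sum_negf mult.commute)
  then show ?thesis
    using assms(1,2) local_parametrization_domain
    unfolding gauss_map_def by (fastforce simp: comp_def)
qed

text \<open>The bound is a multiple of the area density of the sphere under stereographic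
  projection. The domain is cut into the unit disc and dyadic annuli: on the i-th piece the density
  is at most a constant times \<open>(1/16)^i\<close>, the area at most \<open>pi * 4^i\<close>, and
  the products form a geometric series.\<close>

lemma finite_total_curvature_domain:
  assumes "\<And>z. z \<in> \<Omega> \<Longrightarrow> \<bar>gauss_curvature X z\<bar> * area_density X z \<le> C / (1 + (norm z)\<^sup>2)\<^sup>2"
  shows "finite_total_curvature (top_of_set \<Omega>) X"
proof -
  define D where "D i = (case i of 0 \<Rightarrow> \<Omega> \<inter> ball 0 1 | Suc j \<Rightarrow> \<Omega> \<inter> (ball 0 (2 ^ Suc j) - ball 0 (2 ^ j)))" for i
  have D0: "D 0 = \<Omega> \<inter> ball 0 1" and DS: "D (Suc j) = \<Omega> \<inter> (ball 0 (2 ^ Suc j) - ball 0 (2 ^ j))" for j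
    by (simp_all add: D_def)
  have meas: "D i \<in> sets borel" for i
    using open_domain by (cases i) (auto simp: D0 DS)
  have sub: "D i \<subseteq> \<Omega>" "D i \<subseteq> ball 0 (2 ^ i)" for i
    by (cases i; auto simp: D0 DS)+
  have disj_less: "D i \<inter> D j = {}" if ij: "i < j" for i j
  proof -
    obtain k where k: "j = Suc k" "i \<le> k" using ij by (cases j) auto
    have "ball 0 (2 ^ i) \<subseteq> ball (0::complex) (2 ^ k)"
      using k by (intro subset_ball power_increasing) auto
    then show ?thesis using sub(2)[of i] by (auto simp: k DS)
  qed
  have disj: "disjoint_family (\<lambda>i. id ` D i)"
    unfolding disjoint_family_on_def using disj_less by (metis Int_commute image_id id_apply linorder_neqE_nat)
  have "z \<in> (\<Union>i. D i)" if z: "z \<in> \<Omega>" for z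
  proof -
    obtain m where m: "norm z < 2 ^ m"
      using real_arch_pow[of 2 "norm z"] by auto
    define k where "k = (LEAST k. norm z < 2 ^ k)"
    have k: "norm z < 2 ^ k" unfolding k_def by (rule LeastI[of _ m]) (rule m)
    show ?thesis
    proof (cases k)
      case 0
      then have "z \<in> D 0" using z k by (simp add: D0)
      then show ?thesis by blast
    next
      case (Suc j)
      have "\<not> norm z < 2 ^ j" using not_less_Least[of j "\<lambda>k. norm z < 2 ^ k"] Suc k_def by auto
      then have "z \<in> D (Suc j)" using z k Suc by (auto simp: DS)
      then show ?thesis by blast
    qed
  qed
  then have un: "(\<Union>i. id ` D i) = topspace (top_of_set \<Omega>)" using sub by auto
  have C: "C \<ge> 0" if "z \<in> \<Omega>" for z
  proof -
    have "0 \<le> \<bar>gauss_curvature X z\<bar> * area_density X z"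
      using conformal_factor_pos[OF that] by (simp add: area_density_eq[OF that])
    also note assms[OF that]
    finally show ?thesis by (simp add: zero_le_divide_iff) (smt (verit) zero_le_power2)
  qed
  have bound: "ennreal (\<bar>gauss_curvature X z\<bar> * area_density X z) * indicator (D i) z \<le>
      ennreal (\<bar>C\<bar> * 16 * (1 / 16) ^ i) * indicator (ball 0 (2 ^ i)) z" for i z
  proof (cases "z \<in> D i")
    case True
    then have "z \<in> \<Omega>" "z \<in> ball 0 (2 ^ i)" using sub by blast+
    then have z: "z \<in> \<Omega>" "norm z < 2 ^ i" by simp_all
    \<comment> \<open>On the annulus with index \<open>Suc j\<close> one has norm z at least
      \<open>2 ^ j\<close>; the factor 4 pays for passing from the inner to the outer radius. On the
      unit disc the claim is trivial.\<close>
    have "(2 ^ i)\<^sup>2 \<le> 4 * (1 + (norm z)\<^sup>2)"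
    proof (cases i)
      case 0
      then show ?thesis by (simp add: add_increasing2)
    next
      case (Suc j)
      then have "2 ^ j \<le> norm z" using True by (auto simp: DS)
      then have "(2 ^ j)\<^sup>2 \<le> (norm z)\<^sup>2" by (intro power_mono) auto
      moreover have "(2 ^ i)\<^sup>2 = 4 * ((2::real) ^ j)\<^sup>2" using Suc by (simp add: power_mult_distrib)
      moreover define a b where "a = ((2::real) ^ i)\<^sup>2" and "b = ((2::real) ^ j)\<^sup>2"
      ultimately show ?thesis by (fold a_def b_def) simp
    qed
    then have "(((2::real) ^ i)\<^sup>2)\<^sup>2 \<le> (4 * (1 + (norm z)\<^sup>2))\<^sup>2" by (intro power_mono) auto
    moreover have "(((2::real) ^ i)\<^sup>2)\<^sup>2 = 16 ^ i"
      by (simp add: power_mult[symmetric] mult.commute[of i] mult.assoc) (simp add: power_mult)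
    moreover have "(4 * (1 + (norm z)\<^sup>2))\<^sup>2 = 16 * (1 + (norm z)\<^sup>2)\<^sup>2"
      by (simp only: power_mult_distrib) simp
    ultimately have "16 ^ i \<le> 16 * (1 + (norm z)\<^sup>2)\<^sup>2" by simp
    moreover have "0 < 1 + (norm z)\<^sup>2" by (smt (verit) zero_le_power2)
    ultimately have "C / (1 + (norm z)\<^sup>2)\<^sup>2 \<le> C * 16 * (1 / 16) ^ i"
      using mult_left_mono[of "16 ^ i" "16 * (1 + (norm z)\<^sup>2)\<^sup>2" C] C[OF z(1)]
      by (simp add: divide_simps power_one_over)
    then have "\<bar>gauss_curvature X z\<bar> * area_density X z \<le> \<bar>C\<bar> * 16 * (1 / 16) ^ i"
      using assms[OF z(1)] C[OF z(1)] by simp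
    then show ?thesis using z by (simp add: True ennreal_leI)
  qed simp
  have "(\<integral>\<^sup>+z\<in>D i. ennreal (\<bar>gauss_curvature (X \<circ> id) z\<bar> * area_density (X \<circ> id) z) \<partial>lborel)
      \<le> ennreal (\<bar>C\<bar> * 16 * pi * (1 / 4) ^ i)" for i
  proof -
    have "(\<integral>\<^sup>+z\<in>D i. ennreal (\<bar>gauss_curvature (X \<circ> id) z\<bar> * area_density (X \<circ> id) z) \<partial>lborel) \<le>
        (\<integral>\<^sup>+z. ennreal (\<bar>C\<bar> * 16 * (1 / 16) ^ i) * indicator (ball 0 (2 ^ i)) z \<partial>(lborel :: complex measure))"
      using bound by (intro nn_integral_mono) simp
    also have "\<dots> = ennreal (\<bar>C\<bar> * 16 * (1 / 16) ^ i) * emeasure lborel (ball (0::complex) (2 ^ i))"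
      by (simp add: nn_integral_cmult_indicator)
    also have "emeasure lborel (ball (0::complex) (2 ^ i)) = ennreal (pi * 4 ^ i)"
      by (simp add: emeasure_ball unit_ball_vol_2 power2_eq_square flip: power_mult_distrib)
    also have "ennreal (\<bar>C\<bar> * 16 * (1 / 16) ^ i) * ennreal (pi * 4 ^ i) = ennreal (\<bar>C\<bar> * 16 * pi * (1 / 4) ^ i)"
    proof -
      have "(1 / 16) ^ i * 4 ^ i = (1 / 4 :: real) ^ i" by (simp flip: power_mult_distrib)
      then show ?thesis by (simp add: mult.assoc mult.left_commute flip: ennreal_mult)
    qed
    finally show ?thesis .
  qed
  then have "(\<Sum>i. \<integral>\<^sup>+z\<in>D i. ennreal (\<bar>gauss_curvature (X \<circ> id) z\<bar> * area_density (X \<circ> id) z) \<partial>lborel)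
      \<le> (\<Sum>i. ennreal (\<bar>C\<bar> * 16 * pi * (1 / 4) ^ i))"
    by (intro suminf_le) auto
  also have "\<dots> < \<infinity>"
  proof -
    have "summable (\<lambda>i. \<bar>C\<bar> * 16 * pi * (1 / 4) ^ i)"
      by (intro summable_mult summable_geometric) simp
    then have "(\<Sum>i. ennreal (\<bar>C\<bar> * 16 * pi * (1 / 4) ^ i)) \<noteq> top"
      by (intro ennreal_suminf_neq_top) auto
    then show ?thesis by (simp add: less_top)
  qed
  finally have fin: "(\<Sum>i. \<integral>\<^sup>+z\<in>D i. ennreal (\<bar>gauss_curvature (X \<circ> id) z\<bar> * area_density (X \<circ> id) z) \<partial>lborel) < \<infinity>" .
  show ?thesis
    unfolding finite_total_curvature_def
    by (rule exI[of _ "\<lambda>_. \<Omega>"], rule exI[of _ "\<lambda>_. id"], rule exI[of _ D])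
      (use local_parametrization_domain meas sub disj un fin in auto)
qed

end

text \<open>A curve of finite length has bounded image under \<open>X\<close>, hence stays in one
  compact subset of \<open>M\<close> and cannot diverge.\<close>

lemma complete_surface_proper:
  assumes "\<And>R. \<exists>K. compactin M K \<and> {p \<in> topspace M. norm (X p) \<le> R} \<subseteq> K"
  shows "complete_surface M X"
  unfolding complete_surface_def
proof (intro allI impI notI, elim conjE)
  fix \<gamma> v
  assume c: "continuous_map (top_of_set {0::real..}) M \<gamma>"
    and d: "\<forall>t\<ge>0. (X \<circ> \<gamma> has_vector_derivative v t) (at t within {0..})"
    and v: "continuous_on {0..} v"
    and lim: "\<forall>K. compactin M K \<longrightarrow> (\<forall>\<^sub>F t in at_top. \<gamma> t \<notin> K)"
    and int: "(\<lambda>t. norm (v t)) integrable_on {0..}"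
  define I where "I = integral {0..} (\<lambda>t. norm (v t))"
  have bound: "norm (X (\<gamma> t)) \<le> norm (X (\<gamma> 0)) + I" if t: "t \<ge> 0" for t
  proof -
    have hi: "(v has_integral (X (\<gamma> t) - X (\<gamma> 0))) {0..t}"
      using fundamental_theorem_of_calculus[of 0 t "X \<circ> \<gamma>" v] t d
      by (simp add: has_vector_derivative_within_subset[of _ _ _ "{0..}" "{0..t}"] subset_eq)
    have ni: "(\<lambda>t. norm (v t)) integrable_on {0..t}"
      by (rule integrable_continuous_interval)
        (intro continuous_intros continuous_on_subset[OF v], auto)
    have "norm (X (\<gamma> t) - X (\<gamma> 0)) \<le> integral {0..t} (\<lambda>t. norm (v t))"
      using integral_norm_bound_integral[of v "{0..t}" "\<lambda>t. norm (v t)"] hi ni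
      by (metis has_integral_integrable integral_unique order_refl)
    also have "\<dots> \<le> I"
      unfolding I_def by (intro integral_subset_le ni int) auto
    finally show ?thesis by (smt (verit) norm_triangle_sub)
  qed
  obtain K where K: "compactin M K" "{p \<in> topspace M. norm (X p) \<le> norm (X (\<gamma> 0)) + I} \<subseteq> K"
    using assms by blast
  have "\<gamma> t \<in> K" if "t \<ge> 0" for t
    using K(2) bound[OF that] c that by (auto simp: continuous_map_def)
  moreover have "\<forall>\<^sub>F t in at_top. \<gamma> t \<notin> K" using lim K by blast
  ultimately have "\<forall>\<^sub>F t in at_top. t < (0::real)"
    by (auto elim!: eventually_mono simp: not_le[symmetric])
  then show False
    using eventually_ge_at_top[of "0::real"] 
    by (smt (verit) eventually_at_top_linorder)
qed

section \<open>Ends of a finitely punctured plane\<close>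

text \<open>Punctures are labelled by \<^typ>\<open>complex option\<close>, where \<^const>\<open>None\<close> stands for infinity.\<close>

definition puncture_nhd :: "complex option \<Rightarrow> real \<Rightarrow> complex set" where
  "puncture_nhd q \<epsilon> = (case q of None \<Rightarrow> {z. 1 / \<epsilon> < norm z} | Some p \<Rightarrow> ball p \<epsilon> - {p})"

definition puncture_filter :: "complex option \<Rightarrow> complex filter" where
  "puncture_filter q = (case q of None \<Rightarrow> at_infinity | Some p \<Rightarrow> at p)"

definition punctures :: "complex set \<Rightarrow> complex option set" where
  "punctures P = insert None (Some ` P)"

text \<open>The component of the complement of \<open>K\<close> that contains all small
  neighbourhoods of the puncture, written without choosing a base point. The value \<open>{}\<close>
  for non-compact \<open>K\<close> is the normalization prescribed in \<open>ends\<close>.\<close>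

definition end_at :: "complex set \<Rightarrow> complex option \<Rightarrow> complex set \<Rightarrow> complex set" where
  "end_at P q K = (if compactin (top_of_set (- P)) K
     then {z. \<exists>\<epsilon>>0. \<forall>w\<in>puncture_nhd q \<epsilon>. connected_component (- P - K) w z} else {})"

lemma open_puncture_nhd: "open (puncture_nhd q \<epsilon>)"
  by (cases q) (auto simp: puncture_nhd_def intro!: open_Collect_less continuous_intros)

lemma connected_puncture_nhd: "connected (puncture_nhd q \<epsilon>)"
proof (cases q)
  case None
  have "{z::complex. 1 / \<epsilon> < norm z} = - cball 0 (1 / \<epsilon>)" by auto
  moreover have "connected (- cball (0::complex) (1 / \<epsilon>))"
    by (intro connected_complement_bounded_convex) auto
  ultimately show ?thesis using None by (simp add: puncture_nhd_def)
next
  case (Some p)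
  then show ?thesis
    by (simp add: puncture_nhd_def connected_punctured_ball)
qed

lemma puncture_nhd_nonempty: "\<epsilon> > 0 \<Longrightarrow> puncture_nhd q \<epsilon> \<noteq> {}"
proof (cases q)
  case None
  have "1 / \<epsilon> < norm (of_real (\<bar>1 / \<epsilon>\<bar> + 1) :: complex)"
    unfolding norm_of_real by linarith
  then show ?thesis using None by (auto simp: puncture_nhd_def)
next
  case (Some p)
  assume "\<epsilon> > 0"
  then have "p + of_real (\<epsilon> / 2) \<in> puncture_nhd q \<epsilon>"
    using Some by (simp add: puncture_nhd_def dist_norm)
  then show ?thesis by blast
qed

lemma puncture_nhd_mono: "0 < \<epsilon> \<Longrightarrow> \<epsilon> \<le> \<delta> \<Longrightarrow> puncture_nhd q \<epsilon> \<subseteq> puncture_nhd q \<delta>"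
  using frac_le[of 1 1 \<epsilon> \<delta>] by (cases q) (auto simp: puncture_nhd_def)

lemma eventually_puncture_filter:
  "eventually R (puncture_filter q) \<longleftrightarrow> (\<exists>\<epsilon>>0. \<forall>z\<in>puncture_nhd q \<epsilon>. R z)"
proof (cases q)
  case None
  have "(\<exists>b. \<forall>x. b \<le> norm x \<longrightarrow> R x) \<longleftrightarrow> (\<exists>\<epsilon>>0. \<forall>z. 1 / \<epsilon> < norm z \<longrightarrow> R z)"
  proof
    assume "\<exists>b. \<forall>x. b \<le> norm x \<longrightarrow> R x"
    then obtain b where b: "\<And>x. b \<le> norm x \<Longrightarrow> R x" by blast
    show "\<exists>\<epsilon>>0. \<forall>z. 1 / \<epsilon> < norm z \<longrightarrow> R z"
    proof (intro exI[of _ "1 / (\<bar>b\<bar> + 1)"] conjI allI impI)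
      fix z :: complex assume "1 / (1 / (\<bar>b\<bar> + 1)) < norm z"
      then show "R z" by (intro b) simp
    qed simp
  next
    assume "\<exists>\<epsilon>>0. \<forall>z. 1 / \<epsilon> < norm z \<longrightarrow> R z"
    then obtain \<epsilon> where e: "\<And>z. 1 / \<epsilon> < norm z \<Longrightarrow> R z" by blast
    have "1 / \<epsilon> < norm x" if "1 / \<epsilon> + 1 \<le> norm x" for x :: complex using that by linarith
    then show "\<exists>b. \<forall>x. b \<le> norm x \<longrightarrow> R x" using e by blast
  qed
  then show ?thesis using None by (simp add: puncture_filter_def puncture_nhd_def eventually_at_infinity)
next
  case (Some p)
  then show ?thesis
    by (simp add: puncture_filter_def puncture_nhd_def eventually_at Ball_def dist_commute conj_commute)
qed

lemma eventually_at_right_0_mono: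
  fixes R :: "real \<Rightarrow> bool"
  assumes "\<epsilon>0 > 0" "\<And>\<epsilon>. 0 < \<epsilon> \<Longrightarrow> \<epsilon> \<le> \<epsilon>0 \<Longrightarrow> R \<epsilon>"
  shows "eventually R (at_right 0)"
  using assms unfolding eventually_at_right_field by (intro exI[of _ \<epsilon>0]) auto

lemma eventually_at_right_0_ex:
  fixes R :: "real \<Rightarrow> bool"
  shows "eventually R (at_right 0) \<Longrightarrow> \<exists>\<epsilon>>0. R \<epsilon>"
  unfolding eventually_at_right_field by (meson dense)

text \<open>A compact exhaustion as \<epsilon> decreases to 0. Questions about all compact sets are
  answered on these, where the components of the complement are explicit.\<close>

definition puncture_core :: "complex set \<Rightarrow> real \<Rightarrow> complex set" where
  "puncture_core P \<epsilon> = - P - (\<Union>q\<in>punctures P. puncture_nhd q \<epsilon>)"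

lemma compact_puncture_core:
  assumes "finite P" "\<epsilon> > 0"
  shows "compact (puncture_core P \<epsilon>)"
proof -
  have "puncture_core P \<epsilon> = cball 0 (1 / \<epsilon>) \<inter> (\<Inter>p\<in>P. - ball p \<epsilon>)"
    using assms by (fastforce simp: puncture_core_def punctures_def puncture_nhd_def not_less)
  then show ?thesis by (auto intro!: compact_Int_closed closed_INT)
qed

lemma puncture_core_subset: "puncture_core P \<epsilon> \<subseteq> - P"
  by (auto simp: puncture_core_def)

lemma compactin_puncture_core:
  "finite P \<Longrightarrow> \<epsilon> > 0 \<Longrightarrow> compactin (top_of_set (- P)) (puncture_core P \<epsilon>)"
  by (simp add: compactin_subtopology compact_puncture_core puncture_core_subset)

lemma eventually_disjoint_puncture_nhd:
  assumes "compact K" "K \<subseteq> - P" "q \<in> punctures P"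
  shows "\<forall>\<^sub>F \<epsilon> in at_right 0. K \<inter> puncture_nhd q \<epsilon> = {}"
proof (cases q)
  case None
  obtain b where b: "\<And>z. z \<in> K \<Longrightarrow> norm z \<le> b" "b > 0"
    using compact_imp_bounded[OF assms(1)] bounded_pos by blast
  show ?thesis
  proof (rule eventually_at_right_0_mono[of "1 / b"])
    fix \<epsilon> :: real assume "0 < \<epsilon>" "\<epsilon> \<le> 1 / b"
    then have "b \<le> 1 / \<epsilon>" using b(2) by (simp add: field_simps)
    then show "K \<inter> puncture_nhd q \<epsilon> = {}" using b(1) None by (fastforce simp: puncture_nhd_def)
  qed (use b(2) in simp)
next
  case (Some p)
  then have "p \<in> - K" using assms by (auto simp: punctures_def)
  then obtain e where e: "e > 0" "ball p e \<subseteq> - K"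
    using compact_imp_closed[OF assms(1)] open_contains_ball open_Compl by metis
  show ?thesis
    proof (rule eventually_at_right_0_mono[of e])
    fix \<epsilon> :: real assume "0 < \<epsilon>" "\<epsilon> \<le> e"
    then have "ball p \<epsilon> \<subseteq> - K" using e by (meson order_trans subset_ball)
    then show "K \<inter> puncture_nhd q \<epsilon> = {}" using Some by (auto simp: puncture_nhd_def)
  qed (use e in simp)
qed

lemma eventually_subset_puncture_core:
  assumes "finite P" "compact K" "K \<subseteq> - P"
  shows "\<forall>\<^sub>F \<epsilon> in at_right 0. K \<subseteq> puncture_core P \<epsilon>"
proof -
  have "\<forall>\<^sub>F \<epsilon> in at_right 0. \<forall>q\<in>punctures P. K \<inter> puncture_nhd q \<epsilon> = {}"
    using assms eventually_disjoint_puncture_nhd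
    by (intro eventually_ball_finite) (auto simp: punctures_def)
  then show ?thesis
    by eventually_elim (use assms in \<open>auto simp: puncture_core_def\<close>)
qed

lemma eventually_puncture_nhds_disjoint:
  assumes "finite P"
  shows "\<forall>\<^sub>F \<epsilon> in at_right 0. (\<forall>q\<in>punctures P. puncture_nhd q \<epsilon> \<subseteq> - P) \<and>
     (\<forall>q\<in>punctures P. \<forall>q'\<in>punctures P. q \<noteq> q' \<longrightarrow> puncture_nhd q \<epsilon> \<inter> puncture_nhd q' \<epsilon> = {})"
proof -
  have sub: "\<forall>\<^sub>F \<epsilon> in at_right 0. puncture_nhd q \<epsilon> \<subseteq> - {p}" if "q \<in> punctures P" "p \<in> P" for q p
  proof (cases "q = Some p")
    case True
    then show ?thesis by (auto simp: puncture_nhd_def)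
  next
    case False
    have "\<forall>\<^sub>F \<epsilon> in at_right 0. {p} \<inter> puncture_nhd q \<epsilon> = {}"
      using that False eventually_disjoint_puncture_nhd[of "{p}" "P - {p}" q]
      by (auto simp: punctures_def)
    then show ?thesis by eventually_elim auto
  qed
  have None_Some: "\<forall>\<^sub>F \<epsilon> in at_right 0. puncture_nhd None \<epsilon> \<inter> puncture_nhd (Some p) \<epsilon> = {}" for p
  proof (rule eventually_at_right_0_mono[of "1 / (norm p + 2)"])
    show "0 < 1 / (norm p + 2)" by (smt (verit) divide_pos_pos norm_ge_zero)
    fix \<epsilon> :: real assume e: "0 < \<epsilon>" "\<epsilon> \<le> 1 / (norm p + 2)"
    have n: "norm p + 2 > 0" by (smt (verit) norm_ge_zero)
    have "\<epsilon> \<le> 1" using e n by (smt (verit) divide_le_eq_1 norm_ge_zero)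
    moreover have "1 / \<epsilon> \<ge> norm p + 2" using e n by (simp add: field_simps)
    ultimately have "norm z \<le> 1 / \<epsilon>" if "z \<in> ball p \<epsilon>" for z
      using that norm_triangle_ineq2[of z p] by (simp add: dist_norm norm_minus_commute)
    then show "puncture_nhd None \<epsilon> \<inter> puncture_nhd (Some p) \<epsilon> = {}"
      by (force simp: puncture_nhd_def)
  qed
  have Some_Some: "\<forall>\<^sub>F \<epsilon> in at_right 0. puncture_nhd (Some p) \<epsilon> \<inter> puncture_nhd (Some p') \<epsilon> = {}"
    if "p \<noteq> p'" for p p'
  proof (rule eventually_at_right_0_mono[of "dist p p' / 2"])
    show "0 < dist p p' / 2" using that by simp
    fix \<epsilon> :: real assume e: "0 < \<epsilon>" "\<epsilon> \<le> dist p p' / 2"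
    then have "ball p \<epsilon> \<inter> ball p' \<epsilon> = {}"
      by (intro disjoint_ballI) simp
    then show "puncture_nhd (Some p) \<epsilon> \<inter> puncture_nhd (Some p') \<epsilon> = {}"
      by (auto simp: puncture_nhd_def)
  qed
  have "\<forall>\<^sub>F \<epsilon> in at_right 0. puncture_nhd q \<epsilon> \<inter> puncture_nhd q' \<epsilon> = {}" if "q \<noteq> q'" for q q'
    using that None_Some Some_Some by (cases q; cases q') (auto simp: Int_commute)
  then have "\<forall>\<^sub>F \<epsilon> in at_right 0. \<forall>q\<in>punctures P. \<forall>q'\<in>punctures P. q \<noteq> q' \<longrightarrow>
      puncture_nhd q \<epsilon> \<inter> puncture_nhd q' \<epsilon> = {}"
    using assms by (intro eventually_ball_finite ballI) (auto simp: punctures_def)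
  moreover have "\<forall>\<^sub>F \<epsilon> in at_right 0. \<forall>q\<in>punctures P. \<forall>p\<in>P. puncture_nhd q \<epsilon> \<subseteq> - {p}"
    using assms sub by (intro eventually_ball_finite ballI) (auto simp: punctures_def)
  ultimately show ?thesis by eventually_elim blast
qed

lemma components_of_puncture_core_complement:
  assumes "finite P"
  shows "\<forall>\<^sub>F \<epsilon> in at_right 0. components (- P - puncture_core P \<epsilon>) = (\<lambda>q. puncture_nhd q \<epsilon>) ` punctures P"
proof -
  have "\<forall>\<^sub>F \<epsilon> in at_right (0::real). \<epsilon> > 0" by (simp add: eventually_at_right_less)
  then show ?thesis
    using eventually_puncture_nhds_disjoint[OF assms]
  proof eventually_elim
    case (elim \<epsilon>)
    note sub = elim(2)[THEN conjunct1, rule_format] and disj = elim(2)[THEN conjunct2, rule_format]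
    show ?case
    proof (rule components_open_unique)
      show "pairwise disjnt ((\<lambda>q. puncture_nhd q \<epsilon>) ` punctures P)"
      proof (rule pairwiseI)
        fix S T assume "S \<in> (\<lambda>q. puncture_nhd q \<epsilon>) ` punctures P" "T \<in> (\<lambda>q. puncture_nhd q \<epsilon>) ` punctures P" "S \<noteq> T"
        then show "disjnt S T" using disj unfolding disjnt_def by fast
      qed
      show "\<Union> ((\<lambda>q. puncture_nhd q \<epsilon>) ` punctures P) = - P - puncture_core P \<epsilon>"
        using sub unfolding puncture_core_def by fast
      fix S assume "S \<in> (\<lambda>q. puncture_nhd q \<epsilon>) ` punctures P"
      then show "open S \<and> connected S \<and> S \<noteq> {}"
        using elim(1) open_puncture_nhd connected_puncture_nhd puncture_nhd_nonempty by fast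
    qed
  qed
qed

lemma connected_components_of_top_of_set: "connected_components_of (top_of_set S) = components S"
proof -
  have "connected_component_of (top_of_set S) = connected_component S"
    by (auto simp: fun_eq_iff connected_component_of_def connected_component_def
        connectedin_subtopology)
  then show ?thesis
    by (auto simp: connected_components_of_def components_def)
qed

lemma connected_components_of_complement:
  "connected_components_of (subtopology (top_of_set (- P)) (topspace (top_of_set (- P)) - K)) =
     components (- P - K)"
proof -
  have "- P \<inter> (- P - K) = - P - K" by auto
  then show ?thesis
    by (simp add: subtopology_subtopology connected_components_of_top_of_set)
qed

lemma end_at_component:
  assumes "finite P" "q \<in> punctures P" "compactin (top_of_set (- P)) K"
  shows "end_at P q K \<in> components (- P - K)"
    and "\<forall>\<^sub>F \<epsilon> in at_right 0. puncture_nhd q \<epsilon> \<subseteq> end_at P q K"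
proof -
  have K: "compact K" "K \<subseteq> - P" using assms(3) by (auto simp: compactin_subtopology)
  have ev: "\<forall>\<^sub>F \<epsilon> in at_right 0. \<epsilon> > 0 \<and> puncture_nhd q \<epsilon> \<subseteq> - P - K"
    using eventually_puncture_nhds_disjoint[OF assms(1)]
      eventually_disjoint_puncture_nhd[OF K assms(2)] eventually_at_right_less[of "0::real"]
    by eventually_elim (use assms(2) in auto)
  then obtain \<delta> where \<delta>: "\<delta> > 0" "puncture_nhd q \<delta> \<subseteq> - P - K"
    using eventually_at_right_0_ex[OF ev] by blast
  have conn: "connected_component (- P - K) w w'" if "w \<in> puncture_nhd q \<delta>" "w' \<in> puncture_nhd q \<delta>" for w w'
    using that \<delta> connected_puncture_nhd unfolding connected_component_def by blast
  obtain w where w: "w \<in> puncture_nhd q \<delta>" using puncture_nhd_nonempty[OF \<delta>(1)] by blast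
  have "end_at P q K = connected_component_set (- P - K) w"
  proof (intro equalityI subsetI)
    fix z assume "z \<in> end_at P q K"
    then obtain \<epsilon> where \<epsilon>: "\<epsilon> > 0" "\<forall>w\<in>puncture_nhd q \<epsilon>. connected_component (- P - K) w z"
      using assms(3) by (auto simp: end_at_def)
    obtain w' where w': "w' \<in> puncture_nhd q (min \<epsilon> \<delta>)"
      using puncture_nhd_nonempty[of "min \<epsilon> \<delta>" q] \<epsilon> \<delta> by auto
    then have "w' \<in> puncture_nhd q \<epsilon>" "w' \<in> puncture_nhd q \<delta>"
      using puncture_nhd_mono[of "min \<epsilon> \<delta>" \<epsilon> q] puncture_nhd_mono[of "min \<epsilon> \<delta>" \<delta> q] \<epsilon> \<delta> by auto
    then show "z \<in> connected_component_set (- P - K) w"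
      using conn[OF w] \<epsilon> by (metis connected_component_trans mem_Collect_eq)
  next
    fix z assume "z \<in> connected_component_set (- P - K) w"
    then have "\<forall>w'\<in>puncture_nhd q \<delta>. connected_component (- P - K) w' z"
      using conn[OF _ w] by (metis connected_component_trans mem_Collect_eq)
    then show "z \<in> end_at P q K" using assms(3) \<delta>(1) by (auto simp: end_at_def)
  qed
  note eq = this
  show "end_at P q K \<in> components (- P - K)"
    unfolding eq using w \<delta> by (intro componentsI) auto
  have "puncture_nhd q \<delta> \<subseteq> end_at P q K"
    using conn[OF w] eq by auto
  then show "\<forall>\<^sub>F \<epsilon> in at_right 0. puncture_nhd q \<epsilon> \<subseteq> end_at P q K"
    by (intro eventually_at_right_0_mono[OF \<delta>(1)]) (use puncture_nhd_mono in blast)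
qed

lemma end_at_in_ends:
  assumes "finite P" "q \<in> punctures P"
  shows "end_at P q \<in> ends (top_of_set (- P))"
proof -
  have "end_at P q L \<subseteq> end_at P q K"
    if KL: "compactin (top_of_set (- P)) K" "compactin (top_of_set (- P)) L" "K \<subseteq> L" for K L
  proof
    fix z assume "z \<in> end_at P q L"
    then obtain \<epsilon> where "\<epsilon> > 0" "\<forall>w\<in>puncture_nhd q \<epsilon>. connected_component (- P - L) w z"
      using KL(2) by (auto simp: end_at_def)
    moreover have "- P - L \<subseteq> - P - K" using KL(3) by blast
    ultimately have "\<forall>w\<in>puncture_nhd q \<epsilon>. connected_component (- P - K) w z"
      using connected_component_of_subset by blast
    then show "z \<in> end_at P q K"
      using KL(1) \<open>\<epsilon> > 0\<close> by (auto simp: end_at_def)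
  qed
  then show ?thesis
    unfolding ends_def connected_components_of_complement
    using end_at_component(1)[OF assms] by (auto simp: end_at_def)
qed

text \<open>The components of the complement of a small core are the pairwise disjoint puncture
  neighbourhoods. The one chosen by the end contains a still smaller neighbourhood of
  \<open>q\<close>, so it can only be that of \<open>q\<close>.\<close>

lemma end_at_puncture_core:
  assumes "finite P" "q \<in> punctures P"
  shows "\<forall>\<^sub>F \<epsilon> in at_right 0. end_at P q (puncture_core P \<epsilon>) = puncture_nhd q \<epsilon>"
  using eventually_puncture_nhds_disjoint[OF assms(1)]
    components_of_puncture_core_complement[OF assms(1)] eventually_at_right_less[of "0::real"]
proof eventually_elim
  case (elim \<epsilon>)
  note K = compactin_puncture_core[OF assms(1) elim(3)]
  obtain r where r: "r \<in> punctures P" "end_at P q (puncture_core P \<epsilon>) = puncture_nhd r \<epsilon>"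
    using end_at_component(1)[OF assms K] elim by auto
  have "\<forall>\<^sub>F \<delta> in at_right (0::real). r = q"
    using end_at_component(2)[OF assms K] eventually_at_right_less[of "0::real"]
      eventually_at_right_real[OF elim(3)]
  proof eventually_elim
    case (elim \<delta>)
    then have "puncture_nhd q \<delta> \<subseteq> puncture_nhd q \<epsilon> \<inter> puncture_nhd r \<epsilon>"
      using puncture_nhd_mono[of \<delta> \<epsilon>] r by auto
    then have "puncture_nhd q \<epsilon> \<inter> puncture_nhd r \<epsilon> \<noteq> {}"
      using puncture_nhd_nonempty[of \<delta> q] elim by auto
    then show ?case using \<open>(\<forall>q\<in>punctures P. puncture_nhd q \<epsilon> \<subseteq> - P) \<and> _\<close> r(1) assms(2) by blast
  qed
  then show ?case using r by (auto dest: eventually_at_right_0_ex)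
qed

lemma inj_on_end_at:
  assumes "finite P"
  shows "inj_on (end_at P) (punctures P)"
proof
  fix q q' assume q: "q \<in> punctures P" "q' \<in> punctures P" and eq: "end_at P q = end_at P q'"
  have "\<forall>\<^sub>F \<epsilon> in at_right (0::real). q = q'"
    using eventually_puncture_nhds_disjoint[OF assms] end_at_puncture_core[OF assms q(1)]
      end_at_puncture_core[OF assms q(2)] eventually_at_right_less[of "0::real"]
  proof eventually_elim
    case (elim \<epsilon>)
    then have "puncture_nhd q \<epsilon> = puncture_nhd q' \<epsilon>" using eq by simp
    moreover have "puncture_nhd q \<epsilon> \<noteq> {}" using elim by (simp add: puncture_nhd_nonempty)
    ultimately show ?case using elim(1) q by blast
  qed
  then show "q = q'" by (auto dest: eventually_at_right_0_ex)
qed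

text \<open>On a small core an end selects one puncture neighbourhood; nestedness forces the same
  puncture for all smaller \<epsilon>. For arbitrary compact \<open>K\<close>, pass to a core
  containing \<open>K\<close>: the neighbourhood selected there lies both in \<open>e K\<close> and
  in \<open>end_at P q K\<close>, and two components that meet are equal.\<close>

theorem ends_punctured_plane:
  assumes "finite P"
  shows "ends (top_of_set (- P)) = end_at P ` punctures P"
proof
  show "end_at P ` punctures P \<subseteq> ends (top_of_set (- P))"
    using end_at_in_ends[OF assms] by blast
  show "ends (top_of_set (- P)) \<subseteq> end_at P ` punctures P"
  proof
    fix e assume e: "e \<in> ends (top_of_set (- P))"
    let ?c = "compactin (top_of_set (- P))"
    have e0: "e K = {}" if "\<not> ?c K" for K using e that unfolding ends_def by blast
    have e1: "e K \<in> components (- P - K)" if "?c K" for K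
      using e that unfolding ends_def connected_components_of_complement by blast
    have e2: "e L \<subseteq> e K" if "?c K" "?c L" "K \<subseteq> L" for K L
      using e that unfolding ends_def by blast
    define good where "good \<epsilon> \<longleftrightarrow> components (- P - puncture_core P \<epsilon>) = (\<lambda>q. puncture_nhd q \<epsilon>) ` punctures P
      \<and> (\<forall>q\<in>punctures P. \<forall>q'\<in>punctures P. q \<noteq> q' \<longrightarrow> puncture_nhd q \<epsilon> \<inter> puncture_nhd q' \<epsilon> = {})" for \<epsilon>
    have good: "eventually good (at_right 0)"
      unfolding good_def
      by (intro eventually_conj components_of_puncture_core_complement[OF assms]
          eventually_mono[OF eventually_puncture_nhds_disjoint[OF assms] conjunct2])
    have e_core: "\<exists>r\<in>punctures P. e (puncture_core P \<epsilon>) = puncture_nhd r \<epsilon>" if "\<epsilon> > 0" "good \<epsilon>" for \<epsilon>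
    proof -
      have "e (puncture_core P \<epsilon>) \<in> (\<lambda>q. puncture_nhd q \<epsilon>) ` punctures P"
        using e1[OF compactin_puncture_core[OF assms that(1)]] that(2) unfolding good_def by metis
      then show ?thesis by blast
    qed
    have disj: "q = r" if "good \<epsilon>" "q \<in> punctures P" "r \<in> punctures P" "z \<in> puncture_nhd q \<epsilon>" "z \<in> puncture_nhd r \<epsilon>" for q r \<epsilon> z
      using that unfolding good_def by blast
    obtain \<epsilon>0 where \<epsilon>0: "\<epsilon>0 > 0" "good \<epsilon>0"
      using eventually_at_right_0_ex[OF good] by blast
    obtain q where q: "q \<in> punctures P" "e (puncture_core P \<epsilon>0) = puncture_nhd q \<epsilon>0"
      using e_core[OF \<epsilon>0] by blast
    have "e K = end_at P q K" for K
    proof (cases "?c K")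
      case False
      then show ?thesis using e0[OF False] by (simp add: end_at_def)
    next
      case K: True
      then have K': "compact K" "K \<subseteq> - P" by (auto simp: compactin_subtopology)
      have "\<forall>\<^sub>F \<epsilon> in at_right 0. \<epsilon> \<le> \<epsilon>0"
        using \<epsilon>0 by (intro eventually_at_right_0_mono[of \<epsilon>0]) auto
      then have "\<forall>\<^sub>F \<epsilon> in at_right 0. good \<epsilon> \<and> K \<subseteq> puncture_core P \<epsilon> \<and> \<epsilon> \<le> \<epsilon>0 \<and> puncture_nhd q \<epsilon> \<subseteq> end_at P q K"
        by (intro eventually_conj good eventually_subset_puncture_core[OF assms K']
            end_at_component(2)[OF assms q(1) K])
      then obtain \<epsilon> where \<epsilon>: "\<epsilon> > 0" "good \<epsilon>" "K \<subseteq> puncture_core P \<epsilon>" "\<epsilon> \<le> \<epsilon>0" "puncture_nhd q \<epsilon> \<subseteq> end_at P q K"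
        using eventually_at_right_0_ex by blast
      note c\<epsilon> = compactin_puncture_core[OF assms \<epsilon>(1)]
      obtain r where r: "r \<in> punctures P" "e (puncture_core P \<epsilon>) = puncture_nhd r \<epsilon>"
        using e_core[OF \<epsilon>(1,2)] by blast
      obtain z where z: "z \<in> puncture_nhd r \<epsilon>"
        using puncture_nhd_nonempty[OF \<epsilon>(1)] by blast
      have "puncture_core P \<epsilon>0 \<subseteq> puncture_core P \<epsilon>"
        using puncture_nhd_mono[OF \<epsilon>(1,4)] unfolding puncture_core_def by blast
      then have "puncture_nhd r \<epsilon> \<subseteq> puncture_nhd q \<epsilon>0"
        using e2[OF compactin_puncture_core[OF assms \<epsilon>0(1)] c\<epsilon>] r(2) q(2) by simp
      then have "z \<in> puncture_nhd q \<epsilon>0" "z \<in> puncture_nhd r \<epsilon>0"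
        using z puncture_nhd_mono[OF \<epsilon>(1,4)] by blast+
      then have rq: "r = q" using disj[OF \<epsilon>0(2)] r(1) q(1) by blast
      then have "z \<in> e K \<inter> end_at P q K"
        using e2[OF K c\<epsilon> \<epsilon>(3)] r(2) z \<epsilon>(5) by blast
      then show ?thesis
        using components_eq[OF e1[OF K] end_at_component(1)[OF assms q(1) K]] by blast
    qed
    then have "e = end_at P q" by blast
    then show "e \<in> end_at P ` punctures P" using q by auto
  qed
qed

text \<open>Carries limits at a puncture of the plane over to limits along the end.\<close>

lemma end_filter_end_at_le:
  assumes "finite P" "q \<in> punctures P"
  shows "end_filter (top_of_set (- P)) (end_at P q) \<le> puncture_filter q"
proof (rule filter_leI)
  fix R assume "eventually R (puncture_filter q)"
  then obtain \<epsilon> where \<epsilon>: "\<epsilon> > 0" "\<forall>z\<in>puncture_nhd q \<epsilon>. R z"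
    by (auto simp: eventually_puncture_filter)
  have "\<forall>\<^sub>F \<delta> in at_right 0. \<delta> \<le> \<epsilon>"
    using \<epsilon> by (intro eventually_at_right_0_mono[of \<epsilon>]) auto
  then have "\<forall>\<^sub>F \<delta> in at_right 0. \<delta> > 0 \<and> \<delta> \<le> \<epsilon> \<and> end_at P q (puncture_core P \<delta>) = puncture_nhd q \<delta>"
    using end_at_puncture_core[OF assms] eventually_at_right_less[of "0::real"] by eventually_elim auto
  then obtain \<delta> where \<delta>: "\<delta> > 0" "\<delta> \<le> \<epsilon>" "end_at P q (puncture_core P \<delta>) = puncture_nhd q \<delta>"
    using eventually_at_right_0_ex by blast
  have "end_filter (top_of_set (- P)) (end_at P q) \<le> principal (puncture_nhd q \<delta>)"
    unfolding end_filter_def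
    by (rule INF_lower2[of "puncture_core P \<delta>"])
      (use compactin_puncture_core[OF assms(1) \<delta>(1)] \<delta>(3) in auto)
  moreover have "eventually R (principal (puncture_nhd q \<delta>))"
    using \<epsilon> puncture_nhd_mono[OF \<delta>(1,2), of q] by (auto simp: eventually_principal)
  ultimately show "eventually R (end_filter (top_of_set (- P)) (end_at P q))"
    by (rule filter_leD)
qed

lemma end_neighborhood_end_at:
  assumes "finite P" "q \<in> punctures P" "open U" "U \<subseteq> - P" "\<epsilon> > 0" "puncture_nhd q \<epsilon> \<subseteq> U"
  shows "end_neighborhood (top_of_set (- P)) (end_at P q) U"
proof -
  have "\<forall>\<^sub>F \<delta> in at_right 0. \<delta> \<le> \<epsilon>"
    using assms by (intro eventually_at_right_0_mono[of \<epsilon>]) auto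
  then have "\<forall>\<^sub>F \<delta> in at_right 0. \<delta> > 0 \<and> \<delta> \<le> \<epsilon> \<and> end_at P q (puncture_core P \<delta>) = puncture_nhd q \<delta>"
    using end_at_puncture_core[OF assms(1,2)] eventually_at_right_less[of "0::real"] by eventually_elim auto
  then obtain \<delta> where \<delta>: "\<delta> > 0" "\<delta> \<le> \<epsilon>" "end_at P q (puncture_core P \<delta>) = puncture_nhd q \<delta>"
    using eventually_at_right_0_ex by blast
  have "openin (top_of_set (- P)) U"
    using assms by (simp add: open_subset)
  moreover have "puncture_nhd q \<delta> \<subseteq> U"
    using puncture_nhd_mono[OF \<delta>(1,2), of q] assms(6) by (rule order_trans)
  then have "end_at P q (puncture_core P \<delta>) \<subseteq> U"
    by (simp only: \<delta>(3))
  then have "\<exists>K. compactin (top_of_set (- P)) K \<and> end_at P q K \<subseteq> U"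
    using compactin_puncture_core[OF assms(1) \<delta>(1)] by (intro exI[of _ "puncture_core P \<delta>"] conjI)
  ultimately show ?thesis
    unfolding end_neighborhood_def by (rule conjI)
qed

text \<open>The plane is a sphere minus one point (through the hyperplane orthogonal to the axis).
  That point, which stands for infinity, is added to the images of the punctures.\<close>

lemma genus_zero_punctured_plane:
  fixes P :: "complex set"
  assumes "finite P"
  shows "genus_zero (top_of_set (- P))"
proof -
  have a: "(sphere (0::real^3) 1 - {axis 1 1}) homeomorphic {x::real^3. axis 1 1 \<bullet> x = 0}"
    using homeomorphic_punctured_sphere_hyperplane[of 1 "axis 1 1" "0::real^3" "axis 1 1" 0]
    by (simp add: axis_eq_axis)
  have "axis 1 1 \<noteq> (0::real^3)" by (metis norm_axis_1 norm_zero zero_neq_one)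
  then have "aff_dim {x::real^3. axis 1 1 \<bullet> x = 0} = 2"
    by (subst aff_dim_hyperplane) simp_all
  then have b: "{x::real^3. axis 1 1 \<bullet> x = 0} homeomorphic (UNIV :: complex set)"
    by (intro homeomorphic_affine_sets) (simp_all add: affine_hyperplane)
  have "(UNIV::complex set) homeomorphic (sphere (0::real^3) 1 - {axis 1 1})"
    using homeomorphic_trans[OF a b] homeomorphic_sym by blast
  then obtain f g where fg: "homeomorphism (UNIV::complex set) (sphere (0::real^3) 1 - {axis 1 1}) f g"
    unfolding homeomorphic_def by blast
  have "homeomorphism (- P) (f ` (- P)) f g"
    by (rule homeomorphism_of_subsets[OF fg]) (use homeomorphism_image1[OF fg] in fast)+
  moreover have "f ` (- P) = sphere 0 1 - insert (axis 1 1) (f ` P)"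
  proof -
    have "f ` UNIV = sphere 0 1 - {axis 1 1}"
      using homeomorphism_image1[OF fg] .
    moreover have "inj f"
      using homeomorphism_apply1[OF fg] by (auto intro: inj_on_inverseI)
    ultimately have "f ` (UNIV - P) = (sphere 0 1 - {axis 1 1}) - f ` P"
      by (simp add: image_set_diff)
    then show ?thesis by (auto simp: Compl_eq_Diff_UNIV)
  qed
  ultimately have "homeomorphism (- P) (sphere 0 1 - insert (axis 1 1) (f ` P)) f g"
    by simp
  then have "top_of_set (- P) homeomorphic_space top_of_set (sphere (0::real^3) 1 - insert (axis 1 1) (f ` P))"
    unfolding homeomorphic_space_def homeomorphic_maps_def homeomorphism_def
    by (intro exI[of _ f] exI[of _ g] conjI) (simp_all add: continuous_map_in_subtopology image_subset_iff_funcset[symmetric])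
  moreover have "insert (axis 1 1) (f ` P) \<subseteq> sphere 0 1"
    using homeomorphism_image1[OF fg] by auto
  moreover have "finite (insert (axis 1 1) (f ` P))"
    using assms by simp
  ultimately show ?thesis
    unfolding genus_zero_def by blast
qed

section \<open>Catenoid ends in normal form\<close>

text \<open>On the closed disc of half the radius all derivatives are bounded by compactness; the
  last two estimates are Taylor remainders of order zero and one. One constant is used for all four
  bounds.\<close>

lemma holomorphic_ball_bounds:
  assumes "h holomorphic_on ball 0 \<rho>" "\<rho> > 0"
  shows "\<exists>M>0. \<forall>z\<in>cball 0 (\<rho> / 2). norm (h z) \<le> M \<and> norm (deriv h z) \<le> M \<and>
    norm (h z - h 0) \<le> M * norm z \<and> norm (h z - h 0 - deriv h 0 * z) \<le> M * (norm z)\<^sup>2"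
proof -
  let ?C = "cball (0::complex) (\<rho> / 2)"
  have sub: "?C \<subseteq> ball 0 \<rho>" using assms by auto
  have hol: "(deriv ^^ k) h holomorphic_on ball 0 \<rho>" for k
    using assms by (intro holomorphic_higher_deriv) auto
  have bdd: "\<exists>B>0. \<forall>z\<in>?C. norm ((deriv ^^ k) h z) \<le> B" for k
  proof -
    have "continuous_on ?C ((deriv ^^ k) h)"
      using holomorphic_on_imp_continuous_on[OF hol] sub continuous_on_subset by blast
    then have "bounded ((deriv ^^ k) h ` ?C)"
      by (intro compact_imp_bounded compact_continuous_image) auto
    then show ?thesis unfolding bounded_pos by auto
  qed
  obtain B0 where B0: "B0 > 0" "\<And>z. z \<in> ?C \<Longrightarrow> norm (h z) \<le> B0" using bdd[of 0] by auto
  obtain B1 where B1: "B1 > 0" "\<And>z. z \<in> ?C \<Longrightarrow> norm (deriv h z) \<le> B1" using bdd[of 1] by auto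
  obtain B2 where B2: "B2 > 0" "\<And>z. z \<in> ?C \<Longrightarrow> norm (deriv (deriv h) z) \<le> B2"
    using bdd[of 2] by (auto simp: numeral_2_eq_2)
  have d: "((deriv ^^ i) h has_field_derivative (deriv ^^ Suc i) h z) (at z within ?C)" if "z \<in> ?C" for i z
  proof -
    have "z \<in> ball 0 \<rho>" using that sub by blast
    then show ?thesis
      using holomorphic_derivI[OF hol[of i] open_ball, of z] by (simp add: has_field_derivative_at_within)
  qed
  define M where "M = max B0 (max B1 B2)"
  have "norm (h z) \<le> M \<and> norm (deriv h z) \<le> M \<and>
    norm (h z - h 0) \<le> M * norm z \<and> norm (h z - h 0 - deriv h 0 * z) \<le> M * (norm z)\<^sup>2"
    if z: "z \<in> ?C" for z
  proof (intro conjI)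
    show "norm (h z) \<le> M" "norm (deriv h z) \<le> M"
      using B0(2)[OF z] B1(2)[OF z] by (auto simp: M_def)
    have c0: "0 \<in> ?C" using assms by simp
    have "norm (h z - h 0) \<le> B1 * norm z"
      using complex_Taylor[of ?C 0 "\<lambda>i. (deriv ^^ i) h" B1 0 z, OF _ d _ c0 z] B1 by simp
    also have "\<dots> \<le> M * norm z" by (intro mult_right_mono) (auto simp: M_def)
    finally show "norm (h z - h 0) \<le> M * norm z" .
    have "norm (h z - (h 0 + deriv h 0 * z)) \<le> B2 * (norm z)\<^sup>2"
      using complex_Taylor[of ?C 1 "\<lambda>i. (deriv ^^ i) h" B2 0 z, OF _ d _ c0 z] B2
      by (simp add: power2_eq_square)
    also have "\<dots> \<le> M * (norm z)\<^sup>2" by (intro mult_right_mono) (auto simp: M_def)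
    finally show "norm (h z - h 0 - deriv h 0 * z) \<le> M * (norm z)\<^sup>2" by (simp add: algebra_simps)
  qed
  moreover have "M > 0" using B0 by (simp add: M_def)
  ultimately show ?thesis by blast
qed

lemma ln_norm_has_derivative:
  fixes z :: complex
  assumes "z \<noteq> 0"
  shows "((\<lambda>w. ln (norm w)) has_derivative (\<lambda>v. Re (v / z))) (at z)"
proof -
  \<comment> \<open>Dividing by \<open>z\<close> moves the base point to 1, away from the branch
    cut; the real part is the wanted function up to the constant ln of norm z.\<close>
  have "((\<lambda>w. Ln (w / z)) has_field_derivative 1 / z) (at z)"
    using assms by (auto intro!: derivative_eq_intros)
  then have "((\<lambda>w. Re (Ln (w / z))) has_derivative (\<lambda>v. Re (1 / z * v))) (at z)"
    by (intro has_derivative_Re) (simp only: has_field_derivative_def)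
  then have "((\<lambda>w. Re (Ln (w / z)) + ln (norm z)) has_derivative (\<lambda>v. Re (v / z))) (at z)"
    using has_derivative_add[OF _ has_derivative_const] by fastforce
  then show ?thesis
  proof (rule has_derivative_transform_within_open[of _ _ _ _ "- {0}"])
    fix w :: complex assume "w \<in> - {0}"
    then show "Re (Ln (w / z)) + ln (norm z) = ln (norm w)"
      using assms by (simp add: norm_divide ln_div)
  qed (use assms in auto)
qed

text \<open>Near a catenoid end with vertical normal there is a conformal parameter \<^term>\<open>\<zeta>\<close> for which the
  immersion is \<open>(hor \<zeta>, ht \<zeta>)\<close>: the horizontal part has a simple pole without residue and the
  height has a logarithmic pole.\<close>

locale catenoid_form =
  fixes \<rho> c a :: real and f g h :: "complex \<Rightarrow> complex"
  assumes radius_pos: "\<rho> > 0" and pole: "c \<noteq> 0" and log_growth: "a \<noteq> 0"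
    and f: "f holomorphic_on ball 0 \<rho>" and g: "g holomorphic_on ball 0 \<rho>" and h: "h holomorphic_on ball 0 \<rho>"
begin

definition hor :: "complex \<Rightarrow> complex" where
  "hor \<zeta> = Complex (Re (\<i> * of_real c / \<zeta> + f \<zeta>)) (Re (of_real c / \<zeta> + g \<zeta>))"

definition ht :: "complex \<Rightarrow> real" where
  "ht \<zeta> = a * ln (norm \<zeta>) + Re (h \<zeta>)"

text \<open>The bounded part of \<open>hor\<close>. It is built from real parts, so it is only real
  differentiable, and the coordinate change below must be handled as a map of the real
  plane.\<close>

definition rem :: "complex \<Rightarrow> complex" where
  "rem \<zeta> = of_real (Re (f \<zeta>)) + \<i> * of_real (Re (g \<zeta>))"

text \<open>This is \<zeta> times \<open>hor \<zeta>\<close>, which extends to the puncture with the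
  nonzero value \<i> c.\<close>

definition den :: "complex \<Rightarrow> complex" where
  "den \<zeta> = \<i> * c + \<zeta> * rem \<zeta>"

lemma hor_eq: "\<zeta> \<noteq> 0 \<Longrightarrow> hor \<zeta> = den \<zeta> / \<zeta>"
proof -
  assume "\<zeta> \<noteq> 0"
  have "hor \<zeta> = \<i> * (c / \<zeta>) + rem \<zeta>"
    by (simp add: hor_def rem_def complex_eq_iff flip: times_divide_eq_right)
  then show ?thesis using \<open>\<zeta> \<noteq> 0\<close> by (simp add: den_def field_simps)
qed

lemma deriv_f: "norm \<zeta> < \<rho> \<Longrightarrow> (f has_field_derivative deriv f \<zeta>) (at \<zeta>)"
  and deriv_g: "norm \<zeta> < \<rho> \<Longrightarrow> (g has_field_derivative deriv g \<zeta>) (at \<zeta>)"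
  and deriv_h: "norm \<zeta> < \<rho> \<Longrightarrow> (h has_field_derivative deriv h \<zeta>) (at \<zeta>)"
  using f g h by (auto intro: holomorphic_derivI[OF _ open_ball])

definition rem' :: "complex \<Rightarrow> complex \<Rightarrow> complex" where
  "rem' \<zeta> v = of_real (Re (deriv f \<zeta> * v)) + \<i> * of_real (Re (deriv g \<zeta> * v))"

lemma has_derivative_rem:
  assumes "norm \<zeta> < \<rho>"
  shows "(rem has_derivative rem' \<zeta>) (at \<zeta>)"
proof -
  have "(f has_derivative (\<lambda>v. deriv f \<zeta> * v)) (at \<zeta>)" "(g has_derivative (\<lambda>v. deriv g \<zeta> * v)) (at \<zeta>)"
    using deriv_f[OF assms] deriv_g[OF assms] by (simp_all add: has_field_derivative_def)
  then show ?thesis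
    unfolding rem_def[abs_def] rem'_def[abs_def] by (auto intro!: derivative_eq_intros)
qed

lemma norm_rem'_le: "norm (rem' \<zeta> v) \<le> (norm (deriv f \<zeta>) + norm (deriv g \<zeta>)) * norm v"
proof -
  have "norm (rem' \<zeta> v) \<le> \<bar>Re (deriv f \<zeta> * v)\<bar> + \<bar>Re (deriv g \<zeta> * v)\<bar>"
    unfolding rem'_def by (rule norm_triangle_le) (simp only: norm_mult norm_of_real norm_ii)
  also have "\<dots> \<le> norm (deriv f \<zeta> * v) + norm (deriv g \<zeta> * v)"
    by (intro add_mono abs_Re_le_cmod)
  finally show ?thesis by (simp add: norm_mult algebra_simps)
qed

lemma has_derivative_ht:
  assumes "\<zeta> \<noteq> 0" "norm \<zeta> < \<rho>"
  shows "(ht has_derivative (\<lambda>v. a * Re (v / \<zeta>) + Re (deriv h \<zeta> * v))) (at \<zeta>)"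
proof -
  have "(h has_derivative (\<lambda>v. deriv h \<zeta> * v)) (at \<zeta>)"
    using deriv_h[OF assms(2)] by (simp add: has_field_derivative_def)
  then show ?thesis
    unfolding ht_def[abs_def] using ln_norm_has_derivative[OF assms(1)]
    by (intro has_derivative_add has_derivative_mult_right has_derivative_Re)
qed

text \<open>The reciprocal of the horizontal part extends to a diffeomorphism at the puncture.\<close>

definition chart :: "complex \<Rightarrow> complex" where
  "chart \<zeta> = \<zeta> / den \<zeta>"

definition chart' :: "complex \<Rightarrow> complex \<Rightarrow> complex" where
  "chart' \<zeta> v = (\<i> * c * v - \<zeta>\<^sup>2 * rem' \<zeta> v) / (den \<zeta>)\<^sup>2"

lemma has_derivative_chart:
  assumes "norm \<zeta> < \<rho>" "den \<zeta> \<noteq> 0"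
  shows "(chart has_derivative chart' \<zeta>) (at \<zeta>)"
proof -
  have "(den has_derivative (\<lambda>v. v * rem \<zeta> + \<zeta> * rem' \<zeta> v)) (at \<zeta>)"
    unfolding den_def[abs_def] using has_derivative_rem[OF assms(1)]
    by (auto intro!: derivative_eq_intros)
  then have "(chart has_derivative (\<lambda>v. (v * den \<zeta> - \<zeta> * (v * rem \<zeta> + \<zeta> * rem' \<zeta> v)) / (den \<zeta> * den \<zeta>))) (at \<zeta>)"
    unfolding chart_def[abs_def] using assms(2)
    by (intro has_derivative_divide'[OF has_derivative_ident]) auto
  moreover have "(v * den \<zeta> - \<zeta> * (v * rem \<zeta> + \<zeta> * rem' \<zeta> v)) / (den \<zeta> * den \<zeta>) = chart' \<zeta> v" for v
    by (simp add: chart'_def den_def power2_eq_square algebra_simps)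
  ultimately show ?thesis by simp
qed

definition bounded_by :: "real \<Rightarrow> bool" where
  "bounded_by m \<longleftrightarrow> m > 0 \<and> (\<forall>z\<in>cball 0 (\<rho> / 2).
     (norm (f z) \<le> m \<and> norm (deriv f z) \<le> m \<and> norm (f z - f 0) \<le> m * norm z) \<and>
     (norm (g z) \<le> m \<and> norm (deriv g z) \<le> m \<and> norm (g z - g 0) \<le> m * norm z) \<and>
     (norm (h z) \<le> m \<and> norm (deriv h z) \<le> m \<and> norm (h z - h 0 - deriv h 0 * z) \<le> m * (norm z)\<^sup>2))"

text \<open>Choosing the common bound once makes it a constant of the locale, so that the radius
  \<delta> and all later constants can be written in terms of it.\<close>

definition M :: real where
  "M = (SOME m. bounded_by m)"

lemma M: "M > 0"
  "norm z \<le> \<rho> / 2 \<Longrightarrow> norm (f z) \<le> M" "norm z \<le> \<rho> / 2 \<Longrightarrow> norm (g z) \<le> M"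
  "norm z \<le> \<rho> / 2 \<Longrightarrow> norm (deriv f z) \<le> M" "norm z \<le> \<rho> / 2 \<Longrightarrow> norm (deriv g z) \<le> M"
  "norm z \<le> \<rho> / 2 \<Longrightarrow> norm (deriv h z) \<le> M" "norm z \<le> \<rho> / 2 \<Longrightarrow> norm (f z - f 0) \<le> M * norm z"
  "norm z \<le> \<rho> / 2 \<Longrightarrow> norm (g z - g 0) \<le> M * norm z"
  "norm z \<le> \<rho> / 2 \<Longrightarrow> norm (h z - h 0 - deriv h 0 * z) \<le> M * (norm z)\<^sup>2"
proof -
  obtain Mf where Mf: "\<forall>z\<in>cball 0 (\<rho> / 2). norm (f z) \<le> Mf \<and> norm (deriv f z) \<le> Mf \<and> norm (f z - f 0) \<le> Mf * norm z"
    using holomorphic_ball_bounds[OF f radius_pos] by blast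
  obtain Mg where Mg: "\<forall>z\<in>cball 0 (\<rho> / 2). norm (g z) \<le> Mg \<and> norm (deriv g z) \<le> Mg \<and> norm (g z - g 0) \<le> Mg * norm z"
    using holomorphic_ball_bounds[OF g radius_pos] by blast
  obtain Mh where Mh: "Mh > 0" "\<forall>z\<in>cball 0 (\<rho> / 2). norm (h z) \<le> Mh \<and> norm (deriv h z) \<le> Mh \<and>
      norm (h z - h 0 - deriv h 0 * z) \<le> Mh * (norm z)\<^sup>2"
    using holomorphic_ball_bounds[OF h radius_pos] by blast
  define m where "m = max Mf (max Mg Mh)"
  have le: "Mf * x \<le> m * x" "Mg * x \<le> m * x" "Mh * x \<le> m * x" if "x \<ge> 0" for x
    using that by (auto intro!: mult_right_mono simp: m_def)
  have le': "Mf \<le> m" "Mg \<le> m" "Mh \<le> m" by (auto simp: m_def)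
  have "bounded_by m"
    unfolding bounded_by_def
  proof (intro conjI ballI)
    show "m > 0" using Mh(1) le'(3) by linarith
    fix z :: complex assume z: "z \<in> cball 0 (\<rho> / 2)"
    note B = Mf[rule_format, OF z] Mg[rule_format, OF z] Mh(2)[rule_format, OF z]
      le(1,2)[of "norm z"] le(3)[of "(norm z)\<^sup>2"] le'
    show "norm (f z) \<le> m" "norm (deriv f z) \<le> m" "norm (f z - f 0) \<le> m * norm z"
      "norm (g z) \<le> m" "norm (deriv g z) \<le> m" "norm (g z - g 0) \<le> m * norm z"
      "norm (h z) \<le> m" "norm (deriv h z) \<le> m" "norm (h z - h 0 - deriv h 0 * z) \<le> m * (norm z)\<^sup>2"
      using B by auto
  qed
  then have *: "bounded_by M"
    unfolding M_def by (rule someI)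
  have **: "norm z \<le> \<rho> / 2 \<Longrightarrow> z \<in> cball 0 (\<rho> / 2)" for z :: complex by simp
  show "M > 0"
    "norm z \<le> \<rho> / 2 \<Longrightarrow> norm (f z) \<le> M" "norm z \<le> \<rho> / 2 \<Longrightarrow> norm (g z) \<le> M"
    "norm z \<le> \<rho> / 2 \<Longrightarrow> norm (deriv f z) \<le> M" "norm z \<le> \<rho> / 2 \<Longrightarrow> norm (deriv g z) \<le> M"
    "norm z \<le> \<rho> / 2 \<Longrightarrow> norm (deriv h z) \<le> M" "norm z \<le> \<rho> / 2 \<Longrightarrow> norm (f z - f 0) \<le> M * norm z"
    "norm z \<le> \<rho> / 2 \<Longrightarrow> norm (g z - g 0) \<le> M * norm z"
    "norm z \<le> \<rho> / 2 \<Longrightarrow> norm (h z - h 0 - deriv h 0 * z) \<le> M * (norm z)\<^sup>2"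
    using *[unfolded bounded_by_def, THEN conjunct1]
      *[unfolded bounded_by_def, THEN conjunct2, THEN bspec, OF **] by blast+
qed

lemma norm_rem_le: "norm z \<le> \<rho> / 2 \<Longrightarrow> norm (rem z) \<le> 2 * M"
  and norm_rem_diff_le: "norm z \<le> \<rho> / 2 \<Longrightarrow> norm (rem z - rem 0) \<le> 2 * M * norm z"
proof -
  assume z: "norm z \<le> \<rho> / 2"
  have "norm (rem z) \<le> \<bar>Re (f z)\<bar> + \<bar>Re (g z)\<bar>"
    unfolding rem_def by (rule norm_triangle_le) (simp only: norm_mult norm_of_real norm_ii)
  then show "norm (rem z) \<le> 2 * M"
    using abs_Re_le_cmod[of "f z"] abs_Re_le_cmod[of "g z"] M(2)[OF z] M(3)[OF z] by linarith
  have "rem z - rem 0 = of_real (Re (f z - f 0)) + \<i> * of_real (Re (g z - g 0))"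
    by (simp add: rem_def algebra_simps)
  also have "norm \<dots> \<le> \<bar>Re (f z - f 0)\<bar> + \<bar>Re (g z - g 0)\<bar>"
    by (rule norm_triangle_le) (simp only: norm_mult norm_of_real norm_ii)
  finally show "norm (rem z - rem 0) \<le> 2 * M * norm z"
    using abs_Re_le_cmod[of "f z - f 0"] abs_Re_le_cmod[of "g z - g 0"] M(7)[OF z] M(8)[OF z] by linarith
qed

text \<open>The third entry makes the relative deviation \<open>u\<close> of \<open>den\<close> from
  its value at 0 at most 1/10, which is the smallness used in \<open>chart'_approx\<close>; the
  entry 1 allows one power of norm \<zeta> to be dropped there.\<close>

definition "\<delta> = min (\<rho> / 2) (min 1 (\<bar>c\<bar> / (20 * M)))"

lemma \<delta>: "\<delta> > 0" "\<delta> \<le> \<rho> / 2" "\<delta> \<le> 1" "2 * M * \<delta> \<le> \<bar>c\<bar> / 10"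
proof -
  show "\<delta> > 0" "\<delta> \<le> \<rho> / 2" "\<delta> \<le> 1" using M(1) radius_pos pole by (auto simp: \<delta>_def)
  have "\<delta> \<le> \<bar>c\<bar> / (20 * M)" by (simp add: \<delta>_def)
  then show "2 * M * \<delta> \<le> \<bar>c\<bar> / 10" using M(1) by (simp add: field_simps)
qed

definition "u \<zeta> = \<zeta> * rem \<zeta> / (\<i> * c)"

lemma den_eq: "den \<zeta> = \<i> * c * (1 + u \<zeta>)"
  using pole by (simp add: den_def u_def field_simps)

lemma norm_u_le:
  assumes "norm \<zeta> < \<delta>"
  shows "norm (u \<zeta>) \<le> 2 * M * norm \<zeta> / \<bar>c\<bar>" "norm (u \<zeta>) \<le> 1 / 10"
proof -
  have "norm (u \<zeta>) = norm \<zeta> * norm (rem \<zeta>) / \<bar>c\<bar>" by (simp add: u_def norm_mult norm_divide)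
  also have "\<dots> \<le> norm \<zeta> * (2 * M) / \<bar>c\<bar>"
    using norm_rem_le[of \<zeta>] assms \<delta> by (intro divide_right_mono mult_left_mono) auto
  finally show 1: "norm (u \<zeta>) \<le> 2 * M * norm \<zeta> / \<bar>c\<bar>" by (simp add: mult_ac)
  also have "\<dots> \<le> 2 * M * \<delta> / \<bar>c\<bar>"
    using assms M(1) by (intro divide_right_mono mult_left_mono) auto
  also have "\<dots> \<le> 1 / 10" using \<delta>(4) pole by (simp add: field_simps)
  finally show "norm (u \<zeta>) \<le> 1 / 10" .
qed

lemma norm_1_plus_u: "norm \<zeta> < \<delta> \<Longrightarrow> 9 / 10 \<le> norm (1 + u \<zeta>)" "norm \<zeta> < \<delta> \<Longrightarrow> norm (1 + u \<zeta>) \<le> 11 / 10"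
  using norm_u_le(2)[of \<zeta>] norm_triangle_ineq[of 1 "u \<zeta>"] norm_triangle_ineq[of "1 + u \<zeta>" "- u \<zeta>"] by auto

lemma den_nonzero: "norm \<zeta> < \<delta> \<Longrightarrow> den \<zeta> \<noteq> 0"
  using norm_1_plus_u(1)[of \<zeta>] pole by (auto simp: den_eq)

lemma norm_den: "norm (den \<zeta>) = \<bar>c\<bar> * norm (1 + u \<zeta>)"
  by (simp add: den_eq norm_mult)

text \<open>The map v / (\<i> c) is the derivative of \<open>chart\<close> at 0; an error of at most
  half its norm keeps the chart injective with a Lipschitz inverse. With U = 1 + u the two error
  terms carry the factors 21/100 (from 2/10 + 1/100) and 1/10, both over 81/100 (from
  \<open>(9/10)^2\<close>), and 31/81 is below 1/2.\<close>

lemma chart'_approx: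
  assumes z: "norm \<zeta> < \<delta>"
  shows "norm (chart' \<zeta> v - v / (\<i> * c)) \<le> norm v / (2 * \<bar>c\<bar>)"
proof -
  define U where "U = 1 + u \<zeta>"
  have U: "9 / 10 \<le> norm U" "U \<noteq> 0" using norm_1_plus_u(1)[OF z] by (auto simp: U_def)
  then have U2: "81 / 100 \<le> (norm U)\<^sup>2" using power_mono[of "9/10" "norm U" 2] by (simp add: power2_eq_square)
  have z': "norm \<zeta> \<le> \<rho> / 2" "norm \<zeta> \<le> 1" using z \<delta> by auto
  have "chart' \<zeta> v - v / (\<i> * c) = v * (1 - U\<^sup>2) / (\<i> * c * U\<^sup>2) + \<zeta>\<^sup>2 * rem' \<zeta> v / (c\<^sup>2 * U\<^sup>2)"
    using U pole by (simp add: chart'_def den_eq U_def[symmetric] power_mult_distrib field_simps)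
      (simp add: power2_eq_square power4_eq_xxxx algebra_simps)
  also have "norm \<dots> \<le> norm (v * (1 - U\<^sup>2) / (\<i> * c * U\<^sup>2)) + norm (\<zeta>\<^sup>2 * rem' \<zeta> v / (c\<^sup>2 * U\<^sup>2))"
    by (rule norm_triangle_ineq)
  also have "norm (v * (1 - U\<^sup>2) / (\<i> * c * U\<^sup>2)) \<le> norm v * (21 / 100) / (\<bar>c\<bar> * (81 / 100))"
  proof -
    have "1 - U\<^sup>2 = - (2 * u \<zeta> + (u \<zeta>)\<^sup>2)" by (simp add: U_def power2_eq_square algebra_simps)
    then have "norm (1 - U\<^sup>2) \<le> 2 * norm (u \<zeta>) + (norm (u \<zeta>))\<^sup>2"
      using norm_triangle_ineq[of "2 * u \<zeta>" "(u \<zeta>)\<^sup>2"] by (simp only: norm_minus_cancel norm_mult norm_power) simp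
    also have "\<dots> \<le> 2 * (1 / 10) + (1 / 10)\<^sup>2"
      using norm_u_le(2)[OF z] by (intro add_mono mult_left_mono power_mono) auto
    finally have "norm (1 - U\<^sup>2) \<le> 21 / 100" by (simp add: power2_eq_square)
    then have "norm v * norm (1 - U\<^sup>2) / (\<bar>c\<bar> * (norm U)\<^sup>2) \<le> norm v * (21 / 100) / (\<bar>c\<bar> * (81 / 100))"
      using U2 pole by (intro frac_le mult_left_mono mult_mono) auto
    then show ?thesis by (simp add: norm_mult norm_divide norm_power)
  qed
  also have "norm (\<zeta>\<^sup>2 * rem' \<zeta> v / (c\<^sup>2 * U\<^sup>2)) \<le> norm v * (1 / 10) / (\<bar>c\<bar> * (81 / 100))"
  proof -
    have "norm (rem' \<zeta> v) \<le> 2 * M * norm v"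
      using norm_rem'_le[of \<zeta> v] M(4)[OF z'(1)] M(5)[OF z'(1)]
      by (smt (verit) mult_right_mono norm_ge_zero)
    then have "(norm \<zeta>)\<^sup>2 * norm (rem' \<zeta> v) \<le> norm \<zeta> * (2 * M * norm v)"
      using z'(2) M(1) by (intro mult_mono) (auto simp: power2_eq_square mult_left_le)
    also have "\<dots> \<le> \<delta> * (2 * M * norm v)" using z M(1) by (intro mult_right_mono) auto
    also have "\<dots> = 2 * M * \<delta> * norm v" by simp
    also have "\<dots> \<le> \<bar>c\<bar> / 10 * norm v" using \<delta>(4) by (intro mult_right_mono) auto
    finally have "(norm \<zeta>)\<^sup>2 * norm (rem' \<zeta> v) / (c\<^sup>2 * (norm U)\<^sup>2) \<le> (\<bar>c\<bar> / 10 * norm v) / (c\<^sup>2 * (81 / 100))"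
      using U2 pole by (intro frac_le mult_left_mono) auto
    also have "c\<^sup>2 = \<bar>c\<bar> * \<bar>c\<bar>" by (simp add: power2_eq_square)
    also have "(\<bar>c\<bar> / 10 * norm v) / (\<bar>c\<bar> * \<bar>c\<bar> * (81 / 100)) = norm v * (1 / 10) / (\<bar>c\<bar> * (81 / 100))"
      using pole by (simp add: field_simps)
    finally show ?thesis using pole by (simp add: norm_mult norm_divide norm_power power2_eq_square)
  qed
  also have "norm v * (21 / 100) / (\<bar>c\<bar> * (81 / 100)) + norm v * (1 / 10) / (\<bar>c\<bar> * (81 / 100)) \<le> norm v / (2 * \<bar>c\<bar>)"
    using pole by (simp add: field_simps)
  finally show ?thesis by simp
qed

lemma norm_chart'_ge: "norm \<zeta> < \<delta> \<Longrightarrow> norm v / (2 * \<bar>c\<bar>) \<le> norm (chart' \<zeta> v)"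
  using chart'_approx[of \<zeta> v] norm_triangle_ineq2[of "v / (\<i> * c)" "v / (\<i> * c) - chart' \<zeta> v"]
  by (simp add: norm_divide norm_mult norm_minus_commute field_simps)

text \<open>Mean value inequality on the convex disc, applied to \<open>chart\<close> minus its
  linear part at 0. It yields the lower bound \<open>chart_diff_ge\<close>, hence
  injectivity.\<close>

lemma chart_diff:
  assumes "norm x < \<delta>" "norm y < \<delta>"
  shows "norm (chart x - chart y - (x - y) / (\<i> * c)) \<le> norm (x - y) / (2 * \<bar>c\<bar>)"
proof -
  define k where "k z = chart z - z / (\<i> * c)" for z
  have "norm (k x - k y) \<le> 1 / (2 * \<bar>c\<bar>) * norm (x - y)"
  proof (rule differentiable_bound[of "ball 0 \<delta>" k "\<lambda>z v. chart' z v - v / (\<i> * c)"])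
    fix z :: complex assume z: "z \<in> ball 0 \<delta>"
    then have "norm z < \<rho>" "den z \<noteq> 0" using \<delta> den_nonzero by auto
    then have "(chart has_derivative chart' z) (at z)" by (rule has_derivative_chart)
    moreover have "((\<lambda>z. z / (\<i> * c)) has_derivative (\<lambda>v. v / (\<i> * c))) (at z)"
      by (intro bounded_linear_imp_has_derivative bounded_linear_divide)
    ultimately have "(k has_derivative (\<lambda>v. chart' z v - v / (\<i> * c))) (at z)"
      unfolding k_def[abs_def] by (rule has_derivative_diff)
    then show "(k has_derivative (\<lambda>v. chart' z v - v / (\<i> * c))) (at z within ball 0 \<delta>)"
      by (rule has_derivative_at_withinI)
    have "norm (chart' z v - v / (\<i> * c)) \<le> 1 / (2 * \<bar>c\<bar>) * norm v" for v
      using chart'_approx[of z v] z by simp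
    then show "onorm (\<lambda>v. chart' z v - v / (\<i> * c)) \<le> 1 / (2 * \<bar>c\<bar>)"
      by (rule onorm_le)
  qed (use assms in auto)
  then show ?thesis by (simp add: k_def algebra_simps diff_divide_distrib)
qed

lemma chart_diff_ge:
  assumes "norm x < \<delta>" "norm y < \<delta>"
  shows "norm (x - y) / (2 * \<bar>c\<bar>) \<le> norm (chart x - chart y)"
  using chart_diff[OF assms]
    norm_triangle_ineq2[of "(x - y) / (\<i> * c)" "(x - y) / (\<i> * c) - (chart x - chart y)"]
  by (simp add: norm_divide norm_mult norm_minus_commute field_simps)

lemma chart_0 [simp]: "chart 0 = 0" by (simp add: chart_def)

lemma norm_chart_bounds:
  assumes "norm x < \<delta>"
  shows "norm x \<le> 2 * \<bar>c\<bar> * norm (chart x)" "norm (chart x) \<le> 2 / \<bar>c\<bar> * norm x"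
proof -
  show "norm x \<le> 2 * \<bar>c\<bar> * norm (chart x)"
    using chart_diff_ge[of x 0] assms \<delta> pole by (simp add: field_simps)
  have "norm (chart x) = norm x / (\<bar>c\<bar> * norm (1 + u x))"
    by (simp add: chart_def norm_divide norm_den)
  also have "\<dots> \<le> norm x / (\<bar>c\<bar> * (1 / 2))"
    using norm_1_plus_u(1)[OF assms] pole by (intro divide_left_mono mult_left_mono mult_pos_pos) auto
  finally show "norm (chart x) \<le> 2 / \<bar>c\<bar> * norm x" by (simp add: mult.commute)
qed

lemma inj_on_chart: "inj_on chart (ball 0 \<delta>)"
proof
  fix x y assume "x \<in> ball 0 \<delta>" "y \<in> ball 0 \<delta>" "chart x = chart y"
  then show "x = y" using chart_diff_ge[of x y] pole by (simp add: divide_le_0_iff)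
qed

lemma continuous_on_chart: "continuous_on (ball 0 \<delta>) chart"
proof -
  have "isCont chart x" if "x \<in> ball 0 \<delta>" for x
    using that has_derivative_chart[of x] den_nonzero[of x] \<delta> has_derivative_continuous by auto
  then show ?thesis by (simp add: continuous_at_imp_continuous_on)
qed

end

context catenoid_form
begin

text \<open>The height is to be expanded in \<eta>, the reciprocal of the horizontal coordinate.
  Substitute \<zeta> = \<i> c \<eta> (1 + u): the logarithm contributes ln of norm \<eta>, the
  constant ln of abs c, and Re (Ln (1 + u)), where u = \<eta> \<open>rem 0\<close> up to second
  order; the Taylor expansion of \<open>h\<close> contributes the rest of the linear term.\<close>

lemma height_expansion:
  assumes "\<zeta> \<noteq> 0" "norm \<zeta> < \<delta>"
  defines "\<eta> \<equiv> chart \<zeta>"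
  shows "\<bar>ht \<zeta> - (a * ln (norm \<eta>) + (a * ln \<bar>c\<bar> + Re (h 0)) + Re ((a * rem 0 + deriv h 0 * (\<i> * c)) * \<eta>))\<bar>
    \<le> (\<bar>a\<bar> * (18 * M\<^sup>2 + 4 * M * \<bar>c\<bar> + 8 * M\<^sup>2) + (4 * M * c\<^sup>2 + 4 * M\<^sup>2 * \<bar>c\<bar>)) * (norm \<eta>)\<^sup>2"
proof -
  let ?u = "u \<zeta>"
  have z: "norm \<zeta> \<le> \<rho> / 2" "norm \<zeta> < \<rho>" using assms \<delta> by auto
  have den: "den \<zeta> \<noteq> 0" using den_nonzero assms by blast
  have \<eta>0: "\<eta> \<noteq> 0" using assms den by (simp add: \<eta>_def chart_def)
  have \<zeta>\<eta>: "\<zeta> = \<eta> * (\<i> * c * (1 + ?u))" using den by (simp add: \<eta>_def chart_def flip: den_eq)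
  have n\<zeta>: "norm \<zeta> \<le> 2 * \<bar>c\<bar> * norm \<eta>" using norm_chart_bounds(1)[OF assms(2)] by (simp add: \<eta>_def)
  have u1: "norm ?u \<le> 2 * M * norm \<zeta> / \<bar>c\<bar>" "norm ?u \<le> 1 / 10" using norm_u_le[OF assms(2)] by auto
  have u2: "norm ?u \<le> 4 * M * norm \<eta>"
  proof -
    have "2 * M * norm \<zeta> / \<bar>c\<bar> \<le> 2 * M * (2 * \<bar>c\<bar> * norm \<eta>) / \<bar>c\<bar>"
      using n\<zeta> M(1) by (intro divide_right_mono mult_left_mono) auto
    then show ?thesis using u1 pole by simp
  qed
  have U0: "1 + ?u \<noteq> 0" using norm_1_plus_u(1)[OF assms(2)] by auto
  have "ln (norm \<zeta>) = ln (norm \<eta>) + (ln \<bar>c\<bar> + ln (norm (1 + ?u)))"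
    by (subst (1) \<zeta>\<eta>) (use \<eta>0 pole U0 in \<open>simp add: norm_mult ln_mult del: add_eq_0_iff\<close>)
  moreover have "ln (norm (1 + ?u)) = Re (Ln (1 + ?u))" using U0 by simp
  ultimately have ht: "ht \<zeta> - (a * ln (norm \<eta>) + (a * ln \<bar>c\<bar> + Re (h 0)) + Re ((a * rem 0 + deriv h 0 * (\<i> * c)) * \<eta>))
    = a * (Re (Ln (1 + ?u) - ?u) + Re (?u - \<eta> * rem 0)) +
      (Re (h \<zeta> - h 0 - deriv h 0 * \<zeta>) + Re (deriv h 0 * (\<zeta> - \<i> * c * \<eta>)))"
    by (simp add: ht_def algebra_simps)
  \<comment> \<open>The remainder of the logarithm is at most norm u squared divided by 9/10, norm u
    is at most 4 M norm \<eta>, and 16 / (9/10) is below 18.\<close>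
  have T1: "norm (Ln (1 + ?u) - ?u) \<le> 18 * M\<^sup>2 * (norm \<eta>)\<^sup>2"
  proof -
    have "norm (Ln (1 + ?u) - ?u) \<le> (norm ?u)\<^sup>2 / (1 - norm ?u)"
      using u1 by (intro Ln_approx_linear) auto
    also have "\<dots> \<le> (4 * M * norm \<eta>)\<^sup>2 / (9 / 10)"
      using u1 u2 by (intro frac_le power_mono) auto
    also have "\<dots> \<le> 18 * M\<^sup>2 * (norm \<eta>)\<^sup>2" by (simp add: power_mult_distrib)
    finally show ?thesis .
  qed
  have T2: "norm (?u - \<eta> * rem 0) \<le> (4 * M * \<bar>c\<bar> + 8 * M\<^sup>2) * (norm \<eta>)\<^sup>2"
  proof -
    \<comment> \<open>Inserting \<zeta> = \<i> c \<eta> (1 + u) into the definition of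
      \<open>u\<close> turns it into a fixed point equation, from which the first order term is read
      off.\<close>
    have "?u = \<eta> * rem \<zeta> * (1 + ?u)"
      using pole by (subst (1) u_def, subst (1) \<zeta>\<eta>) simp
    then have "?u - \<eta> * rem 0 = \<eta> * (rem \<zeta> - rem 0) + \<eta> * rem \<zeta> * ?u" by (simp add: algebra_simps)
    then have "norm (?u - \<eta> * rem 0) \<le> norm (\<eta> * (rem \<zeta> - rem 0)) + norm (\<eta> * rem \<zeta> * ?u)"
      by (simp only: norm_triangle_ineq)
    also have "\<dots> \<le> norm \<eta> * (2 * M * (2 * \<bar>c\<bar> * norm \<eta>)) + norm \<eta> * (2 * M) * (4 * M * norm \<eta>)"
    proof -
      have "norm (rem \<zeta> - rem 0) \<le> 2 * M * norm \<zeta>" by (rule norm_rem_diff_le[OF z(1)])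
      also have "\<dots> \<le> 2 * M * (2 * \<bar>c\<bar> * norm \<eta>)" using n\<zeta> M(1) by (intro mult_left_mono) simp_all
      finally have "norm (\<eta> * (rem \<zeta> - rem 0)) \<le> norm \<eta> * (2 * M * (2 * \<bar>c\<bar> * norm \<eta>))"
        unfolding norm_mult by (intro mult_left_mono) simp_all
      moreover have "norm (\<eta> * rem \<zeta>) \<le> norm \<eta> * (2 * M)"
        unfolding norm_mult using norm_rem_le[OF z(1)] by (intro mult_left_mono) simp_all
      then have "norm (\<eta> * rem \<zeta>) * norm ?u \<le> norm \<eta> * (2 * M) * (4 * M * norm \<eta>)"
        using u2 M(1) by (intro mult_mono) simp_all
      ultimately show ?thesis by (simp only: norm_mult add_mono)
    qed
    finally show ?thesis by (simp add: power2_eq_square algebra_simps)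
  qed
  have H1: "norm (h \<zeta> - h 0 - deriv h 0 * \<zeta>) \<le> 4 * M * c\<^sup>2 * (norm \<eta>)\<^sup>2"
  proof -
    have "norm (h \<zeta> - h 0 - deriv h 0 * \<zeta>) \<le> M * (norm \<zeta>)\<^sup>2" by (rule M(9)[OF z(1)])
    also have "\<dots> \<le> M * (2 * \<bar>c\<bar> * norm \<eta>)\<^sup>2"
      using n\<zeta> M(1) by (intro mult_left_mono power_mono) auto
    finally show ?thesis by (simp add: power_mult_distrib)
  qed
  have H2: "norm (deriv h 0 * (\<zeta> - \<i> * c * \<eta>)) \<le> 4 * M\<^sup>2 * \<bar>c\<bar> * (norm \<eta>)\<^sup>2"
  proof -
    have "\<zeta> - \<i> * c * \<eta> = \<i> * c * \<eta> * ?u" by (subst (1) \<zeta>\<eta>) (simp add: algebra_simps)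
    then have "norm (deriv h 0 * (\<zeta> - \<i> * c * \<eta>)) = norm (deriv h 0) * (\<bar>c\<bar> * norm \<eta> * norm ?u)"
      by (simp add: norm_mult)
    also have "\<dots> \<le> M * (\<bar>c\<bar> * norm \<eta> * (4 * M * norm \<eta>))"
      using u2 M(6)[of 0] M(1) radius_pos by (intro mult_mono) auto
    finally show ?thesis by (simp add: power2_eq_square algebra_simps)
  qed
  have "\<bar>a * (Re (Ln (1 + ?u) - ?u) + Re (?u - \<eta> * rem 0))\<bar>
      \<le> \<bar>a\<bar> * (18 * M\<^sup>2 * (norm \<eta>)\<^sup>2 + (4 * M * \<bar>c\<bar> + 8 * M\<^sup>2) * (norm \<eta>)\<^sup>2)"
    unfolding abs_mult using T1 T2 abs_Re_le_cmod[of "Ln (1 + ?u) - ?u"] abs_Re_le_cmod[of "?u - \<eta> * rem 0"]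
    by (intro mult_left_mono) linarith+
  moreover have "\<bar>Re (h \<zeta> - h 0 - deriv h 0 * \<zeta>) + Re (deriv h 0 * (\<zeta> - \<i> * c * \<eta>))\<bar>
      \<le> 4 * M * c\<^sup>2 * (norm \<eta>)\<^sup>2 + 4 * M\<^sup>2 * \<bar>c\<bar> * (norm \<eta>)\<^sup>2"
    using H1 H2 abs_Re_le_cmod[of "h \<zeta> - h 0 - deriv h 0 * \<zeta>"] abs_Re_le_cmod[of "deriv h 0 * (\<zeta> - \<i> * c * \<eta>)"]
    by linarith
  ultimately have "\<bar>a * (Re (Ln (1 + ?u) - ?u) + Re (?u - \<eta> * rem 0)) +
      (Re (h \<zeta> - h 0 - deriv h 0 * \<zeta>) + Re (deriv h 0 * (\<zeta> - \<i> * c * \<eta>)))\<bar> \<le>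
      \<bar>a\<bar> * (18 * M\<^sup>2 * (norm \<eta>)\<^sup>2 + (4 * M * \<bar>c\<bar> + 8 * M\<^sup>2) * (norm \<eta>)\<^sup>2) +
      (4 * M * c\<^sup>2 * (norm \<eta>)\<^sup>2 + 4 * M\<^sup>2 * \<bar>c\<bar> * (norm \<eta>)\<^sup>2)"
    by linarith
  also have "\<dots> = (\<bar>a\<bar> * (18 * M\<^sup>2 + 4 * M * \<bar>c\<bar> + 8 * M\<^sup>2) + (4 * M * c\<^sup>2 + 4 * M\<^sup>2 * \<bar>c\<bar>)) * (norm \<eta>)\<^sup>2"
    by (simp add: algebra_simps)
  finally show ?thesis unfolding ht .
qed

text \<open>The inverse function theorem gives differentiability; the bound on the derivative is
  \<open>norm_chart'_ge\<close> read backwards.\<close>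

lemma chart_inverse_derivative:
  assumes "norm \<zeta> < \<delta>"
  obtains G where "(inv_into (ball 0 \<delta>) chart has_derivative G) (at (chart \<zeta>))"
    "\<And>v. norm (G v) \<le> 2 * \<bar>c\<bar> * norm v"
proof -
  have d: "(chart has_derivative chart' \<zeta>) (at \<zeta>)"
    using has_derivative_chart[of \<zeta>] den_nonzero[of \<zeta>] assms \<delta> by auto
  then have lin: "linear (chart' \<zeta>)"
    using has_derivative_bounded_linear bounded_linear.linear by blast
  have "inj (chart' \<zeta>)"
    unfolding linear_injective_0[OF lin]
    using norm_chart'_ge[OF assms] pole by (metis divide_le_0_iff mult_less_cancel_left_disj norm_eq_zero norm_le_zero_iff norm_zero zero_less_abs_iff zero_less_mult_iff zero_less_numeral not_less)
  then obtain G where G: "linear G" "\<And>x. G (chart' \<zeta> x) = x" "\<And>x. chart' \<zeta> (G x) = x"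
    using linear_injective_isomorphism[OF lin] by blast
  have "(inv_into (ball 0 \<delta>) chart has_derivative G) (at (chart \<zeta>))"
    using assms inj_on_chart G(3)
    by (intro has_derivative_inverse_strong[OF open_ball _ continuous_on_chart _ d]) (auto simp: fun_eq_iff)
  moreover have "norm (G v) \<le> 2 * \<bar>c\<bar> * norm v" for v
    using norm_chart'_ge[OF assms, of "G v"] G(3) pole by (simp add: field_simps)
  ultimately show thesis using that by blast
qed

text \<open>Away from the puncture \<open>hor\<close> is 1 / \<open>chart\<close>. Taking
  \<open>V\<close> as the preimage under \<open>chart\<close> of a disc about 0 makes the image of
  \<open>hor\<close> exactly the exterior of a closed disc. The logarithmic coefficient changes sign
  because norm y is the reciprocal of norm \<eta>. The slope stays bounded since the derivative of
  \<open>ht\<close> is of order 1 / norm \<zeta>, while that of \<zeta> with respect to y is of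
  order norm \<eta> squared.\<close>

theorem graph_at_infinity:
  obtains V r \<epsilon> fn fn' B b k where
    "open V" "V \<subseteq> ball 0 \<rho> - {0}" "\<epsilon> > 0" "ball 0 \<epsilon> - {0} \<subseteq> V"
    "inj_on hor V" "hor ` V = - cball 0 r" "\<And>\<zeta>. \<zeta> \<in> V \<Longrightarrow> fn (hor \<zeta>) = ht \<zeta>"
    "\<And>y. y \<in> - cball 0 r \<Longrightarrow> (fn has_derivative fn' y) (at y) \<and> onorm (fn' y) \<le> B"
    "(\<lambda>y. fn y - (- a * ln (norm y) + b + Re (k / y))) \<in> O[at_infinity](\<lambda>y. 1 / (norm y)\<^sup>2)"
proof -
  have "open (chart ` ball 0 \<delta>)"
    by (rule invariance_of_domain[OF continuous_on_chart open_ball inj_on_chart])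
  moreover have "0 \<in> chart ` ball 0 \<delta>" using \<delta> chart_0 by (metis centre_in_ball imageI)
  ultimately obtain \<eta>0 where \<eta>0: "\<eta>0 > 0" "ball 0 \<eta>0 \<subseteq> chart ` ball 0 \<delta>"
    using open_contains_ball by blast
  define \<Psi> where "\<Psi> = inv_into (ball 0 \<delta>) chart"
  have \<Psi>chart: "\<Psi> (chart \<zeta>) = \<zeta>" if "norm \<zeta> < \<delta>" for \<zeta>
    using that inj_on_chart by (simp add: \<Psi>_def)
  have chart\<Psi>: "chart (\<Psi> \<eta>) = \<eta>" "norm (\<Psi> \<eta>) < \<delta>" if "norm \<eta> < \<eta>0" for \<eta>
  proof -
    have "\<eta> \<in> chart ` ball 0 \<delta>" using that \<eta>0 by auto
    then show "chart (\<Psi> \<eta>) = \<eta>" "norm (\<Psi> \<eta>) < \<delta>"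
      unfolding \<Psi>_def using f_inv_into_f[of \<eta> chart "ball 0 \<delta>"] inv_into_into[of \<eta> chart "ball 0 \<delta>"] by auto
  qed
  define V where "V = {\<zeta> \<in> ball 0 \<delta>. chart \<zeta> \<in> ball 0 \<eta>0} - {0}"
  define fn where "fn y = ht (\<Psi> (1 / y))" for y
  define b where "b = a * ln \<bar>c\<bar> + Re (h 0)"
  define k where "k = a * rem 0 + deriv h 0 * (\<i> * c)"
  \<comment> \<open>The first factor bounds norm \<eta> times the derivative of \<open>ht\<close>,
    by means of norm \<eta> / norm \<zeta> at most 2 / abs c; the second bounds what remains of the
    derivative of the inverse chart and of 1/y.\<close>
  define B where "B = (\<bar>a\<bar> * (2 / \<bar>c\<bar>) + M * \<eta>0) * (2 * \<bar>c\<bar> * \<eta>0)"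
  have "open {\<zeta> \<in> ball 0 \<delta>. chart \<zeta> \<in> ball 0 \<eta>0}"
    using continuous_open_preimage[OF continuous_on_chart open_ball open_ball[of 0 \<eta>0]]
    by (simp add: vimage_def Int_def)
  then have V1: "open V" unfolding V_def by (intro open_Diff) auto
  have V2: "V \<subseteq> ball 0 \<rho> - {0}" using \<delta> by (auto simp: V_def)
  have hor_chart: "hor \<zeta> = 1 / chart \<zeta>" if "\<zeta> \<noteq> 0" for \<zeta>
    using that by (simp add: hor_eq chart_def)
  have nz: "chart \<zeta> \<noteq> 0" if "\<zeta> \<noteq> 0" "norm \<zeta> < \<delta>" for \<zeta>
    using that den_nonzero by (simp add: chart_def)
  have "continuous (at 0) chart"
    using has_derivative_chart[of 0] den_nonzero[of 0] \<delta> radius_pos has_derivative_continuous by auto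
  then obtain e where e: "e > 0" "\<And>\<zeta>. norm \<zeta> < e \<Longrightarrow> norm (chart \<zeta>) < \<eta>0"
    using \<eta>0(1) unfolding continuous_at_eps_delta by (auto simp: dist_norm)
  have V3: "ball 0 (min e \<delta>) - {0} \<subseteq> V" using e by (auto simp: V_def)
  have VD: "\<zeta> \<noteq> 0" "norm \<zeta> < \<delta>" "norm (chart \<zeta>) < \<eta>0" if "\<zeta> \<in> V" for \<zeta>
    using that by (simp_all add: V_def)
  have inj: "inj_on hor V"
  proof
    fix x y assume xy: "x \<in> V" "y \<in> V" "hor x = hor y"
    have "1 / chart x = 1 / chart y"
      using xy(3) unfolding hor_chart[OF VD(1)[OF xy(1)]] hor_chart[OF VD(1)[OF xy(2)]] .
    then have "\<Psi> (chart x) = \<Psi> (chart y)" by simp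
    then show "x = y" unfolding \<Psi>chart[OF VD(2)[OF xy(1)]] \<Psi>chart[OF VD(2)[OF xy(2)]] .
  qed
  have inv: "1 / y \<noteq> 0" "norm (1 / y) < \<eta>0" if "y \<in> - cball 0 (1 / \<eta>0)" for y :: complex
  proof -
    have "1 / \<eta>0 < norm y" using that by simp
    moreover have "0 < 1 / \<eta>0" using \<eta>0 by simp
    ultimately have "0 < norm y" "1 < norm y * \<eta>0" using \<eta>0 by (linarith, simp add: divide_less_eq)
    then show "1 / y \<noteq> 0" "norm (1 / y) < \<eta>0" by (auto simp: norm_divide divide_less_eq mult.commute)
  qed
  have \<Psi>V: "\<Psi> (1 / y) \<in> V" "hor (\<Psi> (1 / y)) = y" if "y \<in> - cball 0 (1 / \<eta>0)" for y
  proof -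
    have "\<Psi> (1 / y) \<noteq> 0" using chart\<Psi>(1)[OF inv(2)[OF that]] inv(1)[OF that] by auto
    then show "\<Psi> (1 / y) \<in> V" "hor (\<Psi> (1 / y)) = y"
      using chart\<Psi>[OF inv(2)[OF that]] inv(2)[OF that] by (auto simp: V_def hor_chart)
  qed
  have horV: "hor \<zeta> \<in> - cball 0 (1 / \<eta>0)" if "\<zeta> \<in> V" for \<zeta>
  proof -
    have z: "\<zeta> \<noteq> 0" "norm \<zeta> < \<delta>" "norm (chart \<zeta>) < \<eta>0" using that by (auto simp: V_def)
    have "1 / \<eta>0 < 1 / norm (chart \<zeta>)"
      using z nz[OF z(1,2)] \<eta>0 by (intro divide_strict_left_mono) auto
    then show ?thesis using z by (simp add: hor_chart norm_divide)
  qed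
  have img: "hor ` V = - cball 0 (1 / \<eta>0)"
  proof
    show "hor ` V \<subseteq> - cball 0 (1 / \<eta>0)" using horV by blast
    show "- cball 0 (1 / \<eta>0) \<subseteq> hor ` V"
    proof
      fix y :: complex assume "y \<in> - cball 0 (1 / \<eta>0)"
      from \<Psi>V[OF this] show "y \<in> hor ` V" by (intro image_eqI[of y hor "\<Psi> (1 / y)"]) simp_all
    qed
  qed
  have fn_hor: "fn (hor \<zeta>) = ht \<zeta>" if "\<zeta> \<in> V" for \<zeta>
  proof -
    have "1 / hor \<zeta> = chart \<zeta>" using that nz[of \<zeta>] by (simp add: V_def hor_chart)
    then show ?thesis using that \<Psi>chart[of \<zeta>] by (simp add: fn_def V_def)
  qed
  have deriv: "\<exists>D. (fn has_derivative D) (at y) \<and> onorm D \<le> B" if y: "y \<in> - cball 0 (1 / \<eta>0)" for y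
  proof -
    define \<eta> where "\<eta> = 1 / y"
    define \<zeta> where "\<zeta> = \<Psi> \<eta>"
    note \<eta> = inv[OF y, folded \<eta>_def]
    have \<zeta>: "norm \<zeta> < \<delta>" "chart \<zeta> = \<eta>" "\<zeta> \<noteq> 0"
      using chart\<Psi>[OF \<eta>(2)] \<eta>(1) by (auto simp: \<zeta>_def)
    obtain G where G: "(\<Psi> has_derivative G) (at \<eta>)" "\<And>v. norm (G v) \<le> 2 * \<bar>c\<bar> * norm v"
      using chart_inverse_derivative[OF \<zeta>(1)] unfolding \<zeta>(2) \<Psi>_def by blast
    define H where "H v = a * Re (v / \<zeta>) + Re (deriv h \<zeta> * v)" for v
    have H: "(ht has_derivative H) (at \<zeta>)"
      unfolding H_def[abs_def] using has_derivative_ht[of \<zeta>] \<zeta> \<delta> by auto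
    have y0: "y \<noteq> 0" using \<eta>(1) by (auto simp: \<eta>_def)
    have "((\<lambda>y. 1 / y) has_field_derivative - (1 / y\<^sup>2)) (at y)"
      using y0 by (auto intro!: derivative_eq_intros simp: power2_eq_square)
    then have I: "((\<lambda>y. 1 / y) has_derivative (\<lambda>v. - (1 / y\<^sup>2) * v)) (at y)"
      by (simp only: has_field_derivative_def)
    have "((ht \<circ> (\<Psi> \<circ> (\<lambda>y. 1 / y))) has_derivative (H \<circ> (G \<circ> (\<lambda>v. - (1 / y\<^sup>2) * v)))) (at y)"
      by (intro diff_chain_at I) (use G(1) H in \<open>simp_all add: \<eta>_def \<zeta>_def\<close>)
    then have D: "(fn has_derivative (\<lambda>v. H (G (- (1 / y\<^sup>2) * v)))) (at y)"
      by (simp add: fn_def[abs_def] comp_def)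
    have \<eta>2: "norm \<eta> \<le> 2 / \<bar>c\<bar> * norm \<zeta>" using norm_chart_bounds(2)[OF \<zeta>(1)] \<zeta>(2) by simp
    have "\<bar>H (G (- (1 / y\<^sup>2) * v))\<bar> \<le> B * norm v" for v
    proof -
      define w where "w = G (- (1 / y\<^sup>2) * v)"
      have "norm w \<le> 2 * \<bar>c\<bar> * norm (- (1 / y\<^sup>2) * v)" unfolding w_def by (rule G(2))
      also have "norm (- (1 / y\<^sup>2) * v) = (norm \<eta>)\<^sup>2 * norm v"
        by (simp add: \<eta>_def norm_mult norm_divide norm_power power_divide)
      finally have w: "norm w \<le> 2 * \<bar>c\<bar> * ((norm \<eta>)\<^sup>2 * norm v)" .
      have "\<bar>H w\<bar> \<le> \<bar>a\<bar> * \<bar>Re (w / \<zeta>)\<bar> + \<bar>Re (deriv h \<zeta> * w)\<bar>"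
        unfolding H_def by (rule order_trans[OF abs_triangle_ineq]) (simp add: abs_mult)
      also have "\<dots> \<le> \<bar>a\<bar> * norm (w / \<zeta>) + norm (deriv h \<zeta> * w)"
        by (intro add_mono mult_left_mono abs_Re_le_cmod) auto
      also have "\<dots> = (\<bar>a\<bar> / norm \<zeta> + norm (deriv h \<zeta>)) * norm w"
        by (simp add: norm_divide norm_mult algebra_simps)
      also have "\<dots> \<le> (\<bar>a\<bar> / norm \<zeta> + M) * (2 * \<bar>c\<bar> * ((norm \<eta>)\<^sup>2 * norm v))"
        using w M(6)[of \<zeta>] M(1) \<zeta> \<delta> by (intro mult_mono add_mono) auto
      also have "\<dots> = (\<bar>a\<bar> * (norm \<eta> / norm \<zeta>) + M * norm \<eta>) * (2 * \<bar>c\<bar> * norm \<eta>) * norm v"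
        by (simp add: power2_eq_square algebra_simps add_divide_distrib)
      also have "\<dots> \<le> B * norm v"
        unfolding B_def using \<eta>2 \<eta>(2) \<zeta>(3) M(1) \<eta>0
        by (intro mult_right_mono mult_mono add_mono mult_left_mono) (auto simp: field_simps)
      finally show ?thesis by (simp add: w_def)
    qed
    then have "onorm (\<lambda>v. H (G (- (1 / y\<^sup>2) * v))) \<le> B" by (intro onorm_le) auto
    then show ?thesis using D by blast
  qed
  define fn' where "fn' y = (SOME D. (fn has_derivative D) (at y) \<and> onorm D \<le> B)" for y
  have fn': "(fn has_derivative fn' y) (at y) \<and> onorm (fn' y) \<le> B" if "y \<in> - cball 0 (1 / \<eta>0)" for y
    unfolding fn'_def by (rule someI_ex[OF deriv[OF that]])
  define C where "C = \<bar>a\<bar> * (18 * M\<^sup>2 + 4 * M * \<bar>c\<bar> + 8 * M\<^sup>2) + (4 * M * c\<^sup>2 + 4 * M\<^sup>2 * \<bar>c\<bar>)"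
  have asym: "norm (fn y - (- a * ln (norm y) + b + Re (k / y))) \<le> C * norm (1 / (norm y)\<^sup>2)"
    if y: "y \<in> - cball 0 (1 / \<eta>0)" for y
  proof -
    define \<zeta> where "\<zeta> = \<Psi> (1 / y)"
    have \<zeta>: "\<zeta> \<noteq> 0" "norm \<zeta> < \<delta>" "chart \<zeta> = 1 / y"
      using \<Psi>V(1)[OF y] chart\<Psi>[OF inv(2)[OF y]] by (auto simp: \<zeta>_def V_def)
    have "ln (norm (1 / y)) = - ln (norm y)" using inv(1)[OF y] by (simp add: norm_divide ln_div)
    then show ?thesis
      using height_expansion[OF \<zeta>(1,2)] unfolding \<zeta>(3)
      by (simp add: fn_def C_def b_def k_def norm_divide power_divide flip: \<zeta>_def)
  qed
  have "\<forall>\<^sub>F y in at_infinity. y \<in> - cball (0::complex) (1 / \<eta>0)"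
    unfolding eventually_at_infinity by (intro exI[of _ "1 / \<eta>0 + 1"]) auto
  then have "\<forall>\<^sub>F y in at_infinity. norm (fn y - (- a * ln (norm y) + b + Re (k / y))) \<le> C * norm (1 / (norm y)\<^sup>2)"
    by (rule eventually_mono) (rule asym)
  then have O: "(\<lambda>y. fn y - (- a * ln (norm y) + b + Re (k / y))) \<in> O[at_infinity](\<lambda>y. 1 / (norm y)\<^sup>2)"
    by (rule bigoI)
  show thesis
    by (rule that[OF V1 V2 _ V3 inj img fn_hor fn' O]) (use e \<delta> in auto)
qed

end

section \<open>Catenoid ends of a punctured plane: graph and weight\<close>

lemma has_derivative_vector_3:
  assumes "(f1 has_derivative f1') F" "(f2 has_derivative f2') F" "(f3 has_derivative f3') F"
    and F: "F = at x within S"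
  shows "((\<lambda>x. vector [f1 x, f2 x, f3 x] :: real^3) has_derivative (\<lambda>v. vector [f1' v, f2' v, f3' v])) F"
proof -
  have eq: "(vector [p, q, r] :: real^3) = (\<chi> i. if i = 1 then p else if i = 2 then q else r)" for p q r
    by (simp add: vec_eq_iff forall_3)
  show ?thesis unfolding eq F
  proof (rule has_derivative_vec_lambda)
    fix i :: 3
    show "((\<lambda>x. if i = 1 then f1 x else if i = 2 then f2 x else f3 x) has_derivative
        (\<lambda>v. if i = 1 then f1' v else if i = 2 then f2' v else f3' v)) (at x within S)"
      using assms(1-3) F by (cases "i = 1"; cases "i = 2") simp_all
  qed
qed

lemma orthogonal_matrix_isometry:
  fixes L :: "real^'n^'n"
  assumes "orthogonal_matrix L"
  shows "(L *v x) \<bullet> (L *v y) = x \<bullet> y" "norm (L *v x) = norm x"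
proof -
  have "orthogonal_transformation ((*v) L)"
    using assms by (simp add: orthogonal_transformation_matrix matrix_vector_mul_linear)
  then show "(L *v x) \<bullet> (L *v y) = x \<bullet> y" "norm (L *v x) = norm x"
    by (auto simp: orthogonal_transformation_def orthogonal_transformation_norm)
qed

lemma homeomorphism_imp_homeomorphic_maps:
  "homeomorphism S T f g \<Longrightarrow> homeomorphic_maps (top_of_set S) (top_of_set T) f g"
  by (simp add: homeomorphism_def homeomorphic_maps_def continuous_map_in_subtopology
      flip: image_subset_iff_funcset)

text \<open>Insensitive to orientation on purpose: the end parameters used later may be
  antiholomorphic.\<close>

definition conformal_at :: "(complex \<Rightarrow> real^3) \<Rightarrow> complex \<Rightarrow> bool" where
  "conformal_at Z \<zeta> \<longleftrightarrow> (\<exists>D. (Z has_derivative D) (at \<zeta>) \<and>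
     (\<forall>v. norm (D (\<i> * v)) = norm (D v) \<and> D (\<i> * v) \<bullet> D v = 0 \<and> (v \<noteq> 0 \<longrightarrow> D v \<noteq> 0)))"

text \<open>The normal form as it sits on the surface: \<kappa> carries punctured discs about 0 to
  the puncture neighbourhoods of the same radius, and the rotation \<open>L\<close> carries the
  upright model to the actual end. Conformality is demanded of the immersion, not of
  \<kappa>.\<close>

locale catenoid_chart = catenoid_form +
  fixes P :: "complex set" and q :: "complex option" and \<kappa> :: "complex \<Rightarrow> complex"
    and L :: "real^3^3" and X :: "complex \<Rightarrow> real^3"
  assumes finite_P: "finite P" and q: "q \<in> punctures P"
    and rotation_L: "rotation_matrix L"
    and cont_\<kappa>: "continuous_on (ball 0 \<rho> - {0}) \<kappa>" and inj_\<kappa>: "inj_on \<kappa> (ball 0 \<rho> - {0})"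
    and nhd_\<kappa>: "\<And>r. 0 < r \<Longrightarrow> r \<le> \<rho> \<Longrightarrow> \<kappa> ` (ball 0 r - {0}) = puncture_nhd q r"
    and avoid: "puncture_nhd q \<rho> \<subseteq> - P"
    and closed_\<kappa>: "\<And>r. 0 < r \<Longrightarrow> r < \<rho> \<Longrightarrow> closedin (top_of_set (- P)) (\<kappa> ` (cball 0 r - {0}))"
    and X_\<kappa>: "\<And>\<zeta>. \<zeta> \<noteq> 0 \<Longrightarrow> norm \<zeta> < \<rho> \<Longrightarrow> X (\<kappa> \<zeta>) = L *v vector [Re (hor \<zeta>), Im (hor \<zeta>), ht \<zeta>]"
    and conf: "\<And>\<zeta>. \<zeta> \<noteq> 0 \<Longrightarrow> norm \<zeta> < \<rho> \<Longrightarrow> conformal_at (X \<circ> \<kappa>) \<zeta>"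
begin

lemma orth_L: "orthogonal_matrix L"
  using rotation_L by (simp add: rotation_matrix_def)

lemma transpose_L: "transpose L *v (L *v x) = x"
proof -
  have "transpose L ** L = mat 1" using orth_L by (simp only: orthogonal_matrix_def)
  then show ?thesis by (simp only: matrix_vector_mul_assoc matrix_vector_mul_lid)
qed

theorem catenoid_end: "catenoid_end (top_of_set (- P)) X (end_at P q)"
proof -
  obtain V r \<epsilon> fn fn' B b k where V:
    "open V" "V \<subseteq> ball 0 \<rho> - {0}" "\<epsilon> > 0" "ball 0 \<epsilon> - {0} \<subseteq> V"
    "inj_on hor V" "hor ` V = - cball 0 r" "\<And>\<zeta>. \<zeta> \<in> V \<Longrightarrow> fn (hor \<zeta>) = ht \<zeta>"
    "\<And>y. y \<in> - cball 0 r \<Longrightarrow> (fn has_derivative fn' y) (at y) \<and> onorm (fn' y) \<le> B"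
    "(\<lambda>y. fn y - (- a * ln (norm y) + b + Re (k / y))) \<in> O[at_infinity](\<lambda>y. 1 / (norm y)\<^sup>2)"
    by (rule graph_at_infinity) (rule that)
  define U where "U = \<kappa> ` V"
  have VD: "\<zeta> \<noteq> 0" "norm \<zeta> < \<rho>" if "\<zeta> \<in> V" for \<zeta> using that V(2) by auto
  have "open U"
    unfolding U_def using V(1,2) cont_\<kappa> inj_\<kappa>
    by (intro invariance_of_domain) (auto intro: continuous_on_subset inj_on_subset)
  moreover have "U \<subseteq> - P"
    using nhd_\<kappa>[of \<rho>] radius_pos avoid V(2) unfolding U_def by blast
  moreover have "puncture_nhd q (min \<epsilon> \<rho>) \<subseteq> U"
  proof -
    have "ball 0 (min \<epsilon> \<rho>) - {0} \<subseteq> V" using V(4) by auto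
    then have "\<kappa> ` (ball 0 (min \<epsilon> \<rho>) - {0}) \<subseteq> U" unfolding U_def by (rule image_mono)
    then show ?thesis using nhd_\<kappa>[of "min \<epsilon> \<rho>"] V(3) radius_pos by simp
  qed
  ultimately have U: "end_neighborhood (top_of_set (- P)) (end_at P q) U"
    using V(3) radius_pos finite_P q by (intro end_neighborhood_end_at[of P q U "min \<epsilon> \<rho>"]) auto
  have X: "transpose L *v X (\<kappa> \<zeta>) = vector [Re (hor \<zeta>), Im (hor \<zeta>), ht \<zeta>]" if "\<zeta> \<in> V" for \<zeta>
    by (simp only: X_\<kappa>[OF VD[OF that]] transpose_L)
  have inj: "inj_on X U"
  proof
    fix x y assume "x \<in> U" "y \<in> U" and eq: "X x = X y"
    then obtain s t where st: "s \<in> V" "x = \<kappa> s" "t \<in> V" "y = \<kappa> t" by (auto simp: U_def)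
    then have "(vector [Re (hor s), Im (hor s), ht s] :: real^3) = vector [Re (hor t), Im (hor t), ht t]"
      using X[OF st(1)] X[OF st(3)] eq by (simp only:)
    then have "hor s = hor t" by (simp add: vec_eq_iff forall_3 complex_eq_iff)
    then show "x = y" using V(5) st by (auto dest: inj_onD)
  qed
  have img: "(\<lambda>p. transpose L *v X p) ` U = graph_over (- cball 0 r) fn"
  proof (intro equalityI subsetI)
    fix x assume "x \<in> (\<lambda>p. transpose L *v X p) ` U"
    then obtain \<zeta> where \<zeta>: "\<zeta> \<in> V" "x = vector [Re (hor \<zeta>), Im (hor \<zeta>), ht \<zeta>]"
      using X by (auto simp: U_def)
    then show "x \<in> graph_over (- cball 0 r) fn"
      using V(6) V(7)[OF \<zeta>(1)] unfolding graph_over_def by auto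
  next
    fix x assume x: "x \<in> graph_over (- cball 0 r) fn"
    then obtain \<zeta> where \<zeta>: "\<zeta> \<in> V" "hor \<zeta> = Complex (x $ 1) (x $ 2)"
      using V(6) unfolding graph_over_def by (metis (mono_tags, lifting) imageE mem_Collect_eq)
    then have "x = vector [Re (hor \<zeta>), Im (hor \<zeta>), ht \<zeta>]"
      using x V(7)[OF \<zeta>(1)] by (simp add: graph_over_def vec_eq_iff forall_3)
    then show "x \<in> (\<lambda>p. transpose L *v X p) ` U"
      using X[OF \<zeta>(1)] \<zeta>(1) unfolding U_def by (metis image_eqI)
  qed
  \<comment> \<open>This is the term with the coefficients \<open>c\<^sub>1\<close> and
    \<open>c\<^sub>2\<close> in the definition of a catenoid end.\<close>
  have kre: "Re (k / y) = (Re k * Re y + Im k * Im y) / (norm y)\<^sup>2" for y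
    by (simp add: Re_divide cmod_power2)
  have rot: "rotation_matrix (transpose L)"
    using rotation_L by (simp add: rotation_matrix_def)
  have con: "connected (- cball (0::complex) r)"
    by (intro connected_complement_bounded_convex) auto
  show ?thesis
    unfolding catenoid_end_def
    apply (rule exI[of _ "transpose L"], rule exI[of _ U], rule exI[of _ "cball 0 r"], rule exI[of _ fn],
        rule exI[of _ fn'], rule exI[of _ B], rule exI[of _ "- a"], rule exI[of _ b],
        rule exI[of _ "Re k"], rule exI[of _ "Im k"])
    using rot U inj con img V(8,9) log_growth unfolding kre by simp
qed

definition \<psi> :: "3 \<Rightarrow> complex \<Rightarrow> complex" where
  "\<psi> i \<zeta> = (if i = 1 then deriv f \<zeta> - \<i> * of_real c / \<zeta>\<^sup>2
     else if i = 2 then deriv g \<zeta> - of_real c / \<zeta>\<^sup>2 else deriv h \<zeta> + of_real a / \<zeta>)"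

definition dY :: "complex \<Rightarrow> complex \<Rightarrow> real^3" where
  "dY \<zeta> v = vector [Re (\<psi> 1 \<zeta> * v), Re (\<psi> 2 \<zeta> * v), Re (\<psi> 3 \<zeta> * v)]"

lemma dY_eq: "dY \<zeta> v = (\<chi> i. Re (\<psi> i \<zeta> * v))"
  by (simp add: dY_def vec_eq_iff forall_3)

lemma X_\<kappa>_has_derivative:
  assumes "\<zeta> \<noteq> 0" "norm \<zeta> < \<rho>"
  shows "((X \<circ> \<kappa>) has_derivative (\<lambda>v. L *v dY \<zeta> v)) (at \<zeta>)"
proof -
  have "((\<lambda>\<zeta>. \<i> * of_real c / \<zeta> + f \<zeta>) has_field_derivative \<psi> 1 \<zeta>) (at \<zeta>)"
    using deriv_f[OF assms(2)] assms(1)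
    by (auto intro!: derivative_eq_intros simp: \<psi>_def power2_eq_square)
  then have 1: "((\<lambda>\<zeta>. Re (\<i> * of_real c / \<zeta> + f \<zeta>)) has_derivative (\<lambda>v. Re (\<psi> 1 \<zeta> * v))) (at \<zeta>)"
    by (intro has_derivative_Re) (simp only: has_field_derivative_def)
  have "((\<lambda>\<zeta>. of_real c / \<zeta> + g \<zeta>) has_field_derivative \<psi> 2 \<zeta>) (at \<zeta>)"
    using deriv_g[OF assms(2)] assms(1)
    by (auto intro!: derivative_eq_intros simp: \<psi>_def power2_eq_square)
  then have 2: "((\<lambda>\<zeta>. Re (of_real c / \<zeta> + g \<zeta>)) has_derivative (\<lambda>v. Re (\<psi> 2 \<zeta> * v))) (at \<zeta>)"
    by (intro has_derivative_Re) (simp only: has_field_derivative_def)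
  have "(\<lambda>v. a * Re (v / \<zeta>) + Re (deriv h \<zeta> * v)) = (\<lambda>v. Re (\<psi> 3 \<zeta> * v))"
  proof
    fix v
    have "\<psi> 3 \<zeta> * v = deriv h \<zeta> * v + of_real a * (v / \<zeta>)" by (simp add: \<psi>_def algebra_simps)
    moreover have "Re (of_real a * (v / \<zeta>)) = a * Re (v / \<zeta>)" by (simp only: Re_complex_of_real Im_complex_of_real mult_zero_left diff_zero times_complex.sel)
    ultimately show "a * Re (v / \<zeta>) + Re (deriv h \<zeta> * v) = Re (\<psi> 3 \<zeta> * v)" by (simp only: plus_complex.sel)
  qed
  then have 3: "(ht has_derivative (\<lambda>v. Re (\<psi> 3 \<zeta> * v))) (at \<zeta>)"
    using has_derivative_ht[OF assms] by simp
  have "((\<lambda>\<zeta>. vector [Re (hor \<zeta>), Im (hor \<zeta>), ht \<zeta>] :: real^3) has_derivative dY \<zeta>) (at \<zeta>)"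
    unfolding dY_def[abs_def] hor_def complex.sel
    by (rule has_derivative_vector_3[OF 1 2 3]) simp
  then have "((\<lambda>\<zeta>. L *v vector [Re (hor \<zeta>), Im (hor \<zeta>), ht \<zeta>]) has_derivative (\<lambda>v. L *v dY \<zeta> v)) (at \<zeta>)"
    by (rule bounded_linear.has_derivative[OF matrix_vector_mul_bounded_linear])
  then show ?thesis
    by (rule has_derivative_transform_within_open[of _ _ _ _ "ball 0 \<rho> - {0}"])
      (use assms X_\<kappa> in auto)
qed

text \<open>The model inherits conformality from the immersion: derivatives are unique and
  \<open>L\<close> is an isometry.\<close>

lemma dY_conformal:
  assumes "\<zeta> \<noteq> 0" "norm \<zeta> < \<rho>"
  shows "norm (dY \<zeta> (\<i> * v)) = norm (dY \<zeta> v)" "dY \<zeta> (\<i> * v) \<bullet> dY \<zeta> v = 0" "v \<noteq> 0 \<Longrightarrow> dY \<zeta> v \<noteq> 0"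
proof -
  obtain D where D: "((X \<circ> \<kappa>) has_derivative D) (at \<zeta>)"
    "\<And>v. norm (D (\<i> * v)) = norm (D v)" "\<And>v. D (\<i> * v) \<bullet> D v = 0" "\<And>v. v \<noteq> 0 \<Longrightarrow> D v \<noteq> 0"
    using conf[OF assms] unfolding conformal_at_def by blast
  have eq: "D = (\<lambda>v. L *v dY \<zeta> v)"
    by (rule has_derivative_unique[OF D(1) X_\<kappa>_has_derivative[OF assms]])
  show "norm (dY \<zeta> (\<i> * v)) = norm (dY \<zeta> v)" "dY \<zeta> (\<i> * v) \<bullet> dY \<zeta> v = 0" "v \<noteq> 0 \<Longrightarrow> dY \<zeta> v \<noteq> 0"
    using D(2,3,4)[of v] unfolding eq orthogonal_matrix_isometry[OF orth_L] by auto
qed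

lemma dY_scale: "dY \<zeta> (of_real s * v) = s *\<^sub>R dY \<zeta> v"
  by (simp add: dY_def vec_eq_iff forall_3 algebra_simps)

text \<open>Along the image of a circle about the puncture the inward conormal is the normalized
  image of the inward radial direction, and the speed is 2 pi times the norm of the image of the
  outward radius \<beta>. So the integrand is \<open>L *v dY \<beta> (- 2 pi \<beta>)\<close>, the
  derivative along the circle of the conjugate harmonic functions. Only the logarithm has a period,
  and the weight vector is vertical in the model.\<close>

theorem end_weight: "end_weight (top_of_set (- P)) X (end_at P q) (2 * pi * \<bar>a\<bar>)"
proof -
  define s where "s = \<rho> / 2"
  have s: "0 < s" "s < \<rho>" using radius_pos by (auto simp: s_def)
  define \<beta> where "\<beta> t = of_real s * exp (of_real (2 * pi * t) * \<i>)" for t :: real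
  have n\<beta>: "norm (\<beta> t) = s" for t using s by (simp add: \<beta>_def norm_mult)
  have \<beta>: "\<beta> t \<noteq> 0" "norm (\<beta> t) < \<rho>" for t using n\<beta>[of t] s by auto
  have \<beta>': "(\<beta> has_vector_derivative (2 * pi * \<i> * \<beta> t)) (at t)" for t
  proof -
    have "((\<lambda>z. of_real s * exp (2 * pi * z * \<i>)) has_field_derivative 2 * pi * \<i> * \<beta> t) (at (of_real t))"
      by (auto intro!: derivative_eq_intros simp: \<beta>_def)
    from has_vector_derivative_real_field[OF this] show ?thesis
      by (simp add: \<beta>_def[abs_def] o_def)
  qed
  define \<alpha> where "\<alpha> = \<kappa> \<circ> \<beta>"
  define D where "D = \<kappa> ` (ball 0 s - {0})"
  have range_\<beta>: "range \<beta> = sphere 0 s"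
  proof (intro equalityI subsetI)
    fix z :: complex assume "z \<in> sphere 0 s"
    then have "z = of_real s * exp (of_real (Arg z) * \<i>)"
      using Arg_eq[of z] s by (auto simp: mult.commute)
    also have "\<dots> = \<beta> (Arg z / (2 * pi))" by (simp add: \<beta>_def)
    finally show "z \<in> range \<beta>" by blast
  qed (use n\<beta> in auto)
  have range_\<alpha>: "range \<alpha> = \<kappa> ` sphere 0 s"
    by (simp add: \<alpha>_def range_\<beta> flip: image_image image_comp)
  have D_range: "D \<union> range \<alpha> = \<kappa> ` (cball 0 s - {0})"
  proof -
    have "cball 0 s - {0} = (ball 0 s - {0}) \<union> sphere (0::complex) s" using s by auto
    then show ?thesis unfolding D_def range_\<alpha> by (simp add: image_Un)
  qed
  have sub: "cball 0 s - {0} \<subseteq> ball (0::complex) \<rho> - {0}" using s by auto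
  have \<kappa>P: "\<kappa> \<zeta> \<in> - P" if "\<zeta> \<noteq> 0" "norm \<zeta> < \<rho>" for \<zeta>
  proof -
    have "\<kappa> \<zeta> \<in> puncture_nhd q \<rho>" using nhd_\<kappa>[of \<rho>] radius_pos that by auto
    then show ?thesis using avoid by blast
  qed
  have cont_\<beta>: "continuous_on UNIV \<beta>"
    unfolding \<beta>_def by (intro continuous_intros)
  have D_nhd: "D = puncture_nhd q s" using nhd_\<kappa>[of s] s by (simp add: D_def)
  have vd: "((X \<circ> \<alpha>) has_vector_derivative (L *v dY (\<beta> t) (2 * pi * \<i> * \<beta> t))) (at t)" for t
  proof -
    have "((X \<circ> \<kappa>) \<circ> \<beta> has_vector_derivative (L *v dY (\<beta> t) (2 * pi * \<i> * \<beta> t))) (at t)"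
      by (rule vector_derivative_diff_chain_within[OF \<beta>'])
        (rule has_derivative_at_withinI[OF X_\<kappa>_has_derivative[OF \<beta>]])
    then show ?thesis by (simp only: \<alpha>_def o_assoc)
  qed
  \<comment> \<open>Primitive of the integrand: real parts of \<i> times the coordinate functions.
    The logarithm is continued along the circle by hand, which gives the linear term and avoids a
    branch.\<close>
  define A where "A t = L *v (vector [Re (\<i> * (\<i> * of_real c / \<beta> t + f (\<beta> t))),
      Re (\<i> * (of_real c / \<beta> t + g (\<beta> t))), Re (\<i> * h (\<beta> t)) - 2 * pi * a * t] :: real^3)" for t :: real
  define \<upsilon> where "\<upsilon> t = L *v dY (\<beta> t) (of_real (- (1 / norm (dY (\<beta> t) (\<beta> t)))) * \<beta> t)" for t
  have nd: "norm (dY (\<beta> t) (\<beta> t)) > 0" for t using dY_conformal(3)[OF \<beta> \<beta>(1)] by simp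
  have nvd: "norm (L *v dY (\<beta> t) (2 * pi * \<i> * \<beta> t)) = 2 * pi * norm (dY (\<beta> t) (\<beta> t))" for t
  proof -
    have "dY (\<beta> t) (2 * pi * \<i> * \<beta> t) = (2 * pi) *\<^sub>R dY (\<beta> t) (\<i> * \<beta> t)"
      using dY_scale[of "\<beta> t" "2 * pi" "\<i> * \<beta> t"] by (simp add: mult.assoc)
    then show ?thesis
      by (simp add: orthogonal_matrix_isometry[OF orth_L] dY_conformal(1)[OF \<beta>])
  qed
  have \<upsilon>_eq: "\<upsilon> t = (- (1 / norm (dY (\<beta> t) (\<beta> t)))) *\<^sub>R (L *v dY (\<beta> t) (\<beta> t))" for t
    by (simp only: \<upsilon>_def dY_scale matrix_vector_mult_scaleR)
  have integrand: "norm (vector_derivative (X \<circ> \<alpha>) (at t)) *\<^sub>R \<upsilon> t = L *v dY (\<beta> t) (of_real (- 2 * pi) * \<beta> t)" for t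
  proof -
    have "norm (vector_derivative (X \<circ> \<alpha>) (at t)) *\<^sub>R \<upsilon> t = (- 2 * pi) *\<^sub>R (L *v dY (\<beta> t) (\<beta> t))"
      unfolding vector_derivative_at[OF vd] nvd \<upsilon>_eq using nd[of t] by simp
    also have "\<dots> = L *v dY (\<beta> t) (of_real (- 2 * pi) * \<beta> t)"
      by (simp only: dY_scale matrix_vector_mult_scaleR)
    finally show ?thesis .
  qed
  have "(A has_vector_derivative (L *v dY (\<beta> t) (of_real (- 2 * pi) * \<beta> t))) (at t)" for t
  proof -
    have comp: "((\<lambda>t. Re (\<i> * k (\<beta> t))) has_derivative (\<lambda>x. x * Re (k' * (of_real (- 2 * pi) * \<beta> t)))) (at t)"
      if "(k has_field_derivative k') (at (\<beta> t))" for k k'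
    proof -
      have "((k \<circ> \<beta>) has_vector_derivative (2 * pi * \<i> * \<beta> t * k')) (at t)"
        by (rule field_vector_diff_chain_at[OF \<beta>' that])
      then have "((\<lambda>t. \<i> * k (\<beta> t)) has_vector_derivative (\<i> * (2 * pi * \<i> * \<beta> t * k'))) (at t)"
        by (auto intro!: derivative_eq_intros simp: o_def)
      then have "((\<lambda>t. Re (\<i> * k (\<beta> t))) has_derivative (\<lambda>x. Re (x *\<^sub>R (\<i> * (2 * pi * \<i> * \<beta> t * k'))))) (at t)"
        unfolding has_vector_derivative_def by (rule has_derivative_Re)
      moreover have "\<i> * (2 * pi * \<i> * \<beta> t * k') = k' * (of_real (- 2 * pi) * \<beta> t)"
        by (simp add: algebra_simps)
      ultimately show ?thesis by (simp only: scaleR_complex.sel)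
    qed
    have 1: "((\<lambda>\<zeta>. \<i> * of_real c / \<zeta> + f \<zeta>) has_field_derivative \<psi> 1 (\<beta> t)) (at (\<beta> t))"
      using deriv_f[OF \<beta>(2)] \<beta>(1)
      by (auto intro!: derivative_eq_intros simp: \<psi>_def power2_eq_square)
    have 2: "((\<lambda>\<zeta>. of_real c / \<zeta> + g \<zeta>) has_field_derivative \<psi> 2 (\<beta> t)) (at (\<beta> t))"
      using deriv_g[OF \<beta>(2)] \<beta>(1)
      by (auto intro!: derivative_eq_intros simp: \<psi>_def power2_eq_square)
    have m: "((\<lambda>t. 2 * pi * a * t) has_derivative (\<lambda>x. 2 * pi * a * x)) (at t)"
      by (intro has_derivative_mult_right has_derivative_ident)
    have "((\<lambda>t. Re (\<i> * h (\<beta> t)) - 2 * pi * a * t) has_derivative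
        (\<lambda>x. x * Re (deriv h (\<beta> t) * (of_real (- 2 * pi) * \<beta> t)) - 2 * pi * a * x)) (at t)"
      by (rule has_derivative_diff[OF comp[OF deriv_h[OF \<beta>(2)]] m])
    moreover have "Re (\<psi> 3 (\<beta> t) * (of_real (- 2 * pi) * \<beta> t)) = Re (deriv h (\<beta> t) * (of_real (- 2 * pi) * \<beta> t)) - 2 * pi * a"
      using \<beta>(1)[of t] by (simp add: \<psi>_def algebra_simps)
    ultimately have 3: "((\<lambda>t. Re (\<i> * h (\<beta> t)) - 2 * pi * a * t) has_derivative
        (\<lambda>x. x * Re (\<psi> 3 (\<beta> t) * (of_real (- 2 * pi) * \<beta> t)))) (at t)"
      by (simp only: right_diff_distrib) (simp add: mult.commute)
    have "((\<lambda>t. vector [Re (\<i> * (\<i> * of_real c / \<beta> t + f (\<beta> t))), Re (\<i> * (of_real c / \<beta> t + g (\<beta> t))),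
        Re (\<i> * h (\<beta> t)) - 2 * pi * a * t] :: real^3) has_derivative
        (\<lambda>x. vector [x * Re (\<psi> 1 (\<beta> t) * (of_real (- 2 * pi) * \<beta> t)), x * Re (\<psi> 2 (\<beta> t) * (of_real (- 2 * pi) * \<beta> t)),
          x * Re (\<psi> 3 (\<beta> t) * (of_real (- 2 * pi) * \<beta> t))])) (at t)"
      by (rule has_derivative_vector_3[OF comp[OF 1] comp[OF 2] 3]) simp
    then have "(A has_derivative (\<lambda>x. L *v vector [x * Re (\<psi> 1 (\<beta> t) * (of_real (- 2 * pi) * \<beta> t)),
        x * Re (\<psi> 2 (\<beta> t) * (of_real (- 2 * pi) * \<beta> t)), x * Re (\<psi> 3 (\<beta> t) * (of_real (- 2 * pi) * \<beta> t))])) (at t)"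
      unfolding A_def[abs_def]
      by (rule bounded_linear.has_derivative[OF matrix_vector_mul_bounded_linear])
    moreover have "(\<lambda>x. L *v vector [x * Re (\<psi> 1 (\<beta> t) * (of_real (- 2 * pi) * \<beta> t)),
        x * Re (\<psi> 2 (\<beta> t) * (of_real (- 2 * pi) * \<beta> t)), x * Re (\<psi> 3 (\<beta> t) * (of_real (- 2 * pi) * \<beta> t))]) =
        (\<lambda>x. x *\<^sub>R (L *v dY (\<beta> t) (of_real (- 2 * pi) * \<beta> t)))"
    proof
      fix x
      have "vector [x * Re (\<psi> 1 (\<beta> t) * (of_real (- 2 * pi) * \<beta> t)), x * Re (\<psi> 2 (\<beta> t) * (of_real (- 2 * pi) * \<beta> t)),
          x * Re (\<psi> 3 (\<beta> t) * (of_real (- 2 * pi) * \<beta> t))] = x *\<^sub>R dY (\<beta> t) (of_real (- 2 * pi) * \<beta> t)"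
        unfolding dY_def by (simp only: vec_eq_iff forall_3 vector_3 vector_scaleR_component real_scaleR_def)
      then show "L *v vector [x * Re (\<psi> 1 (\<beta> t) * (of_real (- 2 * pi) * \<beta> t)), x * Re (\<psi> 2 (\<beta> t) * (of_real (- 2 * pi) * \<beta> t)),
          x * Re (\<psi> 3 (\<beta> t) * (of_real (- 2 * pi) * \<beta> t))] = x *\<^sub>R (L *v dY (\<beta> t) (of_real (- 2 * pi) * \<beta> t))"
        by (simp only: matrix_vector_mult_scaleR)
    qed
    ultimately show ?thesis unfolding has_vector_derivative_def by simp
  qed
  then have "((\<lambda>t. L *v dY (\<beta> t) (of_real (- 2 * pi) * \<beta> t)) has_integral (A 1 - A 0)) {0..1}"
    by (intro fundamental_theorem_of_calculus) (auto intro: has_vector_derivative_at_within)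
  moreover have "A 1 - A 0 = L *v vector [0, 0, - 2 * pi * a]"
  proof -
    have "exp (2 * complex_of_real pi * \<i>) = 1" by (metis exp_two_pi_i mult.commute mult.left_commute)
    then have "\<beta> 1 = \<beta> 0" by (simp add: \<beta>_def)
    then show ?thesis
      unfolding A_def matrix_vector_mult_diff_distrib[symmetric]
      by (intro arg_cong[of _ _ "(*v) L"]) (simp add: vec_eq_iff forall_3)
  qed
  ultimately have int: "((\<lambda>t. norm (vector_derivative (X \<circ> \<alpha>) (at t)) *\<^sub>R \<upsilon> t) has_integral
      (L *v vector [0, 0, - 2 * pi * a])) {0..1}"
    by (simp add: integrand)
  have nW: "norm (L *v vector [0, 0, - 2 * pi * a]) = 2 * pi * \<bar>a\<bar>"
    unfolding orthogonal_matrix_isometry(2)[OF orth_L]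
    by (simp add: norm_vec_def L2_set_def sum_3 abs_mult)
  have cm_\<alpha>: "continuous_map euclidean (top_of_set (- P)) \<alpha>"
  proof -
    have "continuous_on UNIV \<alpha>"
      unfolding \<alpha>_def
      by (rule continuous_on_compose[OF cont_\<beta> continuous_on_subset[OF cont_\<kappa>]]) (use \<beta> in auto)
    then show ?thesis using \<kappa>P[OF \<beta>] by (auto simp: continuous_map_in_subtopology \<alpha>_def)
  qed
  have inj_\<beta>: "inj_on \<beta> {0..<1}"
  proof
    fix x y :: real assume xy: "x \<in> {0..<1}" "y \<in> {0..<1}" "\<beta> x = \<beta> y"
    then have "exp (of_real (2 * pi * x) * \<i>) = exp (of_real (2 * pi * y) * \<i>)"
      using s by (simp add: \<beta>_def)
    then obtain m :: int where "of_real (2 * pi * x) * \<i> = of_real (2 * pi * y) * \<i> + of_int (2 * m) * pi * \<i>"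
      unfolding exp_eq by auto
    then have "2 * pi * x = 2 * pi * y + of_int (2 * m) * pi"
      by (simp add: complex_eq_iff)
    then have "2 * pi * (x - y) = 2 * pi * of_int m" by (simp add: algebra_simps)
    then have "x - y = of_int m" by simp
    moreover have "\<bar>x - y\<bar> < 1" using xy by auto
    ultimately have "m = 0" by linarith
    then show "x = y" using \<open>x - y = of_int m\<close> by simp
  qed
  have inj_\<alpha>: "inj_on \<alpha> {0..<1}"
    unfolding \<alpha>_def
    by (rule comp_inj_on[OF inj_\<beta> inj_on_subset[OF inj_\<kappa>]]) (use \<beta> in auto)
  have C1: "(X \<circ> \<alpha>) C1_differentiable_on UNIV"
    unfolding C1_differentiable_on_def
  proof (intro exI conjI ballI)
    show "((X \<circ> \<alpha>) has_vector_derivative (L *v dY (\<beta> t) (2 * pi * \<i> * \<beta> t))) (at t)" for t by (rule vd)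
    have hd: "continuous_on (ball 0 \<rho> - {0}) (\<psi> i)" for i
    proof -
      have "continuous_on (ball 0 \<rho> - {0}) (deriv k)" if "k holomorphic_on ball 0 \<rho>" for k
        by (rule holomorphic_on_imp_continuous_on[OF holomorphic_on_subset[OF holomorphic_deriv[OF that open_ball]]]) auto
      note d = this[OF f] this[OF g] this[OF h]
      show ?thesis
        unfolding \<psi>_def by (cases "i = 1"; cases "i = 2") (auto intro!: continuous_on_add continuous_on_diff d continuous_on_divide continuous_on_power continuous_on_const continuous_on_id)
    qed
    have "continuous_on UNIV (\<lambda>t. \<psi> i (\<beta> t))" for i
      by (rule continuous_on_compose2[OF hd cont_\<beta>]) (use \<beta> in auto)
    then have "continuous_on UNIV (\<lambda>t. dY (\<beta> t) (2 * pi * \<i> * \<beta> t))"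
      unfolding dY_eq by (intro continuous_on_vec_lambda continuous_intros cont_\<beta>)
    then show "continuous_on UNIV (\<lambda>t. L *v dY (\<beta> t) (2 * pi * \<i> * \<beta> t))"
      by (rule bounded_linear.continuous_on[OF matrix_vector_mul_bounded_linear])
  qed
  have loop: "loop_around_end (top_of_set (- P)) X (end_at P q) \<alpha> D"
    unfolding loop_around_end_def
  proof (intro conjI allI)
    show "\<alpha> (t + 1) = \<alpha> t" for t
    proof -
      have "exp (of_real (2 * pi * (t + 1)) * \<i>) = exp (of_real (2 * pi * t) * \<i>)"
        unfolding exp_eq by (rule exI[of _ 1]) (simp add: algebra_simps)
      then show ?thesis by (simp add: \<alpha>_def \<beta>_def)
    qed
    show "vector_derivative (X \<circ> \<alpha>) (at t) \<noteq> 0" for t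
    proof
      assume "vector_derivative (X \<circ> \<alpha>) (at t) = 0"
      then have "norm (L *v dY (\<beta> t) (2 * pi * \<i> * \<beta> t)) = 0"
        unfolding vector_derivative_at[OF vd] by (simp only: norm_zero)
      then show False unfolding nvd using nd[of t] by simp
    qed
    show "end_neighborhood (top_of_set (- P)) (end_at P q) D"
      unfolding D_nhd
      by (rule end_neighborhood_end_at[OF finite_P q open_puncture_nhd _ s(1) order_refl])
        (use puncture_nhd_mono[OF s(1), of \<rho> q] s avoid in auto)
    have "(ball 0 s - {0}) \<inter> sphere (0::complex) s = {}" by auto
    then show "D \<inter> range \<alpha> = {}"
      unfolding D_def range_\<alpha> using inj_on_image_Int[OF inj_\<kappa>, of "ball 0 s - {0}" "sphere 0 s"] s by fastforce
    show "closedin (top_of_set (- P)) (D \<union> range \<alpha>)"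
      unfolding D_range by (rule closed_\<kappa>[OF s])
    show "\<exists>k. homeomorphic_map (top_of_set {z::complex. 0 < norm z \<and> norm z \<le> 1})
            (subtopology (top_of_set (- P)) (D \<union> range \<alpha>)) k \<and> k ` sphere 0 1 = range \<alpha>"
    proof (intro exI conjI)
      let ?A = "{z::complex. 0 < norm z \<and> norm z \<le> 1}"
      let ?k = "\<lambda>z. \<kappa> (of_real s * z)"
      have sA: "(\<lambda>z. of_real s * z) ` ?A = cball 0 s - {0}"
      proof (intro equalityI subsetI)
        fix z :: complex assume "z \<in> cball 0 s - {0}"
        then show "z \<in> (\<lambda>z. of_real s * z) ` ?A"
          using s by (intro image_eqI[of _ _ "z / of_real s"]) (auto simp: norm_divide)
      qed (use s in \<open>auto simp: norm_mult mult_left_le\<close>)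
      have sS: "(\<lambda>z. of_real s * z) ` sphere 0 1 = sphere (0::complex) s"
      proof (intro equalityI subsetI)
        fix z :: complex assume "z \<in> sphere 0 s"
        then show "z \<in> (\<lambda>z. of_real s * z) ` sphere 0 1"
          using s by (intro image_eqI[of _ _ "z / of_real s"]) (auto simp: norm_divide)
      qed (use s in \<open>auto simp: norm_mult\<close>)
      have "?k ` sphere 0 1 = \<kappa> ` ((\<lambda>z. of_real s * z) ` sphere 0 1)" by (simp only: image_image)
      then show "?k ` sphere 0 1 = range \<alpha>" by (simp only: range_\<alpha> sS)
      obtain \<kappa>' where \<kappa>': "homeomorphism (ball 0 \<rho> - {0}) (\<kappa> ` (ball 0 \<rho> - {0})) \<kappa> \<kappa>'"
        using invariance_of_domain_homeomorphism[OF _ cont_\<kappa> _ inj_\<kappa>] by (auto simp: open_Diff)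
      have 1: "homeomorphism (cball 0 s - {0}) (\<kappa> ` (cball 0 s - {0})) \<kappa> \<kappa>'"
        by (rule homeomorphism_of_subsets[OF \<kappa>' sub image_mono[OF sub] refl])
      have 2: "homeomorphism ?A (cball 0 s - {0}) (\<lambda>z. of_real s * z) (\<lambda>z. z / of_real s)"
        by (rule homeomorphismI)
          (use s in \<open>auto intro!: continuous_intros simp: norm_mult norm_divide mult_left_le\<close>)
      have 3: "homeomorphism ?A (D \<union> range \<alpha>) ?k ((\<lambda>z. z / of_real s) \<circ> \<kappa>')"
        using homeomorphism_compose[OF 2 1] by (simp add: D_range o_def)
      have "D \<union> range \<alpha> \<subseteq> - P" unfolding D_range using \<kappa>P s by auto
      then have "subtopology (top_of_set (- P)) (D \<union> range \<alpha>) = top_of_set (D \<union> range \<alpha>)"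
        by (simp add: subtopology_subtopology Int_absorb1)
      then show "homeomorphic_map (top_of_set ?A) (subtopology (top_of_set (- P)) (D \<union> range \<alpha>)) ?k"
        unfolding homeomorphic_map_maps using homeomorphism_imp_homeomorphic_maps[OF 3] by (intro exI) simp
    qed
  qed (use cm_\<alpha> inj_\<alpha> C1 in auto)
  have con: "unit_conormal_into (top_of_set (- P)) X \<alpha> D \<upsilon>"
    unfolding unit_conormal_into_def
  proof (intro allI conjI)
    fix t
    show "norm (\<upsilon> t) = 1"
      using nd[of t] by (simp add: \<upsilon>_eq orthogonal_matrix_isometry[OF orth_L])
    have "dY (\<beta> t) (2 * pi * \<i> * \<beta> t) = (2 * pi) *\<^sub>R dY (\<beta> t) (\<i> * \<beta> t)"
      using dY_scale[of "\<beta> t" "2 * pi" "\<i> * \<beta> t"] by (simp add: mult.assoc)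
    then show "\<upsilon> t \<bullet> vector_derivative (X \<circ> \<alpha>) (at t) = 0"
      using dY_conformal(2)[OF \<beta>, of t "\<beta> t"]
      unfolding vector_derivative_at[OF vd] \<upsilon>_eq inner_scaleR_left orthogonal_matrix_isometry[OF orth_L]
      by (simp add: inner_commute)
    \<comment> \<open>The conormal must be realized by a curve entering \<open>D\<close>: take the
      radial curve \<beta> exp (- b x), with \<open>b\<close> chosen so that its image starts with
      unit speed.\<close>
    define b where "b = 1 / norm (dY (\<beta> t) (\<beta> t))"
    have b: "b > 0" using nd[of t] by (simp add: b_def)
    define \<eta> where "\<eta> x = \<beta> t * exp (- of_real (b * x))" for x :: real
    have n\<eta>: "norm (\<eta> x) = s * exp (- (b * x))" for x
      by (simp add: \<eta>_def norm_mult n\<beta> flip: of_real_minus of_real_mult)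
    have \<eta>: "\<eta> x \<noteq> 0" "norm (\<eta> x) < \<rho>" if "x \<ge> 0" for x
    proof -
      show "\<eta> x \<noteq> 0" using \<beta> by (simp add: \<eta>_def)
      have "exp (- (b * x)) \<le> 1" using b that by simp
      then have "s * exp (- (b * x)) \<le> s * 1" using s by (intro mult_left_mono) simp_all
      then show "norm (\<eta> x) < \<rho>" using s(2) unfolding n\<eta> by linarith
    qed
    have c\<eta>: "continuous_on {0..<1} \<eta>" unfolding \<eta>_def by (intro continuous_intros)
    have \<eta>0: "\<eta> 0 = \<beta> t" by (simp add: \<eta>_def)
    have "((\<lambda>z. \<beta> t * exp (- (of_real b * z))) has_field_derivative of_real (- b) * \<beta> t) (at (of_real 0))"
      by (auto intro!: derivative_eq_intros)
    from has_vector_derivative_real_field[OF this]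
    have "(\<eta> has_vector_derivative (of_real (- b) * \<beta> t)) (at 0)"
      by (simp add: \<eta>_def[abs_def] o_def)
    then have 1: "(\<eta> has_vector_derivative (of_real (- b) * \<beta> t)) (at 0 within {0..<1})"
      by (rule has_vector_derivative_at_within)
    have 2: "((X \<circ> \<kappa>) has_derivative (\<lambda>v. L *v dY (\<beta> t) v)) (at (\<eta> 0) within \<eta> ` {0..<1})"
      unfolding \<eta>0 by (rule has_derivative_at_withinI[OF X_\<kappa>_has_derivative[OF \<beta>]])
    have "((X \<circ> \<kappa>) \<circ> \<eta> has_vector_derivative (L *v dY (\<beta> t) (of_real (- b) * \<beta> t))) (at 0 within {0..<1})"
      by (rule vector_derivative_diff_chain_within[OF 1 2])
    then have d\<gamma>: "((X \<circ> (\<kappa> \<circ> \<eta>)) has_vector_derivative \<upsilon> t) (at 0 within {0..<1})"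
      by (simp add: \<upsilon>_def b_def o_assoc)
    have "continuous_on {0..<1} (\<kappa> \<circ> \<eta>)"
      by (rule continuous_on_compose[OF c\<eta> continuous_on_subset[OF cont_\<kappa>]]) (use \<eta> in auto)
    then have "continuous_map (top_of_set {0::real..<1}) (top_of_set (- P)) (\<kappa> \<circ> \<eta>)"
      using \<kappa>P \<eta> by (auto simp: continuous_map_in_subtopology)
    moreover have "(\<kappa> \<circ> \<eta>) 0 = \<alpha> t" by (simp add: \<alpha>_def \<eta>_def)
    moreover have "(\<kappa> \<circ> \<eta>) x \<in> D" if "x \<in> {0<..<1}" for x
    proof -
      have "exp (- (b * x)) < 1" using b that by simp
      then have "s * exp (- (b * x)) < s * 1" using s by (intro mult_strict_left_mono) simp_all
      then have "norm (\<eta> x) < s" unfolding n\<eta> by simp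
      then show ?thesis using \<eta>[of x] that by (auto simp: D_def)
    qed
    ultimately show "\<exists>\<gamma>. continuous_map (top_of_set {0::real..<1}) (top_of_set (- P)) \<gamma> \<and> \<gamma> 0 = \<alpha> t \<and>
           (\<forall>s\<in>{0<..<1}. \<gamma> s \<in> D) \<and> ((X \<circ> \<gamma>) has_vector_derivative \<upsilon> t) (at 0 within {0..<1})"
      using d\<gamma> by blast
  qed
  show ?thesis
    unfolding end_weight_def end_weight_vector_def using loop con int nW by blast
qed

end

section \<open>Growth vectors and symmetries\<close>

text \<open>A vector that is not parallel to \<open>v\<close> is not orthogonal to the whole plane
  orthogonal to \<open>v\<close>. On the line e1 + s e2 in that plane each such vector therefore
  excludes at most one value of \<open>s\<close>.\<close>

lemma finite_avoid_normal:
  fixes v :: "real^3"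
  assumes "finite F" "v \<noteq> 0" "\<And>u. u \<in> F \<Longrightarrow> cross3 u v \<noteq> 0"
  obtains d where "norm d = 1" "d \<bullet> v = 0" "\<And>u. u \<in> F \<Longrightarrow> d \<bullet> u \<noteq> 0"
proof -
  obtain e1 where e1: "e1 \<noteq> 0" "e1 \<bullet> v = 0"
    using cross_basis_nonzero[OF assms(2)] dot_cross_self(4)[of v] dot_cross_self(1)[of v]
    by (metis inner_commute)
  define e2 where "e2 = cross3 v e1"
  have e2: "e2 \<bullet> v = 0" "e2 \<bullet> e1 = 0" by (simp_all add: e2_def dot_cross_self)
  have ne: "u \<bullet> e1 \<noteq> 0 \<or> u \<bullet> e2 \<noteq> 0" if "u \<in> F" for u
  proof (rule ccontr)
    assume "\<not> ?thesis"
    then have u: "u \<bullet> e1 = 0" "u \<bullet> e2 = 0" by auto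
    define w where "w = cross3 u v"
    have "cross3 e1 w = 0" unfolding w_def Lagrange using u e1 by (simp add: inner_commute)
    moreover have "e1 \<bullet> w = 0"
      using u(2) cross_triple[of u v e1] cross_triple[of v e1 u] by (simp add: w_def e2_def inner_commute)
    ultimately have "w = 0" using norm_cross_dot[of e1 w] e1 by simp
    then show False using assms(3)[OF that] by (simp add: w_def)
  qed
  define bad where "bad u = {s. u \<bullet> e1 + s * (u \<bullet> e2) = 0}" for u
  have "finite (bad u)" if "u \<in> F" for u
  proof (cases "u \<bullet> e2 = 0")
    case True
    then have "bad u = {}" using ne[OF that] by (simp add: bad_def)
    then show ?thesis by simp
  next
    case False
    then have "bad u \<subseteq> {- (u \<bullet> e1) / (u \<bullet> e2)}" by (auto simp: bad_def field_simps)
    then show ?thesis using finite_subset by blast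
  qed
  then have "finite (\<Union>u\<in>F. bad u)" using assms(1) by blast
  then obtain s where s: "s \<notin> (\<Union>u\<in>F. bad u)"
    using infinite_UNIV_char_0[where 'a = real] by (metis UNIV_I finite_subset subsetI)
  define d where "d = e1 + s *\<^sub>R e2"
  have du: "d \<bullet> u \<noteq> 0" if "u \<in> F" for u
    using s that by (auto simp: bad_def d_def inner_left_distrib inner_commute[of _ u] inner_right_distrib)
  have "d \<bullet> e1 = e1 \<bullet> e1" using e2 by (simp add: d_def inner_left_distrib)
  then have d0: "d \<noteq> 0" using e1 by auto
  have dv: "d \<bullet> v = 0" using e1 e2 by (simp add: d_def inner_left_distrib)
  show thesis
    by (rule that[of "d /\<^sub>R norm d"]) (use d0 dv du in auto)
qed

lemma cross_zero_parallel:
  fixes u v :: "real^3"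
  assumes "cross3 u v = 0" "v \<noteq> 0"
  shows "u = ((u \<bullet> v) / (v \<bullet> v)) *\<^sub>R v"
proof -
  have "(v \<bullet> v) *\<^sub>R u = (v \<bullet> u) *\<^sub>R v"
    using Lagrange[of v u v] assms by simp
  then have "((1 / (v \<bullet> v)) * (v \<bullet> v)) *\<^sub>R u = ((1 / (v \<bullet> v)) * (v \<bullet> u)) *\<^sub>R v"
    by (simp only: scaleR_scaleR[symmetric])
  then show ?thesis using assms(2) by (simp add: inner_commute)
qed

text \<open>The growth vectors of the image of a surface with catenoid ends are the logarithmic growth rates of the ends,
  pointing along their normals.\<close>

definition growth_vector :: "(real^3) set \<Rightarrow> real^3 \<Rightarrow> bool" where
  "growth_vector S v \<longleftrightarrow> v \<noteq> 0 \<and> (\<forall>d. norm d = 1 \<and> d \<bullet> v = 0 \<longrightarrow>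
     (\<exists>y :: nat \<Rightarrow> real^3. (\<forall>k. y k \<in> S) \<and> filterlim (\<lambda>k. norm (y k)) at_top sequentially \<and>
        (\<lambda>k. y k /\<^sub>R norm (y k)) \<longlonglongrightarrow> d \<and> (\<lambda>k. (y k \<bullet> v) / ln (norm (y k))) \<longlonglongrightarrow> v \<bullet> v))"

lemma ln_over_self: "((\<lambda>x::real. ln x / x) \<longlongrightarrow> 0) at_top"
  by real_asymp

text \<open>The linear part transports the defining sequences. The translation part changes norms by
  at most norm \<tau>, so quotients of norms and of their logarithms tend to 1, and its contribution
  to the height is bounded and disappears after division by the logarithm.\<close>

lemma growth_vector_isometry:
  assumes L: "orthogonal_transformation L" and T: "\<And>x. T x = L x + \<tau>" and S: "T ` S = S"
    and v: "growth_vector S v"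
  shows "growth_vector S (L v)"
proof -
  have lin: "linear L" and inner: "\<And>x y. L x \<bullet> L y = x \<bullet> y" and nL: "\<And>x. norm (L x) = norm x"
    using L by (auto simp: orthogonal_transformation_def orthogonal_transformation_norm)
  have surj: "surj L" using L by (rule orthogonal_transformation_surj)
  have bl: "bounded_linear L" using lin linear_conv_bounded_linear by blast
  have v0: "v \<noteq> 0" using v by (simp add: growth_vector_def)
  have "L v \<noteq> 0" using nL[of v] v0 by auto
  moreover have "\<exists>y :: nat \<Rightarrow> real^3. (\<forall>k. y k \<in> S) \<and> filterlim (\<lambda>k. norm (y k)) at_top sequentially \<and>
        (\<lambda>k. y k /\<^sub>R norm (y k)) \<longlonglongrightarrow> d' \<and> (\<lambda>k. (y k \<bullet> L v) / ln (norm (y k))) \<longlonglongrightarrow> L v \<bullet> L v"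
    if d': "norm d' = 1" "d' \<bullet> L v = 0" for d'
  proof -
    obtain d where d: "d' = L d" using surj by blast
    have "norm d = 1" "d \<bullet> v = 0" using d' by (simp_all add: d nL inner)
    then obtain y where y: "\<forall>k. y k \<in> S" "filterlim (\<lambda>k. norm (y k)) at_top sequentially"
      "(\<lambda>k. y k /\<^sub>R norm (y k)) \<longlonglongrightarrow> d" "(\<lambda>k. (y k \<bullet> v) / ln (norm (y k))) \<longlonglongrightarrow> v \<bullet> v"
      using v unfolding growth_vector_def by blast
    define n where "n k = norm (y k)" for k
    define m where "m k = norm (T (y k))" for k
    have n: "filterlim n at_top sequentially" using y(2) by (simp add: n_def[abs_def])
    have mn: "\<bar>m k - n k\<bar> \<le> norm \<tau>" for k
      using norm_triangle_ineq3[of "L (y k) + \<tau>" "L (y k)"] by (simp add: m_def n_def T nL)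
    have m: "filterlim m at_top sequentially"
    proof (rule filterlim_at_top_mono)
      show "filterlim (\<lambda>k. - norm \<tau> + n k) at_top sequentially"
        by (rule filterlim_tendsto_add_at_top[OF tendsto_const n])
      show "\<forall>\<^sub>F k in sequentially. - norm \<tau> + n k \<le> m k"
        using mn by (intro always_eventually allI) (smt (verit))
    qed
    have npos: "\<forall>\<^sub>F k in sequentially. n k > 1" using n by (simp add: filterlim_at_top_dense)
    have mpos: "\<forall>\<^sub>F k in sequentially. m k > 1" using m by (simp add: filterlim_at_top_dense)
    have inv_n: "(\<lambda>k. 1 / n k) \<longlonglongrightarrow> 0"
      using tendsto_inverse_0_at_top[OF n] by (simp add: inverse_eq_divide)
    have inv_m: "(\<lambda>k. 1 / m k) \<longlonglongrightarrow> 0"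
      using tendsto_inverse_0_at_top[OF m] by (simp add: inverse_eq_divide)
    have ratio0: "(\<lambda>k. m k / n k - 1) \<longlonglongrightarrow> 0"
    proof (rule Lim_null_comparison)
      show "\<forall>\<^sub>F k in sequentially. norm (m k / n k - 1) \<le> norm \<tau> * (1 / n k)"
        using npos
      proof eventually_elim
        case (elim k)
        then have "m k / n k - 1 = (m k - n k) / n k" by (simp add: diff_divide_distrib)
        then show ?case using mn[of k] elim by (simp add: divide_right_mono)
      qed
      show "(\<lambda>k. norm \<tau> * (1 / n k)) \<longlonglongrightarrow> 0" using tendsto_mult_right_zero[OF inv_n] by simp
    qed
    then have ratio: "(\<lambda>k. m k / n k) \<longlonglongrightarrow> 1" by (simp add: LIM_zero_iff)
    then have ratio': "(\<lambda>k. n k / m k) \<longlonglongrightarrow> 1"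
      using tendsto_inverse[OF ratio] by simp
    have ln_m: "filterlim (\<lambda>k. ln (m k)) at_top sequentially"
      by (rule filterlim_compose[OF ln_at_top m])
    have inv_ln_m: "(\<lambda>k. 1 / ln (m k)) \<longlonglongrightarrow> 0"
      using tendsto_inverse_0_at_top[OF ln_m] by (simp add: inverse_eq_divide)
    have ln_ratio: "(\<lambda>k. ln (n k) / ln (m k)) \<longlonglongrightarrow> 1"
    proof -
      have "(\<lambda>k. 1 + ln (n k / m k) * (1 / ln (m k))) \<longlonglongrightarrow> 1 + ln 1 * 0"
        by (intro tendsto_intros ratio' inv_ln_m) simp
      moreover have "\<forall>\<^sub>F k in sequentially. 1 + ln (n k / m k) * (1 / ln (m k)) = ln (n k) / ln (m k)"
        using npos mpos by eventually_elim (simp add: ln_div field_simps)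
      ultimately have "(\<lambda>k. ln (n k) / ln (m k)) \<longlonglongrightarrow> 1 + ln 1 * 0"
        by (rule Lim_transform_eventually)
      then show ?thesis by simp
    qed
    have 1: "T (y k) \<in> S" for k using y(1) S by blast
    have 2: "filterlim (\<lambda>k. norm (T (y k))) at_top sequentially" using m by (simp add: m_def[abs_def])
    have 3: "(\<lambda>k. T (y k) /\<^sub>R norm (T (y k))) \<longlonglongrightarrow> d'"
    proof -
      have "(\<lambda>k. (n k / m k) *\<^sub>R L (y k /\<^sub>R norm (y k)) + (1 / m k) *\<^sub>R \<tau>) \<longlonglongrightarrow> 1 *\<^sub>R L d + 0 *\<^sub>R \<tau>"
        by (intro tendsto_intros ratio' inv_m bounded_linear.tendsto[OF bl y(3)])
      moreover have "\<forall>\<^sub>F k in sequentially. (n k / m k) *\<^sub>R L (y k /\<^sub>R norm (y k)) + (1 / m k) *\<^sub>R \<tau> =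
          T (y k) /\<^sub>R norm (T (y k))"
        using npos
      proof eventually_elim
        case (elim k)
        have "(n k / m k) *\<^sub>R L (y k /\<^sub>R norm (y k)) = (1 / m k) *\<^sub>R L (y k)"
          using elim unfolding linear_cmul[OF lin] n_def[symmetric] by simp
        then show ?case by (simp add: T m_def scaleR_right_distrib inverse_eq_divide)
      qed
      ultimately show ?thesis by (simp add: d filterlim_cong)
    qed
    have 4: "(\<lambda>k. (T (y k) \<bullet> L v) / ln (norm (T (y k)))) \<longlonglongrightarrow> L v \<bullet> L v"
    proof -
      have "(\<lambda>k. (y k \<bullet> v) / ln (norm (y k)) * (ln (n k) / ln (m k)) + (\<tau> \<bullet> L v) * (1 / ln (m k))) \<longlonglongrightarrow>
          (v \<bullet> v) * 1 + (\<tau> \<bullet> L v) * 0"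
        by (intro tendsto_intros y(4) ln_ratio inv_ln_m)
      moreover have "\<forall>\<^sub>F k in sequentially. (y k \<bullet> v) / ln (norm (y k)) * (ln (n k) / ln (m k)) + (\<tau> \<bullet> L v) * (1 / ln (m k)) =
          (T (y k) \<bullet> L v) / ln (norm (T (y k)))"
        using npos
      proof eventually_elim
        case (elim k)
        then have "ln (n k) \<noteq> 0" by simp
        then show ?case by (simp add: T inner_left_distrib inner n_def m_def add_divide_distrib)
      qed
      ultimately show ?thesis by (simp add: inner filterlim_cong)
    qed
    show ?thesis using 1 2 3 4 by (intro exI[of _ "\<lambda>k. T (y k)"]) blast
  qed
  ultimately show ?thesis unfolding growth_vector_def by blast
qed

text \<open>What the rigidity argument uses about the ends: each one is asymptotically flat with
  normal direction \<open>v q\<close>, reaches every direction orthogonal to it, and grows along it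
  like the logarithm with a prescribed rate.\<close>

locale tame_ends =
  fixes P :: "complex set" and X :: "complex \<Rightarrow> real^3" and v :: "complex option \<Rightarrow> real^3"
  assumes finite_P: "finite P" and continuous_X: "continuous_on (- P) X"
    and diverges: "\<And>q. q \<in> punctures P \<Longrightarrow> filterlim (\<lambda>z. norm (X z)) at_top (puncture_filter q)"
    and growth: "\<And>q. q \<in> punctures P \<Longrightarrow>
       ((\<lambda>z. (X z \<bullet> v q) / ln (norm (X z))) \<longlongrightarrow> v q \<bullet> v q) (puncture_filter q)"
    and growth_nonzero: "\<And>q. q \<in> punctures P \<Longrightarrow> v q \<noteq> 0"
    and all_directions: "\<And>q d. q \<in> punctures P \<Longrightarrow> norm d = 1 \<Longrightarrow> d \<bullet> v q = 0 \<Longrightarrow>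
       \<exists>z :: nat \<Rightarrow> complex. (\<forall>k. z k \<in> - P) \<and> filterlim z (puncture_filter q) sequentially \<and>
         (\<lambda>k. X (z k) /\<^sub>R norm (X (z k))) \<longlonglongrightarrow> d"
begin

abbreviation "S \<equiv> X ` (- P)"

lemma proper: "\<exists>K. compactin (top_of_set (- P)) K \<and> {z \<in> - P. norm (X z) \<le> R} \<subseteq> K"
proof -
  have "\<forall>\<^sub>F \<epsilon> in at_right 0. \<forall>z\<in>puncture_nhd q \<epsilon>. norm (X z) > R" if "q \<in> punctures P" for q
  proof -
    have "\<forall>\<^sub>F z in puncture_filter q. norm (X z) > R"
      using diverges[OF that] by (simp add: filterlim_at_top_dense)
    then obtain \<epsilon> where \<epsilon>: "\<epsilon> > 0" "\<forall>z\<in>puncture_nhd q \<epsilon>. norm (X z) > R"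
      by (auto simp: eventually_puncture_filter)
    show ?thesis
      by (rule eventually_at_right_0_mono[OF \<epsilon>(1)]) (use \<epsilon> puncture_nhd_mono in blast)
  qed
  then have "\<forall>\<^sub>F \<epsilon> in at_right 0. \<forall>q\<in>punctures P. \<forall>z\<in>puncture_nhd q \<epsilon>. norm (X z) > R"
    using finite_P by (intro eventually_ball_finite) (auto simp: punctures_def)
  then obtain \<epsilon> where \<epsilon>: "\<epsilon> > 0" "\<forall>q\<in>punctures P. \<forall>z\<in>puncture_nhd q \<epsilon>. norm (X z) > R"
    using eventually_at_right_0_ex by blast
  have "{z \<in> - P. norm (X z) \<le> R} \<subseteq> puncture_core P \<epsilon>"
    using \<epsilon>(2) by (fastforce simp: puncture_core_def)
  then show ?thesis using compactin_puncture_core[OF finite_P \<epsilon>(1)] by blast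
qed

text \<open>A sequence whose images tend to infinity leaves every compact core, and the pigeonhole
  principle selects one of the finitely many punctures.\<close>

lemma subsequence_to_puncture:
  assumes z: "\<And>k. z k \<in> - P" and div: "filterlim (\<lambda>k. norm (X (z k))) at_top sequentially"
  obtains q s where "q \<in> punctures P" "strict_mono s" "filterlim (z \<circ> s) (puncture_filter q) sequentially"
proof -
  have ev: "\<forall>\<^sub>F k in sequentially. \<exists>q\<in>punctures P. z k \<in> puncture_nhd q \<epsilon>" if "\<epsilon> > 0" for \<epsilon>
  proof -
    have "compact (X ` puncture_core P \<epsilon>)"
      using compact_puncture_core[OF finite_P that] continuous_X puncture_core_subset
      by (intro compact_continuous_image) (auto intro: continuous_on_subset)
    then obtain b where b: "\<And>w. w \<in> puncture_core P \<epsilon> \<Longrightarrow> norm (X w) \<le> b"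
      using compact_imp_bounded bounded_iff by (metis imageI)
    have "\<forall>\<^sub>F k in sequentially. norm (X (z k)) > b"
      using div by (simp add: filterlim_at_top_dense)
    then show ?thesis
    proof eventually_elim
      case (elim k)
      then have "z k \<notin> puncture_core P \<epsilon>" using b[of "z k"] by auto
      then show ?case using z by (auto simp: puncture_core_def)
    qed
  qed
  obtain \<epsilon>0 where \<epsilon>0: "\<epsilon>0 > 0"
    "\<forall>q\<in>punctures P. \<forall>q'\<in>punctures P. q \<noteq> q' \<longrightarrow> puncture_nhd q \<epsilon>0 \<inter> puncture_nhd q' \<epsilon>0 = {}"
    using eventually_at_right_0_ex[OF eventually_puncture_nhds_disjoint[OF finite_P]] by blast
  have fin: "finite (punctures P)" using finite_P by (simp add: punctures_def)
  have "\<exists>q\<in>punctures P. infinite {k. z k \<in> puncture_nhd q \<epsilon>0}"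
  proof (rule ccontr)
    assume "\<not> ?thesis"
    then have "finite (\<Union>q\<in>punctures P. {k. z k \<in> puncture_nhd q \<epsilon>0})" using fin by blast
    then obtain N where N: "\<And>k. k \<in> (\<Union>q\<in>punctures P. {k. z k \<in> puncture_nhd q \<epsilon>0}) \<Longrightarrow> k < N"
      using finite_nat_set_iff_bounded by meson
    obtain k where "k \<ge> N" "\<exists>q\<in>punctures P. z k \<in> puncture_nhd q \<epsilon>0"
      using ev[OF \<epsilon>0(1)] unfolding eventually_sequentially by (meson nat_le_linear)
    then show False using N[of k] by auto
  qed
  then obtain q where q: "q \<in> punctures P" "infinite {k. z k \<in> puncture_nhd q \<epsilon>0}" by blast
  define s where "s = enumerate {k. z k \<in> puncture_nhd q \<epsilon>0}"
  have s: "strict_mono s" unfolding s_def by (rule strict_mono_enumerate[OF q(2)])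
  have sq: "z (s k) \<in> puncture_nhd q \<epsilon>0" for k
    using enumerate_in_set[OF q(2), of k] by (simp add: s_def)
  have "filterlim (z \<circ> s) (puncture_filter q) sequentially"
    unfolding filterlim_iff eventually_puncture_filter
  proof (intro allI impI, elim exE conjE)
    fix R \<epsilon> assume \<epsilon>: "0 < \<epsilon>" "\<forall>z\<in>puncture_nhd q \<epsilon>. R z"
    define \<epsilon>1 where "\<epsilon>1 = min \<epsilon> \<epsilon>0"
    have \<epsilon>1: "0 < \<epsilon>1" "\<epsilon>1 \<le> \<epsilon>" "\<epsilon>1 \<le> \<epsilon>0" using \<epsilon> \<epsilon>0 by (auto simp: \<epsilon>1_def)
    have "\<forall>\<^sub>F k in sequentially. \<exists>q'\<in>punctures P. z (s k) \<in> puncture_nhd q' \<epsilon>1"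
      using eventually_subseq[OF s ev[OF \<epsilon>1(1)]] .
    then show "\<forall>\<^sub>F k in sequentially. R ((z \<circ> s) k)"
    proof eventually_elim
      case (elim k)
      then obtain q' where q': "q' \<in> punctures P" "z (s k) \<in> puncture_nhd q' \<epsilon>1" by blast
      have "z (s k) \<in> puncture_nhd q' \<epsilon>0" using puncture_nhd_mono[OF \<epsilon>1(1,3)] q'(2) by blast
      then have "q' = q" using \<epsilon>0(2) q(1) q'(1) sq[of k] by blast
      then have "z (s k) \<in> puncture_nhd q \<epsilon>" using puncture_nhd_mono[OF \<epsilon>1(1,2)] q'(2) by blast
      then show ?case using \<epsilon>(2) by simp
    qed
  qed
  then show thesis using that[OF q(1) s] by blast
qed

text \<open>The second limit follows from the first because ln x / x tends to 0: limit directions at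
  an end are orthogonal to its growth vector.\<close>

lemma subsequence_growth:
  assumes y: "\<And>k. y k \<in> S" and div: "filterlim (\<lambda>k. norm (y k)) at_top sequentially"
  obtains q s where "q \<in> punctures P" "strict_mono s"
    "(\<lambda>k. (y (s k) \<bullet> v q) / ln (norm (y (s k)))) \<longlonglongrightarrow> v q \<bullet> v q"
    "(\<lambda>k. (y (s k) \<bullet> v q) / norm (y (s k))) \<longlonglongrightarrow> 0"
proof -
  have "\<forall>k. \<exists>z. z \<in> - P \<and> y k = X z" using y by blast
  then obtain z where z: "\<And>k. z k \<in> - P" "\<And>k. y k = X (z k)" by metis
  have "filterlim (\<lambda>k. norm (X (z k))) at_top sequentially" using div by (simp add: z(2))
  then obtain q s where qs: "q \<in> punctures P" "strict_mono s" "filterlim (z \<circ> s) (puncture_filter q) sequentially"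
    using subsequence_to_puncture[of z] z(1) by blast
  have 1: "(\<lambda>k. (y (s k) \<bullet> v q) / ln (norm (y (s k)))) \<longlonglongrightarrow> v q \<bullet> v q"
    using filterlim_compose[OF growth[OF qs(1)] qs(3)] by (simp add: z(2))
  have div_s: "filterlim (\<lambda>k. norm (y (s k))) at_top sequentially"
    using filterlim_compose[OF div filterlim_subseq[OF qs(2)]] .
  have "(\<lambda>k. (y (s k) \<bullet> v q) / ln (norm (y (s k))) * (ln (norm (y (s k))) / norm (y (s k)))) \<longlonglongrightarrow> (v q \<bullet> v q) * 0"
    by (intro tendsto_mult 1 filterlim_compose[OF ln_over_self div_s])
  moreover have "\<forall>\<^sub>F k in sequentially. (y (s k) \<bullet> v q) / ln (norm (y (s k))) * (ln (norm (y (s k))) / norm (y (s k)))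
      = (y (s k) \<bullet> v q) / norm (y (s k))"
  proof -
    have "\<forall>\<^sub>F k in sequentially. norm (y (s k)) > 1" using div_s by (simp add: filterlim_at_top_dense)
    then show ?thesis
    proof eventually_elim
      case (elim k)
      then have "ln (norm (y (s k))) > 0" by (rule ln_gt_zero)
      then show ?case by simp
    qed
  qed
  ultimately have "(\<lambda>k. (y (s k) \<bullet> v q) / norm (y (s k))) \<longlonglongrightarrow> (v q \<bullet> v q) * 0"
    by (rule Lim_transform_eventually)
  then have "(\<lambda>k. (y (s k) \<bullet> v q) / norm (y (s k))) \<longlonglongrightarrow> 0" by simp
  then show thesis using that[OF qs(1,2) 1] by blast
qed

text \<open>For the converse, pick \<open>d\<close> orthogonal to \<open>x\<close> but not to any
  \<open>v q\<close> that is not parallel to \<open>x\<close>. A sequence tending to infinity in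
  direction \<open>d\<close> escapes along an end whose \<open>v q\<close> is orthogonal to
  \<open>d\<close>, so that \<open>v q\<close> is parallel to \<open>x\<close>, say l times
  \<open>x\<close>. Comparing the two growth rates gives l = \<open>l * l\<close>, hence l = 1. This
  choice of \<open>d\<close> is why \<open>growth_vector\<close> quantifies over all orthogonal
  directions.\<close>

lemma growth_vectors: "growth_vector S x \<longleftrightarrow> x \<in> v ` punctures P"
proof
  assume "x \<in> v ` punctures P"
  then obtain q where q: "q \<in> punctures P" "x = v q" by blast
  show "growth_vector S x"
    unfolding growth_vector_def
  proof (intro conjI allI impI)
    show "x \<noteq> 0" using growth_nonzero q by simp
    fix d assume d: "norm d = 1 \<and> d \<bullet> x = 0"
    then obtain z where z: "\<forall>k::nat. z k \<in> - P" "filterlim z (puncture_filter q) sequentially"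
      "(\<lambda>k. X (z k) /\<^sub>R norm (X (z k))) \<longlonglongrightarrow> d"
      using all_directions[OF q(1)] q(2) by blast
    show "\<exists>y :: nat \<Rightarrow> real^3. (\<forall>k. y k \<in> S) \<and> filterlim (\<lambda>k. norm (y k)) at_top sequentially \<and>
        (\<lambda>k. y k /\<^sub>R norm (y k)) \<longlonglongrightarrow> d \<and> (\<lambda>k. (y k \<bullet> x) / ln (norm (y k))) \<longlonglongrightarrow> x \<bullet> x"
      using z filterlim_compose[OF diverges[OF q(1)] z(2)] filterlim_compose[OF growth[OF q(1)] z(2)]
      unfolding q(2) by (intro exI[of _ "\<lambda>k. X (z k)"]) auto
  qed
next
  assume x: "growth_vector S x"
  then have x0: "x \<noteq> 0" by (simp add: growth_vector_def)
  define F where "F = {u \<in> v ` punctures P. cross3 u x \<noteq> 0}"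
  have "finite F" using finite_P by (simp add: F_def punctures_def)
  then obtain d where d: "norm d = 1" "d \<bullet> x = 0" "\<And>u. u \<in> F \<Longrightarrow> d \<bullet> u \<noteq> 0"
    using finite_avoid_normal[of F x] x0 unfolding F_def by blast
  obtain y where y: "\<And>k. y k \<in> S" "filterlim (\<lambda>k. norm (y k)) at_top sequentially"
    "(\<lambda>k. y k /\<^sub>R norm (y k)) \<longlonglongrightarrow> d" "(\<lambda>k. (y k \<bullet> x) / ln (norm (y k))) \<longlonglongrightarrow> x \<bullet> x"
    using x d(1,2) unfolding growth_vector_def by blast
  obtain q s where qs: "q \<in> punctures P" "strict_mono s"
    "(\<lambda>k. (y (s k) \<bullet> v q) / ln (norm (y (s k)))) \<longlonglongrightarrow> v q \<bullet> v q"
    "(\<lambda>k. (y (s k) \<bullet> v q) / norm (y (s k))) \<longlonglongrightarrow> 0"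
    using subsequence_growth[OF y(1,2)] by blast
  have "(\<lambda>k. (y (s k) /\<^sub>R norm (y (s k))) \<bullet> v q) \<longlonglongrightarrow> d \<bullet> v q"
    using LIMSEQ_subseq_LIMSEQ[OF y(3) qs(2)] by (intro tendsto_inner tendsto_const) (simp add: o_def)
  moreover have "(y (s k) /\<^sub>R norm (y (s k))) \<bullet> v q = (y (s k) \<bullet> v q) / norm (y (s k))" for k
    by (simp add: divide_inverse)
  ultimately have "d \<bullet> v q = 0" using qs(4) LIMSEQ_unique by simp
  then have "v q \<notin> F" using d(3) by blast
  then have "cross3 (v q) x = 0" using qs(1) by (simp add: F_def)
  then obtain l where l: "v q = l *\<^sub>R x" using cross_zero_parallel x0 by blast
  have l0: "l \<noteq> 0" using growth_nonzero[OF qs(1)] l by auto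
  have "(\<lambda>k. l * ((y (s k) \<bullet> x) / ln (norm (y (s k))))) \<longlonglongrightarrow> l * (x \<bullet> x)"
    using LIMSEQ_subseq_LIMSEQ[OF y(4) qs(2)] by (intro tendsto_mult_left) (simp add: o_def)
  moreover have "(\<lambda>k. l * ((y (s k) \<bullet> x) / ln (norm (y (s k))))) \<longlonglongrightarrow> l * l * (x \<bullet> x)"
    using qs(3) by (simp add: l mult.assoc)
  ultimately have "l * (x \<bullet> x) = l * l * (x \<bullet> x)" using LIMSEQ_unique by blast
  then have "l = 1" using l0 x0 by simp
  then show "x \<in> v ` punctures P" using l qs(1) by auto
qed

text \<open>The progression escapes in direction \<tau> along some end, so \<tau> is orthogonal to
  \<open>v q\<close>. But then the height along \<open>v q\<close> is constant on the progression,
  and divided by the logarithm of the norm it tends to 0 instead of the positive number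
  \<open>v q \<bullet> v q\<close>.\<close>

lemma no_translation:
  assumes "(\<lambda>x. x + \<tau>) ` S = S"
  shows "\<tau> = 0"
proof (rule ccontr)
  assume \<tau>: "\<tau> \<noteq> 0"
  have "S \<noteq> {}" using infinite_UNIV_char_0[where 'a = complex] finite_P by (metis Compl_eq_Diff_UNIV Diff_eq_empty_iff finite_subset image_is_empty)
  then obtain y0 where y0: "y0 \<in> S" by blast
  define y where "y k = y0 + real k *\<^sub>R \<tau>" for k :: nat
  have y: "y k \<in> S" for k
  proof (induction k)
    case 0
    then show ?case using y0 by (simp add: y_def)
  next
    case (Suc k)
    have "y (Suc k) = y k + \<tau>" by (simp add: y_def algebra_simps)
    then show ?case using Suc assms by (metis imageI)
  qed
  have lim: "(\<lambda>k. (1 / real k) *\<^sub>R y k) \<longlonglongrightarrow> \<tau>"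
  proof -
    have "(\<lambda>k. (1 / real k) *\<^sub>R y0 + \<tau>) \<longlonglongrightarrow> 0 *\<^sub>R y0 + \<tau>"
      by (intro tendsto_intros lim_1_over_n)
    moreover have "\<forall>\<^sub>F k in sequentially. (1 / real k) *\<^sub>R y0 + \<tau> = (1 / real k) *\<^sub>R y k"
      using eventually_gt_at_top[of 0] by eventually_elim (simp add: y_def algebra_simps)
    ultimately show ?thesis by (simp add: filterlim_cong)
  qed
  have div: "filterlim (\<lambda>k. norm (y k)) at_top sequentially"
  proof -
    have "(\<lambda>k. norm ((1 / real k) *\<^sub>R y k)) \<longlonglongrightarrow> norm \<tau>" by (intro tendsto_norm lim)
    then have "filterlim (\<lambda>k. norm ((1 / real k) *\<^sub>R y k) * real k) at_top sequentially"
      using \<tau> by (intro filterlim_tendsto_pos_mult_at_top[OF _ _ filterlim_real_sequentially]) auto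
    moreover have "\<forall>\<^sub>F k in sequentially. norm ((1 / real k) *\<^sub>R y k) * real k = norm (y k)"
      using eventually_gt_at_top[of 0] by eventually_elim simp
    ultimately show ?thesis by (simp add: filterlim_cong)
  qed
  obtain q s where qs: "q \<in> punctures P" "strict_mono s"
    "(\<lambda>k. (y (s k) \<bullet> v q) / ln (norm (y (s k)))) \<longlonglongrightarrow> v q \<bullet> v q"
    "(\<lambda>k. (y (s k) \<bullet> v q) / norm (y (s k))) \<longlonglongrightarrow> 0"
    using subsequence_growth[OF y div] by blast
  have lim_s: "(\<lambda>k. (1 / real (s k)) *\<^sub>R y (s k)) \<longlonglongrightarrow> \<tau>"
    using LIMSEQ_subseq_LIMSEQ[OF lim qs(2)] by (simp add: o_def)
  have "(\<lambda>k. (((1 / real (s k)) *\<^sub>R y (s k)) \<bullet> v q) / norm ((1 / real (s k)) *\<^sub>R y (s k))) \<longlonglongrightarrow> (\<tau> \<bullet> v q) / norm \<tau>"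
    using \<tau> by (intro tendsto_intros lim_s) simp
  moreover have "\<forall>\<^sub>F k in sequentially. (((1 / real (s k)) *\<^sub>R y (s k)) \<bullet> v q) / norm ((1 / real (s k)) *\<^sub>R y (s k))
      = (y (s k) \<bullet> v q) / norm (y (s k))"
  proof -
    have "\<forall>\<^sub>F k in sequentially. s k > 0"
      using eventually_subseq[OF qs(2) eventually_gt_at_top[of 0]] .
    then show ?thesis by eventually_elim simp
  qed
  ultimately have "(\<lambda>k. (y (s k) \<bullet> v q) / norm (y (s k))) \<longlonglongrightarrow> (\<tau> \<bullet> v q) / norm \<tau>"
    by (rule Lim_transform_eventually)
  then have "(\<tau> \<bullet> v q) / norm \<tau> = 0" using qs(4) LIMSEQ_unique by blast
  then have "\<tau> \<bullet> v q = 0" using \<tau> by simp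
  then have const: "y k \<bullet> v q = y0 \<bullet> v q" for k by (simp add: y_def inner_left_distrib)
  have "filterlim (\<lambda>k. ln (norm (y (s k)))) at_top sequentially"
    by (rule filterlim_compose[OF ln_at_top filterlim_compose[OF div filterlim_subseq[OF qs(2)]]])
  from tendsto_inverse_0_at_top[OF this]
  have "(\<lambda>k. (y (s k) \<bullet> v q) / ln (norm (y (s k)))) \<longlonglongrightarrow> 0"
    unfolding const divide_inverse by (intro tendsto_mult_right_zero)
  then have "v q \<bullet> v q = 0" using qs(3) LIMSEQ_unique by blast
  then show False using growth_nonzero[OF qs(1)] by simp
qed

end

section \<open>Asymptotics of an end in catenoid form\<close>

context catenoid_chart
begin

lemma filtermap_\<kappa>: "filtermap \<kappa> (at 0) = puncture_filter q"
proof (rule filter_eqI)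
  fix R
  have "(\<exists>d>0. \<forall>\<zeta>. \<zeta> \<noteq> 0 \<and> norm \<zeta> < d \<longrightarrow> R (\<kappa> \<zeta>)) \<longleftrightarrow> (\<exists>\<epsilon>>0. \<forall>z\<in>puncture_nhd q \<epsilon>. R z)"
  proof
    assume "\<exists>d>0. \<forall>\<zeta>. \<zeta> \<noteq> 0 \<and> norm \<zeta> < d \<longrightarrow> R (\<kappa> \<zeta>)"
    then obtain d where d: "d > 0" "\<And>\<zeta>. \<zeta> \<noteq> 0 \<Longrightarrow> norm \<zeta> < d \<Longrightarrow> R (\<kappa> \<zeta>)" by blast
    have "\<forall>z\<in>\<kappa> ` (ball 0 (min d \<rho>) - {0}). R z" using d(2) by auto
    then show "\<exists>\<epsilon>>0. \<forall>z\<in>puncture_nhd q \<epsilon>. R z"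
      using nhd_\<kappa>[of "min d \<rho>"] d(1) radius_pos by (intro exI[of _ "min d \<rho>"]) auto
  next
    assume "\<exists>\<epsilon>>0. \<forall>z\<in>puncture_nhd q \<epsilon>. R z"
    then obtain \<epsilon> where \<epsilon>: "\<epsilon> > 0" "\<forall>z\<in>puncture_nhd q \<epsilon>. R z" by blast
    have pos: "min \<epsilon> \<rho> > 0" using \<epsilon>(1) radius_pos by simp
    have "R (\<kappa> \<zeta>)" if "\<zeta> \<noteq> 0" "norm \<zeta> < min \<epsilon> \<rho>" for \<zeta>
    proof -
      have "\<kappa> \<zeta> \<in> \<kappa> ` (ball 0 (min \<epsilon> \<rho>) - {0})" using that by auto
      then have "\<kappa> \<zeta> \<in> puncture_nhd q (min \<epsilon> \<rho>)" using nhd_\<kappa>[of "min \<epsilon> \<rho>"] pos by simp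
      then show ?thesis using puncture_nhd_mono[OF pos, of \<epsilon> q] \<epsilon>(2) by auto
    qed
    then show "\<exists>d>0. \<forall>\<zeta>. \<zeta> \<noteq> 0 \<and> norm \<zeta> < d \<longrightarrow> R (\<kappa> \<zeta>)" using pos by blast
  qed
  then show "eventually R (filtermap \<kappa> (at 0)) \<longleftrightarrow> eventually R (puncture_filter q)"
    by (simp add: eventually_filtermap eventually_at eventually_puncture_filter)
qed

definition Y :: "complex \<Rightarrow> real^3" where
  "Y \<zeta> = vector [Re (hor \<zeta>), Im (hor \<zeta>), ht \<zeta>]"

lemma eventually_in_domain: "\<forall>\<^sub>F \<zeta> in at 0. \<zeta> \<noteq> 0 \<and> norm \<zeta> < \<rho>"
  using radius_pos unfolding eventually_at by (intro exI[of _ \<rho>]) auto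

lemma norm_X_\<kappa>:
  assumes "\<zeta> \<noteq> 0" "norm \<zeta> < \<rho>"
  shows "norm (X (\<kappa> \<zeta>)) = norm (Y \<zeta>)"
  unfolding X_\<kappa>[OF assms] Y_def orthogonal_matrix_isometry(2)[OF orth_L] ..

lemma norm_at_right: "filterlim (norm :: complex \<Rightarrow> real) (at_right 0) (at 0)"
  unfolding filterlim_at by (auto intro!: tendsto_eq_intros simp: eventually_at_filter)

lemma ln_norm_at_bot: "filterlim (\<lambda>\<zeta>::complex. ln (norm \<zeta>)) at_bot (at 0)"
  by (rule filterlim_compose[OF ln_at_0 norm_at_right])

lemma tendsto_h: "(h \<longlongrightarrow> h 0) (at 0)"
  using DERIV_isCont[OF deriv_h[of 0]] radius_pos by (simp add: isCont_def)

lemma tendsto_den: "(den \<longlongrightarrow> \<i> * c) (at 0)"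
proof -
  have "isCont rem 0" using has_derivative_rem[of 0] radius_pos has_derivative_continuous by auto
  then have "((\<lambda>\<zeta>. \<i> * c + \<zeta> * rem \<zeta>) \<longlongrightarrow> \<i> * c + 0 * rem 0) (at 0)"
    by (intro tendsto_intros) (simp add: isCont_def)
  then show ?thesis by (simp add: den_def[abs_def])
qed

lemma tendsto_norm_ht: "((\<lambda>\<zeta>. norm \<zeta> * ht \<zeta>) \<longlongrightarrow> 0) (at 0)"
proof -
  have "((\<lambda>x::real. x * ln x) \<longlongrightarrow> 0) (at_right 0)" by real_asymp
  then have 1: "((\<lambda>\<zeta>::complex. norm \<zeta> * ln (norm \<zeta>)) \<longlongrightarrow> 0) (at 0)"
    by (rule filterlim_compose[OF _ norm_at_right])
  have "((\<lambda>\<zeta>. a * (norm \<zeta> * ln (norm \<zeta>)) + norm \<zeta> * Re (h \<zeta>)) \<longlongrightarrow> a * 0 + 0 * Re (h 0)) (at 0)"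
    by (intro tendsto_intros 1 tendsto_h tendsto_norm_zero)
  then show ?thesis by (simp add: ht_def algebra_simps)
qed

lemma norm_Y: "(norm (Y \<zeta>))\<^sup>2 = (norm (hor \<zeta>))\<^sup>2 + (ht \<zeta>)\<^sup>2"
  unfolding power2_norm_eq_inner[of "Y \<zeta>"] cmod_power2
  by (simp add: Y_def inner_vec_def sum_3 power2_eq_square)

text \<open>The horizontal part dominates: \<zeta> times \<open>hor\<close> tends to \<i> c, while
  norm \<zeta> times the logarithmic height tends to 0. Hence the logarithm of the norm of the
  immersion behaves like - ln (norm \<zeta>).\<close>

lemma tendsto_scaled_norm: "((\<lambda>\<zeta>. norm \<zeta> * norm (X (\<kappa> \<zeta>))) \<longlongrightarrow> \<bar>c\<bar>) (at 0)"
proof -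
  have "((\<lambda>\<zeta>. sqrt ((norm (den \<zeta>))\<^sup>2 + (norm \<zeta> * ht \<zeta>)\<^sup>2)) \<longlongrightarrow> sqrt ((norm (\<i> * c))\<^sup>2 + 0\<^sup>2)) (at 0)"
    by (intro tendsto_intros tendsto_den tendsto_norm_ht)
  then have "((\<lambda>\<zeta>. sqrt ((norm (den \<zeta>))\<^sup>2 + (norm \<zeta> * ht \<zeta>)\<^sup>2)) \<longlongrightarrow> \<bar>c\<bar>) (at 0)"
    by (simp add: norm_mult)
  moreover have "\<forall>\<^sub>F \<zeta> in at 0. sqrt ((norm (den \<zeta>))\<^sup>2 + (norm \<zeta> * ht \<zeta>)\<^sup>2) = norm \<zeta> * norm (X (\<kappa> \<zeta>))"
    using eventually_in_domain
  proof eventually_elim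
    case (elim \<zeta>)
    then have "norm (den \<zeta>) = norm \<zeta> * norm (hor \<zeta>)" by (simp add: hor_eq norm_divide)
    then have "(norm (den \<zeta>))\<^sup>2 + (norm \<zeta> * ht \<zeta>)\<^sup>2 = (norm \<zeta> * norm (Y \<zeta>))\<^sup>2"
      by (simp only: power_mult_distrib norm_Y distrib_left)
    then show ?case using elim norm_X_\<kappa>[of \<zeta>] by simp
  qed
  ultimately show ?thesis by (rule Lim_transform_eventually)
qed

lemma norm_X_\<kappa>_at_top: "filterlim (\<lambda>\<zeta>. norm (X (\<kappa> \<zeta>))) at_top (at 0)"
proof -
  have "filterlim (\<lambda>\<zeta>::complex. inverse (norm \<zeta>)) at_top (at 0)"
    by (rule filterlim_compose[OF filterlim_inverse_at_top_right norm_at_right])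
  from filterlim_tendsto_pos_mult_at_top[OF tendsto_scaled_norm _ this]
  have "filterlim (\<lambda>\<zeta>. norm \<zeta> * norm (X (\<kappa> \<zeta>)) * inverse (norm \<zeta>)) at_top (at 0)"
    using pole by simp
  moreover have "\<forall>\<^sub>F \<zeta> in at 0. norm \<zeta> * norm (X (\<kappa> \<zeta>)) * inverse (norm \<zeta>) = norm (X (\<kappa> \<zeta>))"
    using eventually_in_domain by eventually_elim simp
  ultimately show ?thesis by (rule filterlim_cong[THEN iffD1, OF refl refl, rotated])
qed

theorem diverges: "filterlim (\<lambda>z. norm (X z)) at_top (puncture_filter q)"
  using norm_X_\<kappa>_at_top unfolding filtermap_\<kappa>[symmetric] filterlim_filtermap .

definition growth_dir :: "real^3" where
  "growth_dir = (- a) *\<^sub>R (L *v vector [0, 0, 1])"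

lemma growth_dir_inner: "growth_dir \<bullet> growth_dir = a * a"
  by (simp add: growth_dir_def orthogonal_matrix_isometry[OF orth_L])
    (simp add: inner_vec_def sum_3)

lemma growth_dir_nonzero: "growth_dir \<noteq> 0"
  using growth_dir_inner log_growth by auto

lemma X_\<kappa>_growth_dir:
  assumes "\<zeta> \<noteq> 0" "norm \<zeta> < \<rho>"
  shows "X (\<kappa> \<zeta>) \<bullet> growth_dir = - a * ht \<zeta>"
  unfolding X_\<kappa>[OF assms] growth_dir_def inner_scaleR_right orthogonal_matrix_isometry[OF orth_L]
  by (simp add: inner_vec_def sum_3)

theorem growth: "((\<lambda>z. (X z \<bullet> growth_dir) / ln (norm (X z))) \<longlongrightarrow> growth_dir \<bullet> growth_dir) (puncture_filter q)"
proof -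
  have inv: "((\<lambda>\<zeta>::complex. inverse (ln (norm \<zeta>))) \<longlongrightarrow> 0) (at 0)"
    by (rule filterlim_compose[OF tendsto_inverse_0 filterlim_mono[OF ln_norm_at_bot at_bot_le_at_infinity order_refl]])
  \<comment> \<open>The quotient in question, with numerator and denominator both divided by ln
    (norm \<zeta>); the -1 comes from writing the norm of the immersion as the bounded product of
    \<open>tendsto_scaled_norm\<close> over norm \<zeta>.\<close>
  have "((\<lambda>\<zeta>. (- a * (a + Re (h \<zeta>) * inverse (ln (norm \<zeta>)))) /
      (ln (norm \<zeta> * norm (X (\<kappa> \<zeta>))) * inverse (ln (norm \<zeta>)) - 1)) \<longlongrightarrow>
      (- a * (a + Re (h 0) * 0)) / (ln \<bar>c\<bar> * 0 - 1)) (at 0)"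
    using pole by (intro tendsto_intros tendsto_h inv tendsto_scaled_norm) auto
  then have "((\<lambda>\<zeta>. (- a * (a + Re (h \<zeta>) * inverse (ln (norm \<zeta>)))) /
      (ln (norm \<zeta> * norm (X (\<kappa> \<zeta>))) * inverse (ln (norm \<zeta>)) - 1)) \<longlongrightarrow> a * a) (at 0)"
    by simp
  moreover have "\<forall>\<^sub>F \<zeta> in at 0. (- a * (a + Re (h \<zeta>) * inverse (ln (norm \<zeta>)))) /
      (ln (norm \<zeta> * norm (X (\<kappa> \<zeta>))) * inverse (ln (norm \<zeta>)) - 1) = (X (\<kappa> \<zeta>) \<bullet> growth_dir) / ln (norm (X (\<kappa> \<zeta>)))"
  proof -
    have "\<forall>\<^sub>F \<zeta> in at 0. norm (X (\<kappa> \<zeta>)) > 1" using norm_X_\<kappa>_at_top by (simp add: filterlim_at_top_dense)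
    moreover have "\<forall>\<^sub>F \<zeta>::complex in at 0. ln (norm \<zeta>) < 0"
      using ln_norm_at_bot by (simp add: filterlim_at_bot_dense)
    ultimately show ?thesis using eventually_in_domain
    proof eventually_elim
      case (elim \<zeta>)
      then have l: "ln (norm \<zeta>) \<noteq> 0" by simp
      have 1: "- a * (a + Re (h \<zeta>) * inverse (ln (norm \<zeta>))) = (- a * ht \<zeta>) / ln (norm \<zeta>)"
        using l by (simp add: ht_def field_simps)
      have "ln (norm \<zeta> * norm (X (\<kappa> \<zeta>))) = ln (norm \<zeta>) + ln (norm (X (\<kappa> \<zeta>)))"
        using elim by (intro ln_mult_pos) auto
      then have 2: "ln (norm \<zeta> * norm (X (\<kappa> \<zeta>))) * inverse (ln (norm \<zeta>)) - 1 = ln (norm (X (\<kappa> \<zeta>))) / ln (norm \<zeta>)"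
        using l by (simp add: field_simps)
      show ?case unfolding 1 2 using l elim X_\<kappa>_growth_dir[of \<zeta>] by simp
    qed
  qed
  ultimately have "((\<lambda>\<zeta>. (X (\<kappa> \<zeta>) \<bullet> growth_dir) / ln (norm (X (\<kappa> \<zeta>)))) \<longlongrightarrow> a * a) (at 0)"
    by (rule Lim_transform_eventually)
  then show ?thesis
    unfolding filtermap_\<kappa>[symmetric] filterlim_filtermap growth_dir_inner .
qed

theorem all_directions:
  assumes d: "norm d = 1" "d \<bullet> growth_dir = 0"
  shows "\<exists>z :: nat \<Rightarrow> complex. (\<forall>k. z k \<in> - P) \<and> filterlim z (puncture_filter q) sequentially \<and>
     (\<lambda>k. X (z k) /\<^sub>R norm (X (z k))) \<longlonglongrightarrow> d"
proof -
  define e where "e = transpose L *v d"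
  have orth_T: "orthogonal_matrix (transpose L)" using orth_L by simp
  have d_e: "d = L *v e"
  proof -
    have "L ** transpose L = mat 1" using orth_L by (simp only: orthogonal_matrix_def)
    then show ?thesis by (simp only: e_def matrix_vector_mul_assoc matrix_vector_mul_lid)
  qed
  have "e \<bullet> vector [0, 0, 1] = 0"
    using d(2) log_growth unfolding d_e growth_dir_def inner_scaleR_right orthogonal_matrix_isometry[OF orth_L]
    by simp
  then have e3: "e $ 3 = 0" by (simp add: inner_vec_def sum_3)
  define w where "w = Complex (e $ 1) (e $ 2)"
  have "norm e = 1" using d(1) unfolding d_e orthogonal_matrix_isometry[OF orth_L] .
  then have w: "norm w = 1"
    using e3 by (simp add: w_def cmod_def norm_vec_def L2_set_def sum_3)
  \<comment> \<open>On the ray through \<open>u\<close> the horizontal part is asymptotic to \<i> c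
    / (u norm \<zeta>). So \<open>u\<close> is the unit number for which \<i> c / u is a positive
    multiple of \<open>w\<close>, the direction \<open>d\<close> in model coordinates.\<close>
  define u where "u = \<i> * of_real c / (of_real \<bar>c\<bar> * w)"
  have u: "norm u = 1" using w pole by (simp add: u_def norm_mult norm_divide)
  define \<zeta> where "\<zeta> k = of_real (\<rho> / 2 / real (Suc k)) * u" for k
  have n\<zeta>: "norm (\<zeta> k) = \<rho> / 2 / real (Suc k)" for k
    unfolding \<zeta>_def norm_mult norm_of_real u using radius_pos by simp
  have \<zeta>: "\<zeta> k \<noteq> 0" "norm (\<zeta> k) < \<rho>" for k
  proof -
    have "norm (\<zeta> k) > 0" using n\<zeta>[of k] radius_pos by simp
    then show "\<zeta> k \<noteq> 0" by auto
    have "\<rho> / 2 / real (Suc k) \<le> \<rho> / 2" using radius_pos by (simp add: divide_le_eq)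
    then show "norm (\<zeta> k) < \<rho>" unfolding n\<zeta> using radius_pos by linarith
  qed
  have "(\<lambda>k. norm (\<zeta> k)) \<longlonglongrightarrow> 0"
    unfolding n\<zeta> by real_asymp
  then have lim0: "\<zeta> \<longlonglongrightarrow> 0" by (simp add: tendsto_norm_zero_iff)
  then have lim: "filterlim \<zeta> (at 0) sequentially"
    using \<zeta> by (simp add: filterlim_at)
  have 1: "\<kappa> (\<zeta> k) \<in> - P" for k
  proof -
    have "\<kappa> (\<zeta> k) \<in> puncture_nhd q \<rho>" using nhd_\<kappa>[of \<rho>] radius_pos \<zeta> by auto
    then show ?thesis using avoid by blast
  qed
  have 2: "filterlim (\<lambda>k. \<kappa> (\<zeta> k)) (puncture_filter q) sequentially"
    unfolding filtermap_\<kappa>[symmetric] using lim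
    by (simp add: filterlim_def filtermap_filtermap[symmetric] filtermap_mono)
  have sc: "(\<lambda>k. norm (\<zeta> k) * norm (X (\<kappa> (\<zeta> k)))) \<longlonglongrightarrow> \<bar>c\<bar>"
    by (rule filterlim_compose[OF tendsto_scaled_norm lim])
  have u_ic: "\<i> * of_real c / u = of_real \<bar>c\<bar> * w" using pole w by (auto simp: u_def)
  have hor: "(\<lambda>k. of_real (norm (\<zeta> k)) * hor (\<zeta> k)) \<longlonglongrightarrow> of_real \<bar>c\<bar> * w"
  proof -
    have "(\<lambda>k. den (\<zeta> k) / u) \<longlonglongrightarrow> (\<i> * of_real c) / u"
      using u by (intro tendsto_intros filterlim_compose[OF tendsto_den lim]) auto
    moreover have "den (\<zeta> k) / u = of_real (norm (\<zeta> k)) * hor (\<zeta> k)" for k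
    proof -
      have e: "\<zeta> k = of_real (norm (\<zeta> k)) * u" unfolding n\<zeta> by (rule \<zeta>_def)
      have "norm (\<zeta> k) \<noteq> 0" using \<zeta>(1)[of k] by simp
      then have "of_real (norm (\<zeta> k)) * (den (\<zeta> k) / (of_real (norm (\<zeta> k)) * u)) = den (\<zeta> k) / u" by simp
      then show ?thesis unfolding hor_eq[OF \<zeta>(1)] e[symmetric] by (rule sym)
    qed
    ultimately show ?thesis unfolding u_ic by simp
  qed
  have ht: "(\<lambda>k. norm (\<zeta> k) * ht (\<zeta> k)) \<longlonglongrightarrow> 0"
    by (rule filterlim_compose[OF tendsto_norm_ht lim])
  have Ylim: "(\<lambda>k. norm (\<zeta> k) *\<^sub>R Y (\<zeta> k)) \<longlonglongrightarrow> \<bar>c\<bar> *\<^sub>R e"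
  proof (rule vec_tendstoI)
    fix i :: 3
    have "(\<lambda>k. Re (of_real (norm (\<zeta> k)) * hor (\<zeta> k))) \<longlonglongrightarrow> Re (of_real \<bar>c\<bar> * w)"
      "(\<lambda>k. Im (of_real (norm (\<zeta> k)) * hor (\<zeta> k))) \<longlonglongrightarrow> Im (of_real \<bar>c\<bar> * w)"
      by (intro tendsto_intros hor)+
    then have "\<forall>i. (\<lambda>k. (norm (\<zeta> k) *\<^sub>R Y (\<zeta> k)) $ i) \<longlonglongrightarrow> (\<bar>c\<bar> *\<^sub>R e) $ i"
      using ht e3 by (simp add: forall_3 Y_def w_def)
    then show "(\<lambda>k. (norm (\<zeta> k) *\<^sub>R Y (\<zeta> k)) $ i) \<longlonglongrightarrow> (\<bar>c\<bar> *\<^sub>R e) $ i" by blast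
  qed
  have "(\<lambda>k. L *v ((1 / (norm (\<zeta> k) * norm (X (\<kappa> (\<zeta> k))))) *\<^sub>R (norm (\<zeta> k) *\<^sub>R Y (\<zeta> k)))) \<longlonglongrightarrow> L *v ((1 / \<bar>c\<bar>) *\<^sub>R (\<bar>c\<bar> *\<^sub>R e))"
    using pole by (intro bounded_linear.tendsto[OF matrix_vector_mul_bounded_linear] tendsto_scaleR tendsto_divide
        tendsto_const sc Ylim) auto
  moreover have "L *v ((1 / (norm (\<zeta> k) * norm (X (\<kappa> (\<zeta> k))))) *\<^sub>R (norm (\<zeta> k) *\<^sub>R Y (\<zeta> k))) = X (\<kappa> (\<zeta> k)) /\<^sub>R norm (X (\<kappa> (\<zeta> k)))" for k
    using \<zeta>[of k] unfolding X_\<kappa>[OF \<zeta>] Y_def[symmetric] by (simp add: matrix_vector_mult_scaleR divide_inverse)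
  moreover have "L *v ((1 / \<bar>c\<bar>) *\<^sub>R (\<bar>c\<bar> *\<^sub>R e)) = d" using pole by (simp add: d_e)
  ultimately have "(\<lambda>k. X (\<kappa> (\<zeta> k)) /\<^sub>R norm (X (\<kappa> (\<zeta> k)))) \<longlonglongrightarrow> d" by simp
  then show ?thesis using 1 2 by (intro exI[of _ "\<lambda>k. \<kappa> (\<zeta> k)"]) blast
qed

end

section \<open>Sums over roots of unity\<close>

abbreviation (input) roots_of_unity :: "nat \<Rightarrow> complex set" where
  "roots_of_unity n \<equiv> {w. w ^ n = 1}"

lemma finite_roots_of_unity: "n > 0 \<Longrightarrow> finite (roots_of_unity n)"
  by (rule finite_roots_unity) simp

lemma root_of_unity_norm: "w \<in> roots_of_unity n \<Longrightarrow> n > 0 \<Longrightarrow> norm w = 1"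
proof -
  assume "w \<in> roots_of_unity n" "n > 0"
  then have "norm w ^ n = 1 ^ n" by (simp flip: norm_power)
  then show "norm w = 1" by (rule power_eq_imp_eq_base) (use \<open>n > 0\<close> in simp_all)
qed

lemma cnj_root_of_unity:
  assumes "w \<in> roots_of_unity n" "n > 0"
  shows "cnj w \<in> roots_of_unity n" "w * cnj w = 1" "cnj w = 1 / w" "w \<noteq> 0"
proof -
  have nw: "norm w = 1" by (rule root_of_unity_norm[OF assms])
  show "cnj w \<in> roots_of_unity n" using assms by (simp flip: complex_cnj_power)
  show wc: "w * cnj w = 1" using nw by (simp add: complex_mult_cnj cmod_def)
  show "w \<noteq> 0" using nw by auto
  then show "cnj w = 1 / w" using wc by (simp add: field_simps)
qed

lemma sum_roots_cnj:
  assumes "n > 0"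
  shows "(\<Sum>w\<in>roots_of_unity n. F (cnj w)) = (\<Sum>w\<in>roots_of_unity n. F w)"
  by (rule sum.reindex_bij_witness[of _ cnj cnj]) (use cnj_root_of_unity(1) assms in auto)

lemma sum_roots_mult:
  assumes "n > 0" "u \<in> roots_of_unity n"
  shows "(\<Sum>w\<in>roots_of_unity n. F (u * w)) = (\<Sum>w\<in>roots_of_unity n. F w)"
proof (rule sum.reindex_bij_witness[of _ "\<lambda>w. cnj u * w" "\<lambda>w. u * w"])
  have u: "u * cnj u = 1" "cnj u * u = 1" "cnj u \<in> roots_of_unity n"
    using cnj_root_of_unity[OF assms(2,1)] by (auto simp: mult.commute)
  fix w assume w: "w \<in> roots_of_unity n"
  show "cnj u * (u * w) = w" "u * (cnj u * w) = w" using u by (simp_all flip: mult.assoc)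
  show "u * w \<in> roots_of_unity n" "cnj u * w \<in> roots_of_unity n"
    using w u assms(2) by (simp_all add: power_mult_distrib)
qed (rule refl)

text \<open>Multiplication by a primitive root \<open>u\<close> permutes the roots, so the sum
  equals itself times \<open>u ^ k\<close>, and \<open>u ^ k\<close> is not 1.\<close>

lemma sum_root_powers:
  assumes "0 < k" "k < n"
  shows "(\<Sum>w\<in>roots_of_unity n. w ^ k) = 0"
proof -
  define u where "u = cis (2 * pi / real n)"
  have n: "n > 0" using assms by simp
  have "u ^ n = cis (real n * (2 * pi / real n))" unfolding u_def by (rule Complex.DeMoivre)
  then have u: "u \<in> roots_of_unity n" using n by simp
  have "u ^ k \<noteq> 1"
  proof
    assume "u ^ k = 1"
    then have "cis (real k * (2 * pi / real n)) = 1"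
      unfolding u_def Complex.DeMoivre .
    then have "cos (real k * (2 * pi / real n)) = 1"
      by (metis cis.sel(1) one_complex.sel(1))
    then have "cos (2 * pi * real k / real n) = 1"
      by (simp add: mult_ac)
    then obtain m :: int where "2 * pi * real k / real n = of_int m * 2 * pi"
      unfolding cos_one_2pi_int by blast
    then have "2 * pi * (real k / real n) = 2 * pi * of_int m" by (simp only: times_divide_eq_right mult_ac)
    then have "real k / real n = of_int m" by (simp only: mult_cancel_left) simp
    moreover have "0 < real k / real n" "real k / real n < 1" using assms by auto
    ultimately have "0 < m" "m < 1" by linarith+
    then show False by simp
  qed
  moreover have "u ^ k * (\<Sum>w\<in>roots_of_unity n. w ^ k) = (\<Sum>w\<in>roots_of_unity n. w ^ k)"
    using sum_roots_mult[OF n u, of "\<lambda>w. w ^ k"] by (simp add: sum_distrib_left power_mult_distrib)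
  ultimately show ?thesis by (metis mult_cancel_right1)
qed

text \<open>After multiplication by \<open>z ^ n - 1\<close> each summand becomes a geometric sum in
  z and w. Summed over the roots, only the exponent n of w survives, where every power is 1.\<close>

lemma sum_root_div:
  assumes n: "n > 0" and z: "z ^ n \<noteq> 1"
  shows "(\<Sum>w\<in>roots_of_unity n. w / (z - w)) = of_nat n / (z ^ n - 1)"
proof -
  have "(z ^ n - 1) * (\<Sum>w\<in>roots_of_unity n. w / (z - w)) = (\<Sum>w\<in>roots_of_unity n. (z ^ n - 1) * (w / (z - w)))"
    by (rule sum_distrib_left)
  also have "\<dots> = (\<Sum>w\<in>roots_of_unity n. \<Sum>i<n. z ^ i * w ^ (n - i))"
  proof (rule sum.cong[OF refl])
    fix w :: complex assume w: "w \<in> roots_of_unity n"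
    then have zw: "z - w \<noteq> 0" using z by auto
    have "z ^ n - 1 = (z - w) * (\<Sum>i<n. w ^ (n - Suc i) * z ^ i)"
      using power_diff_sumr2[of z n w] w by simp
    then have "(z ^ n - 1) * (w / (z - w)) = (\<Sum>i<n. w ^ (n - Suc i) * z ^ i) * w" using zw by simp
    also have "\<dots> = (\<Sum>i<n. z ^ i * w ^ (n - i))"
      unfolding sum_distrib_right
    proof (rule sum.cong[OF refl])
      fix i assume "i \<in> {..<n}"
      then have "w ^ (n - i) = w * w ^ (n - Suc i)" by (simp add: Suc_diff_Suc flip: power_Suc)
      then show "w ^ (n - Suc i) * z ^ i * w = z ^ i * w ^ (n - i)" by simp
    qed
    finally show "(z ^ n - 1) * (w / (z - w)) = (\<Sum>i<n. z ^ i * w ^ (n - i))" .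
  qed
  also have "\<dots> = (\<Sum>i<n. z ^ i * (\<Sum>w\<in>roots_of_unity n. w ^ (n - i)))"
    by (subst sum.swap) (simp add: sum_distrib_left)
  also have "\<dots> = (\<Sum>i<n. if i = 0 then of_nat n else 0)"
  proof (rule sum.cong[OF refl])
    fix i assume i: "i \<in> {..<n}"
    show "z ^ i * (\<Sum>w\<in>roots_of_unity n. w ^ (n - i)) = (if i = 0 then of_nat n else 0)"
    proof (cases "i = 0")
      case True
      have "(\<Sum>w\<in>roots_of_unity n. w ^ n) = (\<Sum>w\<in>roots_of_unity n. 1)" by (rule sum.cong) auto
      then show ?thesis using True card_roots_unity_eq[OF n] by simp
    next
      case False
      then show ?thesis using sum_root_powers[of "n - i" n] i by simp
    qed
  qed
  also have "\<dots> = of_nat n" using n by simp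
  finally show ?thesis using z by (simp add: field_simps)
qed

text \<open>Minus the derivative of \<open>sum_root_div\<close>, which holds on an open set.\<close>

lemma sum_root_div_square:
  assumes n: "n > 0" and z: "z ^ n \<noteq> 1"
  shows "(\<Sum>w\<in>roots_of_unity n. w / (z - w)\<^sup>2) = (of_nat n)\<^sup>2 * z ^ (n - 1) / (z ^ n - 1)\<^sup>2"
proof -
  let ?W = "{z::complex. z ^ n \<noteq> 1}"
  have op: "open ?W"
    by (intro open_Collect_neq continuous_intros)
  have nz: "z - w \<noteq> 0" if "w \<in> roots_of_unity n" for w using that z by auto
  have d1: "((\<lambda>z. \<Sum>w\<in>roots_of_unity n. w / (z - w)) has_field_derivative
      (\<Sum>w\<in>roots_of_unity n. - w / (z - w)\<^sup>2)) (at z)"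
    using nz by (intro DERIV_sum) (auto intro!: derivative_eq_intros simp: power2_eq_square)
  have d2: "((\<lambda>z. of_nat n / (z ^ n - 1)) has_field_derivative
      - ((of_nat n)\<^sup>2 * z ^ (n - 1) / (z ^ n - 1)\<^sup>2)) (at z)"
    using z by (auto intro!: derivative_eq_intros simp: power2_eq_square)
  have "((\<lambda>z. \<Sum>w\<in>roots_of_unity n. w / (z - w)) has_field_derivative
      - ((of_nat n)\<^sup>2 * z ^ (n - 1) / (z ^ n - 1)\<^sup>2)) (at z)"
    by (rule DERIV_cong_ev[THEN iffD2, OF refl _ refl d2])
      (use eventually_nhds_in_open[OF op, of z] z sum_root_div[OF n] in \<open>auto elim!: eventually_mono\<close>)
  from DERIV_unique[OF d1 this] show ?thesis
    by (simp add: sum_negf)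
qed

lemma sum_root_square_div_square:
  assumes n: "n > 0" and z: "z ^ n \<noteq> 1"
  shows "(\<Sum>w\<in>roots_of_unity n. w\<^sup>2 / (z - w)\<^sup>2) =
    (of_nat n)\<^sup>2 * z ^ n / (z ^ n - 1)\<^sup>2 - of_nat n / (z ^ n - 1)"
proof -
  have "w\<^sup>2 / (z - w)\<^sup>2 = z * (w / (z - w)\<^sup>2) - w / (z - w)" if "w \<in> roots_of_unity n" for w
  proof -
    have "z - w \<noteq> 0" using that z by auto
    then have "w / (z - w) = w * (z - w) / (z - w)\<^sup>2" by (simp add: power2_eq_square)
    then show ?thesis by (simp add: diff_divide_distrib[symmetric] power2_eq_square algebra_simps)
  qed
  then have "(\<Sum>w\<in>roots_of_unity n. w\<^sup>2 / (z - w)\<^sup>2) =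
      z * (\<Sum>w\<in>roots_of_unity n. w / (z - w)\<^sup>2) - (\<Sum>w\<in>roots_of_unity n. w / (z - w))"
    by (simp add: sum_subtractf sum_distrib_left)
  also have "\<dots> = (of_nat n)\<^sup>2 * (z * z ^ (n - 1)) / (z ^ n - 1)\<^sup>2 - of_nat n / (z ^ n - 1)"
    by (simp add: sum_root_div[OF assms] sum_root_div_square[OF assms])
  also have "z * z ^ (n - 1) = z ^ n" using n by (simp add: power_eq_if)
  finally show ?thesis .
qed

text \<open>The partial fraction expansion of the form \<open>g dh\<close> of the Weierstrass data, up to scale; the
  value of the residue \<^term>\<open>r\<close> is what makes the two sides agree.\<close>

lemma partial_fractions:
  fixes \<alpha> :: real
  assumes n: "n > 0" and z: "z ^ n \<noteq> 1"
    and r: "r = (1 - \<alpha>) * (real n + 1 + (real n - 1) * \<alpha>) / (real n)\<^sup>2" and d: "d = ((1 - \<alpha>) / real n)\<^sup>2"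
  shows "1 + (\<Sum>w\<in>roots_of_unity n. of_real r * w / (z - w) + of_real d * w\<^sup>2 / (z - w)\<^sup>2) =
    ((z ^ n - of_real \<alpha>) / (z ^ n - 1))\<^sup>2"
proof -
  define t where "t = z ^ n - 1"
  have t: "t \<noteq> 0" "z ^ n = t + 1" using z by (auto simp: t_def)
  have nn: "of_nat n \<noteq> (0::complex)" using n by simp
  have "(\<Sum>w\<in>roots_of_unity n. of_real r * w / (z - w) + of_real d * w\<^sup>2 / (z - w)\<^sup>2) =
      of_real r * (\<Sum>w\<in>roots_of_unity n. w / (z - w)) + of_real d * (\<Sum>w\<in>roots_of_unity n. w\<^sup>2 / (z - w)\<^sup>2)"
    by (simp add: sum.distrib sum_distrib_left)
  also have "\<dots> = of_real r * (of_nat n / t) + of_real d * ((of_nat n)\<^sup>2 * (t + 1) / t\<^sup>2 - of_nat n / t)"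
    unfolding sum_root_div[OF n z] sum_root_square_div_square[OF n z] t_def[symmetric] unfolding t(2) ..
  finally have eq: "(\<Sum>w\<in>roots_of_unity n. of_real r * w / (z - w) + of_real d * w\<^sup>2 / (z - w)\<^sup>2) =
      of_real r * (of_nat n / t) + of_real d * ((of_nat n)\<^sup>2 * (t + 1) / t\<^sup>2 - of_nat n / t)" .
  \<comment> \<open>In t = \<open>z ^ n - 1\<close> and \<beta> = 1 - \<alpha> the numerator on the
    right is \<open>(t + \<beta>)^2\<close>; its coefficients \<open>\<beta>^2\<close> and 2 \<beta>
    determine \<open>d\<close> and then \<open>r\<close>.\<close>
  define \<beta> :: complex where "\<beta> = 1 - of_real \<alpha>"
  have r': "(of_real r :: complex) = \<beta> * (2 * of_nat n - (of_nat n - 1) * \<beta>) / (of_nat n)\<^sup>2"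
    unfolding r \<beta>_def by (simp add: algebra_simps)
  have d': "(of_real d :: complex) = \<beta>\<^sup>2 / (of_nat n)\<^sup>2"
    unfolding d \<beta>_def by (simp add: power_divide)
  define N :: complex where "N = of_nat n"
  have N: "N \<noteq> 0" using nn by (simp add: N_def)
  have "\<beta> * (2 * N - (N - 1) * \<beta>) / N\<^sup>2 * (N / t) + \<beta>\<^sup>2 / N\<^sup>2 * (N\<^sup>2 * (t + 1) / t\<^sup>2 - N / t) = (t\<^sup>2 + 2 * \<beta> * t + \<beta>\<^sup>2) / t\<^sup>2 - 1"
    using N t(1) by (simp add: field_simps power2_eq_square)
  also have "t\<^sup>2 + 2 * \<beta> * t + \<beta>\<^sup>2 = (t + \<beta>)\<^sup>2" by (simp add: power2_eq_square algebra_simps)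
  also have "t + \<beta> = z ^ n - of_real \<alpha>" by (simp add: t(2) \<beta>_def)
  finally show ?thesis
    unfolding eq unfolding r' d' N_def[symmetric] power_divide t_def[symmetric] by (simp only: add.commute) simp
qed

text \<open>The companion expansion, for the form dh / g up to scale. Replace z by 1 / z in
  \<open>partial_fractions\<close> and each root by its conjugate. The terms
  \<open>r / z * cnj w\<close> disappear because the roots of unity sum to 0, which uses n at least
  2.\<close>

lemma partial_fractions_inverse:
  fixes \<alpha> :: real
  assumes n: "n \<ge> 2" and z: "z ^ n \<noteq> 1" "z \<noteq> 0"
    and r: "r = (1 - \<alpha>) * (real n + 1 + (real n - 1) * \<alpha>) / (real n)\<^sup>2" and d: "d = ((1 - \<alpha>) / real n)\<^sup>2"
  shows "- 1 / z\<^sup>2 + (\<Sum>w\<in>roots_of_unity n. of_real r * cnj w / (z - w) - of_real d / (z - w)\<^sup>2) =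
    - ((1 - of_real \<alpha> * z ^ n) / (z * (z ^ n - 1)))\<^sup>2"
proof -
  have n0: "n > 0" using n by simp
  have zi: "(1 / z) ^ n \<noteq> 1" using z by (simp add: power_divide)
  have summand: "of_real r * w / (1 / z - w) + of_real d * w\<^sup>2 / (1 / z - w)\<^sup>2 =
      - (of_real r * z / (z - cnj w)) + of_real d * z\<^sup>2 / (z - cnj w)\<^sup>2" if w: "w \<in> roots_of_unity n" for w
  proof -
    have w0: "w \<noteq> 0" "cnj w = 1 / w" using cnj_root_of_unity[OF w n0] by auto
    have zw: "z - cnj w \<noteq> 0" using cnj_root_of_unity(1)[OF w n0] z by auto
    have e0: "1 / z - w = - (w * (z - cnj w) / z)" using z w0 by (simp add: field_simps)
    then have e: "w / (1 / z - w) = - (z / (z - cnj w))" unfolding e0 using zw z(2) w0(1) by simp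
    then have e2: "w\<^sup>2 / (1 / z - w)\<^sup>2 = z\<^sup>2 / (z - cnj w)\<^sup>2"
      by (simp add: power_divide[symmetric])
    show ?thesis using e e2 by (metis mult_minus_right times_divide_eq_right)
  qed
  have "((1 - of_real \<alpha> * z ^ n) / (z ^ n - 1))\<^sup>2 = (((1 / z) ^ n - of_real \<alpha>) / ((1 / z) ^ n - 1))\<^sup>2"
  proof -
    have e: "(1 / z) ^ n - of_real \<alpha> = (1 - of_real \<alpha> * z ^ n) / z ^ n"
      "(1 / z) ^ n - 1 = - ((z ^ n - 1) / z ^ n)" using z by (simp_all add: power_divide field_simps)
    have "((1 / z) ^ n - of_real \<alpha>) / ((1 / z) ^ n - 1) = - ((1 - of_real \<alpha> * z ^ n) / (z ^ n - 1))"
      unfolding e using z(2) by simp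
    then show ?thesis by (simp only: power2_minus)
  qed
  also have "\<dots> = 1 + (\<Sum>w\<in>roots_of_unity n. of_real r * w / (1 / z - w) + of_real d * w\<^sup>2 / (1 / z - w)\<^sup>2)"
    using partial_fractions[OF n0 zi r d] by simp
  also have "\<dots> = 1 + (\<Sum>w\<in>roots_of_unity n. - (of_real r * z / (z - cnj w)) + of_real d * z\<^sup>2 / (z - cnj w)\<^sup>2)"
    by (rule arg_cong[OF sum.cong[OF refl summand]])
  also have "\<dots> = 1 + (\<Sum>w\<in>roots_of_unity n. - (of_real r * z / (z - w)) + of_real d * z\<^sup>2 / (z - w)\<^sup>2)"
    by (simp only: sum_roots_cnj[OF n0, of "\<lambda>w. - (of_real r * z / (z - w)) + of_real d * z\<^sup>2 / (z - w)\<^sup>2"])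
  finally have Q: "((1 - of_real \<alpha> * z ^ n) / (z ^ n - 1))\<^sup>2 =
      1 + (\<Sum>w\<in>roots_of_unity n. - (of_real r * z / (z - w)) + of_real d * z\<^sup>2 / (z - w)\<^sup>2)" .
  have s0: "(\<Sum>w\<in>roots_of_unity n. cnj w) = 0"
    using sum_roots_cnj[OF n0, of "\<lambda>w. w"] sum_roots_unity[of n] n by simp
  have "(\<Sum>w\<in>roots_of_unity n. of_real r * cnj w / (z - w) - of_real d / (z - w)\<^sup>2) =
      (\<Sum>w\<in>roots_of_unity n. (of_real r / z) * cnj w + (of_real r / (z * (z - w)) - of_real d / (z - w)\<^sup>2))"
  proof (rule sum.cong[OF refl])
    fix w assume w: "w \<in> roots_of_unity n"
    have wc: "cnj w * w = 1" using cnj_root_of_unity[OF w n0] by (simp add: mult.commute)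
    have zw: "z - w \<noteq> 0" using w z by auto
    have "(1 / z) * cnj w + 1 / (z * (z - w)) = (cnj w * (z - w) + cnj w * w) / (z * (z - w))"
      unfolding wc using zw z(2) by (simp add: field_simps)
    also have "\<dots> = cnj w / (z - w)" using zw z(2) by (simp add: field_simps)
    finally have "of_real r * (cnj w / (z - w)) = of_real r * ((1 / z) * cnj w + 1 / (z * (z - w)))" by simp
    then show "of_real r * cnj w / (z - w) - of_real d / (z - w)\<^sup>2 =
      (of_real r / z) * cnj w + (of_real r / (z * (z - w)) - of_real d / (z - w)\<^sup>2)"
      by (simp add: algebra_simps)
  qed
  also have "\<dots> = (\<Sum>w\<in>roots_of_unity n. of_real r / (z * (z - w)) - of_real d / (z - w)\<^sup>2)"
    unfolding sum.distrib sum_distrib_left[symmetric] s0 by simp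
  finally have S: "(\<Sum>w\<in>roots_of_unity n. of_real r * cnj w / (z - w) - of_real d / (z - w)\<^sup>2) =
      (\<Sum>w\<in>roots_of_unity n. of_real r / (z * (z - w)) - of_real d / (z - w)\<^sup>2)" .
  have "of_real r / (z * (z - w)) - of_real d / (z - w)\<^sup>2 =
      (- 1 / z\<^sup>2) * (- (of_real r * z / (z - w)) + of_real d * z\<^sup>2 / (z - w)\<^sup>2)" for w
  proof -
    have a: "of_real r / (z * (z - w)) = (1 / z\<^sup>2) * (of_real r * z / (z - w))"
      using z(2) by (simp add: power2_eq_square)
    have b: "of_real d / (z - w)\<^sup>2 = (1 / z\<^sup>2) * (of_real d * z\<^sup>2 / (z - w)\<^sup>2)"
      using z(2) by simp
    have c: "k * x - k * y = (- k) * (- x + y)" for k x y :: complex by (simp add: algebra_simps)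
    show ?thesis unfolding a b c by (simp only: minus_divide_left)
  qed
  then have "(\<Sum>w\<in>roots_of_unity n. of_real r / (z * (z - w)) - of_real d / (z - w)\<^sup>2) =
      (- 1 / z\<^sup>2) * (\<Sum>w\<in>roots_of_unity n. - (of_real r * z / (z - w)) + of_real d * z\<^sup>2 / (z - w)\<^sup>2)"
    by (simp only: sum_distrib_left)
  then have "- 1 / z\<^sup>2 + (\<Sum>w\<in>roots_of_unity n. of_real r * cnj w / (z - w) - of_real d / (z - w)\<^sup>2) =
      (- 1 / z\<^sup>2) * (1 + (\<Sum>w\<in>roots_of_unity n. - (of_real r * z / (z - w)) + of_real d * z\<^sup>2 / (z - w)\<^sup>2))"
    unfolding S distrib_left by simp
  also have "\<dots> = (- 1 / z\<^sup>2) * ((1 - of_real \<alpha> * z ^ n) / (z ^ n - 1))\<^sup>2" unfolding Q ..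
  finally show ?thesis by (simp add: power_mult_distrib power_divide)
qed

section \<open>The surface\<close>

text \<open>Real residues integrate to single-valued logarithms of norms, so forms with such
  residues get a globally defined real primitive.\<close>

lemma log_sum_has_derivative:
  fixes G :: "complex \<Rightarrow> complex" and b :: "complex \<Rightarrow> real"
  assumes "finite S" "z \<notin> S" "(G has_field_derivative G') (at z)"
  shows "((\<lambda>z. Re (G z) + (\<Sum>w\<in>S. b w * ln (norm (z - w)))) has_derivative
    (\<lambda>v. Re ((G' + (\<Sum>w\<in>S. of_real (b w) / (z - w))) * v))) (at z)"
proof -
  have "((\<lambda>z. b w * ln (norm (z - w))) has_derivative (\<lambda>v. b w * Re (v / (z - w)))) (at z)" if "w \<in> S" for w
  proof -
    have "z - w \<noteq> 0" using that assms by auto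
    have "((\<lambda>z. z - w) has_derivative (\<lambda>v. v)) (at z)" by (auto intro!: derivative_eq_intros)
    from diff_chain_at[OF this ln_norm_has_derivative[OF \<open>z - w \<noteq> 0\<close>]]
    have "((\<lambda>z. ln (norm (z - w))) has_derivative (\<lambda>v. Re (v / (z - w)))) (at z)" by (simp add: o_def)
    then show ?thesis by (rule has_derivative_mult_right)
  qed
  then have 1: "((\<lambda>z. \<Sum>w\<in>S. b w * ln (norm (z - w))) has_derivative (\<lambda>v. \<Sum>w\<in>S. b w * Re (v / (z - w)))) (at z)"
    by (rule has_derivative_sum)
  have "((\<lambda>z. Re (G z)) has_derivative (\<lambda>v. Re (G' * v))) (at z)"
    by (intro has_derivative_Re) (use assms(3) in \<open>simp only: has_field_derivative_def\<close>)
  from has_derivative_add[OF this 1]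
  have "((\<lambda>z. Re (G z) + (\<Sum>w\<in>S. b w * ln (norm (z - w)))) has_derivative
      (\<lambda>v. Re (G' * v) + (\<Sum>w\<in>S. b w * Re (v / (z - w))))) (at z)" .
  moreover have "Re ((G' + (\<Sum>w\<in>S. of_real (b w) / (z - w))) * v) = Re (G' * v) + (\<Sum>w\<in>S. b w * Re (v / (z - w)))" for v
  proof -
    have "(G' + (\<Sum>w\<in>S. of_real (b w) / (z - w))) * v = G' * v + (\<Sum>w\<in>S. of_real (b w) * (v / (z - w)))"
      by (simp add: distrib_right sum_distrib_right)
    moreover have "Re (of_real s * x) = s * Re x" for s x by simp
    ultimately show ?thesis by (simp only: plus_complex.sel Re_sum)
  qed
  ultimately show ?thesis by (simp only:)
qed

locale jmv =
  fixes n :: nat and \<alpha> A :: real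
  assumes n: "n \<ge> 2" and \<alpha>: "0 < \<alpha>" "\<alpha> < 1" and A: "A > 0"
begin

text \<open>\<open>r\<close> and \<open>d\<close> are the residue and the double pole coefficient of
  \<open>partial_fractions\<close>; \<open>B\<close> is the common scale of the forms g dh / 2 and
  dh / (2 g) up to sign.\<close>

definition "r = (1 - \<alpha>) * (real n + 1 + (real n - 1) * \<alpha>) / (real n)\<^sup>2"
definition "d = ((1 - \<alpha>) / real n)\<^sup>2"
definition "B = A / (2 * \<alpha>)"

abbreviation "W \<equiv> roots_of_unity n"

definition P :: "complex set" where "P = insert 0 W"

text \<open>For the horizontal coordinates the Weierstrass formula reads B times (a primitive of
  \<open>F1\<close> plus the conjugate of a primitive of \<open>F2\<close>), with \<open>F1\<close>,
  \<open>F2\<close> as defined further down. The residues r w and r \<open>cnj w\<close> are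
  conjugate, so the two logarithms at \<open>w\<close> combine to the single-valued 2 r w ln (norm
  (z - w)).\<close>

definition hor_X :: "complex \<Rightarrow> complex" where
  "hor_X z = of_real B * (z + 1 / cnj z +
     (\<Sum>w\<in>W. of_real (2 * r * ln (norm (z - w))) * w - of_real d * w\<^sup>2 / (z - w) + of_real d / cnj (z - w)))"

text \<open>The constant n / 2 centres the surface: z \<mapsto> 1 / cnj z replaces each Re (w / (z -
  w)) by -1 minus itself, and with the constant the height changes exactly its sign.\<close>

definition ht_X :: "complex \<Rightarrow> real" where
  "ht_X z = A * ln (norm z) + 2 * B * d * (real n / 2 + (\<Sum>w\<in>W. Re (w / (z - w))))"

definition X :: "complex \<Rightarrow> real^3" where
  "X z = vector [Re (hor_X z), Im (hor_X z), ht_X z]"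

lemma n0: "n > 0" using n by simp
lemma finite_W: "finite W" using n0 by (rule finite_roots_of_unity)
lemma finite_P: "finite P" using finite_W by (simp add: P_def)
lemma r_pos: "r > 0"
  unfolding r_def using \<alpha> n by (intro divide_pos_pos mult_pos_pos add_pos_nonneg) auto
lemma d_pos: "d > 0" unfolding d_def using \<alpha> n by simp
lemma B_pos: "B > 0" unfolding B_def using \<alpha> A by simp
lemma B2: "2 * B = A / \<alpha>" by (simp add: B_def)
lemma sum_W: "\<Sum>W = 0" using sum_roots_unity[of n] n by simp

lemma hor_X_cnj: "hor_X (cnj z) = cnj (hor_X z)"
proof -
  let ?F = "\<lambda>z w. of_real (2 * r * ln (norm (z - w))) * w - of_real d * w\<^sup>2 / (z - w) + of_real d / cnj (z - w)"
  have "?F (cnj z) (cnj w) = cnj (?F z w)" for w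
  proof -
    have "norm (cnj z - cnj w) = norm (z - w)" by (metis complex_cnj_diff complex_mod_cnj)
    then show ?thesis by simp
  qed
  then have "(\<Sum>w\<in>W. ?F (cnj z) w) = cnj (\<Sum>w\<in>W. ?F z w)"
    using sum_roots_cnj[OF n0, of "?F (cnj z)"] by (simp only: cnj_sum)
  then show ?thesis unfolding hor_X_def by simp
qed

lemma ht_X_cnj: "ht_X (cnj z) = ht_X z"
proof -
  have "Re (cnj w / (cnj z - cnj w)) = Re (w / (z - w))" for w
  proof -
    have "cnj w / (cnj z - cnj w) = cnj (w / (z - w))" by simp
    then show ?thesis by (simp only: cnj.sel)
  qed
  then show ?thesis
    using sum_roots_cnj[OF n0, of "\<lambda>w. Re (w / (cnj z - w))"] by (simp add: ht_X_def)
qed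

lemma hor_X_rot:
  assumes u: "u \<in> W"
  shows "hor_X (u * z) = u * hor_X z"
proof -
  let ?F = "\<lambda>z w. of_real (2 * r * ln (norm (z - w))) * w - of_real d * w\<^sup>2 / (z - w) + of_real d / cnj (z - w)"
  have nu: "norm u = 1" by (rule root_of_unity_norm[OF u n0])
  have u': "u \<noteq> 0" "cnj u = 1 / u" using cnj_root_of_unity[OF u n0] by auto
  have "?F (u * z) (u * w) = u * ?F z w" for w
  proof -
    have 1: "norm (u * z - u * w) = norm (z - w)" by (simp add: nu norm_mult flip: right_diff_distrib)
    have 2: "of_real d * (u * w)\<^sup>2 / (u * z - u * w) = u * (of_real d * w\<^sup>2 / (z - w))"
      using u' by (simp add: power2_eq_square flip: right_diff_distrib)
    have 3: "of_real d / cnj (u * z - u * w) = u * (of_real d / cnj (z - w))"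
      using u' by (simp flip: right_diff_distrib)
    show ?thesis unfolding 1 2 3 by (simp add: algebra_simps)
  qed
  then have "(\<Sum>w\<in>W. ?F (u * z) w) = u * (\<Sum>w\<in>W. ?F z w)"
    using sum_roots_mult[OF n0 u, of "?F (u * z)"] by (simp only: sum_distrib_left)
  moreover have "u * z + 1 / cnj (u * z) = u * (z + 1 / cnj z)" using u' by (simp add: distrib_left)
  ultimately show ?thesis unfolding hor_X_def by (simp only: distrib_left mult.left_commute)
qed

lemma ht_X_rot:
  assumes u: "u \<in> W"
  shows "ht_X (u * z) = ht_X z"
proof -
  have "norm u = 1" "u \<noteq> 0" using root_of_unity_norm[OF u n0] by auto
  then have "u * w / (u * z - u * w) = w / (z - w)" for w
    by (simp flip: right_diff_distrib)
  then show ?thesis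
    using sum_roots_mult[OF n0 u, of "\<lambda>w. Re (w / (u * z - w))"] \<open>norm u = 1\<close>
    by (simp add: ht_X_def norm_mult)
qed

lemma inversion_diff:
  assumes "z \<noteq> 0" "w \<in> W"
  shows "1 / cnj z - w = - (w * cnj (z - w) / cnj z)"
proof -
  have "w * cnj w = 1" using cnj_root_of_unity[OF assms(2) n0] by auto
  then show ?thesis using assms(1) by (simp add: field_simps)
qed

text \<open>The inversion exchanges the two pole terms of each \<open>w\<close>, with additive
  constants that cancel. The logarithms change by multiples of \<open>w\<close> with a common
  factor, which sum to zero over the roots.\<close>

lemma hor_X_inv:
  assumes z: "z \<noteq> 0" "z \<notin> W"
  shows "hor_X (1 / cnj z) = hor_X z"
proof -
  let ?F = "\<lambda>z w. of_real (2 * r * ln (norm (z - w))) * w - of_real d * w\<^sup>2 / (z - w) + of_real d / cnj (z - w)"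
  have "?F (1 / cnj z) w = ?F z w - of_real (2 * r * ln (norm z)) * w" if w: "w \<in> W" for w
  proof -
    have w': "w \<noteq> 0" "cnj w = 1 / w" "norm w = 1" "w * cnj w = 1"
      using cnj_root_of_unity[OF w n0] root_of_unity_norm[OF w n0] by auto
    have zw: "z - w \<noteq> 0" "cnj (z - w) \<noteq> 0" using w z by auto
    note e = inversion_diff[OF z(1) w]
    have "norm (1 / cnj z - w) = norm (z - w) / norm z"
      unfolding e using w' by (simp add: norm_mult norm_divide del: complex_cnj_diff)
    then have 1: "ln (norm (1 / cnj z - w)) = ln (norm (z - w)) - ln (norm z)"
      using zw z by (simp add: ln_div)
    have "w\<^sup>2 / (1 / cnj z - w) = - (w * (cnj z / cnj (z - w)))"
      unfolding e using w' zw z(1) by (simp add: power2_eq_square del: complex_cnj_diff)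
    also have "cnj z / cnj (z - w) = 1 + cnj w / cnj (z - w)" using zw by (simp add: field_simps)
    also have "w * (1 + cnj w / cnj (z - w)) = w + 1 / cnj (z - w)"
      using w'(4) by (simp only: distrib_left mult_1_right times_divide_eq_right)
    finally have 2: "w\<^sup>2 / (1 / cnj z - w) = - (w + 1 / cnj (z - w))" .
    have "cnj (1 / cnj z - w) = - (cnj w * (z - w) / z)" unfolding e by simp
    then have "1 / cnj (1 / cnj z - w) = - (w * (z / (z - w)))"
      unfolding w'(2) using w' zw z(1) by simp
    also have "z / (z - w) = 1 + w / (z - w)" using zw by (simp add: field_simps)
    also have "w * (1 + w / (z - w)) = w + w\<^sup>2 / (z - w)" by (simp add: distrib_left power2_eq_square)
    finally have 3: "1 / cnj (1 / cnj z - w) = - (w + w\<^sup>2 / (z - w))" .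
    have d2: "of_real d * w\<^sup>2 / (1 / cnj z - w) = of_real d * - (w + 1 / cnj (z - w))"
      using 2 by (metis times_divide_eq_right)
    have d3: "of_real d / cnj (1 / cnj z - w) = of_real d * - (w + w\<^sup>2 / (z - w))"
      using 3 by (metis mult.right_neutral times_divide_eq_right)
    show ?thesis unfolding 1 d2 d3 by (simp add: algebra_simps)
  qed
  then have "(\<Sum>w\<in>W. ?F (1 / cnj z) w) = (\<Sum>w\<in>W. ?F z w - of_real (2 * r * ln (norm z)) * w)"
    by (rule sum.cong[OF refl])
  also have "\<dots> = (\<Sum>w\<in>W. ?F z w)"
    unfolding sum_subtractf sum_distrib_left[symmetric] sum_W by simp
  finally show ?thesis unfolding hor_X_def using z by (simp only: complex_cnj_divide complex_cnj_one complex_cnj_cnj) (simp add: add.commute)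
qed

lemma ht_X_inv:
  assumes z: "z \<noteq> 0" "z \<notin> W"
  shows "ht_X (1 / cnj z) = - ht_X z"
proof -
  have "Re (w / (1 / cnj z - w)) = - 1 - Re (w / (z - w))" if w: "w \<in> W" for w
  proof -
    have w': "w \<noteq> 0" using cnj_root_of_unity[OF w n0] by auto
    have zw: "cnj (z - w) \<noteq> 0" using w z by auto
    have "w / (1 / cnj z - w) = - (cnj z / cnj (z - w))"
      unfolding inversion_diff[OF z(1) w] using w' zw z(1) by (simp del: complex_cnj_diff)
    also have "cnj z / cnj (z - w) = 1 + cnj (w / (z - w))" using zw by (simp add: field_simps)
    finally show ?thesis by (simp del: complex_cnj_divide)
  qed
  then have "(\<Sum>w\<in>W. Re (w / (1 / cnj z - w))) = (\<Sum>w\<in>W. - 1 - Re (w / (z - w)))" by (rule sum.cong[OF refl])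
  also have "\<dots> = - real n - (\<Sum>w\<in>W. Re (w / (z - w)))"
    using card_roots_unity_eq[OF n0] by (simp add: sum_subtractf)
  finally have s: "(\<Sum>w\<in>W. Re (w / (1 / cnj z - w))) = - real n - (\<Sum>w\<in>W. Re (w / (z - w)))" .
  have "ln (norm (1 / cnj z)) = - ln (norm z)" using z by (simp add: norm_divide ln_div)
  then show ?thesis unfolding ht_X_def s by (simp add: algebra_simps)
qed

subsection \<open>Weierstrass data\<close>

text \<open>In the notation of the overview g = p / q and dh = wt p q. Keeping numerator and
  denominator apart avoids the poles of g.\<close>

definition p :: "complex \<Rightarrow> complex" where "p z = z * (z ^ n - of_real \<alpha>)"
definition q :: "complex \<Rightarrow> complex" where "q z = 1 - of_real \<alpha> * z ^ n"
definition wt :: "complex \<Rightarrow> complex" where "wt z = - of_real (A / \<alpha>) / (z * (z ^ n - 1))\<^sup>2"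

text \<open>The Weierstrass forms (1/g - g) dh / 2, \<i> (1/g + g) dh / 2 and dh, cleared of
  denominators in g.\<close>

definition \<phi> :: "3 \<Rightarrow> complex \<Rightarrow> complex" where
  "\<phi> i z = (if i = 1 then wt z * ((q z)\<^sup>2 - (p z)\<^sup>2) / 2
     else if i = 2 then \<i> * wt z * ((q z)\<^sup>2 + (p z)\<^sup>2) / 2 else wt z * p z * q z)"

definition F1 :: "complex \<Rightarrow> complex" where
  "F1 z = 1 + (\<Sum>w\<in>W. of_real r * w / (z - w) + of_real d * w\<^sup>2 / (z - w)\<^sup>2)"
definition F2 :: "complex \<Rightarrow> complex" where
  "F2 z = - 1 / z\<^sup>2 + (\<Sum>w\<in>W. of_real r * cnj w / (z - w) - of_real d / (z - w)\<^sup>2)"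

lemma not_in_P: "z \<notin> P \<longleftrightarrow> z \<noteq> 0 \<and> z ^ n \<noteq> 1"
  by (auto simp: P_def)

lemma F1_eq: "z \<in> - P \<Longrightarrow> of_real B * F1 z = - (wt z * (p z)\<^sup>2 / 2)"
proof -
  assume "z \<in> - P"
  then have z: "z \<noteq> 0" "z ^ n \<noteq> 1" by (auto simp: not_in_P)
  have "F1 z = ((z ^ n - of_real \<alpha>) / (z ^ n - 1))\<^sup>2"
    unfolding F1_def by (rule partial_fractions[OF n0 z(2) r_def d_def])
  moreover have "(of_real B :: complex) = of_real (A / \<alpha>) / 2" by (simp add: B_def)
  ultimately show ?thesis
    using z by (simp add: wt_def p_def power_mult_distrib power_divide)
qed

lemma F2_eq: "z \<in> - P \<Longrightarrow> of_real B * F2 z = wt z * (q z)\<^sup>2 / 2"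
proof -
  assume "z \<in> - P"
  then have z: "z \<noteq> 0" "z ^ n \<noteq> 1" by (auto simp: not_in_P)
  have "F2 z = - ((1 - of_real \<alpha> * z ^ n) / (z * (z ^ n - 1)))\<^sup>2"
    unfolding F2_def by (rule partial_fractions_inverse[OF n z(2,1) r_def d_def])
  moreover have "(of_real B :: complex) = of_real (A / \<alpha>) / 2" by (simp add: B_def)
  ultimately show ?thesis
    using z by (simp add: wt_def q_def power_mult_distrib power_divide)
qed

text \<open>The rational parts of the primitives of the three forms; the logarithms are added
  separately, through norms, so that everything is single-valued.\<close>

definition G1 :: "complex \<Rightarrow> complex" where
  "G1 z = of_real B * (z + 1 / z + (\<Sum>w\<in>W. of_real d / (z - w) - of_real d * w\<^sup>2 / (z - w)))"
definition G2 :: "complex \<Rightarrow> complex" where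
  "G2 z = - \<i> * of_real B * (z - 1 / z - (\<Sum>w\<in>W. of_real d / (z - w) + of_real d * w\<^sup>2 / (z - w)))"
definition G3 :: "complex \<Rightarrow> complex" where
  "G3 z = of_real (2 * B * d) * (of_nat n / 2 + (\<Sum>w\<in>W. w / (z - w)))"

lemma Re_hor_X: "Re (hor_X z) = Re (G1 z) + (\<Sum>w\<in>W. (2 * B * r * Re w) * ln (norm (z - w)))"
proof -
  have cR: "Re (of_real s / cnj x) = Re (of_real s / x)" for s x
  proof -
    have "of_real s / cnj x = cnj (of_real s / x)" by simp
    then show ?thesis by (simp only: cnj.sel)
  qed
  have cR1: "Re (1 / cnj x) = Re (1 / x)" for x using cR[of 1 x] by simp
  have sc: "Re (of_real s * x) = s * Re x" for s x by simp
  have "Re (hor_X z) = B * (Re z + Re (1 / z) + (\<Sum>w\<in>W. 2 * r * ln (norm (z - w)) * Re w -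
      Re (of_real d * w\<^sup>2 / (z - w)) + Re (of_real d / (z - w))))"
    unfolding hor_X_def sc plus_complex.sel minus_complex.sel Re_sum cR cR1 ..
  also have "\<dots> = Re (G1 z) + (\<Sum>w\<in>W. (2 * B * r * Re w) * ln (norm (z - w)))"
    unfolding G1_def sc plus_complex.sel minus_complex.sel Re_sum sum.distrib sum_subtractf
    by (simp add: algebra_simps sum_distrib_left)
  finally show ?thesis .
qed

lemma Im_hor_X: "Im (hor_X z) = Re (G2 z) + (\<Sum>w\<in>W. (2 * B * r * Im w) * ln (norm (z - w)))"
proof -
  have cI: "Im (of_real s / cnj x) = - Im (of_real s / x)" for s x
  proof -
    have "of_real s / cnj x = cnj (of_real s / x)" by simp
    then show ?thesis by (simp only: cnj.sel)
  qed
  have cI1: "Im (1 / cnj x) = - Im (1 / x)" for x using cI[of 1 x] by simp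
  have sc: "Im (of_real s * x) = s * Im x" for s x by simp
  have sc2: "Re (- \<i> * of_real s * x) = s * Im x" for s x by simp
  have "Im (hor_X z) = B * (Im z + - Im (1 / z) + (\<Sum>w\<in>W. 2 * r * ln (norm (z - w)) * Im w -
      Im (of_real d * w\<^sup>2 / (z - w)) + - Im (of_real d / (z - w))))"
    unfolding hor_X_def sc plus_complex.sel minus_complex.sel Im_sum cI cI1 ..
  also have "\<dots> = Re (G2 z) + (\<Sum>w\<in>W. (2 * B * r * Im w) * ln (norm (z - w)))"
    unfolding G2_def sc2 plus_complex.sel minus_complex.sel Im_sum sum.distrib sum_subtractf sum_negf
    by (simp add: algebra_simps sum_distrib_left)
  finally show ?thesis .
qed

lemma ht_X_eq: "ht_X z = Re (G3 z) + A * ln (norm z)"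
proof -
  have sc: "Re (of_real s * x) = s * Re x" for s x by simp
  have h: "Re (of_nat n / 2) = real n / 2" by simp
  show ?thesis unfolding ht_X_def G3_def sc plus_complex.sel Re_sum h by simp
qed

lemma G_deriv:
  assumes "z \<in> - P"
  shows "(G1 has_field_derivative (of_real B * (1 - 1 / z\<^sup>2 +
      (\<Sum>w\<in>W. - of_real d / (z - w)\<^sup>2 + of_real d * w\<^sup>2 / (z - w)\<^sup>2)))) (at z)"
    and "(G2 has_field_derivative (- \<i> * of_real B * (1 + 1 / z\<^sup>2 -
      (\<Sum>w\<in>W. - of_real d / (z - w)\<^sup>2 - of_real d * w\<^sup>2 / (z - w)\<^sup>2)))) (at z)"
    and "(G3 has_field_derivative (- of_real (2 * B * d) * (\<Sum>w\<in>W. w / (z - w)\<^sup>2))) (at z)"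
proof -
  have z: "z \<noteq> 0" "\<And>w. w \<in> W \<Longrightarrow> z - w \<noteq> 0" using assms by (auto simp: P_def)
  have c: "((\<lambda>z. k / (z - w)) has_field_derivative - k / (z - w)\<^sup>2) (at z)" if "w \<in> W" for k w
    using z(2)[OF that] by (auto intro!: derivative_eq_intros simp: power2_eq_square)
  have i: "((\<lambda>z. 1 / z) has_field_derivative - 1 / z\<^sup>2) (at z)"
    using z(1) by (auto intro!: derivative_eq_intros simp: power2_eq_square)
  have "((\<lambda>z. of_real d / (z - w) - of_real d * w\<^sup>2 / (z - w)) has_field_derivative
      - of_real d / (z - w)\<^sup>2 - - (of_real d * w\<^sup>2) / (z - w)\<^sup>2) (at z)" if "w \<in> W" for w
    by (intro DERIV_diff c that)
  then have s1: "((\<lambda>z. \<Sum>w\<in>W. of_real d / (z - w) - of_real d * w\<^sup>2 / (z - w)) has_field_derivative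
      (\<Sum>w\<in>W. - of_real d / (z - w)\<^sup>2 - - (of_real d * w\<^sup>2) / (z - w)\<^sup>2)) (at z)"
    by (rule DERIV_sum)
  have "((\<lambda>z. of_real d / (z - w) + of_real d * w\<^sup>2 / (z - w)) has_field_derivative
      - of_real d / (z - w)\<^sup>2 + - (of_real d * w\<^sup>2) / (z - w)\<^sup>2) (at z)" if "w \<in> W" for w
    by (intro DERIV_add c that)
  then have s2: "((\<lambda>z. \<Sum>w\<in>W. of_real d / (z - w) + of_real d * w\<^sup>2 / (z - w)) has_field_derivative
      (\<Sum>w\<in>W. - of_real d / (z - w)\<^sup>2 + - (of_real d * w\<^sup>2) / (z - w)\<^sup>2)) (at z)"
    by (rule DERIV_sum)
  have s3: "((\<lambda>z. \<Sum>w\<in>W. w / (z - w)) has_field_derivative (\<Sum>w\<in>W. - w / (z - w)\<^sup>2)) (at z)"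
    by (rule DERIV_sum) (rule c)
  have "(G1 has_field_derivative (of_real B * (1 + - 1 / z\<^sup>2 +
      (\<Sum>w\<in>W. - of_real d / (z - w)\<^sup>2 - - (of_real d * w\<^sup>2) / (z - w)\<^sup>2)))) (at z)"
    unfolding G1_def[abs_def] by (intro DERIV_cmult DERIV_add DERIV_ident i s1)
  then show "(G1 has_field_derivative (of_real B * (1 - 1 / z\<^sup>2 +
      (\<Sum>w\<in>W. - of_real d / (z - w)\<^sup>2 + of_real d * w\<^sup>2 / (z - w)\<^sup>2)))) (at z)" by simp
  have "(G2 has_field_derivative (- \<i> * of_real B * (1 - - 1 / z\<^sup>2 -
      (\<Sum>w\<in>W. - of_real d / (z - w)\<^sup>2 + - (of_real d * w\<^sup>2) / (z - w)\<^sup>2)))) (at z)"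
    unfolding G2_def[abs_def] by (intro DERIV_cmult DERIV_diff DERIV_ident i s2)
  then show "(G2 has_field_derivative (- \<i> * of_real B * (1 + 1 / z\<^sup>2 -
      (\<Sum>w\<in>W. - of_real d / (z - w)\<^sup>2 - of_real d * w\<^sup>2 / (z - w)\<^sup>2)))) (at z)" by simp
  have "(G3 has_field_derivative (of_real (2 * B * d) * (0 + (\<Sum>w\<in>W. - w / (z - w)\<^sup>2)))) (at z)"
    unfolding G3_def[abs_def] by (intro DERIV_cmult DERIV_add DERIV_const s3)
  then show "(G3 has_field_derivative (- of_real (2 * B * d) * (\<Sum>w\<in>W. w / (z - w)\<^sup>2))) (at z)"
    by (simp add: sum_negf)
qed

lemma deriv_X:
  assumes z: "z \<in> - P"
  shows "(X has_derivative (\<lambda>v. \<chi> i. Re (\<phi> i z * v))) (at z)"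
proof -
  have zW: "z \<notin> W" and z0: "z \<noteq> 0" "z ^ n \<noteq> 1" using z by (auto simp: P_def)
  \<comment> \<open>The residue 2 B r Re w is the sum of the residues B r w of B \<open>F1\<close>
    and B r \<open>cnj w\<close> of B \<open>F2\<close>, so the derivative of the first coordinate
    is governed by B (\<open>F1\<close> + \<open>F2\<close>).\<close>
  have "of_real B * (1 - 1 / z\<^sup>2 + (\<Sum>w\<in>W. - of_real d / (z - w)\<^sup>2 + of_real d * w\<^sup>2 / (z - w)\<^sup>2)) +
      (\<Sum>w\<in>W. of_real (2 * B * r * Re w) / (z - w)) = of_real B * (F1 z + F2 z)"
  proof -
    have t: "of_real (2 * B * r * Re w) / (z - w) = of_real B * (of_real r * w / (z - w) + of_real r * cnj w / (z - w))" for w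
    proof -
      have "of_real (2 * B * r * Re w) = of_real B * (of_real r * (w + cnj w))"
        unfolding complex_add_cnj by simp
      then show ?thesis by (simp add: distrib_left add_divide_distrib)
    qed
    have S: "(\<Sum>w\<in>W. of_real (2 * B * r * Re w) / (z - w)) =
        of_real B * ((\<Sum>w\<in>W. of_real r * w / (z - w)) + (\<Sum>w\<in>W. of_real r * cnj w / (z - w)))"
      by (simp only: t sum_distrib_left[symmetric] sum.distrib)
    show ?thesis
      unfolding F1_def F2_def S by (simp add: sum.distrib sum_subtractf sum_negf algebra_simps)
  qed
  also have "\<dots> = \<phi> 1 z"
    unfolding distrib_left F1_eq[OF z] F2_eq[OF z] by (simp add: \<phi>_def algebra_simps diff_divide_distrib)
  finally have 1: "((\<lambda>z. Re (hor_X z)) has_derivative (\<lambda>v. Re (\<phi> 1 z * v))) (at z)"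
    using log_sum_has_derivative[OF finite_W zW G_deriv(1)[OF z], of "\<lambda>w. 2 * B * r * Re w"]
    unfolding Re_hor_X by (simp only:)
  have "- \<i> * of_real B * (1 + 1 / z\<^sup>2 - (\<Sum>w\<in>W. - of_real d / (z - w)\<^sup>2 - of_real d * w\<^sup>2 / (z - w)\<^sup>2)) +
      (\<Sum>w\<in>W. of_real (2 * B * r * Im w) / (z - w)) = - \<i> * (of_real B * (F1 z - F2 z))"
  proof -
    have t: "of_real (2 * B * r * Im w) / (z - w) = - \<i> * (of_real B * (of_real r * w / (z - w) - of_real r * cnj w / (z - w)))" for w
    proof -
      have "of_real (2 * B * r * Im w) = - \<i> * (of_real B * (of_real r * (w - cnj w)))"
        unfolding complex_diff_cnj by (simp add: algebra_simps)
      then show ?thesis by (simp add: right_diff_distrib diff_divide_distrib)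
    qed
    have S: "(\<Sum>w\<in>W. of_real (2 * B * r * Im w) / (z - w)) =
        - \<i> * (of_real B * ((\<Sum>w\<in>W. of_real r * w / (z - w)) - (\<Sum>w\<in>W. of_real r * cnj w / (z - w))))"
      by (simp only: t sum_distrib_left[symmetric] sum_subtractf)
    show ?thesis
      unfolding F1_def F2_def S by (simp add: sum.distrib sum_subtractf sum_negf algebra_simps)
  qed
  also have "\<dots> = \<phi> 2 z"
    unfolding right_diff_distrib F1_eq[OF z] F2_eq[OF z] by (simp add: \<phi>_def algebra_simps add_divide_distrib)
  finally have 2: "((\<lambda>z. Im (hor_X z)) has_derivative (\<lambda>v. Re (\<phi> 2 z * v))) (at z)"
    using log_sum_has_derivative[OF finite_W zW G_deriv(2)[OF z], of "\<lambda>w. 2 * B * r * Im w"]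
    unfolding Im_hor_X by (simp only:)
  have "- of_real (2 * B * d) * (\<Sum>w\<in>W. w / (z - w)\<^sup>2) + (\<Sum>w\<in>{0}. of_real A / (z - w)) = \<phi> 3 z"
  proof -
    define t where "t = z ^ n"
    have t: "t - 1 \<noteq> 0" "z * z ^ (n - 1) = t" using z0 n0 by (auto simp: t_def power_eq_if)
    have zn: "z ^ (n - 1) = t / z" using t(2) z0 by (simp add: field_simps)
    define a b :: complex where "a = of_real \<alpha>" and "b = of_real A"
    have a0: "a \<noteq> 0" using \<alpha> by (simp add: a_def)
    have Bd: "of_real (2 * B * d) * (of_nat n)\<^sup>2 = b / a * (1 - a)\<^sup>2"
    proof -
      have "2 * B * d * (real n)\<^sup>2 = A / \<alpha> * (1 - \<alpha>)\<^sup>2"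
        unfolding B2 d_def using n by (simp add: power_divide)
      then have "complex_of_real (2 * B * d * (real n)\<^sup>2) = complex_of_real (A / \<alpha> * (1 - \<alpha>)\<^sup>2)" by (rule arg_cong)
      then show ?thesis by (simp add: a_def b_def)
    qed
    have "- of_real (2 * B * d) * (\<Sum>w\<in>W. w / (z - w)\<^sup>2) = - (of_real (2 * B * d) * (of_nat n)\<^sup>2) * (t / z) / (t - 1)\<^sup>2"
      unfolding sum_root_div_square[OF n0 z0(2)] zn unfolding t_def by simp
    also have "\<dots> = - (b / a * (1 - a)\<^sup>2) * (t / z) / (t - 1)\<^sup>2" unfolding Bd ..
    finally have 1: "- of_real (2 * B * d) * (\<Sum>w\<in>W. w / (z - w)\<^sup>2) = - (b / a * (1 - a)\<^sup>2) * (t / z) / (t - 1)\<^sup>2" .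
    have 2: "\<phi> 3 z = - (b / a) / (z * (t - 1))\<^sup>2 * (z * (t - a)) * (1 - a * t)"
      by (simp add: \<phi>_def wt_def p_def q_def a_def b_def t_def)
    have 3: "(\<Sum>w\<in>{0}. of_real A / (z - w)) = b / z" by (simp add: b_def)
    show ?thesis unfolding 1 2 3 using z0(1) t(1) a0
      by (simp add: divide_simps) (simp add: power2_eq_square algebra_simps)
  qed
  then have 3: "(ht_X has_derivative (\<lambda>v. Re (\<phi> 3 z * v))) (at z)"
    using log_sum_has_derivative[OF _ _ G_deriv(3)[OF z], of "{0}" "\<lambda>w. A"] z0
    unfolding ht_X_eq[abs_def] by simp
  have "(X has_derivative (\<lambda>v. vector [Re (\<phi> 1 z * v), Re (\<phi> 2 z * v), Re (\<phi> 3 z * v)])) (at z)"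
    unfolding X_def[abs_def] by (rule has_derivative_vector_3[OF 1 2 3]) simp
  moreover have "vector [Re (\<phi> 1 z * v), Re (\<phi> 2 z * v), Re (\<phi> 3 z * v)] = (\<chi> i. Re (\<phi> i z * v))" for v
    by (simp add: vec_eq_iff forall_3)
  ultimately show ?thesis by (simp only:)
qed

lemma no_common_zero: "p z \<noteq> 0 \<or> q z \<noteq> 0"
proof (rule ccontr)
  assume "\<not> ?thesis"
  then have pq: "z * (z ^ n - of_real \<alpha>) = 0" "1 - of_real \<alpha> * z ^ n = 0" by (auto simp: p_def q_def)
  then have "z \<noteq> 0" using n0 by (auto simp: power_0_left)
  then have "z ^ n = of_real \<alpha>" using pq by simp
  then have "complex_of_real (1 - \<alpha> * \<alpha>) = 0" using pq by simp
  then have "1 - \<alpha> * \<alpha> = 0" by (simp only: of_real_eq_0_iff)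
  moreover have "\<alpha> * \<alpha> < 1 * 1" using \<alpha> by (intro mult_strict_mono) auto
  ultimately show False by simp
qed

lemma wt_nonzero: "z \<in> - P \<Longrightarrow> wt z \<noteq> 0"
  using A \<alpha> by (simp add: wt_def not_in_P)

sublocale weierstrass "- P" \<phi> X
proof
  show "open (- P)" by (intro open_Compl finite_imp_closed finite_P)
  show "\<phi> i holomorphic_on - P" for i
  proof -
    have nz: "z * (z ^ n - 1) \<noteq> 0" if "z \<in> - P" for z using that by (simp add: not_in_P)
    have "wt holomorphic_on - P" unfolding wt_def[abs_def]
      by (intro holomorphic_intros) (use nz in auto)
    moreover have "p holomorphic_on - P" "q holomorphic_on - P"
      unfolding p_def[abs_def] q_def[abs_def] by (intro holomorphic_intros)+
    ultimately show ?thesis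
      unfolding \<phi>_def by (cases "i = 1"; cases "i = 2") (auto intro!: holomorphic_intros)
  qed
  show "(X has_derivative (\<lambda>v. \<chi> i. Re (\<phi> i z * v))) (at z)" if "z \<in> - P" for z
    by (rule deriv_X[OF that])
  show "(\<Sum>i\<in>UNIV. (\<phi> i z)\<^sup>2) = 0" for z
    by (simp add: sum_3 \<phi>_def power2_eq_square algebra_simps add_divide_distrib diff_divide_distrib)
  show "\<exists>i. \<phi> i z \<noteq> 0" if "z \<in> - P" for z
  proof (rule ccontr)
    assume "\<not> ?thesis"
    then have "\<phi> 1 z = 0" "\<phi> 2 z = 0" by auto
    then have "(q z)\<^sup>2 = (p z)\<^sup>2" "(q z)\<^sup>2 + (p z)\<^sup>2 = 0" using wt_nonzero[OF that] by (simp_all add: \<phi>_def)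
    then show False using no_common_zero[of z] by auto
  qed
qed

text \<open>Inverse stereographic projection of g = p / q in homogeneous form. Since
  \<open>p\<close> and \<open>q\<close> have no common zero it is continuous on the whole plane,
  punctures included, and its values there are the limit normals.\<close>

definition N :: "complex \<Rightarrow> real^3" where
  "N z = (1 / ((norm (p z))\<^sup>2 + (norm (q z))\<^sup>2)) *\<^sub>R
     vector [2 * Re (p z * cnj (q z)), 2 * Im (p z * cnj (q z)), (norm (p z))\<^sup>2 - (norm (q z))\<^sup>2]"

lemma pq_pos: "(norm (p z))\<^sup>2 + (norm (q z))\<^sup>2 > 0"
  using no_common_zero[of z] by (auto intro: add_pos_nonneg add_nonneg_pos)

lemma norm_N: "norm (N z) = 1"
proof -
  let ?s = "(norm (p z))\<^sup>2 + (norm (q z))\<^sup>2"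
  let ?v = "vector [2 * Re (p z * cnj (q z)), 2 * Im (p z * cnj (q z)), (norm (p z))\<^sup>2 - (norm (q z))\<^sup>2] :: real^3"
  have "(norm ?v)\<^sup>2 = 4 * ((Re (p z * cnj (q z)))\<^sup>2 + (Im (p z * cnj (q z)))\<^sup>2) + ((norm (p z))\<^sup>2 - (norm (q z))\<^sup>2)\<^sup>2"
    unfolding power2_norm_eq_inner[of ?v] by (simp add: inner_vec_def sum_3 power2_eq_square algebra_simps)
  also have "(Re (p z * cnj (q z)))\<^sup>2 + (Im (p z * cnj (q z)))\<^sup>2 = (norm (p z) * norm (q z))\<^sup>2"
    unfolding cmod_power2[symmetric] by (simp add: norm_mult)
  also have "4 * (norm (p z) * norm (q z))\<^sup>2 + ((norm (p z))\<^sup>2 - (norm (q z))\<^sup>2)\<^sup>2 = ?s\<^sup>2"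
    by (simp add: power2_eq_square algebra_simps)
  finally have "(norm ?v)\<^sup>2 = ?s\<^sup>2" .
  then have nv: "norm ?v = ?s" by (rule power2_eq_imp_eq[OF _ norm_ge_zero less_imp_le[OF pq_pos]])
  have "\<bar>1 / s\<bar> * s = 1" if "s > 0" for s :: real using that by simp
  from this[OF pq_pos] show ?thesis unfolding N_def norm_scaleR nv .
qed

lemma continuous_N: "isCont N z"
proof -
  have "isCont p z" "isCont q z" unfolding p_def[abs_def] q_def[abs_def] by (intro continuous_intros)+
  then have "\<forall>i. isCont (\<lambda>z. N z $ i) z"
    using pq_pos[of z] unfolding N_def forall_3
    by (auto intro!: continuous_intros)
  then show ?thesis
    unfolding isCont_def by (intro vec_tendstoI) auto
qed

lemma N_orthogonal: "(\<Sum>i\<in>UNIV. \<phi> i z * of_real (N z $ i)) = 0"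
proof -
  let ?s = "(norm (p z))\<^sup>2 + (norm (q z))\<^sup>2"
  define P Q P' Q' where "P = p z" and "Q = q z" and "P' = cnj (p z)" and "Q' = cnj (q z)"
  have re: "complex_of_real (2 * Re (p z * cnj (q z))) = P * Q' + P' * Q"
  proof -
    have "P * Q' + P' * Q = p z * cnj (q z) + cnj (p z * cnj (q z))"
      by (simp add: P_def Q_def P'_def Q'_def mult.commute)
    then show ?thesis unfolding complex_add_cnj by (rule sym)
  qed
  have im: "complex_of_real (2 * Im (p z * cnj (q z))) = - \<i> * (P * Q' - P' * Q)"
  proof -
    have "P * Q' - P' * Q = p z * cnj (q z) - cnj (p z * cnj (q z))"
      by (simp add: P_def Q_def P'_def Q'_def mult.commute)
    then have "- \<i> * (P * Q' - P' * Q) = - \<i> * (of_real (2 * Im (p z * cnj (q z))) * \<i>)"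
      unfolding complex_diff_cnj by (rule arg_cong)
    moreover have "- \<i> * (x * \<i>) = x" for x :: complex by (simp add: complex_eq_iff)
    ultimately show ?thesis by (simp only:)
  qed
  have nn: "complex_of_real ((norm (p z))\<^sup>2 - (norm (q z))\<^sup>2) = P * P' - Q * Q'"
    by (simp only: of_real_diff complex_norm_square P_def Q_def P'_def Q'_def)
  have e: "\<phi> i z * of_real (N z $ i) = of_real (1 / ?s) * (\<phi> i z * of_real (vector [2 * Re (p z * cnj (q z)),
      2 * Im (p z * cnj (q z)), (norm (p z))\<^sup>2 - (norm (q z))\<^sup>2] $ i))" for i
    by (simp add: N_def)
  have "(\<Sum>i\<in>UNIV. \<phi> i z * of_real (N z $ i)) = of_real (1 / ?s) * (\<phi> 1 z * (P * Q' + P' * Q) +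
      \<phi> 2 z * (- \<i> * (P * Q' - P' * Q)) + \<phi> 3 z * (P * P' - Q * Q'))"
    unfolding sum_3 e vector_3 re im nn by (simp only: distrib_left)
  also have "\<phi> 1 z * (P * Q' + P' * Q) + \<phi> 2 z * (- \<i> * (P * Q' - P' * Q)) + \<phi> 3 z * (P * P' - Q * Q') = 0"
    unfolding \<phi>_def P_def[symmetric] Q_def[symmetric]
    by (simp add: power2_eq_square algebra_simps add_divide_distrib diff_divide_distrib)
  finally show ?thesis by simp
qed

end

section \<open>Change of parameter and finite total curvature\<close>

lemma conformal_at_comp:
  assumes "weierstrass \<Omega> \<phi> X" "\<kappa> \<zeta> \<in> \<Omega>"
    and \<kappa>: "(\<kappa> has_derivative K) (at \<zeta>)" "\<And>v. K (\<i> * v) = \<i> * K v \<or> K (\<i> * v) = - (\<i> * K v)" "\<And>v. v \<noteq> 0 \<Longrightarrow> K v \<noteq> 0"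
  shows "conformal_at (X \<circ> \<kappa>) \<zeta>"
proof -
  interpret weierstrass \<Omega> \<phi> X by fact
  define D where "D v = (\<chi> i. Re (\<phi> i (\<kappa> \<zeta>) * v))" for v
  have d: "((X \<circ> \<kappa>) has_derivative (D \<circ> K)) (at \<zeta>)"
    by (rule diff_chain_at[OF \<kappa>(1)]) (use deriv_X[OF assms(2)] in \<open>simp add: D_def[abs_def]\<close>)
  have Dm: "D (- v) = - D v" for v by (simp add: D_def vec_eq_iff)
  have n: "norm (D v) = sqrt (conformal_factor (\<kappa> \<zeta>)) * norm v" "D (\<i> * v) \<bullet> D v = 0" for v
    using conformal_derivative[OF assms(2), of v] by (simp_all add: D_def)
  have "norm (D (K (\<i> * v))) = norm (D (K v))" for v
    using \<kappa>(2)[of v] by (auto simp: n(1) norm_mult)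
  moreover have "D (K (\<i> * v)) \<bullet> D (K v) = 0" for v
    using \<kappa>(2)[of v] n(2)[of "K v"] by (auto simp: Dm)
  moreover have "D (K v) \<noteq> 0" if "v \<noteq> 0" for v
  proof -
    have "norm (D (K v)) > 0"
      using \<kappa>(3)[OF that] conformal_factor_pos[OF assms(2)] by (simp add: n(1))
    then show ?thesis by auto
  qed
  ultimately show ?thesis
    unfolding conformal_at_def using d by (intro exI[of _ "D \<circ> K"]) auto
qed

context jmv
begin

text \<open>The density is the pull-back of the spherical area under the Gauss map,
  \<open>4 (D / s)^2\<close>, with D the norm of the Wronskian of \<open>p\<close> and
  \<open>q\<close> and s the sum of their squared norms; by the parallelogram law the conformal
  factor is \<open>(norm wt)^2 s^2 / 4\<close>, so the weight cancels. The quotient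
  \<open>(1 + (norm z)^2) D / s\<close> is bounded by continuity on a disc, and by comparing degrees
  outside it.\<close>

lemma total_curvature_bound:
  obtains C where "\<And>z. z \<in> - P \<Longrightarrow> \<bar>gauss_curvature X z\<bar> * area_density X z \<le> C / (1 + (norm z)\<^sup>2)\<^sup>2"
proof -
  define p' where "p' z = of_nat (Suc n) * z ^ n - of_real \<alpha>" for z :: complex
  define q' where "q' z = - of_real \<alpha> * (of_nat n * z ^ (n - 1))" for z :: complex
  define s where "s z = (norm (p z))\<^sup>2 + (norm (q z))\<^sup>2" for z
  define D where "D z = norm (p z * q' z - q z * p' z)" for z
  have zz: "z * z ^ (n - 1) = z ^ n" for z :: complex using n0 by (simp add: power_eq_if)
  have s_pos: "s z > 0" for z using pq_pos by (simp add: s_def)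
  have dp: "(p has_field_derivative p' z) (at z)" for z
  proof -
    have "(p has_field_derivative (1 * (z ^ n - of_real \<alpha>) + (of_nat n * z ^ (n - 1)) * z)) (at z)"
      unfolding p_def[abs_def] by (auto intro!: derivative_eq_intros)
    moreover have "1 * (z ^ n - of_real \<alpha>) + (of_nat n * z ^ (n - 1)) * z = p' z"
      using zz[of z] by (simp add: p'_def algebra_simps)
    ultimately show ?thesis by simp
  qed
  have dq: "(q has_field_derivative q' z) (at z)" for z
    unfolding q_def[abs_def] q'_def by (auto intro!: derivative_eq_intros)
  have density: "\<bar>gauss_curvature X z\<bar> * area_density X z = 4 * (D z / s z)\<^sup>2" if z: "z \<in> - P" for z
  proof -
    have "wt holomorphic_on - P"
      unfolding wt_def[abs_def] by (intro holomorphic_intros) (auto simp: not_in_P)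
    then obtain w' where w': "(wt has_field_derivative w') (at z)"
      using holomorphic_derivI[OF _ open_domain z] by blast
    have "(\<phi> 1 has_field_derivative (w' * ((q z)\<^sup>2 - (p z)\<^sup>2) / 2 + wt z * (q z * q' z - p z * p' z))) (at z)"
      unfolding \<phi>_def using w' dp[of z] dq[of z]
      by (auto intro!: derivative_eq_intros simp: field_simps power2_eq_square)
    then have d1: "deriv (\<phi> 1) z = w' * ((q z)\<^sup>2 - (p z)\<^sup>2) / 2 + wt z * (q z * q' z - p z * p' z)"
      by (rule DERIV_imp_deriv)
    have "(\<phi> 2 has_field_derivative (\<i> * w' * ((q z)\<^sup>2 + (p z)\<^sup>2) / 2 + \<i> * wt z * (q z * q' z + p z * p' z))) (at z)"
      unfolding \<phi>_def using w' dp[of z] dq[of z]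
      by (auto intro!: derivative_eq_intros simp: field_simps power2_eq_square)
    then have d2: "deriv (\<phi> 2) z = \<i> * w' * ((q z)\<^sup>2 + (p z)\<^sup>2) / 2 + \<i> * wt z * (q z * q' z + p z * p' z)"
      by (rule DERIV_imp_deriv)
    have "(\<phi> 3 has_field_derivative (w' * p z * q z + wt z * (p' z * q z + p z * q' z))) (at z)"
      unfolding \<phi>_def using w' dp[of z] dq[of z]
      by (auto intro!: derivative_eq_intros simp: field_simps)
    then have d3: "deriv (\<phi> 3) z = w' * p z * q z + wt z * (p' z * q z + p z * q' z)"
      by (rule DERIV_imp_deriv)
    define a b a' b' k k' x y where "a = p z" and "b = q z" and "a' = cnj (p z)" and "b' = cnj (q z)"
      and "k = wt z" and "k' = w'" and "x = p' z" and "y = q' z"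
    have re: "complex_of_real (2 * Re (p z * cnj (q z))) = a * b' + a' * b"
    proof -
      have "a * b' + a' * b = p z * cnj (q z) + cnj (p z * cnj (q z))"
        by (simp add: a_def b_def a'_def b'_def mult.commute)
      then show ?thesis unfolding complex_add_cnj by (rule sym)
    qed
    have im: "complex_of_real (2 * Im (p z * cnj (q z))) = - \<i> * (a * b' - a' * b)"
    proof -
      have "a * b' - a' * b = p z * cnj (q z) - cnj (p z * cnj (q z))"
        by (simp add: a_def b_def a'_def b'_def mult.commute)
      then have "- \<i> * (a * b' - a' * b) = - \<i> * (of_real (2 * Im (p z * cnj (q z))) * \<i>)"
        unfolding complex_diff_cnj by (rule arg_cong)
      moreover have "- \<i> * (x * \<i>) = x" for x :: complex by (simp add: complex_eq_iff)
      ultimately show ?thesis by (simp only:)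
    qed
    have nn: "complex_of_real ((norm (p z))\<^sup>2 - (norm (q z))\<^sup>2) = a * a' - b * b'"
      by (simp only: of_real_diff complex_norm_square a_def b_def a'_def b'_def)
    have ss: "complex_of_real (s z) = a * a' + b * b'"
      unfolding s_def by (simp only: of_real_add complex_norm_square a_def b_def a'_def b'_def)
    have e: "deriv (\<phi> i) z * of_real (N z $ i) = of_real (1 / s z) * (deriv (\<phi> i) z * of_real (vector [2 * Re (p z * cnj (q z)),
        2 * Im (p z * cnj (q z)), (norm (p z))\<^sup>2 - (norm (q z))\<^sup>2] $ i))" for i
      by (simp add: N_def s_def)
    have "(\<Sum>i\<in>UNIV. deriv (\<phi> i) z * of_real (N z $ i)) = of_real (1 / s z) * (deriv (\<phi> 1) z * (a * b' + a' * b) +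
        deriv (\<phi> 2) z * (- \<i> * (a * b' - a' * b)) + deriv (\<phi> 3) z * (a * a' - b * b'))"
      unfolding sum_3 e vector_3 re im nn by (simp only: distrib_left)
    \<comment> \<open>The derivative of the weight drops out because the forms themselves are
      orthogonal to the normal; what is left is the Wronskian.\<close>
    also have "deriv (\<phi> 1) z * (a * b' + a' * b) + deriv (\<phi> 2) z * (- \<i> * (a * b' - a' * b)) + deriv (\<phi> 3) z * (a * a' - b * b')
        = k * (a * a' + b * b') * (a * y - b * x)"
      unfolding d1 d2 d3 a_def[symmetric] b_def[symmetric] k_def[symmetric] k'_def[symmetric] x_def[symmetric] y_def[symmetric]
      by (simp add: power2_eq_square algebra_simps add_divide_distrib diff_divide_distrib)
    also have "a * a' + b * b' = of_real (s z)" by (rule ss[symmetric])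
    finally have "(\<Sum>i\<in>UNIV. deriv (\<phi> i) z * of_real (N z $ i)) = k * (a * y - b * x)"
      using s_pos[of z] by simp
    then have num: "norm (\<Sum>i\<in>UNIV. deriv (\<phi> i) z * of_real (N z $ i)) = norm (wt z) * D z"
      by (simp only: norm_mult D_def a_def b_def k_def x_def y_def)
    have par: "(norm (u - v))\<^sup>2 + (norm (u + v))\<^sup>2 = 2 * (norm u)\<^sup>2 + 2 * (norm v)\<^sup>2" for u v :: complex
      unfolding cmod_power2 by (simp add: power2_eq_square algebra_simps)
    have "conformal_factor z = ((norm (wt z))\<^sup>2 * (norm ((q z)\<^sup>2 - (p z)\<^sup>2))\<^sup>2 / 4 +
        (norm (wt z))\<^sup>2 * (norm ((q z)\<^sup>2 + (p z)\<^sup>2))\<^sup>2 / 4 + (norm (wt z))\<^sup>2 * (norm (p z))\<^sup>2 * (norm (q z))\<^sup>2) / 2"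
      unfolding conformal_factor_def sum_3 \<phi>_def by (simp add: norm_mult norm_divide power_mult_distrib power_divide)
    also have "\<dots> = (norm (wt z))\<^sup>2 * ((norm ((q z)\<^sup>2 - (p z)\<^sup>2))\<^sup>2 + (norm ((q z)\<^sup>2 + (p z)\<^sup>2))\<^sup>2 +
        4 * (norm (p z))\<^sup>2 * (norm (q z))\<^sup>2) / 8" by (simp add: algebra_simps add_divide_distrib)
    also have "\<dots> = (norm (wt z))\<^sup>2 * (s z)\<^sup>2 / 4"
      unfolding par s_def by (simp add: norm_mult power2_eq_square algebra_simps add_divide_distrib)
    finally have cf: "conformal_factor z = (norm (wt z))\<^sup>2 * (s z)\<^sup>2 / 4" .
    have orth: "N z \<bullet> partial_u X z = 0" "N z \<bullet> partial_v X z = 0"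
      using N_orthogonal[of z]
      by (simp_all add: partials[OF z] inner_vec_def complex_eq_iff sum_negf mult.commute)
    have w0: "norm (wt z) \<noteq> 0" using wt_nonzero[OF z] by simp
    show ?thesis
      unfolding total_curvature_density[OF z norm_N orth] num cf
      using w0 by (simp add: power_mult_distrib power_divide)
  qed
  have cont: "continuous_on UNIV (\<lambda>z. (1 + (norm z)\<^sup>2) * D z / s z)"
    unfolding D_def s_def p_def q_def p'_def q'_def
    using pq_pos unfolding p_def q_def by (intro continuous_intros) (metis less_irrefl)
  have "compact ((\<lambda>z. (1 + (norm z)\<^sup>2) * D z / s z) ` cball 0 2)"
    by (intro compact_continuous_image continuous_on_subset[OF cont]) auto
  then have "bounded ((\<lambda>z. (1 + (norm z)\<^sup>2) * D z / s z) ` cball 0 2)" by (rule compact_imp_bounded)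
  then obtain b where "\<forall>x\<in>(\<lambda>z. (1 + (norm z)\<^sup>2) * D z / s z) ` cball 0 2. norm x \<le> b"
    unfolding bounded_iff by blast
  then have b: "norm ((1 + (norm z)\<^sup>2) * D z / s z) \<le> b" if "z \<in> cball 0 2" for z
    using that by blast
  \<comment> \<open>D is at most 4 (n + 1) \<open>t^2\<close> with t = \<open>norm z ^ n\<close>,
    while \<open>(norm z)^2 t^2\<close> is at most 4 s; together with \<open>1 + (norm z)^2\<close>
    at most \<open>2 (norm z)^2\<close> this gives 2 * 4 * 4 = 32.\<close>
  have large: "(1 + (norm z)\<^sup>2) * D z \<le> 32 * (real n + 1) * s z" if z: "norm z \<ge> 2" for z
  proof -
    define t where "t = norm z ^ n"
    have "norm z ^ 1 \<le> norm z ^ n" using n z by (intro power_increasing) auto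
    then have t: "t \<ge> 2" using z by (simp add: t_def)
    have p: "norm z * (t / 2) \<le> norm (p z)"
    proof -
      have "t - \<alpha> \<le> norm (z ^ n - of_real \<alpha>)"
        using norm_triangle_ineq2[of "z ^ n" "of_real \<alpha>"] \<alpha> by (simp add: t_def norm_power)
      then have "t / 2 \<le> norm (z ^ n - of_real \<alpha>)" using t \<alpha> by linarith
      then show ?thesis unfolding p_def norm_mult by (intro mult_left_mono) auto
    qed
    have "(norm z * (t / 2))\<^sup>2 \<le> (norm (p z))\<^sup>2" using t by (intro power_mono p) auto
    also have "\<dots> \<le> s z" by (simp add: s_def)
    finally have s: "(norm z)\<^sup>2 * t\<^sup>2 \<le> 4 * s z" by (simp add: power_mult_distrib power_divide)
    have nza: "norm (z ^ n - of_real \<alpha>) \<le> 2 * t"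
      using norm_triangle_ineq4[of "z ^ n" "of_real \<alpha>"] \<alpha> t by (simp add: t_def norm_power)
    have 1: "norm (p z * q' z) \<le> 2 * real n * t\<^sup>2"
    proof -
      have "p z * q' z = (z ^ n - of_real \<alpha>) * (- of_real \<alpha> * (of_nat n * z ^ n))"
        unfolding p_def q'_def zz[symmetric] by (simp add: algebra_simps)
      then have "norm (p z * q' z) = norm (z ^ n - of_real \<alpha>) * (\<alpha> * (real n * t))"
        using \<alpha> by (simp add: norm_mult norm_power t_def)
      also have "\<dots> \<le> (2 * t) * (1 * (real n * t))"
        using nza \<alpha> t by (intro mult_mono) auto
      finally show ?thesis by (simp add: power2_eq_square mult_ac)
    qed
    have 2: "norm (q z * p' z) \<le> (2 * t) * ((real n + 2) * t)"
    proof -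
      have "norm (q z) \<le> 1 + \<alpha> * t"
        unfolding q_def using norm_triangle_ineq4[of 1 "of_real \<alpha> * z ^ n"] \<alpha> by (simp add: norm_mult norm_power t_def)
      also have "\<dots> \<le> 2 * t" using \<alpha> t mult_right_mono[of \<alpha> 1 t] by linarith
      finally have q: "norm (q z) \<le> 2 * t" .
      have "norm (p' z) \<le> norm (of_nat (Suc n) * z ^ n) + norm (complex_of_real \<alpha>)"
        unfolding p'_def by (rule norm_triangle_ineq4)
      also have "norm (of_nat (Suc n) * z ^ n) = (real n + 1) * t"
        unfolding norm_mult norm_power norm_of_nat t_def by simp
      also have "norm (complex_of_real \<alpha>) \<le> t" using \<alpha> t by simp
      finally have "norm (p' z) \<le> (real n + 2) * t" by (simp add: algebra_simps)
      then show ?thesis unfolding norm_mult using q t by (intro mult_mono) auto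
    qed
    have "D z \<le> norm (p z * q' z) + norm (q z * p' z)" unfolding D_def by (rule norm_triangle_ineq4)
    then have D: "D z \<le> 4 * (real n + 1) * t\<^sup>2" using 1 2 by (simp add: power2_eq_square algebra_simps)
    have "1 \<le> (norm z)\<^sup>2" using power_mono[of 1 "norm z" 2] z by simp
    then have "(1 + (norm z)\<^sup>2) * D z \<le> (2 * (norm z)\<^sup>2) * (4 * (real n + 1) * t\<^sup>2)"
      using D by (intro mult_mono) (auto simp: D_def)
    also have "\<dots> = 8 * (real n + 1) * ((norm z)\<^sup>2 * t\<^sup>2)" by simp
    also have "\<dots> \<le> 8 * (real n + 1) * (4 * s z)" using s by (intro mult_left_mono) auto
    finally show ?thesis by (simp add: algebra_simps)
  qed
  define c where "c = max \<bar>b\<bar> (32 * (real n + 1))"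
  have bound: "(1 + (norm z)\<^sup>2) * (D z / s z) \<le> c" for z
  proof (cases "norm z \<le> 2")
    case True
    then have "norm ((1 + (norm z)\<^sup>2) * D z / s z) \<le> b" using b[of z] by simp
    then have "(1 + (norm z)\<^sup>2) * D z / s z \<le> b" unfolding real_norm_def by (rule abs_le_D1)
    then show ?thesis by (simp add: c_def)
  next
    case False
    then have "(1 + (norm z)\<^sup>2) * D z / s z \<le> 32 * (real n + 1)"
      using large[of z] s_pos[of z] by (simp add: divide_le_eq)
    then show ?thesis by (simp add: c_def)
  qed
  show thesis
  proof (rule that[of "4 * c\<^sup>2"])
    fix z assume z: "z \<in> - P"
    have q: "0 < 1 + (norm z)\<^sup>2" by (intro add_pos_nonneg) auto
    have nn: "0 \<le> D z / s z" using s_pos[of z] by (simp add: D_def)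
    have "D z / s z \<le> c / (1 + (norm z)\<^sup>2)"
      using bound[of z] q by (subst pos_le_divide_eq[OF q]) (simp only: mult.commute)
    then have "(D z / s z)\<^sup>2 \<le> (c / (1 + (norm z)\<^sup>2))\<^sup>2" using nn by (rule power_mono)
    then show "\<bar>gauss_curvature X z\<bar> * area_density X z \<le> 4 * c\<^sup>2 / (1 + (norm z)\<^sup>2)\<^sup>2"
      unfolding density[OF z] by (simp add: power_divide)
  qed
qed

subsection \<open>Normal forms at the ends\<close>

text \<open>Regular parts at the puncture 0. \<open>f0\<close> belongs to the second coordinate and
  \<open>g0\<close> to the first, since it is the second that has the pole \<i> B / \<zeta>. The
  roots have norm 1, so ln (norm (\<zeta> - w)) is the real part of Ln (1 - \<zeta> / w),
  holomorphic on the unit disc.\<close>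

definition f0 :: "complex \<Rightarrow> complex" where
  "f0 \<zeta> = - \<i> * of_real B * (\<zeta> - (\<Sum>w\<in>W. of_real d / (\<zeta> - w) + of_real d * w\<^sup>2 / (\<zeta> - w))) +
     (\<Sum>w\<in>W. of_real (2 * B * r * Im w) * Ln (1 - \<zeta> / w))"
definition g0 :: "complex \<Rightarrow> complex" where
  "g0 \<zeta> = of_real B * (\<zeta> + (\<Sum>w\<in>W. of_real d / (\<zeta> - w) - of_real d * w\<^sup>2 / (\<zeta> - w))) +
     (\<Sum>w\<in>W. of_real (2 * B * r * Re w) * Ln (1 - \<zeta> / w))"

lemma disc_avoids_W:
  assumes "norm \<zeta> < 1" "w \<in> W"
  shows "\<zeta> - w \<noteq> 0" "w \<noteq> 0" "1 - \<zeta> / w \<notin> \<real>\<^sub>\<le>\<^sub>0" "ln (norm (\<zeta> - w)) = Re (Ln (1 - \<zeta> / w))"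
proof -
  have nw: "norm w = 1" by (rule root_of_unity_norm[OF assms(2) n0])
  then show w0: "w \<noteq> 0" by auto
  show zw: "\<zeta> - w \<noteq> 0" using assms(1) nw by auto
  have "norm (\<zeta> / w) < 1" using assms(1) nw by (simp add: norm_divide)
  then have "Re (\<zeta> / w) < 1" using complex_Re_le_cmod[of "\<zeta> / w"] by linarith
  then show "1 - \<zeta> / w \<notin> \<real>\<^sub>\<le>\<^sub>0" by (auto simp: complex_nonpos_Reals_iff)
  have e: "1 - \<zeta> / w = - ((\<zeta> - w) / w)" using w0 by (simp add: field_simps)
  then have "norm (1 - \<zeta> / w) = norm (\<zeta> - w)" using nw by (simp only: norm_minus_cancel norm_divide)
  moreover have "1 - \<zeta> / w \<noteq> 0" unfolding e using zw w0 by simp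
  ultimately show "ln (norm (\<zeta> - w)) = Re (Ln (1 - \<zeta> / w))" by simp
qed

lemma holomorphic_0:
  "f0 holomorphic_on ball 0 1" "g0 holomorphic_on ball 0 1" "G3 holomorphic_on ball 0 1"
  unfolding f0_def[abs_def] g0_def[abs_def] G3_def[abs_def]
  using disc_avoids_W by (auto intro!: holomorphic_intros)

lemma normal_form_0:
  assumes "\<zeta> \<noteq> 0" "norm \<zeta> < 1"
  shows "Re (hor_X \<zeta>) = Re (of_real B / \<zeta> + g0 \<zeta>)" "Im (hor_X \<zeta>) = Re (\<i> * of_real B / \<zeta> + f0 \<zeta>)"
proof -
  have ln: "(\<Sum>w\<in>W. b w * ln (norm (\<zeta> - w))) = Re (\<Sum>w\<in>W. of_real (b w) * Ln (1 - \<zeta> / w))" for b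
  proof -
    have "b w * ln (norm (\<zeta> - w)) = Re (of_real (b w) * Ln (1 - \<zeta> / w))" if "w \<in> W" for w
      unfolding disc_avoids_W(4)[OF assms(2) that] by simp
    then show ?thesis unfolding Re_sum by (rule sum.cong[OF refl])
  qed
  show "Re (hor_X \<zeta>) = Re (of_real B / \<zeta> + g0 \<zeta>)"
    unfolding Re_hor_X ln plus_complex.sel(1)[symmetric]
    by (rule arg_cong[of _ _ Re]) (simp add: G1_def g0_def algebra_simps)
  show "Im (hor_X \<zeta>) = Re (\<i> * of_real B / \<zeta> + f0 \<zeta>)"
    unfolding Im_hor_X ln plus_complex.sel(1)[symmetric]
    by (rule arg_cong[of _ _ Re]) (simp add: G2_def f0_def algebra_simps)
qed

lemma disc_subset: "norm z < 1 \<Longrightarrow> z \<noteq> 0 \<Longrightarrow> z \<in> - P"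
  using root_of_unity_norm[OF _ n0, of z] by (auto simp: P_def)

lemma exterior_subset: "1 < norm z \<Longrightarrow> z \<in> - P"
  using root_of_unity_norm[OF _ n0, of z] by (auto simp: P_def)

text \<open>Rotations from the model to the ends. Exchanging the two horizontal coordinates reverses
  orientation; the parameter \<open>cnj \<zeta>\<close> at 0 adds a sign to one of them and 1 / cnj
  \<zeta> at infinity a sign to the height, which restores determinant 1. \<open>Lroot u\<close> is
  a cyclic permutation of the coordinates followed by the horizontal rotation by
  \<open>u\<close>.\<close>

definition L0 :: "real^3^3" where
  "L0 = vector [vector [0, 1, 0], vector [- 1, 0, 0], vector [0, 0, 1]]"
definition Linf :: "real^3^3" where
  "Linf = vector [vector [0, 1, 0], vector [1, 0, 0], vector [0, 0, - 1]]"
definition Lroot :: "complex \<Rightarrow> real^3^3" where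
  "Lroot u = vector [vector [- Im u, 0, Re u], vector [Re u, 0, Im u], vector [0, 1, 0]]"

lemma rotation_Ls:
  "rotation_matrix L0" "rotation_matrix Linf" "norm u = 1 \<Longrightarrow> rotation_matrix (Lroot u)"
proof -
  show "rotation_matrix L0" "rotation_matrix Linf"
    by (simp_all add: rotation_matrix_def orthogonal_matrix L0_def Linf_def vec_eq_iff forall_3
        transpose_def matrix_matrix_mult_def mat_def sum_3 det_3)
  assume "norm u = 1"
  then have "(Re u)\<^sup>2 + (Im u)\<^sup>2 = 1" by (simp add: cmod_def)
  then have "Re u * Re u + Im u * Im u = 1" "Im u * Im u + Re u * Re u = 1" by (simp_all add: power2_eq_square)
  then show "rotation_matrix (Lroot u)"
    by (simp add: rotation_matrix_def orthogonal_matrix Lroot_def vec_eq_iff forall_3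
        transpose_def matrix_matrix_mult_def mat_def sum_3 det_3)
qed

lemma L_mult:
  "L0 *v vector [x, y, z] = vector [y, - x, z]"
  "Linf *v vector [x, y, z] = vector [y, x, - z]"
  "Lroot u *v vector [x, y, z] = vector [Re u * z - Im u * x, Re u * x + Im u * z, y]"
  by (simp_all add: L0_def Linf_def Lroot_def vec_eq_iff forall_3 matrix_vector_mult_def sum_3)

lemma form_0: "catenoid_form 1 B A f0 g0 G3"
  by unfold_locales (use B_pos A holomorphic_0 in auto)

lemma form_0_hor_ht:
  assumes "\<zeta> \<noteq> 0" "norm \<zeta> < 1"
  shows "Re (catenoid_form.hor B f0 g0 \<zeta>) = Im (hor_X \<zeta>)" "Im (catenoid_form.hor B f0 g0 \<zeta>) = Re (hor_X \<zeta>)"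
    "catenoid_form.ht A G3 \<zeta> = ht_X \<zeta>"
  using normal_form_0[OF assms]
  by (simp_all add: catenoid_form.hor_def[OF form_0] catenoid_form.ht_def[OF form_0] ht_X_eq)

lemma chart_0: "catenoid_chart 1 B A f0 g0 G3 P (Some 0) cnj L0 X"
proof (intro catenoid_chart.intro form_0 catenoid_chart_axioms.intro)
  show "finite P" by (rule finite_P)
  show "Some 0 \<in> punctures P" by (simp add: punctures_def P_def)
  show "rotation_matrix L0" by (rule rotation_Ls)
  show "continuous_on (ball 0 1 - {0}) cnj" by (intro continuous_intros)
  show "inj_on cnj (ball 0 1 - {0})" by (auto intro: inj_onI)
  have img: "cnj ` (ball 0 s - {0}) = ball 0 s - {0}" "cnj ` (cball 0 s - {0}) = cball 0 s - {0}" for s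
  proof -
    have "z \<in> cnj ` S \<longleftrightarrow> cnj z \<in> S" for z S by (metis complex_cnj_cnj image_iff)
    then show "cnj ` (ball 0 s - {0}) = ball 0 s - {0}" "cnj ` (cball 0 s - {0}) = cball 0 s - {0}"
      by (auto simp: set_eq_iff)
  qed
  show "cnj ` (ball 0 s - {0}) = puncture_nhd (Some 0) s" for s
    by (simp add: img puncture_nhd_def)
  show "puncture_nhd (Some 0) 1 \<subseteq> - P" using disc_subset by (auto simp: puncture_nhd_def)
  show "closedin (top_of_set (- P)) (cnj ` (cball 0 s - {0}))" if "0 < s" "s < 1" for s
  proof -
    have "z \<in> - P" if "z \<in> cball 0 s - {0}" for z
      using that \<open>s < 1\<close> by (intro disc_subset) auto
    then have "cball 0 s - {0} = - P \<inter> cball 0 s" by (auto simp: P_def)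
    then show ?thesis unfolding img by (auto simp: closedin_closed)
  qed
  fix \<zeta> :: complex assume \<zeta>: "\<zeta> \<noteq> 0" "norm \<zeta> < 1"
  show "X (cnj \<zeta>) = L0 *v vector [Re (catenoid_form.hor B f0 g0 \<zeta>), Im (catenoid_form.hor B f0 g0 \<zeta>), catenoid_form.ht A G3 \<zeta>]"
    unfolding form_0_hor_ht[OF \<zeta>] L_mult X_def hor_X_cnj ht_X_cnj by simp
  show "conformal_at (X \<circ> cnj) \<zeta>"
  proof (rule conformal_at_comp[OF weierstrass_axioms])
    show "cnj \<zeta> \<in> - P" using \<zeta> by (intro disc_subset) auto
    show "(cnj has_derivative cnj) (at \<zeta>)"
      by (rule bounded_linear_imp_has_derivative[OF bounded_linear_cnj])
  qed auto
qed

text \<open>The inversion symmetry of the surface (\<open>hor_X_inv\<close>,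
  \<open>ht_X_inv\<close>) transports the normal form at 0, so the same functions serve at
  infinity.\<close>

lemma chart_inf: "catenoid_chart 1 B A f0 g0 G3 P None (\<lambda>\<zeta>. 1 / cnj \<zeta>) Linf X"
proof (intro catenoid_chart.intro form_0 catenoid_chart_axioms.intro)
  show "finite P" by (rule finite_P)
  show "None \<in> punctures P" by (simp add: punctures_def)
  show "rotation_matrix Linf" by (rule rotation_Ls)
  show "continuous_on (ball 0 1 - {0}) (\<lambda>\<zeta>. 1 / cnj \<zeta>)" by (intro continuous_intros) auto
  show "inj_on (\<lambda>\<zeta>. 1 / cnj \<zeta>) (ball 0 1 - {0})" by (auto intro: inj_onI)
  have invol: "1 / cnj (1 / cnj z) = z" for z by simp
  have img1: "(\<lambda>\<zeta>. 1 / cnj \<zeta>) ` (ball 0 s - {0}) = puncture_nhd None s" if "0 < s" for s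
  proof (intro equalityI subsetI)
    fix z assume "z \<in> (\<lambda>\<zeta>. 1 / cnj \<zeta>) ` (ball 0 s - {0})"
    then show "z \<in> puncture_nhd None s"
      using that by (auto simp: puncture_nhd_def norm_divide intro!: divide_strict_left_mono)
  next
    fix z assume "z \<in> puncture_nhd None s"
    then have z: "1 / s < norm z" by (simp add: puncture_nhd_def)
    moreover have "0 < 1 / s" using that by simp
    ultimately have z0: "norm z > 0" by linarith
    have "1 / norm z < s" using z z0 that by (simp add: field_simps)
    then have "1 / cnj z \<in> ball 0 s - {0}" using z0 by (auto simp: norm_divide)
    then show "z \<in> (\<lambda>\<zeta>. 1 / cnj \<zeta>) ` (ball 0 s - {0})" using invol[of z] by (intro image_eqI[of z _ "1 / cnj z"]) auto
  qed
  have img2: "(\<lambda>\<zeta>. 1 / cnj \<zeta>) ` (cball 0 s - {0}) = {z. 1 / s \<le> norm z}" if "0 < s" for s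
  proof (intro equalityI subsetI)
    fix z assume "z \<in> (\<lambda>\<zeta>. 1 / cnj \<zeta>) ` (cball 0 s - {0})"
    then show "z \<in> {z. 1 / s \<le> norm z}"
      using that by (auto simp: norm_divide intro!: divide_left_mono)
  next
    fix z :: complex assume "z \<in> {z. 1 / s \<le> norm z}"
    then have z: "1 / s \<le> norm z" by simp
    moreover have "0 < 1 / s" using that by simp
    ultimately have z0: "norm z > 0" by linarith
    have "1 / norm z \<le> s" using z z0 that by (simp add: field_simps)
    then have "1 / cnj z \<in> cball 0 s - {0}" using z0 by (auto simp: norm_divide)
    then show "z \<in> (\<lambda>\<zeta>. 1 / cnj \<zeta>) ` (cball 0 s - {0})" using invol[of z] by (intro image_eqI[of z _ "1 / cnj z"]) auto
  qed
  show "(\<lambda>\<zeta>. 1 / cnj \<zeta>) ` (ball 0 s - {0}) = puncture_nhd None s" if "0 < s" for s by (rule img1[OF that])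
  show "puncture_nhd None 1 \<subseteq> - P" using exterior_subset by (auto simp: puncture_nhd_def)
  show "closedin (top_of_set (- P)) ((\<lambda>\<zeta>. 1 / cnj \<zeta>) ` (cball 0 s - {0}))" if s: "0 < s" "s < 1" for s
  proof -
    have "z \<in> - P" if "1 / s \<le> norm z" for z
    proof -
      have "1 < 1 / s" using s by simp
      then show ?thesis using that by (intro exterior_subset) linarith
    qed
    then have "{z. 1 / s \<le> norm z} = - P \<inter> {z. 1 / s \<le> norm z}" by auto
    moreover have "closed {z::complex. 1 / s \<le> norm z}" by (intro closed_Collect_le continuous_intros)
    ultimately show ?thesis unfolding img2[OF s(1)] closedin_closed by blast
  qed
  fix \<zeta> :: complex assume \<zeta>: "\<zeta> \<noteq> 0" "norm \<zeta> < 1"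
  have \<zeta>P: "\<zeta> \<notin> W" using disc_subset[OF \<zeta>(2,1)] by (simp add: P_def)
  show "X (1 / cnj \<zeta>) = Linf *v vector [Re (catenoid_form.hor B f0 g0 \<zeta>), Im (catenoid_form.hor B f0 g0 \<zeta>), catenoid_form.ht A G3 \<zeta>]"
    unfolding form_0_hor_ht[OF \<zeta>] L_mult X_def hor_X_inv[OF \<zeta>(1) \<zeta>P] ht_X_inv[OF \<zeta>(1) \<zeta>P] ..
  show "conformal_at (X \<circ> (\<lambda>\<zeta>. 1 / cnj \<zeta>)) \<zeta>"
  proof (rule conformal_at_comp[OF weierstrass_axioms])
    show "1 / cnj \<zeta> \<in> - P" using \<zeta> by (intro exterior_subset) (simp add: norm_divide)
    have "((\<lambda>z. 1 / z) has_field_derivative - 1 / (cnj \<zeta>)\<^sup>2) (at (cnj \<zeta>))"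
      using \<zeta> by (auto intro!: derivative_eq_intros simp: power2_eq_square)
    then have "((\<lambda>z. 1 / z) has_derivative (\<lambda>v. - 1 / (cnj \<zeta>)\<^sup>2 * v)) (at (cnj \<zeta>))"
      by (simp only: has_field_derivative_def)
    from diff_chain_at[OF bounded_linear_imp_has_derivative[OF bounded_linear_cnj] this]
    show "((\<lambda>\<zeta>. 1 / cnj \<zeta>) has_derivative (\<lambda>v. - 1 / (cnj \<zeta>)\<^sup>2 * cnj v)) (at \<zeta>)"
      by (simp add: o_def)
  qed (use \<zeta> in auto)
qed

end

section \<open>The ends at the roots of unity\<close>

context jmv
begin

text \<open>Regular parts at the puncture 1. The normal is horizontal there, so the roles change:
  \<open>fr\<close> comes from the second coordinate, \<open>gr\<close> from the height, and
  \<open>hr\<close> from the first coordinate, in which the poles of the summand w = 1 cancel and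
  only its logarithm is left.\<close>

definition fr :: "complex \<Rightarrow> complex" where
  "fr \<zeta> = - \<i> * of_real B * (1 + \<zeta> - 1 / (1 + \<zeta>) -
      (\<Sum>w\<in>W - {1}. of_real d / (1 + \<zeta> - w) + of_real d * w\<^sup>2 / (1 + \<zeta> - w))) +
     (\<Sum>w\<in>W - {1}. of_real (2 * B * r * Im w) * (Ln (1 + \<zeta> / (1 - w)) + of_real (ln (norm (1 - w)))))"
definition gr :: "complex \<Rightarrow> complex" where
  "gr \<zeta> = of_real (2 * B * d) * (of_nat n / 2 + 1 - 1 + (\<Sum>w\<in>W - {1}. w / (1 + \<zeta> - w))) + of_real A * Ln (1 + \<zeta>)"
definition hr :: "complex \<Rightarrow> complex" where
  "hr \<zeta> = of_real B * (1 + \<zeta> + 1 / (1 + \<zeta>) +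
      (\<Sum>w\<in>W - {1}. of_real d / (1 + \<zeta> - w) - of_real d * w\<^sup>2 / (1 + \<zeta> - w))) +
     (\<Sum>w\<in>W - {1}. of_real (2 * B * r * Re w) * (Ln (1 + \<zeta> / (1 - w)) + of_real (ln (norm (1 - w)))))"

text \<open>The distance from 1 to the other finite punctures; the entry 1 is the distance to the
  puncture 0.\<close>

definition \<rho> :: real where
  "\<rho> = Min (insert 1 ((\<lambda>w. norm (1 - w)) ` (W - {1})))"

lemma \<rho>: "\<rho> > 0" "\<rho> \<le> 1" "w \<in> W - {1} \<Longrightarrow> \<rho> \<le> norm (1 - w)"
proof -
  have fin: "finite (insert 1 ((\<lambda>w::complex. norm (1 - w)) ` (W - {1})))" using finite_W by simp
  have "\<rho> \<in> insert 1 ((\<lambda>w. norm (1 - w)) ` (W - {1}))" unfolding \<rho>_def by (rule Min_in[OF fin]) simp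
  then show "\<rho> > 0" by auto
  show "\<rho> \<le> 1" unfolding \<rho>_def by (rule Min_le[OF fin]) simp
  show "w \<in> W - {1} \<Longrightarrow> \<rho> \<le> norm (1 - w)" unfolding \<rho>_def by (rule Min_le[OF fin]) simp
qed

lemma one_in_W: "1 \<in> W" by simp

lemma root_disc:
  assumes "norm \<zeta> < \<rho>"
  shows "1 + \<zeta> \<noteq> 0" "1 + \<zeta> \<notin> \<real>\<^sub>\<le>\<^sub>0" "ln (norm (1 + \<zeta>)) = Re (Ln (1 + \<zeta>))"
    and "w \<in> W - {1} \<Longrightarrow> 1 + \<zeta> - w \<noteq> 0" "w \<in> W - {1} \<Longrightarrow> 1 + \<zeta> / (1 - w) \<notin> \<real>\<^sub>\<le>\<^sub>0"
    "w \<in> W - {1} \<Longrightarrow> 1 - w \<noteq> 0"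
    "w \<in> W - {1} \<Longrightarrow> ln (norm (1 + \<zeta> - w)) = Re (Ln (1 + \<zeta> / (1 - w)) + of_real (ln (norm (1 - w))))"
proof -
  have small: "1 + x \<notin> \<real>\<^sub>\<le>\<^sub>0" "1 + x \<noteq> 0" if "norm x < 1" for x :: complex
  proof -
    have "- 1 < Re x" using abs_Re_le_cmod[of x] that by linarith
    then show "1 + x \<notin> \<real>\<^sub>\<le>\<^sub>0" by (auto simp: complex_nonpos_Reals_iff)
    then show "1 + x \<noteq> 0" by auto
  qed
  have "norm \<zeta> < 1" using assms \<rho>(2) by linarith
  note s = small[OF this]
  show "1 + \<zeta> \<noteq> 0" "1 + \<zeta> \<notin> \<real>\<^sub>\<le>\<^sub>0" using s by auto
  then show "ln (norm (1 + \<zeta>)) = Re (Ln (1 + \<zeta>))" by simp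
  assume w: "w \<in> W - {1}"
  then show w1: "1 - w \<noteq> 0" by auto
  have "norm (\<zeta> / (1 - w)) < 1"
    using assms \<rho>(3)[OF w] w1 by (simp add: norm_divide divide_less_eq)
  note s' = small[OF this]
  show "1 + \<zeta> / (1 - w) \<notin> \<real>\<^sub>\<le>\<^sub>0" by (rule s')
  have e: "1 + \<zeta> - w = (1 - w) * (1 + \<zeta> / (1 - w))" using w1 by (simp add: field_simps)
  show "1 + \<zeta> - w \<noteq> 0" unfolding e using w1 s'(2) by simp
  have "ln (norm (1 + \<zeta> - w)) = ln (norm (1 - w)) + ln (norm (1 + \<zeta> / (1 - w)))"
    unfolding e norm_mult using w1 s'(2) by (intro ln_mult_pos) auto
  also have "ln (norm (1 + \<zeta> / (1 - w))) = Re (Ln (1 + \<zeta> / (1 - w)))" using s'(2) by simp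
  finally show "ln (norm (1 + \<zeta> - w)) = Re (Ln (1 + \<zeta> / (1 - w)) + of_real (ln (norm (1 - w))))" by simp
qed

lemma holomorphic_root: "fr holomorphic_on ball 0 \<rho>" "gr holomorphic_on ball 0 \<rho>" "hr holomorphic_on ball 0 \<rho>"
proof -
  have nz: "1 + \<zeta> \<noteq> 0" "1 + \<zeta> \<notin> \<real>\<^sub>\<le>\<^sub>0" "\<And>w. w \<in> W - {1} \<Longrightarrow> 1 + \<zeta> - w \<noteq> 0"
    "\<And>w. w \<in> W - {1} \<Longrightarrow> 1 + \<zeta> / (1 - w) \<notin> \<real>\<^sub>\<le>\<^sub>0" "\<And>w. w \<in> W - {1} \<Longrightarrow> 1 - w \<noteq> 0" if "\<zeta> \<in> ball 0 \<rho>" for \<zeta>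
    using root_disc[of \<zeta>] that by auto
  have c: "(\<lambda>\<zeta>. k / (1 + \<zeta> - w)) holomorphic_on ball 0 \<rho>" if "w \<in> W - {1}" for k w
    by (intro holomorphic_intros) (use nz(3) that in blast)
  have i: "(\<lambda>\<zeta>. 1 / (1 + \<zeta>)) holomorphic_on ball 0 \<rho>"
    by (intro holomorphic_intros) (use nz(1) in blast)
  have l: "(\<lambda>\<zeta>. Ln (1 + \<zeta> / (1 - w))) holomorphic_on ball 0 \<rho>" if "w \<in> W - {1}" for w
    by (intro holomorphic_intros) (use nz(4,5) that \<rho>(1) centre_in_ball in blast)+
  have l1: "(\<lambda>\<zeta>. Ln (1 + \<zeta>)) holomorphic_on ball 0 \<rho>"
    by (intro holomorphic_intros) (use nz(2) in blast)
  show "fr holomorphic_on ball 0 \<rho>" "gr holomorphic_on ball 0 \<rho>" "hr holomorphic_on ball 0 \<rho>"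
    unfolding fr_def[abs_def] gr_def[abs_def] hr_def[abs_def]
    by (intro holomorphic_on_add holomorphic_on_diff holomorphic_on_mult holomorphic_on_const holomorphic_on_id
        holomorphic_on_sum holomorphic_on_ident c i l l1; assumption)+
qed

lemma normal_form_root:
  assumes \<zeta>: "\<zeta> \<noteq> 0" "norm \<zeta> < \<rho>"
  shows "Im (hor_X (1 + \<zeta>)) = Re (\<i> * of_real (2 * B * d) / \<zeta> + fr \<zeta>)"
    "ht_X (1 + \<zeta>) = Re (of_real (2 * B * d) / \<zeta> + gr \<zeta>)"
    "Re (hor_X (1 + \<zeta>)) = 2 * B * r * ln (norm \<zeta>) + Re (hr \<zeta>)"
proof -
  note rd = root_disc[OF \<zeta>(2)]
  have ln: "(\<Sum>w\<in>W. b w * ln (norm (1 + \<zeta> - w))) = b 1 * ln (norm \<zeta>) +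
      Re (\<Sum>w\<in>W - {1}. of_real (b w) * (Ln (1 + \<zeta> / (1 - w)) + of_real (ln (norm (1 - w)))))" for b
  proof -
    have "b w * ln (norm (1 + \<zeta> - w)) = Re (of_real (b w) * (Ln (1 + \<zeta> / (1 - w)) + of_real (ln (norm (1 - w)))))"
      if "w \<in> W - {1}" for w
      unfolding rd(7)[OF that] by simp
    then have S: "(\<Sum>w\<in>W - {1}. b w * ln (norm (1 + \<zeta> - w))) =
        (\<Sum>w\<in>W - {1}. Re (of_real (b w) * (Ln (1 + \<zeta> / (1 - w)) + of_real (ln (norm (1 - w))))))"
      by (rule sum.cong[OF refl])
    have "1 + \<zeta> - 1 = \<zeta>" by simp
    then show ?thesis
      by (simp only: sum.remove[OF finite_W one_in_W] Re_sum S)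
  qed
  have "Im (hor_X (1 + \<zeta>)) = Re (G2 (1 + \<zeta>) +
      (\<Sum>w\<in>W - {1}. of_real (2 * B * r * Im w) * (Ln (1 + \<zeta> / (1 - w)) + of_real (ln (norm (1 - w))))))"
    unfolding Im_hor_X ln plus_complex.sel(1) by simp
  also have "G2 (1 + \<zeta>) = - \<i> * of_real B * (1 + \<zeta> - 1 / (1 + \<zeta>) -
      (\<Sum>w\<in>W - {1}. of_real d / (1 + \<zeta> - w) + of_real d * w\<^sup>2 / (1 + \<zeta> - w))) + \<i> * of_real (2 * B * d) / \<zeta>"
    unfolding G2_def sum.remove[OF finite_W one_in_W] by (simp add: algebra_simps)
  finally show "Im (hor_X (1 + \<zeta>)) = Re (\<i> * of_real (2 * B * d) / \<zeta> + fr \<zeta>)"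
    unfolding fr_def by (simp only: add_ac)
  have "ht_X (1 + \<zeta>) = Re (G3 (1 + \<zeta>) + of_real A * Ln (1 + \<zeta>))"
    unfolding ht_X_eq rd(3) plus_complex.sel(1) by simp
  also have "G3 (1 + \<zeta>) = of_real (2 * B * d) / \<zeta> + of_real (2 * B * d) * (of_nat n / 2 + 1 - 1 + (\<Sum>w\<in>W - {1}. w / (1 + \<zeta> - w)))"
    unfolding G3_def sum.remove[OF finite_W one_in_W] by (simp add: algebra_simps)
  finally show "ht_X (1 + \<zeta>) = Re (of_real (2 * B * d) / \<zeta> + gr \<zeta>)"
    unfolding gr_def by (simp only: add_ac)
  have "Re (hor_X (1 + \<zeta>)) = 2 * B * r * ln (norm \<zeta>) + Re (G1 (1 + \<zeta>) +
      (\<Sum>w\<in>W - {1}. of_real (2 * B * r * Re w) * (Ln (1 + \<zeta> / (1 - w)) + of_real (ln (norm (1 - w))))))"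
    unfolding Re_hor_X ln plus_complex.sel(1) by simp
  also have "G1 (1 + \<zeta>) = of_real B * (1 + \<zeta> + 1 / (1 + \<zeta>) +
      (\<Sum>w\<in>W - {1}. of_real d / (1 + \<zeta> - w) - of_real d * w\<^sup>2 / (1 + \<zeta> - w)))"
    unfolding G1_def sum.remove[OF finite_W one_in_W] by simp
  finally show "Re (hor_X (1 + \<zeta>)) = 2 * B * r * ln (norm \<zeta>) + Re (hr \<zeta>)"
    unfolding hr_def .
qed

lemma form_root: "catenoid_form \<rho> (2 * B * d) (2 * B * r) fr gr hr"
  by unfold_locales (use B_pos d_pos r_pos \<rho> holomorphic_root in auto)

text \<open>By the rotational symmetry (\<open>hor_X_rot\<close>, \<open>ht_X_rot\<close>) the end
  at \<open>u\<close> is the end at 1 turned about the vertical axis, so one normal form serves all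
  roots.\<close>

lemma chart_root:
  assumes u: "u \<in> W"
  shows "catenoid_chart \<rho> (2 * B * d) (2 * B * r) fr gr hr P (Some u) (\<lambda>\<zeta>. u * (1 + \<zeta>)) (Lroot u) X"
proof (intro catenoid_chart.intro form_root catenoid_chart_axioms.intro)
  have nu: "norm u = 1" by (rule root_of_unity_norm[OF u n0])
  then have u0: "u \<noteq> 0" by auto
  show "finite P" by (rule finite_P)
  show "Some u \<in> punctures P" using u by (simp add: punctures_def P_def)
  show "rotation_matrix (Lroot u)" using nu by (rule rotation_Ls)
  show "continuous_on (ball 0 \<rho> - {0}) (\<lambda>\<zeta>. u * (1 + \<zeta>))" by (intro continuous_intros)
  show "inj_on (\<lambda>\<zeta>. u * (1 + \<zeta>)) (ball 0 \<rho> - {0})" using u0 by (auto intro: inj_onI)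
  have dist: "dist u (u * (1 + \<zeta>)) = norm \<zeta>" for \<zeta>
    by (simp add: dist_norm norm_minus_commute algebra_simps norm_mult nu)
  have inv: "u * (1 + (z / u - 1)) = z" for z using u0 by simp
  have img: "(\<lambda>\<zeta>. u * (1 + \<zeta>)) ` (ball 0 s - {0}) = ball u s - {u}"
    "(\<lambda>\<zeta>. u * (1 + \<zeta>)) ` (cball 0 s - {0}) = cball u s - {u}" for s
  proof -
    have iff: "z \<in> (\<lambda>\<zeta>. u * (1 + \<zeta>)) ` S \<longleftrightarrow> z / u - 1 \<in> S" for z S
    proof
      assume "z \<in> (\<lambda>\<zeta>. u * (1 + \<zeta>)) ` S"
      then show "z / u - 1 \<in> S" using u0 by auto
    next
      assume "z / u - 1 \<in> S"
      then show "z \<in> (\<lambda>\<zeta>. u * (1 + \<zeta>)) ` S" using inv[of z] by (intro image_eqI[of z _ "z / u - 1"]) auto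
    qed
    have nd: "norm (z / u - 1) = dist u z" for z using dist[of "z / u - 1"] unfolding inv by simp
    have z0: "z / u - 1 = 0 \<longleftrightarrow> z = u" for z using u0 by simp
    show "(\<lambda>\<zeta>. u * (1 + \<zeta>)) ` (ball 0 s - {0}) = ball u s - {u}"
      "(\<lambda>\<zeta>. u * (1 + \<zeta>)) ` (cball 0 s - {0}) = cball u s - {u}"
      unfolding set_eq_iff iff Diff_iff mem_ball mem_cball dist_0_norm nd singleton_iff z0 by simp_all
  qed
  show "(\<lambda>\<zeta>. u * (1 + \<zeta>)) ` (ball 0 s - {0}) = puncture_nhd (Some u) s" for s
    by (simp add: img puncture_nhd_def)
  have avoid: "u * (1 + \<zeta>) \<in> - P" if "\<zeta> \<noteq> 0" "norm \<zeta> < \<rho>" for \<zeta>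
  proof -
    have "1 + \<zeta> \<noteq> 0" by (rule root_disc(1)[OF that(2)])
    moreover have "u * (1 + \<zeta>) \<notin> W"
    proof
      assume "u * (1 + \<zeta>) \<in> W"
      then have "1 + \<zeta> \<in> W" using u by (simp add: power_mult_distrib)
      then have "1 + \<zeta> \<in> W - {1}" using that(1) by simp
      then show False using root_disc(4)[OF that(2)] by fastforce
    qed
    ultimately show ?thesis using u0 by (simp add: P_def)
  qed
  have avoid': "z \<in> - P" if zu: "z \<in> ball u \<rho> - {u}" for z
  proof -
    obtain \<zeta> where "\<zeta> \<in> ball 0 \<rho> - {0}" "z = u * (1 + \<zeta>)" using zu unfolding img(1)[symmetric] by blast
    then show ?thesis using avoid by auto
  qed
  then show "puncture_nhd (Some u) \<rho> \<subseteq> - P" by (auto simp: puncture_nhd_def)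
  show "closedin (top_of_set (- P)) ((\<lambda>\<zeta>. u * (1 + \<zeta>)) ` (cball 0 s - {0}))" if s: "0 < s" "s < \<rho>" for s
  proof -
    have uP: "u \<in> P" using u by (simp add: P_def)
    have "cball u s - {u} \<subseteq> ball u \<rho> - {u}" using s by auto
    then have "cball u s - {u} \<subseteq> - P" using avoid' by blast
    then have "cball u s - {u} = - P \<inter> cball u s" using uP by blast
    then show ?thesis unfolding img closedin_closed using closed_cball by blast
  qed
  fix \<zeta> :: complex assume \<zeta>: "\<zeta> \<noteq> 0" "norm \<zeta> < \<rho>"
  have e: "Re (catenoid_form.hor (2 * B * d) fr gr \<zeta>) = Im (hor_X (1 + \<zeta>))"
    "Im (catenoid_form.hor (2 * B * d) fr gr \<zeta>) = ht_X (1 + \<zeta>)"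
    "catenoid_form.ht (2 * B * r) hr \<zeta> = Re (hor_X (1 + \<zeta>))"
    unfolding normal_form_root[OF \<zeta>] catenoid_form.hor_def[OF form_root] catenoid_form.ht_def[OF form_root]
    by simp_all
  show "X (u * (1 + \<zeta>)) = Lroot u *v vector [Re (catenoid_form.hor (2 * B * d) fr gr \<zeta>),
      Im (catenoid_form.hor (2 * B * d) fr gr \<zeta>), catenoid_form.ht (2 * B * r) hr \<zeta>]"
    unfolding e L_mult X_def hor_X_rot[OF u] ht_X_rot[OF u] by simp
  show "conformal_at (X \<circ> (\<lambda>\<zeta>. u * (1 + \<zeta>))) \<zeta>"
  proof (rule conformal_at_comp[OF weierstrass_axioms])
    show "u * (1 + \<zeta>) \<in> - P" by (rule avoid[OF \<zeta>])
    show "((\<lambda>\<zeta>. u * (1 + \<zeta>)) has_derivative (\<lambda>v. u * v)) (at \<zeta>)" by (auto intro!: derivative_eq_intros)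
  qed (use u0 in auto)
qed

section \<open>Growth vectors, weights and limit normals\<close>

text \<open>The values of \<open>growth_dir\<close> for the three charts. At 0 and infinity they
  point along the normal \<open>N\<close>; at a root of unity the surface bends against it, hence
  the minus signs.\<close>

definition gv :: "complex option \<Rightarrow> real^3" where
  "gv e = (case e of None \<Rightarrow> vector [0, 0, A] | Some z \<Rightarrow> if z = 0 then vector [0, 0, - A]
     else vector [- (2 * B * r) * Re z, - (2 * B * r) * Im z, 0])"

lemma end_data:
  assumes "e \<in> punctures P"
  obtains \<rho> c a f g h \<kappa> L where "catenoid_chart \<rho> c a f g h P e \<kappa> L X"
    "catenoid_chart.growth_dir a L = gv e" "a = (if e = None \<or> e = Some 0 then A else 2 * B * r)"
proof -
  consider "e = None" | "e = Some 0" | u where "e = Some u" "u \<in> W"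
    using assms by (auto simp: punctures_def P_def)
  then show thesis
  proof cases
    case 1
    interpret c: catenoid_chart 1 B A f0 g0 G3 P None "\<lambda>\<zeta>. 1 / cnj \<zeta>" Linf X by (rule chart_inf)
    have "c.growth_dir = gv e"
      unfolding c.growth_dir_def L_mult 1 gv_def by (simp add: vec_eq_iff forall_3)
    then show ?thesis using that[OF c.catenoid_chart_axioms[folded 1]] 1 by simp
  next
    case 2
    interpret c: catenoid_chart 1 B A f0 g0 G3 P "Some 0" cnj L0 X by (rule chart_0)
    have "c.growth_dir = gv e"
      unfolding c.growth_dir_def L_mult 2 gv_def by (simp add: vec_eq_iff forall_3)
    then show ?thesis using that[OF c.catenoid_chart_axioms[folded 2]] 2 by simp
  next
    case (3 u)
    have "u \<noteq> 0" using cnj_root_of_unity[OF 3(2) n0] by auto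
    interpret c: catenoid_chart \<rho> "2 * B * d" "2 * B * r" fr gr hr P "Some u" "\<lambda>\<zeta>. u * (1 + \<zeta>)" "Lroot u" X
      by (rule chart_root[OF 3(2)])
    have "c.growth_dir = gv e"
      unfolding c.growth_dir_def L_mult 3 gv_def using \<open>u \<noteq> 0\<close> by (simp add: vec_eq_iff forall_3)
    then show ?thesis using that[OF c.catenoid_chart_axioms[folded 3(1)]] 3 \<open>u \<noteq> 0\<close> by simp
  qed
qed

sublocale tame_ends P X gv
proof
  show "finite P" by (rule finite_P)
  show "continuous_on (- P) X" by (rule continuous_X)
  fix e assume e: "e \<in> punctures P"
  obtain \<rho> c a f g h \<kappa> L where cc: "catenoid_chart \<rho> c a f g h P e \<kappa> L X"
    and gd: "catenoid_chart.growth_dir a L = gv e" by (rule end_data[OF e])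
  interpret c: catenoid_chart \<rho> c a f g h P e \<kappa> L X by (rule cc)
  show "filterlim (\<lambda>z. norm (X z)) at_top (puncture_filter e)" by (rule c.diverges)
  show "((\<lambda>z. (X z \<bullet> gv e) / ln (norm (X z))) \<longlongrightarrow> gv e \<bullet> gv e) (puncture_filter e)"
    using c.growth unfolding gd .
  show "gv e \<noteq> 0" using c.growth_dir_nonzero unfolding gd .
  show "\<exists>z :: nat \<Rightarrow> complex. (\<forall>k. z k \<in> - P) \<and> filterlim z (puncture_filter e) sequentially \<and>
         (\<lambda>k. X (z k) /\<^sub>R norm (X (z k))) \<longlonglongrightarrow> d" if "norm d = 1" "d \<bullet> gv e = 0" for d
    using c.all_directions[of d] that unfolding gd by blast
qed

lemma catenoid_ends:
  assumes "e \<in> punctures P"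
  shows "catenoid_end (top_of_set (- P)) X (end_at P e)"
    "end_weight (top_of_set (- P)) X (end_at P e) (2 * pi * (if e = None \<or> e = Some 0 then A else 2 * B * r))"
proof -
  obtain \<rho> c a f g h \<kappa> L where cc: "catenoid_chart \<rho> c a f g h P e \<kappa> L X"
    and a: "a = (if e = None \<or> e = Some 0 then A else 2 * B * r)" by (rule end_data[OF assms])
  interpret c: catenoid_chart \<rho> c a f g h P e \<kappa> L X by (rule cc)
  show "catenoid_end (top_of_set (- P)) X (end_at P e)" by (rule c.catenoid_end)
  have "2 * B * r > 0" using B_pos r_pos by simp
  then have "a > 0" using A unfolding a by simp
  then show "end_weight (top_of_set (- P)) X (end_at P e) (2 * pi * (if e = None \<or> e = Some 0 then A else 2 * B * r))"
    using c.end_weight unfolding a[symmetric] by simp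
qed

definition end_nrm :: "complex option \<Rightarrow> real^3" where
  "end_nrm e = (case e of None \<Rightarrow> vector [0, 0, 1] | Some z \<Rightarrow> N z)"

lemma N_0: "N 0 = vector [0, 0, - 1]"
  using n0 by (simp add: N_def p_def q_def vec_eq_iff forall_3 power_0_left)

lemma N_root:
  assumes "u \<in> W"
  shows "N u = vector [Re u, Im u, 0]"
proof -
  have nu: "norm u = 1" by (rule root_of_unity_norm[OF assms n0])
  have pu: "p u = u * of_real (1 - \<alpha>)" and qu: "q u = of_real (1 - \<alpha>)" using assms by (simp_all add: p_def q_def)
  have np: "norm (p u) = 1 - \<alpha>" "norm (q u) = 1 - \<alpha>" using \<alpha> nu by (simp_all only: pu qu norm_mult norm_of_real) simp_all
  have pq: "p u * cnj (q u) = of_real ((1 - \<alpha>)\<^sup>2) * u" unfolding pu qu by (simp add: power2_eq_square)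
  have e: "1 / (b + b) * (2 * (b * x)) = x" if "b \<noteq> 0" for b x :: real using that by (simp add: field_simps)
  have b0: "(1 - \<alpha>)\<^sup>2 \<noteq> 0" using \<alpha> by simp
  show ?thesis unfolding N_def np pq
    using e[OF b0] by (simp add: vec_eq_iff forall_3)
qed

text \<open>Expresses g (1 / z) = 1 / g z, a half-turn of the sphere about the first axis. It turns
  continuity of the Gauss map at 0 into its limit at infinity.\<close>

lemma N_inv:
  assumes "z \<noteq> 0"
  shows "N (1 / z) = vector [N z $ 1, - N z $ 2, - N z $ 3]"
proof -
  define k where "k = 1 / z ^ Suc n"
  have k0: "k \<noteq> 0" using assms by (simp add: k_def)
  have pk: "p (1 / z) = k * q z" and qk: "q (1 / z) = k * p z"
    using assms by (simp_all add: p_def q_def k_def field_simps power_divide)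
  define m where "m = (norm k)\<^sup>2"
  have m0: "m \<noteq> 0" using k0 by (simp add: m_def)
  have pq: "p (1 / z) * cnj (q (1 / z)) = of_real m * cnj (p z * cnj (q z))"
    unfolding pk qk m_def complex_norm_square by (simp add: mult_ac)
  have np: "(norm (p (1 / z)))\<^sup>2 = m * (norm (q z))\<^sup>2" "(norm (q (1 / z)))\<^sup>2 = m * (norm (p z))\<^sup>2"
    unfolding pk qk m_def norm_mult power_mult_distrib by simp_all
  have e: "1 / (m * b + m * a) * (2 * (m * x)) = 1 / (a + b) * (2 * x)" for a b x :: real
  proof -
    have "1 / (m * b + m * a) * (2 * (m * x)) = m * (2 * x) / (m * (a + b))" by (simp add: algebra_simps)
    then show ?thesis using m0 by simp
  qed
  have e3: "1 / (m * b + m * a) * (m * b - m * a) = - (1 / (a + b) * (a - b))" for a b :: real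
  proof -
    have "1 / (m * b + m * a) * (m * b - m * a) = m * (b - a) / (m * (a + b))" by (simp add: algebra_simps)
    then show ?thesis using m0 by (simp add: minus_divide_left)
  qed
  have sR: "Re (of_real m * cnj x) = m * Re x" "Im (of_real m * cnj x) = m * - Im x" for x by simp_all
  show ?thesis
    unfolding vec_eq_iff forall_3 vector_3 N_def[of "1 / z"] vector_scaleR_component pq np sR real_scaleR_def e e3
    by (simp only: N_def vector_scaleR_component vector_3 real_scaleR_def mult_minus_right)
qed

lemma N_limit:
  assumes "e \<in> punctures P"
  shows "(N \<longlongrightarrow> end_nrm e) (puncture_filter e)"
proof (cases e)
  case (Some z)
  then show ?thesis using continuous_N[of z] by (simp add: puncture_filter_def end_nrm_def isCont_def)
next
  case None
  have "((\<lambda>z. N (inverse z)) \<longlongrightarrow> N 0) at_infinity"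
    using continuous_N[of 0] tendsto_inverse_0 by (rule isCont_tendsto_compose)
  then have comp: "((\<lambda>z. N (inverse z) $ i) \<longlongrightarrow> N 0 $ i) at_infinity" for i by (rule tendsto_vec_nth)
  have "\<forall>\<^sub>F z in at_infinity. z \<noteq> (0::complex)"
    unfolding eventually_at_infinity by (intro exI[of _ 1]) auto
  then have ev: "\<forall>\<^sub>F z in at_infinity. N (inverse z) $ 1 = N z $ 1 \<and> - N (inverse z) $ 2 = N z $ 2 \<and> - N (inverse z) $ 3 = N z $ 3"
    by eventually_elim (simp add: inverse_eq_divide N_inv)
  have "((\<lambda>z. N z $ 1) \<longlongrightarrow> N 0 $ 1) at_infinity"
    by (rule Lim_transform_eventually[OF comp[of 1]]) (use ev in \<open>auto elim: eventually_mono\<close>)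
  moreover have "((\<lambda>z. N z $ 2) \<longlongrightarrow> - N 0 $ 2) at_infinity"
    by (rule Lim_transform_eventually[OF tendsto_minus[OF comp[of 2]]]) (use ev in \<open>auto elim: eventually_mono\<close>)
  moreover have "((\<lambda>z. N z $ 3) \<longlongrightarrow> - N 0 $ 3) at_infinity"
    by (rule Lim_transform_eventually[OF tendsto_minus[OF comp[of 3]]]) (use ev in \<open>auto elim: eventually_mono\<close>)
  ultimately have "\<forall>i. ((\<lambda>z. N z $ i) \<longlongrightarrow> (vector [0, 0, 1] :: real^3) $ i) at_infinity"
    unfolding forall_3 by (simp add: N_0)
  then have "(N \<longlongrightarrow> vector [0, 0, 1]) at_infinity" by (intro vec_tendstoI) blast
  then show ?thesis by (simp add: None puncture_filter_def end_nrm_def)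
qed

end

section \<open>The symmetry group\<close>

definition plane_iso :: "complex \<Rightarrow> bool \<Rightarrow> real \<Rightarrow> real^3 \<Rightarrow> real^3" where
  "plane_iso u b s x =
     vector [Re (u * (if b then cnj (Complex (x $ 1) (x $ 2)) else Complex (x $ 1) (x $ 2))),
             Im (u * (if b then cnj (Complex (x $ 1) (x $ 2)) else Complex (x $ 1) (x $ 2))), s * x $ 3]"

lemma plane_iso_comp:
  "plane_iso u b s \<circ> plane_iso u' b' s' = plane_iso (u * (if b then cnj u' else u')) (b \<noteq> b') (s * s')"
  by (cases b; cases b') (simp_all add: fun_eq_iff plane_iso_def vec_eq_iff forall_3 algebra_simps)

lemma plane_iso_id: "plane_iso 1 False 1 = id"
  by (simp add: fun_eq_iff plane_iso_def vec_eq_iff forall_3)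

lemma plane_iso_isometry:
  assumes "norm u = 1" "s = 1 \<or> s = - 1"
  shows "dist (plane_iso u b s x) (plane_iso u b s y) = dist x y"
proof -
  define c where "c = Complex (x $ 1 - y $ 1) (x $ 2 - y $ 2)"
  define c' where "c' = u * (if b then cnj c else c)"
  have e: "plane_iso u b s x - plane_iso u b s y = vector [Re c', Im c', s * (x $ 3 - y $ 3)]"
    by (cases b) (simp_all add: plane_iso_def c'_def c_def vec_eq_iff forall_3 algebra_simps)
  have "norm c' = norm c" using assms(1) by (simp add: c'_def norm_mult)
  then have "(Re c')\<^sup>2 + (Im c')\<^sup>2 = (x $ 1 - y $ 1)\<^sup>2 + (x $ 2 - y $ 2)\<^sup>2"
    by (simp add: cmod_def c_def)
  moreover have "(s * (x $ 3 - y $ 3))\<^sup>2 = (x $ 3 - y $ 3)\<^sup>2" using assms(2) by (auto simp: power2_eq_square algebra_simps)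
  ultimately have "norm (vector [Re c', Im c', s * (x $ 3 - y $ 3)] :: real^3) = norm (x - y)"
    by (simp add: norm_vec_def L2_set_def sum_3)
  then show ?thesis unfolding dist_norm e .
qed

text \<open>The plane through the vertical axis and the direction (cos \<theta>, sin \<theta>)
  reflects the horizontal part by conjugation followed by multiplication with cis (2
  \<theta>).\<close>

lemma plane_reflection_iso:
  "plane_reflection (vector [0, 0, 1]) = plane_iso 1 False (- 1)"
  "plane_reflection (vector [0, 1, 0]) = plane_iso 1 True 1"
  "sin \<theta> \<noteq> 0 \<Longrightarrow> plane_reflection (vector [1, - cot \<theta>, 0]) = plane_iso (cis (2 * \<theta>)) True 1"
proof -
  show "plane_reflection (vector [0, 0, 1]) = plane_iso 1 False (- 1)"
    "plane_reflection (vector [0, 1, 0]) = plane_iso 1 True 1"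
    by (simp_all add: fun_eq_iff plane_reflection_def plane_iso_def vec_eq_iff forall_3 inner_vec_def sum_3)
  assume s: "sin \<theta> \<noteq> 0"
  have sc: "(sin \<theta>)\<^sup>2 + (cos \<theta>)\<^sup>2 = 1" by simp
  have n: "1 + cot \<theta> * cot \<theta> = 1 / (sin \<theta>)\<^sup>2"
    using s sc by (simp add: cot_def field_simps power2_eq_square)
  have k: "2 * (x - y * cot \<theta>) / (1 + cot \<theta> * cot \<theta>) = 2 * (x * (sin \<theta>)\<^sup>2 - y * (sin \<theta> * cos \<theta>))" for x y
    unfolding n using s by (simp add: cot_def field_simps power2_eq_square)
  have k2: "2 * (x * (sin \<theta>)\<^sup>2 - y * (sin \<theta> * cos \<theta>)) * cot \<theta> = 2 * (x * (sin \<theta> * cos \<theta>) - y * (cos \<theta>)\<^sup>2)" for x y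
    using s by (simp add: cot_def field_simps power2_eq_square)
  have c2: "cos (2 * \<theta>) = 1 - 2 * (sin \<theta>)\<^sup>2" "cos (2 * \<theta>) = 2 * (cos \<theta>)\<^sup>2 - 1" "sin (2 * \<theta>) = 2 * (sin \<theta> * cos \<theta>)"
    by (rule cos_double_sin, rule cos_double_cos) (simp add: sin_double)
  show "plane_reflection (vector [1, - cot \<theta>, 0]) = plane_iso (cis (2 * \<theta>)) True 1"
  proof
    fix x :: "real^3"
    define K where "K = 2 * (x $ 1 * (sin \<theta>)\<^sup>2 - x $ 2 * (sin \<theta> * cos \<theta>))"
    have i: "x \<bullet> vector [1, - cot \<theta>, 0] = x $ 1 - x $ 2 * cot \<theta>"
      "(vector [1, - cot \<theta>, 0] :: real^3) \<bullet> vector [1, - cot \<theta>, 0] = 1 + cot \<theta> * cot \<theta>"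
      by (simp_all add: inner_vec_def sum_3)
    have "plane_reflection (vector [1, - cot \<theta>, 0]) x = x - K *\<^sub>R vector [1, - cot \<theta>, 0]"
      unfolding plane_reflection_def i k K_def ..
    also have "\<dots> = plane_iso (cis (2 * \<theta>)) True 1 x"
    proof -
      have "x $ 1 - K = cos (2 * \<theta>) * x $ 1 + sin (2 * \<theta>) * x $ 2"
        unfolding K_def c2(1,3) by (simp add: algebra_simps)
      moreover have "x $ 2 + K * cot \<theta> = sin (2 * \<theta>) * x $ 1 - cos (2 * \<theta>) * x $ 2"
        unfolding K_def k2 c2(2,3) by (simp add: algebra_simps)
      ultimately show ?thesis
        by (simp add: plane_iso_def vec_eq_iff forall_3)
    qed
    finally show "plane_reflection (vector [1, - cot \<theta>, 0]) x = plane_iso (cis (2 * \<theta>)) True 1 x" .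
  qed
qed

lemma sin_dihedral_angle: "1 \<le> i \<Longrightarrow> i \<le> n - 1 \<Longrightarrow> sin (real i * pi / real n) \<noteq> 0"
proof -
  assume i: "1 \<le> i" "i \<le> n - 1"
  then have "0 < real i * pi / real n" "real i * pi / real n < pi" by (auto simp: field_simps)
  then have "sin (real i * pi / real n) > 0" by (rule sin_gt_zero)
  then show ?thesis by simp
qed

text \<open>The generators lie in the set on the right, which is closed under composition.
  Conversely the doubled angles of the planes give all roots of unity, the root 1 coming from the
  last generator \<open>Pn\<close> because \<open>Pi\<close> starts at i = 1; the rotation by
  \<open>u\<close> is the product of the reflection belonging to \<open>u\<close> with that last
  one.\<close>

lemma dihedral_Z2_eq:
  assumes n: "n \<ge> 2"
  shows "dihedral_Z2 n = {plane_iso u b s |u b s. u ^ n = 1 \<and> (s = 1 \<or> s = - 1)}" (is "_ = ?G")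
proof
  have n0: "n > 0" using n by simp
  have G_comp: "plane_iso u b s \<circ> T \<in> ?G" if g: "T \<in> ?G" "u ^ n = 1" "s = 1 \<or> s = - 1" for u b s T
  proof -
    obtain u' b' s' where T: "T = plane_iso u' b' s'" "u' ^ n = 1" "s' = 1 \<or> s' = - 1" using g(1) by blast
    have "(u * (if b then cnj u' else u')) ^ n = 1"
      using g(2) T(2) by (simp add: power_mult_distrib flip: complex_cnj_power)
    moreover have "s * s' = 1 \<or> s * s' = - 1" using g(3) T(3) by auto
    ultimately show ?thesis unfolding T(1) plane_iso_comp by blast
  qed
  have root: "cis (2 * (real i * pi / real n)) ^ n = 1" for i
  proof -
    have "cis (2 * (real i * pi / real n)) ^ n = cis (real n * (2 * (real i * pi / real n)))" by (rule Complex.DeMoivre)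
    also have "real n * (2 * (real i * pi / real n)) = 2 * pi * real i" using n0 by simp
    also have "cis (2 * pi * real i) = 1" by (rule cis_multiple_2pi) simp
    finally show ?thesis .
  qed
  show "dihedral_Z2 n \<subseteq> ?G"
  proof
    fix T assume "T \<in> dihedral_Z2 n"
    then show "T \<in> ?G"
    proof induction
      case id
      have "(1::complex) ^ n = 1 \<and> ((1::real) = 1 \<or> (1::real) = - 1)" by simp
      then show ?case using plane_iso_id[symmetric] by blast
    next
      case (P0 T)
      show ?case unfolding plane_reflection_iso(1) by (rule G_comp[OF P0.IH]) simp_all
    next
      case (Pi T i)
      show ?case unfolding plane_reflection_iso(3)[OF sin_dihedral_angle[OF Pi(2,3)]]
        by (rule G_comp[OF Pi.IH root]) simp
    next
      case (Pn T)
      show ?case unfolding plane_reflection_iso(2) by (rule G_comp[OF Pn.IH]) simp_all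
    qed
  qed
  show "?G \<subseteq> dihedral_Z2 n"
  proof
    fix T assume "T \<in> ?G"
    then obtain u b s where T: "T = plane_iso u b s" "u ^ n = 1" "s = 1 \<or> s = - 1" by blast
    have "u \<in> (\<lambda>i. cis (2 * pi * real i / real n)) ` {..<n}"
      using bij_betw_imp_surj_on[OF Complex.bij_betw_roots_unity[OF n0]] T(2) by simp
    then obtain i where i: "i < n" "u = cis (2 * pi * real i / real n)" by blast
    have ud: "u = cis (2 * (real i * pi / real n))" unfolding i(2) by (simp add: mult_ac)
    have Pn1: "plane_iso 1 True 1 \<circ> R \<in> dihedral_Z2 n" if "R \<in> dihedral_Z2 n" for R
      using dihedral_Z2.Pn[OF that] unfolding plane_reflection_iso(2) .
    have step: "plane_iso u True 1 \<circ> R \<in> dihedral_Z2 n" if "R \<in> dihedral_Z2 n" for R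
    proof (cases "i = 0")
      case True
      then have "u = 1" by (simp add: i(2))
      then show ?thesis using Pn1[OF that] by simp
    next
      case False
      then have "1 \<le> i" "i \<le> n - 1" using i(1) by auto
      from dihedral_Z2.Pi[OF that this] show ?thesis
        unfolding plane_reflection_iso(3)[OF sin_dihedral_angle[OF \<open>1 \<le> i\<close> \<open>i \<le> n - 1\<close>]] ud .
    qed
    have one: "plane_iso u b 1 \<in> dihedral_Z2 n"
    proof (cases b)
      case True
      then show ?thesis using step[OF dihedral_Z2.id] by simp
    next
      case False
      have "plane_iso u True 1 \<circ> (plane_iso 1 True 1 \<circ> id) \<in> dihedral_Z2 n"
        by (intro step Pn1 dihedral_Z2.id)
      then show ?thesis using False by (simp add: plane_iso_comp)
    qed
    from T(3) show "T \<in> dihedral_Z2 n"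
    proof
      assume "s = 1"
      then show ?thesis using one T(1) by simp
    next
      assume s: "s = - 1"
      have "plane_iso 1 False (- 1) \<circ> plane_iso u b 1 \<in> dihedral_Z2 n"
        using dihedral_Z2.P0[OF one] unfolding plane_reflection_iso(1) .
      then show ?thesis unfolding T(1) s by (simp add: plane_iso_comp)
    qed
  qed
qed

context jmv
begin

lemma domain_symmetric:
  assumes "z \<in> - P"
  shows "cnj z \<in> - P" "1 / cnj z \<in> - P" "u \<in> W \<Longrightarrow> u * z \<in> - P"
  using assms cnj_root_of_unity(4)[OF _ n0, of u]
  by (auto simp: not_in_P power_divide power_mult_distrib simp flip: complex_cnj_power)

lemma plane_iso_X:
  assumes u: "u \<in> W" and s: "s = 1 \<or> s = - 1" and z: "z \<in> - P"
  shows "plane_iso u b s (X z) \<in> S"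
proof -
  define z1 where "z1 = (if s = 1 then z else 1 / cnj z)"
  define z2 where "z2 = (if b then cnj z1 else z1)"
  have zz: "z \<noteq> 0" "z \<notin> W" using z by (auto simp: P_def)
  have z1: "z1 \<in> - P" "hor_X z1 = hor_X z" "ht_X z1 = s * ht_X z"
    using s domain_symmetric(2)[OF z] hor_X_inv[OF zz] ht_X_inv[OF zz] z by (auto simp: z1_def)
  have z2: "z2 \<in> - P" "hor_X z2 = (if b then cnj (hor_X z) else hor_X z)" "ht_X z2 = s * ht_X z"
    using domain_symmetric(1)[OF z1(1)] z1 by (auto simp: z2_def hor_X_cnj ht_X_cnj)
  have "plane_iso u b s (X z) = X (u * z2)"
    unfolding X_def hor_X_rot[OF u] ht_X_rot[OF u] z2(2,3) by (simp add: plane_iso_def complex_eq_iff)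
  then show ?thesis using domain_symmetric(3)[OF z2(1) u] by blast
qed

lemma plane_iso_S:
  assumes u: "u \<in> W" and s: "s = 1 \<or> s = - 1"
  shows "plane_iso u b s ` S = S"
proof
  show "plane_iso u b s ` S \<subseteq> S" using plane_iso_X[OF u s] by blast
  \<comment> \<open>With conjugation the map is an involution on the horizontal plane, otherwise its
    inverse rotates by the conjugate of \<open>u\<close>.\<close>
  define u' where "u' = (if b then u else cnj u)"
  have u': "u' \<in> W" "u * (if b then cnj u' else u') = 1"
    using cnj_root_of_unity[OF u n0] u by (auto simp: u'_def)
  have inv: "plane_iso u b s \<circ> plane_iso u' b s = id"
    unfolding plane_iso_comp u'(2) using s plane_iso_id by auto
  show "S \<subseteq> plane_iso u b s ` S"
  proof
    fix x assume "x \<in> S"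
    then have "plane_iso u' b s x \<in> S" using plane_iso_X[OF u'(1) s] by blast
    moreover have "x = plane_iso u b s (plane_iso u' b s x)" using fun_cong[OF inv, of x] by simp
    ultimately show "x \<in> plane_iso u b s ` S" by blast
  qed
qed

text \<open>Only the two vertical growth vectors have length \<open>A\<close>, so \<open>L\<close>
  maps the vertical axis to itself. The image of the growth vector at the root 1 is one at some root
  \<open>u\<close>, which fixes the image of the first basis vector. Orthogonality leaves only a
  sign for the second one: rotation or reflection.\<close>

lemma linear_isometry_in_group:
  assumes L: "orthogonal_transformation L" and perm: "\<And>e. e \<in> punctures P \<Longrightarrow> L (gv e) \<in> gv ` punctures P"
    and large: "A > 2 * B * r"
  obtains u b s where "u \<in> W" "s = 1 \<or> s = - 1" "L = plane_iso u b s"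
proof -
  have lin: "linear L" and inner: "\<And>x y. L x \<bullet> L y = x \<bullet> y" and nL: "\<And>x. norm (L x) = norm x"
    using L by (auto simp: orthogonal_transformation_def orthogonal_transformation_norm)
  define k where "k = 2 * B * r"
  have k: "k > 0" "k < A" using B_pos r_pos large by (auto simp: k_def)
  let ?e1 = "vector [1, 0, 0] :: real^3" and ?e2 = "vector [0, 1, 0] :: real^3" and ?e3 = "vector [0, 0, 1] :: real^3"
  have g_None: "gv None = A *\<^sub>R ?e3" and g_0: "gv (Some 0) = (- A) *\<^sub>R ?e3"
    by (simp_all add: gv_def vec_eq_iff forall_3)
  have g_root: "gv (Some u) = (- k) *\<^sub>R vector [Re u, Im u, 0]" "norm (gv (Some u)) = k" if "u \<in> W" for u
  proof -
    have "u \<noteq> 0" using cnj_root_of_unity[OF that n0] by auto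
    then show g: "gv (Some u) = (- k) *\<^sub>R vector [Re u, Im u, 0]"
      by (simp add: gv_def vec_eq_iff forall_3 k_def)
    have "norm (vector [Re u, Im u, 0] :: real^3) = norm u"
      by (simp add: norm_vec_def L2_set_def sum_3 cmod_def)
    then show "norm (gv (Some u)) = k" unfolding g norm_scaleR using root_of_unity_norm[OF that n0] k by simp
  qed
  have n3: "norm ?e3 = 1" by (simp add: norm_vec_def L2_set_def sum_3)
  have n_A: "norm (gv None) = A" "norm (gv (Some 0)) = A"
    unfolding g_None g_0 norm_scaleR n3 using A by simp_all
  have cases: "e = None \<or> e = Some 0 \<or> (\<exists>u\<in>W. e = Some u)" if "e \<in> punctures P" for e
    using that by (auto simp: punctures_def P_def)
  have "\<exists>s. (s = 1 \<or> s = - 1) \<and> L ?e3 = s *\<^sub>R ?e3"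
  proof -
    have "None \<in> punctures P" by (simp add: punctures_def)
    from perm[OF this] obtain e where e: "e \<in> punctures P" "L (gv None) = gv e" by blast
    have "norm (gv e) = A" using nL[of "gv None"] e(2) n_A(1) by simp
    then have "e = None \<or> e = Some 0" using cases[OF e(1)] g_root(2) k(2) by auto
    then have "\<exists>s. (s = 1 \<or> s = - 1) \<and> gv e = (A * s) *\<^sub>R ?e3"
      using g_None g_0 by (metis mult.right_neutral mult_minus_right)
    then obtain s where s: "s = 1 \<or> s = - 1" "gv e = (A * s) *\<^sub>R ?e3" by blast
    have "A *\<^sub>R L ?e3 = A *\<^sub>R (s *\<^sub>R ?e3)"
      using e(2) unfolding g_None s(2) linear_cmul[OF lin] scaleR_scaleR .
    then have "L ?e3 = s *\<^sub>R ?e3" using A by (simp only: scaleR_cancel_left) simp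
    then show ?thesis using s(1) by blast
  qed
  then obtain s where s: "s = 1 \<or> s = - 1" "L ?e3 = s *\<^sub>R ?e3" by blast
  have "\<exists>u\<in>W. L ?e1 = vector [Re u, Im u, 0]"
  proof -
    have "Some 1 \<in> punctures P" using one_in_W by (simp add: punctures_def P_def)
    from perm[OF this] obtain e where e: "e \<in> punctures P" "L (gv (Some 1)) = gv e" by blast
    have "norm (gv e) = k" using nL[of "gv (Some 1)"] e(2) g_root(2)[OF one_in_W] by simp
    then obtain u where u: "u \<in> W" "e = Some u" using cases[OF e(1)] n_A k(2) by auto
    have "(- k) *\<^sub>R L ?e1 = (- k) *\<^sub>R vector [Re u, Im u, 0]"
      using e(2) unfolding u(2) g_root(1)[OF one_in_W] g_root(1)[OF u(1)] linear_cmul[OF lin] one_complex.sel .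
    then have "L ?e1 = vector [Re u, Im u, 0]" using k by (simp only: scaleR_cancel_left) simp
    then show ?thesis using u(1) by blast
  qed
  then obtain u where u: "u \<in> W" "L ?e1 = vector [Re u, Im u, 0]" by blast
  have uu: "Re u * Re u + Im u * Im u = 1"
    using root_of_unity_norm[OF u(1) n0] by (simp add: cmod_def power2_eq_square)
  define y where "y = L ?e2"
  have "y \<bullet> L ?e1 = 0" "y \<bullet> L ?e3 = 0" "y \<bullet> y = 1"
    unfolding y_def inner by (simp_all add: inner_vec_def sum_3)
  then have y: "y $ 1 * Re u + y $ 2 * Im u = 0" "y $ 3 = 0" "y $ 1 * y $ 1 + y $ 2 * y $ 2 = 1"
    using s(1) unfolding u(2) s(2) by (auto simp: inner_vec_def sum_3)
  \<comment> \<open>The component of \<open>y\<close> along the horizontal unit vector perpendicular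
    to \<open>u\<close>; as \<open>y\<close> is horizontal and orthogonal to \<open>u\<close>, it is
    \<open>t\<close> times that vector.\<close>
  define t where "t = y $ 2 * Re u - y $ 1 * Im u"
  have y1: "y $ 1 = - t * Im u" and y2: "y $ 2 = t * Re u"
  proof -
    have "- t * Im u = y $ 1 * (Re u * Re u + Im u * Im u) - Re u * (y $ 1 * Re u + y $ 2 * Im u)"
      by (simp add: t_def algebra_simps)
    then show "y $ 1 = - t * Im u" using uu y(1) by simp
    have "t * Re u = y $ 2 * (Re u * Re u + Im u * Im u) - Im u * (y $ 1 * Re u + y $ 2 * Im u)"
      by (simp add: t_def algebra_simps)
    then show "y $ 2 = t * Re u" using uu y(1) by simp
  qed
  have "t * t * (Re u * Re u + Im u * Im u) = 1" using y(3) unfolding y1 y2 by (simp add: algebra_simps)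
  then have "t * t = 1" using uu by simp
  then have t: "t = 1 \<or> t = - 1" by (simp add: square_eq_1_iff)
  have "L x = plane_iso u (t = - 1) s x" for x
  proof -
    have "x = (x $ 1) *\<^sub>R ?e1 + (x $ 2) *\<^sub>R ?e2 + (x $ 3) *\<^sub>R ?e3" by (simp add: vec_eq_iff forall_3)
    then have "L x = L ((x $ 1) *\<^sub>R ?e1 + (x $ 2) *\<^sub>R ?e2 + (x $ 3) *\<^sub>R ?e3)" by (rule arg_cong)
    also have "\<dots> = (x $ 1) *\<^sub>R vector [Re u, Im u, 0] + (x $ 2) *\<^sub>R y + (x $ 3) *\<^sub>R (s *\<^sub>R ?e3)"
      by (simp only: linear_add[OF lin] linear_cmul[OF lin] u(2) s(2) y_def)
    also have "\<dots> = plane_iso u (t = - 1) s x"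
      using t y1 y2 y(2) by (auto simp: plane_iso_def vec_eq_iff forall_3 algebra_simps)
    finally show ?thesis .
  qed
  then show thesis using that[OF u(1) s(1)] by blast
qed

text \<open>The linear part of a symmetry permutes the growth vectors, hence belongs to the group
  and itself preserves the surface. The translation part then preserves the surface too and must
  vanish.\<close>

theorem symmetry_group_eq:
  assumes "A > 2 * B * r"
  shows "symmetry_group S = dihedral_Z2 n"
proof
  show "dihedral_Z2 n \<subseteq> symmetry_group S"
  proof
    fix T assume "T \<in> dihedral_Z2 n"
    then obtain u b s where T: "T = plane_iso u b s" "u \<in> W" "s = 1 \<or> s = - 1"
      unfolding dihedral_Z2_eq[OF n] by blast
    show "T \<in> symmetry_group S"
      unfolding symmetry_group_def T(1)
      using plane_iso_isometry[OF root_of_unity_norm[OF T(2) n0] T(3)] plane_iso_S[OF T(2,3)] by blast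
  qed
  show "symmetry_group S \<subseteq> dihedral_Z2 n"
  proof
    fix T assume "T \<in> symmetry_group S"
    then have T: "\<And>x y. dist (T x) (T y) = dist x y" "T ` S = S" by (auto simp: symmetry_group_def)
    define L where "L x = T x - T 0" for x
    have "dist (L x) (L y) = dist x y" for x y using T(1)[of x y] by (simp add: L_def dist_norm)
    then have L: "orthogonal_transformation L"
      unfolding orthogonal_transformation_isometry by (simp add: L_def)
    have TL: "T x = L x + T 0" for x by (simp add: L_def)
    have perm: "L (gv e) \<in> gv ` punctures P" if "e \<in> punctures P" for e
    proof -
      have "growth_vector S (gv e)" using growth_vectors that by blast
      then have "growth_vector S (L (gv e))" by (rule growth_vector_isometry[OF L TL T(2)])
      then show ?thesis using growth_vectors by blast
    qed
    obtain u b s where us: "u \<in> W" "s = 1 \<or> s = - 1" "L = plane_iso u b s"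
      by (rule linear_isometry_in_group[OF L perm assms])
    have "L ` S = S" unfolding us(3) by (rule plane_iso_S[OF us(1,2)])
    then have "(\<lambda>x. x + T 0) ` S = (\<lambda>x. x + T 0) ` (L ` S)" by simp
    also have "\<dots> = T ` S" unfolding image_image TL[symmetric] ..
    finally have "(\<lambda>x. x + T 0) ` S = S" using T(2) by simp
    then have T0: "T 0 = 0" by (rule no_translation)
    have "T x = L x" for x unfolding L_def T0 by simp
    then have "T = L" ..
    then have "T = plane_iso u b s" unfolding us(3) .
    then show "T \<in> dihedral_Z2 n" unfolding dihedral_Z2_eq[OF n] using us(1,2) by blast
  qed
qed

section \<open>All properties of the surface together\<close>

lemma surface_exists:
  assumes w: "2 * pi * (2 * B * r) = 1" "2 * pi * A = w" "w \<ge> 2"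
  shows "\<exists>(M :: complex topology) X N \<nu> H e\<^sub>1 e\<^sub>2.
      minimal_surface M X \<and> complete_surface M X \<and> finite_total_curvature M X \<and>
      finite (ends M) \<and> card (ends M) = n + 2 \<and>
      genus_zero M \<and>
      gauss_map M X N \<and> (\<forall>e\<in>ends M. end_normal M N e (\<nu> e)) \<and>
      H \<subseteq> ends M \<and> card H = n \<and>
      (\<forall>e\<in>H. catenoid_end M X e \<and> end_weight M X e 1 \<and> \<nu> e $ 3 = 0) \<and>
      (\<exists>R. rotation_matrix R \<and>
         bij_betw (\<lambda>e. stereographic (R *v \<nu> e)) H {z. z ^ n = 1}) \<and>
      e\<^sub>1 \<noteq> e\<^sub>2 \<and> ends M - H = {e\<^sub>1, e\<^sub>2} \<and>
      (\<forall>e\<in>{e\<^sub>1, e\<^sub>2}. catenoid_end M X e \<and> end_weight M X e w) \<and>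
      \<nu> e\<^sub>1 = vector [0, 0, 1] \<and> \<nu> e\<^sub>2 = - vector [0, 0, 1] \<and>
      symmetry_group (X ` topspace M) = dihedral_Z2 n"
proof -
  define M where "M = top_of_set (- P)"
  define E where "E = end_at P"
  define \<nu> where "\<nu> e = end_nrm (inv_into (punctures P) E e)" for e
  define H where "H = E ` Some ` W"
  have ends: "ends M = E ` punctures P" unfolding M_def E_def by (rule ends_punctured_plane[OF finite_P])
  have inj: "inj_on E (punctures P)" unfolding E_def by (rule inj_on_end_at[OF finite_P])
  have \<nu>: "\<nu> (E e) = end_nrm e" if "e \<in> punctures P" for e
    using inv_into_f_f[OF inj that] by (simp add: \<nu>_def)
  have punc: "punctures P = insert None (insert (Some 0) (Some ` W))" by (auto simp: punctures_def P_def)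
  have zero_W: "0 \<notin> W" using n0 by (auto simp: power_0_left)
  have WP: "Some ` W \<subseteq> punctures P" unfolding punc by blast
  have N0: "None \<in> punctures P" "Some 0 \<in> punctures P" unfolding punc by auto
  have cardW: "card (Some ` W) = n" using card_roots_unity_eq[OF n0] by (simp add: card_image)
  have fin: "finite (ends M)" unfolding ends using finite_P by (simp add: punctures_def)
  have "card (punctures P) = n + 2"
    unfolding punc using cardW finite_W zero_W by (simp add: card_insert_if image_iff)
  then have card: "card (ends M) = n + 2" unfolding ends using card_image[OF inj] by simp
  have sub: "H \<subseteq> ends M" unfolding H_def ends using WP by blast
  have cardH: "card H = n" unfolding H_def using card_image[OF inj_on_subset[OF inj WP]] cardW by simp
  have "connected (- P)"
    using connected_open_delete_finite[OF open_UNIV connected_UNIV _ finite_P] by (simp add: Compl_eq_Diff_UNIV)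
  moreover have "- P \<noteq> {}" using infinite_UNIV_char_0[where 'a = complex] finite_P
    by (metis Compl_UNIV_eq double_compl)
  ultimately have 1: "minimal_surface M X" unfolding M_def by (rule minimal_surface_domain)
  have 2: "complete_surface M X"
    unfolding M_def by (rule complete_surface_proper) (use proper in simp)
  obtain C where C: "\<And>z. z \<in> - P \<Longrightarrow> \<bar>gauss_curvature X z\<bar> * area_density X z \<le> C / (1 + (norm z)\<^sup>2)\<^sup>2"
    by (rule total_curvature_bound) (rule that)
  have 3: "finite_total_curvature M X" unfolding M_def by (rule finite_total_curvature_domain[OF C])
  have 4: "genus_zero M" unfolding M_def by (rule genus_zero_punctured_plane[OF finite_P])
  have 5: "gauss_map M X N" unfolding M_def
    by (rule gauss_map_domain) (use continuous_N norm_N N_orthogonal in \<open>auto intro!: continuous_at_imp_continuous_on\<close>)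
  have 6: "end_normal M N e (\<nu> e)" if end_e: "e \<in> ends M" for e
  proof -
    obtain x where x: "x \<in> punctures P" "e = E x" using end_e unfolding ends by blast
    show ?thesis
      unfolding end_normal_def x(2) \<nu>[OF x(1)] unfolding M_def E_def
      by (rule tendsto_mono[OF end_filter_end_at_le[OF finite_P x(1)] N_limit[OF x(1)]])
  qed
  have nuroot: "\<nu> (E (Some u)) = vector [Re u, Im u, 0]" if "u \<in> W" for u
  proof -
    have "Some u \<in> punctures P" using WP that by blast
    then show ?thesis using \<nu> N_root[OF that] by (simp add: end_nrm_def)
  qed
  have 7: "catenoid_end M X e \<and> end_weight M X e 1 \<and> \<nu> e $ 3 = 0" if eH: "e \<in> H" for e
  proof -
    obtain u where u: "u \<in> W" "e = E (Some u)" using eH unfolding H_def by blast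
    have up: "Some u \<in> punctures P" using WP u(1) by blast
    have "\<not> (Some u = None \<or> Some u = Some 0)" using u(1) zero_W by auto
    then have "2 * pi * (if Some u = None \<or> Some u = Some 0 then A else 2 * B * r) = 1" using w(1) by simp
    then show ?thesis
      using catenoid_ends[OF up, folded M_def E_def] nuroot[OF u(1)] unfolding u(2) by simp
  qed
  \<comment> \<open>The normals are already placed correctly, so the identity serves as the
    rotation: stereographic projection fixes the equator, and the normal at the root
    \<open>u\<close> is \<open>u\<close> itself.\<close>
  have st: "stereographic (mat 1 *v \<nu> (E (Some u))) = u" if "u \<in> W" for u
    unfolding matrix_vector_mul_lid nuroot[OF that] by (simp add: stereographic_def)
  have "bij_betw (\<lambda>e. stereographic (mat 1 *v \<nu> e)) H W"
  proof (rule bij_betw_byWitness[where f' = "\<lambda>u. E (Some u)"])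
    show "\<forall>e\<in>H. E (Some (stereographic (mat 1 *v \<nu> e))) = e" using st unfolding H_def by auto
    show "\<forall>u\<in>W. stereographic (mat 1 *v \<nu> (E (Some u))) = u" using st by blast
    show "(\<lambda>e. stereographic (mat 1 *v \<nu> e)) ` H \<subseteq> W" using st unfolding H_def by auto
    show "(\<lambda>u. E (Some u)) ` W \<subseteq> H" unfolding H_def by blast
  qed
  moreover have "rotation_matrix (mat 1 :: real^3^3)"
    by (simp add: rotation_matrix_def orthogonal_matrix_id)
  ultimately have 8: "\<exists>R. rotation_matrix R \<and> bij_betw (\<lambda>e. stereographic (R *v \<nu> e)) H {z. z ^ n = 1}" by blast
  have 9: "E None \<noteq> E (Some 0)" using inj N0 by (metis inj_onD option.distinct(1))
  have 10: "ends M - H = {E None, E (Some 0)}"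
  proof -
    have "ends M - H = E ` (punctures P - Some ` W)"
      unfolding ends H_def using inj_on_image_set_diff[OF inj, of "punctures P" "Some ` W"] WP by auto
    also have "punctures P - Some ` W = {None, Some 0}" unfolding punc using zero_W by auto
    finally show ?thesis by simp
  qed
  have 11: "catenoid_end M X e \<and> end_weight M X e w" if "e \<in> {E None, E (Some 0)}" for e
    using that catenoid_ends[OF N0(1), folded M_def E_def] catenoid_ends[OF N0(2), folded M_def E_def] w(2) by auto
  have 12: "\<nu> (E None) = vector [0, 0, 1]" "\<nu> (E (Some 0)) = - vector [0, 0, 1]"
    using \<nu>[OF N0(1)] \<nu>[OF N0(2)] N_0 by (simp_all add: end_nrm_def vec_eq_iff forall_3)
  have "2 * pi * (2 * B * r) < 2 * pi * A" unfolding w(1,2) using w(3) by simp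
  then have "A > 2 * B * r" by (rule mult_left_less_imp_less) simp
  then have 13: "symmetry_group (X ` topspace M) = dihedral_Z2 n"
    using symmetry_group_eq by (simp add: M_def)
  show ?thesis
    by (rule exI[of _ M], rule exI[of _ X], rule exI[of _ N], rule exI[of _ \<nu>], rule exI[of _ H],
        rule exI[of _ "E None"], rule exI[of _ "E (Some 0)"], intro conjI ballI)
      (fact 1 2 3 4 5 8 9 10 12 13 fin card sub cardH | erule 6 | erule 7 [THEN conjunct1]
        | erule 7 [THEN conjunct2, THEN conjunct1] | erule 7 [THEN conjunct2, THEN conjunct2]
        | erule 11 [THEN conjunct1] | erule 11 [THEN conjunct2])+
qed

end

theorem theorem1p3:
  fixes n :: nat
  assumes "n \<ge> 2"
  shows "\<exists>c::real. c > 0 \<and> (\<forall>w\<ge>c.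
    \<exists>(M :: complex topology) X N \<nu> H e\<^sub>1 e\<^sub>2.
      minimal_surface M X \<and> complete_surface M X \<and> finite_total_curvature M X \<and>
      finite (ends M) \<and> card (ends M) = n + 2 \<and>
      genus_zero M \<and>
      gauss_map M X N \<and> (\<forall>e\<in>ends M. end_normal M N e (\<nu> e)) \<and>
      H \<subseteq> ends M \<and> card H = n \<and>
      (\<forall>e\<in>H. catenoid_end M X e \<and> end_weight M X e 1 \<and> \<nu> e $ 3 = 0) \<and>
      (\<exists>R. rotation_matrix R \<and>
         bij_betw (\<lambda>e. stereographic (R *v \<nu> e)) H {z. z ^ n = 1}) \<and>
      e\<^sub>1 \<noteq> e\<^sub>2 \<and> ends M - H = {e\<^sub>1, e\<^sub>2} \<and>
      (\<forall>e\<in>{e\<^sub>1, e\<^sub>2}. catenoid_end M X e \<and> end_weight M X e w) \<and>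
      \<nu> e\<^sub>1 = vector [0, 0, 1] \<and> \<nu> e\<^sub>2 = - vector [0, 0, 1] \<and>
      symmetry_group (X ` topspace M) = dihedral_Z2 n)"
proof (rule exI[of _ 2], intro conjI allI impI)
  \<comment> \<open>The constant 2 exceeds the weight 1 of the horizontal ends, so the vertical
    growth vectors are strictly longer, as \<open>symmetry_group_eq\<close> requires.\<close>
  show "(0::real) < 2" by simp
  fix w :: real assume w: "w \<ge> 2"
  \<comment> \<open>The zeros of \<open>F\<close> are the solutions of w r = \<alpha>. At 0 the
    value is w (n + 1) / \<open>n^2\<close>, which is positive, and at 1 it is -1, so the zero lies
    strictly between.\<close>
  define F where "F \<alpha> = w * ((1 - \<alpha>) * (real n + 1 + (real n - 1) * \<alpha>) / (real n)\<^sup>2) - \<alpha>" for \<alpha>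
  have "\<exists>\<alpha>. 0 \<le> \<alpha> \<and> \<alpha> \<le> 1 \<and> F \<alpha> = 0"
  proof (rule IVT2)
    show "F 1 \<le> 0" by (simp add: F_def)
    show "0 \<le> F 0" using w assms by (simp add: F_def)
    show "\<forall>x. 0 \<le> x \<and> x \<le> 1 \<longrightarrow> isCont F x"
      unfolding F_def using assms by (auto intro!: continuous_intros)
  qed simp
  then obtain \<alpha> where root: "0 \<le> \<alpha>" "\<alpha> \<le> 1" "F \<alpha> = 0" by blast
  have "F 0 \<noteq> 0" "F 1 \<noteq> 0" using w assms by (auto simp: F_def)
  then have \<alpha>01: "0 < \<alpha>" "\<alpha> < 1" using root by (auto simp: less_le)
  define A where "A = w / (2 * pi)"
  have A_pos: "A > 0" using w by (simp add: A_def)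
  interpret jmv n \<alpha> A by unfold_locales (use assms \<alpha>01 A_pos in auto)
  have wr: "w * r = \<alpha>" using root(3) unfolding F_def r_def by simp
  have "2 * pi * (2 * B * r) = w * r / \<alpha>" unfolding B2 by (simp add: A_def)
  then have 1: "2 * pi * (2 * B * r) = 1" unfolding wr using \<alpha>01 by simp
  have 2: "2 * pi * A = w" by (simp add: A_def)
  show "\<exists>(M :: complex topology) X N \<nu> H e\<^sub>1 e\<^sub>2.
      minimal_surface M X \<and> complete_surface M X \<and> finite_total_curvature M X \<and>
      finite (ends M) \<and> card (ends M) = n + 2 \<and>
      genus_zero M \<and>
      gauss_map M X N \<and> (\<forall>e\<in>ends M. end_normal M N e (\<nu> e)) \<and>
      H \<subseteq> ends M \<and> card H = n \<and>
      (\<forall>e\<in>H. catenoid_end M X e \<and> end_weight M X e 1 \<and> \<nu> e $ 3 = 0) \<and>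
      (\<exists>R. rotation_matrix R \<and>
         bij_betw (\<lambda>e. stereographic (R *v \<nu> e)) H {z. z ^ n = 1}) \<and>
      e\<^sub>1 \<noteq> e\<^sub>2 \<and> ends M - H = {e\<^sub>1, e\<^sub>2} \<and>
      (\<forall>e\<in>{e\<^sub>1, e\<^sub>2}. catenoid_end M X e \<and> end_weight M X e w) \<and>
      \<nu> e\<^sub>1 = vector [0, 0, 1] \<and> \<nu> e\<^sub>2 = - vector [0, 0, 1] \<and>
      symmetry_group (X ` topspace M) = dihedral_Z2 n"
    by (rule surface_exists[OF 1 2 w])
qed

end
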